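(* Let $(M,\tilde\Psi)$ be a compact $Spin(7)$ manifold whose Lee form $\tilde\theta$ is closed, $d\tilde\theta=0$. Let $\Psi=e^{f}\tilde\Psi$ ($f$ a smooth function) be the Gauduchon $Spin(7)$ structure in the conformal class of $\tilde\Psi$, with Lee form $\theta$, torsion connection $\nabla$ and torsion 3-form $T$. If $\nabla$ is a $Spin(7)$-instanton (with respect to $\Psi$), then the Lee form $\theta$ is parallel with respect to the torsion connection, $\nabla\theta=0$, and the 4-form $d^{\nabla}T$ belongs to $\Lambda^4_{27}$. In particular, the 4-form $d^{\nabla}T$ is self-dual, $*d^{\nabla}T=d^{\nabla}T$.
   Context: Manifolds are smooth; compact means compact without boundary. A $Spin(7)$ manifold $(M,\Psi)$ is an 8-manifold with a 4-form $\Psi$ (a $Spin(7)$ structure) that near each point can be written, in a local coframe $e_0,\dots,e_7$, as $\Psi=-e_{0127}+e_{0236}-e_{0347}-e_{0567}+e_{0146}+e_{0245}-e_{0135}-e_{3456}-e_{1457}-e_{1256}-e_{1234}-e_{2357}-e_{1367}+e_{2467}$, where $e_{ijkl}=e_i\wedge e_j\wedge e_k\wedge e_l$. It induces the metric $g$ and orientation for which such coframes are oriented orthonormal; $*$ is the Hodge star and $\delta=-*d*$ the codifferential. Indices refer to a local orthonormal frame, and repeated indices are summed. The Lee form is $\theta=-\frac17*( *d\Psi\wedge\Psi)$, i.e. $\theta_a=\frac1{42}(\delta\Psi)_{ijk}\Psi_{ijka}$. On a compact manifold every conformal class of $Spin(7)$ structures contains a unique one (up to constant scaling) whose Lee form is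 coclosed, $\delta\theta=0$, with respect to its own induced metric; it is called the Gauduchon $Spin(7)$ structure. For a $Spin(7)$ structure there is a unique linear connection $\nabla$ (the torsion connection) with $\nabla g=0$, $\nabla\Psi=0$ and totally skew-symmetric torsion, i.e. $T(X,Y,Z)=g(\nabla_XY-\nabla_YX-[X,Y],Z)$ is a 3-form. Curvature of $\nabla$: $R(X,Y)Z=[\nabla_X,\nabla_Y]Z-\nabla_{[X,Y]}Z$, $R(X,Y,Z,V)=g(R(X,Y)Z,V)$. $\nabla$ is a $Spin(7)$-instanton if $R_{abij}\Psi_{abkl}=2R_{klij}$ for all $i,j,k,l$, i.e. the curvature 2-form lies in $\mathfrak{spin}(7)\cong\{\alpha\in\Lambda^2:\alpha_{ij}\Psi_{ijkl}=2\alpha_{kl}\}$. The 4-form $d^\nabla T$ is $d^{\nabla}T(X,Y,Z,V)=(\nabla_XT)(Y,Z,V)+(\nabla_YT)(Z,X,V)+(\nabla_ZT)(X,Y,V)-(\nabla_VT)(X,Y,Z)$. The space $\Lambda^4_{27}=\{\sigma\in\Lambda^4:\sigma_{ijkl}\Psi_{mjkl}=0 \text{ for all } i,m\}$ is the 27-dimensional irreducible $Spin(7)$-component of $\Lambda^4$. All metric quantities ($*$, $\delta\theta$, $\nabla$, etc.) in the claim are those of $\Psi$. *)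

theory Defs
  imports "HOL-Analysis.Analysis"
begin

section \<open>Smooth maps on open subsets of the model space\<close>

text \<open>The index type \<^typ>\<open>8\<close> has exactly the elements \<open>0, \<dots>, 7\<close>, so coordinates and frames
  are numbered as in \<open>e\<^sub>0, \<dots>, e\<^sub>7\<close>.\<close>

type_synonym pt = "real ^ 8"

definition pdiff :: "8 \<Rightarrow> (pt \<Rightarrow> 'b::real_normed_vector) \<Rightarrow> pt \<Rightarrow> 'b" where
  "pdiff i f x = frechet_derivative f (at x) (axis i 1)"

primrec Ck_on :: "nat \<Rightarrow> pt set \<Rightarrow> (pt \<Rightarrow> 'b::real_normed_vector) \<Rightarrow> bool" where
  "Ck_on 0 S f \<longleftrightarrow> continuous_on S f"
| "Ck_on (Suc n) S f \<longleftrightarrow> (\<forall>x\<in>S. f differentiable (at x)) \<and> (\<forall>i. Ck_on n S (pdiff i f))"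

definition smooth_on :: "pt set \<Rightarrow> (pt \<Rightarrow> 'b::real_normed_vector) \<Rightarrow> bool" where
  "smooth_on S f \<longleftrightarrow> (\<forall>n. Ck_on n S f)"


section \<open>Smooth 8-manifolds without boundary\<close>

text \<open>A chart is its domain together with its coordinate map; the values of the coordinate map
  outside the domain are irrelevant.  A smooth structure is given by a smooth atlas (not
  necessarily the maximal one).\<close>

type_synonym 'a chart = "'a set \<times> ('a \<Rightarrow> pt)"

definition img :: "'a chart \<Rightarrow> pt set" where
  "img c = snd c ` fst c"

definition from_chart :: "'a chart \<Rightarrow> pt \<Rightarrow> 'a" where
  "from_chart c = inv_into (fst c) (snd c)"

definition transition :: "'a chart \<Rightarrow> 'a chart \<Rightarrow> pt \<Rightarrow> pt" where
  "transition c d = snd d \<circ> from_chart c"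

definition overlap :: "'a chart \<Rightarrow> 'a chart \<Rightarrow> pt set" where
  "overlap c d = snd c ` (fst c \<inter> fst d)"

definition is_chart :: "'a topology \<Rightarrow> 'a chart \<Rightarrow> bool" where
  "is_chart X c \<longleftrightarrow> openin X (fst c) \<and> open (img c) \<and>
     homeomorphic_map (subtopology X (fst c)) (top_of_set (img c)) (snd c)"

definition smooth_manifold8 :: "'a topology \<Rightarrow> 'a chart set \<Rightarrow> bool" where
  "smooth_manifold8 X A \<longleftrightarrow>
     Hausdorff_space X \<and> second_countable X \<and>
     (\<forall>c\<in>A. is_chart X c) \<and> (\<Union>c\<in>A. fst c) = topspace X \<and>
     (\<forall>c\<in>A. \<forall>d\<in>A. smooth_on (overlap c d) (transition c d))"

definition smooth_function :: "'a chart set \<Rightarrow> ('a \<Rightarrow> real) \<Rightarrow> bool" where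
  "smooth_function A f \<longleftrightarrow> (\<forall>c\<in>A. smooth_on (img c) (f \<circ> from_chart c))"


section \<open>Tensors at a point\<close>

text \<open>A covariant \<open>k\<close>-tensor at a point is given by its components with respect to the coordinate
  basis, as a function of the list of its \<open>k\<close> indices.  Its values on lists of any other length
  carry no meaning and are never used.\<close>

type_synonym tensor = "8 list \<Rightarrow> real"

text \<open>Components \<open>t(L\<^bsub>i\<^sub>1\<^esub>, \<dots>, L\<^bsub>i\<^sub>k\<^esub>)\<close> of \<open>t\<close> on a family \<open>L\<close> of tangent vectors.  It serves for the
  pullback by a Jacobian, for components in a frame, and for raising indices.\<close>

definition comps :: "(8 \<Rightarrow> pt) \<Rightarrow> tensor \<Rightarrow> tensor" where
  "comps L t I =
     (\<Sum>J | length J = length I. (\<Prod>k<length I. L (I ! k) $ (J ! k)) * t J)"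

definition alternating :: "nat \<Rightarrow> tensor \<Rightarrow> bool" where
  "alternating k t \<longleftrightarrow>
     (\<forall>I \<sigma>. length I = k \<and> \<sigma> permutes {..<k} \<longrightarrow>
        t (permute_list \<sigma> I) = of_int (sign \<sigma>) * t I)"

text \<open>Wedge product of a \<open>p\<close>-form and a \<open>q\<close>-form, where \<open>p + q\<close> is the length of the index list;
  normalised so that \<open>(e\<^sub>1 \<and> \<dots> \<and> e\<^sub>k)(v\<^sub>1, \<dots>, v\<^sub>k) = det (e\<^sub>i(v\<^sub>j))\<close>.\<close>

definition wedge :: "nat \<Rightarrow> tensor \<Rightarrow> tensor \<Rightarrow> tensor" where
  "wedge p \<alpha> \<beta> I =
     (\<Sum>\<sigma> | \<sigma> permutes {..<length I}. of_int (sign \<sigma>) *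
        \<alpha> (take p (permute_list \<sigma> I)) * \<beta> (drop p (permute_list \<sigma> I)))
     / (fact p * fact (length I - p))"

definition gdot :: "tensor \<Rightarrow> pt \<Rightarrow> pt \<Rightarrow> real" where
  "gdot g u v = (\<Sum>i\<in>UNIV. \<Sum>j\<in>UNIV. g [i, j] * u $ i * v $ j)"

definition raise_indices :: "tensor \<Rightarrow> tensor \<Rightarrow> tensor" where
  "raise_indices g = comps (\<lambda>i. matrix_inv (\<chi> j k. g [j, k]) $ i)"

text \<open>Hodge star for the metric \<open>g\<close> and the volume form \<open>vol\<close>.  The degree \<open>p\<close> of the argument is
  recovered as 8 minus the degree of the result:
  \<open>(*\<alpha>)\<^sub>J = 1/p! \<alpha>\<^sup>I vol\<^bsub>IJ\<^esub>\<close>, which is equivalent to \<open>\<beta> \<and> *\<alpha> = g(\<beta>, \<alpha>) vol\<close>.\<close>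

definition hodge :: "tensor \<Rightarrow> tensor \<Rightarrow> tensor \<Rightarrow> tensor" where
  "hodge g vol \<alpha> J =
     (\<Sum>I | length I = 8 - length J. raise_indices g \<alpha> I * vol (I @ J)) / fact (8 - length J)"

definition orthonormal_frame :: "tensor \<Rightarrow> (8 \<Rightarrow> pt) \<Rightarrow> bool" where
  "orthonormal_frame g E \<longleftrightarrow> (\<forall>a b. gdot g (E a) (E b) = (if a = b then 1 else 0))"


section \<open>Tensor fields\<close>

text \<open>A tensor field is given by its coordinate expression in every chart, as a function on the
  image of the chart; the coordinate expressions are related by the tensor transformation law.\<close>

type_synonym local_field = "pt \<Rightarrow> tensor"
type_synonym 'a field = "'a chart \<Rightarrow> local_field"

definition jacobian :: "'a chart \<Rightarrow> 'a chart \<Rightarrow> pt \<Rightarrow> 8 \<Rightarrow> pt" where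
  "jacobian c d x = (\<lambda>i. pdiff i (transition c d) x)"

definition tensor_field :: "'a chart set \<Rightarrow> nat \<Rightarrow> 'a field \<Rightarrow> bool" where
  "tensor_field A k t \<longleftrightarrow>
     (\<forall>c\<in>A. \<forall>I. length I = k \<longrightarrow> smooth_on (img c) (\<lambda>x. t c x I)) \<and>
     (\<forall>c\<in>A. \<forall>d\<in>A. \<forall>x\<in>overlap c d. \<forall>I. length I = k \<longrightarrow>
        t c x I = comps (jacobian c d x) (t d (transition c d x)) I)"

definition vanishes :: "'a chart set \<Rightarrow> nat \<Rightarrow> 'a field \<Rightarrow> bool" where
  "vanishes A k t \<longleftrightarrow> (\<forall>c\<in>A. \<forall>x\<in>img c. \<forall>I. length I = k \<longrightarrow> t c x I = 0)"

definition diff_form :: "'a chart set \<Rightarrow> nat \<Rightarrow> 'a field \<Rightarrow> bool" where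
  "diff_form A k t \<longleftrightarrow> tensor_field A k t \<and> (\<forall>c\<in>A. \<forall>x\<in>img c. alternating k (t c x))"

definition riemannian_metric :: "'a chart set \<Rightarrow> 'a field \<Rightarrow> bool" where
  "riemannian_metric A g \<longleftrightarrow> tensor_field A 2 g \<and>
     (\<forall>c\<in>A. \<forall>x\<in>img c. (\<forall>i j. g c x [i, j] = g c x [j, i]) \<and>
        (\<forall>v. v \<noteq> 0 \<longrightarrow> gdot (g c x) v v > 0))"

text \<open>Exterior derivative \<open>(d\<omega>)\<^bsub>i\<^sub>0\<dots>i\<^sub>k\<^esub> = \<Sum>\<^sub>j (-1)\<^sup>j \<partial>\<^bsub>i\<^sub>j\<^esub> \<omega>\<^bsub>i\<^sub>0\<dots>i\<^sub>k without i\<^sub>j\<^esub>\<close>.\<close>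

definition ext_d :: "local_field \<Rightarrow> local_field" where
  "ext_d \<omega> x I =
     (\<Sum>j<length I. (-1) ^ j * pdiff (I ! j) (\<lambda>y. \<omega> y (take j I @ drop (Suc j) I)) x)"

definition star :: "local_field \<Rightarrow> local_field \<Rightarrow> local_field \<Rightarrow> local_field" where
  "star g vol \<omega> x = hodge (g x) (vol x) (\<omega> x)"

definition codiff :: "local_field \<Rightarrow> local_field \<Rightarrow> local_field \<Rightarrow> local_field" where
  "codiff g vol \<omega> = (\<lambda>x I. - star g vol (ext_d (star g vol \<omega>)) x I)"


section \<open>\<open>Spin(7)\<close> structures\<close>

definition e4 :: "(8 \<Rightarrow> tensor) \<Rightarrow> 8 \<Rightarrow> 8 \<Rightarrow> 8 \<Rightarrow> 8 \<Rightarrow> tensor" where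
  "e4 e i j k l = wedge 1 (e i) (wedge 1 (e j) (wedge 1 (e k) (e l)))"

definition spin7_model :: "(8 \<Rightarrow> tensor) \<Rightarrow> tensor" where
  "spin7_model e I =
     - e4 e 0 1 2 7 I + e4 e 0 2 3 6 I - e4 e 0 3 4 7 I - e4 e 0 5 6 7 I
     + e4 e 0 1 4 6 I + e4 e 0 2 4 5 I - e4 e 0 1 3 5 I - e4 e 3 4 5 6 I
     - e4 e 1 4 5 7 I - e4 e 1 2 5 6 I - e4 e 1 2 3 4 I - e4 e 2 3 5 7 I
     - e4 e 1 3 6 7 I + e4 e 2 4 6 7 I"

definition e8 :: "(8 \<Rightarrow> tensor) \<Rightarrow> tensor" where
  "e8 e = wedge 1 (e 0) (wedge 1 (e 1) (wedge 1 (e 2) (wedge 1 (e 3)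
            (wedge 1 (e 4) (wedge 1 (e 5) (wedge 1 (e 6) (e 7)))))))"

text \<open>A local coframe on an open subset \<open>W\<close> of (the image of) the chart \<open>c\<close>.\<close>

definition local_coframe :: "'a chart \<Rightarrow> pt set \<Rightarrow> (8 \<Rightarrow> local_field) \<Rightarrow> bool" where
  "local_coframe c W e \<longleftrightarrow> open W \<and> W \<subseteq> img c \<and>
     (\<forall>a i. smooth_on W (\<lambda>x. e a x [i])) \<and>
     (\<forall>x\<in>W. det (\<chi> a i. e a x [i]) \<noteq> 0)"

definition adapted_coframe :: "'a field \<Rightarrow> 'a chart \<Rightarrow> pt set \<Rightarrow> (8 \<Rightarrow> local_field) \<Rightarrow> bool" where
  "adapted_coframe \<Psi> c W e \<longleftrightarrow> local_coframe c W e \<and>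
     (\<forall>x\<in>W. \<forall>I. length I = 4 \<longrightarrow> \<Psi> c x I = spin7_model (\<lambda>a. e a x) I)"

definition spin7_structure :: "'a chart set \<Rightarrow> 'a field \<Rightarrow> bool" where
  "spin7_structure A \<Psi> \<longleftrightarrow> diff_form A 4 \<Psi> \<and>
     (\<forall>c\<in>A. \<forall>x\<in>img c. \<exists>W e. x \<in> W \<and> adapted_coframe \<Psi> c W e)"

text \<open>\<open>g\<close> and \<open>vol\<close> are the metric and the Riemannian volume form for which all adapted coframes
  are oriented orthonormal; the volume form encodes the orientation.\<close>

definition induces :: "'a chart set \<Rightarrow> 'a field \<Rightarrow> 'a field \<Rightarrow> 'a field \<Rightarrow> bool" where
  "induces A \<Psi> g vol \<longleftrightarrow> riemannian_metric A g \<and> diff_form A 8 vol \<and>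
     (\<forall>c\<in>A. \<forall>W e. adapted_coframe \<Psi> c W e \<longrightarrow>
        (\<forall>x\<in>W. (\<forall>i j. g c x [i, j] = (\<Sum>a\<in>UNIV. e a x [i] * e a x [j])) \<and>
           (\<forall>I. length I = 8 \<longrightarrow> vol c x I = e8 (\<lambda>a. e a x) I)))"

definition lee_form :: "'a field \<Rightarrow> 'a field \<Rightarrow> 'a field \<Rightarrow> 'a field" where
  "lee_form g vol \<Psi> c = (\<lambda>x I. - (1 / 7) *
     star (g c) (vol c) (\<lambda>y. wedge 3 (star (g c) (vol c) (ext_d (\<Psi> c)) y) (\<Psi> c y)) x I)"

definition closed_1form :: "'a chart set \<Rightarrow> 'a field \<Rightarrow> bool" where
  "closed_1form A \<theta> \<longleftrightarrow> vanishes A 2 (\<lambda>c. ext_d (\<theta> c))"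

definition coclosed_1form :: "'a chart set \<Rightarrow> 'a field \<Rightarrow> 'a field \<Rightarrow> 'a field \<Rightarrow> bool" where
  "coclosed_1form A g vol \<theta> \<longleftrightarrow> vanishes A 0 (\<lambda>c. codiff (g c) (vol c) (\<theta> c))"

definition gauduchon :: "'a chart set \<Rightarrow> 'a field \<Rightarrow> 'a field \<Rightarrow> 'a field \<Rightarrow> bool" where
  "gauduchon A g vol \<Psi> \<longleftrightarrow> coclosed_1form A g vol (lee_form g vol \<Psi>)"

definition exp_times :: "('a \<Rightarrow> real) \<Rightarrow> 'a field \<Rightarrow> 'a field" where
  "exp_times f t c = (\<lambda>x I. exp (f (from_chart c x)) * t c x I)"


section \<open>Linear connections\<close>

text \<open>A linear connection is given in every chart by \<open>\<Gamma> x i j\<close>, the vector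
  \<open>\<nabla>\<^bsub>\<partial>\<^sub>i\<^esub> \<partial>\<^sub>j\<close> at \<open>x\<close>.\<close>

type_synonym christoffel = "pt \<Rightarrow> 8 \<Rightarrow> 8 \<Rightarrow> pt"

text \<open>The last clause is the transformation law: with \<open>\<tau>\<close> the transition map from \<open>c\<close> to \<open>d\<close>,
  \<open>\<tau>\<^sub>*(\<nabla>\<^bsub>\<partial>\<^sub>i\<^esub> \<partial>\<^sub>j) = \<partial>\<^sub>i\<partial>\<^sub>j\<tau> + \<Gamma>\<^sub>d(\<partial>\<^sub>i\<tau>, \<partial>\<^sub>j\<tau>)\<close>.\<close>

definition linear_connection :: "'a chart set \<Rightarrow> ('a chart \<Rightarrow> christoffel) \<Rightarrow> bool" where
  "linear_connection A \<Gamma> \<longleftrightarrow>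
     (\<forall>c\<in>A. \<forall>i j. smooth_on (img c) (\<lambda>x. \<Gamma> c x i j)) \<and>
     (\<forall>c\<in>A. \<forall>d\<in>A. \<forall>x\<in>overlap c d. \<forall>i j.
        (\<Sum>k\<in>UNIV. \<Gamma> c x i j $ k *\<^sub>R jacobian c d x k) =
          pdiff i (pdiff j (transition c d)) x +
          (\<Sum>a\<in>UNIV. \<Sum>b\<in>UNIV. (jacobian c d x i $ a * jacobian c d x j $ b) *\<^sub>R
             \<Gamma> d (transition c d x) a b))"

text \<open>Covariant derivative \<open>\<nabla>\<^sub>X Y\<close>, Lie bracket and curvature for vector fields in a chart.\<close>

definition cov :: "christoffel \<Rightarrow> (pt \<Rightarrow> pt) \<Rightarrow> (pt \<Rightarrow> pt) \<Rightarrow> pt \<Rightarrow> pt" where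
  "cov \<Gamma> X Y x = frechet_derivative Y (at x) (X x) +
     (\<Sum>i\<in>UNIV. \<Sum>j\<in>UNIV. (X x $ i * Y x $ j) *\<^sub>R \<Gamma> x i j)"

definition lie_bracket :: "(pt \<Rightarrow> pt) \<Rightarrow> (pt \<Rightarrow> pt) \<Rightarrow> pt \<Rightarrow> pt" where
  "lie_bracket X Y x =
     frechet_derivative Y (at x) (X x) - frechet_derivative X (at x) (Y x)"

definition curv :: "christoffel \<Rightarrow> (pt \<Rightarrow> pt) \<Rightarrow> (pt \<Rightarrow> pt) \<Rightarrow> (pt \<Rightarrow> pt) \<Rightarrow> pt \<Rightarrow> pt" where
  "curv \<Gamma> X Y Z x =
     cov \<Gamma> X (cov \<Gamma> Y Z) x - cov \<Gamma> Y (cov \<Gamma> X Z) x - cov \<Gamma> (lie_bracket X Y) Z x"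

definition coord :: "8 \<Rightarrow> pt \<Rightarrow> pt" where
  "coord i = (\<lambda>x. axis i 1)"

definition torsion :: "'a field \<Rightarrow> ('a chart \<Rightarrow> christoffel) \<Rightarrow> 'a field" where
  "torsion g \<Gamma> c x I = (let X = coord (I ! 0); Y = coord (I ! 1); Z = coord (I ! 2) in
     gdot (g c x) (cov (\<Gamma> c) X Y x - cov (\<Gamma> c) Y X x - lie_bracket X Y x) (Z x))"

definition curvature :: "'a field \<Rightarrow> ('a chart \<Rightarrow> christoffel) \<Rightarrow> 'a field" where
  "curvature g \<Gamma> c x I =
     (let X = coord (I ! 0); Y = coord (I ! 1); Z = coord (I ! 2); V = coord (I ! 3) in
      gdot (g c x) (curv (\<Gamma> c) X Y Z x) (V x))"

text \<open>Covariant derivative of a covariant tensor; the first index is the direction: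
  \<open>(\<nabla>t)\<^bsub>m j\<^sub>1\<dots>j\<^sub>k\<^esub> = (\<nabla>\<^bsub>\<partial>\<^sub>m\<^esub> t)(\<partial>\<^bsub>j\<^sub>1\<^esub>, \<dots>, \<partial>\<^bsub>j\<^sub>k\<^esub>)\<close>.\<close>

definition nabla :: "('a chart \<Rightarrow> christoffel) \<Rightarrow> 'a field \<Rightarrow> 'a field" where
  "nabla \<Gamma> t c x I = (let m = hd I; J = tl I in
     pdiff m (\<lambda>y. t c y J) x -
     (\<Sum>k<length J. \<Sum>l\<in>UNIV. \<Gamma> c x m (J ! k) $ l * t c x (J[k := l])))"

text \<open>A \<open>k\<close>-tensor field that is parallel.\<close>

definition parallel :: "'a chart set \<Rightarrow> ('a chart \<Rightarrow> christoffel) \<Rightarrow> nat \<Rightarrow> 'a field \<Rightarrow> bool" where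
  "parallel A \<Gamma> k t \<longleftrightarrow> vanishes A (Suc k) (nabla \<Gamma> t)"

definition torsion_connection ::
    "'a chart set \<Rightarrow> 'a field \<Rightarrow> 'a field \<Rightarrow> ('a chart \<Rightarrow> christoffel) \<Rightarrow> bool" where
  "torsion_connection A g \<Psi> \<Gamma> \<longleftrightarrow> linear_connection A \<Gamma> \<and>
     parallel A \<Gamma> 2 g \<and> parallel A \<Gamma> 4 \<Psi> \<and> diff_form A 3 (torsion g \<Gamma>)"

definition spin7_instanton ::
    "'a chart set \<Rightarrow> 'a field \<Rightarrow> 'a field \<Rightarrow> ('a chart \<Rightarrow> christoffel) \<Rightarrow> bool" where
  "spin7_instanton A g \<Psi> \<Gamma> \<longleftrightarrow>
     (\<forall>c\<in>A. \<forall>x\<in>img c. \<forall>E. orthonormal_frame (g c x) E \<longrightarrow>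
        (let R = comps E (curvature g \<Gamma> c x); P = comps E (\<Psi> c x) in
         \<forall>i j k l. (\<Sum>a\<in>UNIV. \<Sum>b\<in>UNIV. R [a, b, i, j] * P [a, b, k, l]) = 2 * R [k, l, i, j]))"

definition d_nabla :: "('a chart \<Rightarrow> christoffel) \<Rightarrow> 'a field \<Rightarrow> 'a field" where
  "d_nabla \<Gamma> T c x I =
     (let i = I ! 0; j = I ! 1; k = I ! 2; l = I ! 3; D = nabla \<Gamma> T c x in
      D [i, j, k, l] + D [j, k, i, l] + D [k, i, j, l] - D [l, i, j, k])"

definition in_Lambda4_27 :: "'a chart set \<Rightarrow> 'a field \<Rightarrow> 'a field \<Rightarrow> 'a field \<Rightarrow> bool" where
  "in_Lambda4_27 A g \<Psi> \<sigma> \<longleftrightarrow> diff_form A 4 \<sigma> \<and>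
     (\<forall>c\<in>A. \<forall>x\<in>img c. \<forall>E. orthonormal_frame (g c x) E \<longrightarrow>
        (let S = comps E (\<sigma> c x); P = comps E (\<Psi> c x) in
         \<forall>i m. (\<Sum>j\<in>UNIV. \<Sum>k\<in>UNIV. \<Sum>l\<in>UNIV. S [i, j, k, l] * P [m, j, k, l]) = 0))"

definition self_dual :: "'a chart set \<Rightarrow> 'a field \<Rightarrow> 'a field \<Rightarrow> 'a field \<Rightarrow> bool" where
  "self_dual A g vol \<sigma> \<longleftrightarrow>
     (\<forall>c\<in>A. \<forall>x\<in>img c. \<forall>I. length I = 4 \<longrightarrow> star (g c) (vol c) (\<sigma> c) x I = \<sigma> c x I)"

end

(* In an adapted frame the Lee form is a multiple of the contraction t of the torsion T with the
   model form.  The instanton condition and the holonomy reduction, i.e. membership of both index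
   pairs of the curvature in spin(7), turn the contractions of the first Bianchi identity into
   linear relations.  For a closed Lee form they imply Ric(theta, theta) = (7/2) (nabla_theta theta)(theta),
   and once nabla theta = 0 the contraction of d^nabla T with Psi vanishes.
   Under the conformal change theta - theta' = df, so closedness is inherited by the Gauduchon
   structure, whose Lee form is also coclosed.  The Bochner formula for u = |theta|^2 then reads
   L u = 2 |nabla theta|^2 >= 0 for an elliptic operator L without zeroth-order term, and by Hopf's
   maximum principle u is constant on each component of the compact manifold.  Hence nabla theta = 0.
   Self-duality holds because the 4-forms annihilated by the contraction with the model form are
   self-dual. *)

theory Submission imports Defs begin

text \<open>The obstacle is the term \<open>S\<close> of the trace \<open>\<rho>\<close> of the
  curvature: it is quadratic in the torsion and has no sign. Let P contract 2-forms with the model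
  form, t be the contraction of the torsion T with it, d the divergence of T and G the contraction
  of T with t. Torsion destroys the pair symmetry of the curvature, but the defect is linear in
  nabla T. Hence the skew part of \<open>\<rho>\<close> has two expressions, whose comparison is a
  linear relation between d, G and P G; tracing a cyclic identity for nabla T gives another one for
  P d. As (P - 2)(P + 6) = 0, applying P to the first leaves P G = 2 G, so G lies in spin(7), and
  S(t, t), which is half the pairing of G with 2 G - P G, vanishes. What remains of
  \<open>\<rho>\<close> on the Lee direction is first order in u; t = -7 theta and the factor -1/2
  of \<open>ricci_lee\<close> produce 7/2. The maximum principle replaces integration, so local
  analysis and connectedness suffice. The Lee form is given by Hodge stars chart by chart; its
  smoothness and tensoriality are read off from its expression by torsion and Psi.\<close>

abbreviation (input) sum8 :: "(8 \<Rightarrow> 'b::comm_monoid_add) \<Rightarrow> 'b" (binder "\<Sum>\<^sub>8" 10) where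
  "sum8 f \<equiv> sum f UNIV"

subsection \<open>Calculus of smooth functions\<close>

abbreviation dd :: "(pt \<Rightarrow> 'b::real_normed_vector) \<Rightarrow> pt \<Rightarrow> pt \<Rightarrow> 'b" where
  "dd f x v \<equiv> frechet_derivative f (at x) v"

lemma dd_eqI: "(f has_derivative f') (at x) \<Longrightarrow> dd f x v = f' v"
  by (metis frechet_derivative_at)

lemma has_dd: "f differentiable (at x) \<Longrightarrow> (f has_derivative dd f x) (at x)"
  using frechet_derivative_works by blast

lemma linear_dd: "f differentiable (at x) \<Longrightarrow> linear (dd f x)"
  using linear_frechet_derivative by blast

lemma dd_add: "f differentiable (at x) \<Longrightarrow> dd f x (u + v) = dd f x u + dd f x v"
  by (simp add: linear_add linear_dd)

lemma dd_scaleR: "f differentiable (at x) \<Longrightarrow> dd f x (r *\<^sub>R v) = r *\<^sub>R dd f x v"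
  by (simp add: linear_cmul linear_dd)

lemma pt_expand: "(v::pt) = (\<Sum>\<^sub>8i. v $ i *\<^sub>R axis i 1)"
  using basis_expansion[of v] by (simp add: scalar_mult_eq_scaleR)

lemma linear_pt_expand:
  fixes F :: "pt \<Rightarrow> 'b::real_normed_vector"
  assumes "linear F" shows "F v = (\<Sum>\<^sub>8i. v $ i *\<^sub>R F (axis i 1))"
  by (subst pt_expand[of v]) (simp add: linear_sum[OF assms] linear_cmul[OF assms])

lemma dd_pdiff: "f differentiable (at x) \<Longrightarrow> dd f x v = (\<Sum>\<^sub>8i. v $ i *\<^sub>R pdiff i f x)"
  using linear_pt_expand[OF linear_dd] unfolding pdiff_def by blast

text \<open>\<open>frechet_derivative\<close> is a choice among candidate derivatives. The two
  functions have the same candidates, so the choices agree even at points where neither is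
  differentiable.\<close>

lemma dd_cong_open:
  assumes "open S" "x \<in> S" "\<And>y. y \<in> S \<Longrightarrow> f y = g y"
  shows "dd f x = dd g x"
proof -
  have "(f has_derivative F) (at x) \<longleftrightarrow> (g has_derivative F) (at x)" for F
    using has_derivative_transform_within_open[of f F x UNIV S g]
      has_derivative_transform_within_open[of g F x UNIV S f] assms by auto
  then show ?thesis unfolding frechet_derivative_def by simp
qed

lemma pdiff_cong_open:
  "open S \<Longrightarrow> x \<in> S \<Longrightarrow> (\<And>y. y \<in> S \<Longrightarrow> f y = g y) \<Longrightarrow> pdiff i f x = pdiff i g x"
  unfolding pdiff_def by (metis dd_cong_open)

lemma differentiable_cong_open:
  "open S \<Longrightarrow> x \<in> S \<Longrightarrow> (\<And>y. y \<in> S \<Longrightarrow> f y = g y) \<Longrightarrow> f differentiable (at x) \<Longrightarrow> g differentiable (at x)"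
  unfolding differentiable_def by (metis has_derivative_transform_within_open)

lemma Ck_on_cong:
  assumes "open S" "\<And>y. y \<in> S \<Longrightarrow> f y = g y" "Ck_on n S f"
  shows "Ck_on n S g"
  using assms(2,3)
proof (induction n arbitrary: f g)
  case 0 then show ?case by (simp cong: continuous_on_cong_simp)
next
  case (Suc n)
  have "Ck_on n S (pdiff i g)" for i
    using Suc.IH[of "pdiff i f" "pdiff i g"] pdiff_cong_open[OF assms(1) _ Suc.prems(1)] Suc.prems(2) by auto
  then show ?case using differentiable_cong_open[OF assms(1) _ Suc.prems(1)] Suc.prems(2) by auto
qed

lemma Ck_on_Suc_imp: "Ck_on (Suc n) S f \<Longrightarrow> Ck_on n S f"
proof (induction n arbitrary: f)
  case 0 then show ?case
    by (auto intro!: continuous_at_imp_continuous_on differentiable_imp_continuous_within)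
next
  case (Suc n)
  then show ?case by (metis Ck_on.simps(2))
qed

lemma Ck_on_const: "Ck_on n S (\<lambda>x. c)"
proof (induction n arbitrary: c)
  case (Suc n)
  have "pdiff i (\<lambda>x. c) = (\<lambda>x. 0)" for i by (auto simp: pdiff_def fun_eq_iff)
  with Suc show ?case by simp
qed simp

lemma Ck_on_bounded_linear:
  assumes "open S" "bounded_linear L" "Ck_on n S f"
  shows "Ck_on n S (\<lambda>x. L (f x))"
  using assms(3)
proof (induction n arbitrary: f)
  case 0 then show ?case using assms(2) by (simp add: bounded_linear.continuous_on)
next
  case (Suc n)
  have 1: "((\<lambda>x. L (f x)) has_derivative (\<lambda>v. L (dd f x v))) (at x)" if "x \<in> S" for x
    using bounded_linear.has_derivative[OF assms(2) has_dd] Suc.prems that by simp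
  have "pdiff i (\<lambda>x. L (f x)) x = L (pdiff i f x)" if "x \<in> S" for x i
    unfolding pdiff_def using dd_eqI[OF 1[OF that]] by simp
  then have "Ck_on n S (pdiff i (\<lambda>x. L (f x)))" for i
    using Ck_on_cong[OF assms(1) _ Suc.IH[of "pdiff i f"]] Suc.prems by simp
  then show ?case using 1 by (auto simp: differentiable_def)
qed

lemma Ck_on_add:
  assumes "open S" "Ck_on n S f" "Ck_on n S g"
  shows "Ck_on n S (\<lambda>x. f x + g x)"
  using assms(2,3)
proof (induction n arbitrary: f g)
  case 0 then show ?case by (simp add: continuous_on_add)
next
  case (Suc n)
  have 1: "((\<lambda>x. f x + g x) has_derivative (\<lambda>v. dd f x v + dd g x v)) (at x)" if "x \<in> S" for x
    using Suc.prems that by (auto intro!: derivative_eq_intros has_dd)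
  have "pdiff i (\<lambda>x. f x + g x) x = pdiff i f x + pdiff i g x" if "x \<in> S" for x i
    unfolding pdiff_def using dd_eqI[OF 1[OF that]] by simp
  then have "Ck_on n S (pdiff i (\<lambda>x. f x + g x))" for i
    using Ck_on_cong[OF assms(1) _ Suc.IH[of "pdiff i f" "pdiff i g"]] Suc.prems by simp
  then show ?case using 1 by (auto simp: differentiable_def)
qed

lemma Ck_on_bilinear:
  assumes "open S" "bounded_bilinear B" "Ck_on n S f" "Ck_on n S g"
  shows "Ck_on n S (\<lambda>x. B (f x) (g x))"
  using assms(3,4)
proof (induction n arbitrary: f g)
  case 0 then show ?case using assms(2) by (simp add: bounded_bilinear.continuous_on)
next
  case (Suc n)
  have 1: "((\<lambda>x. B (f x) (g x)) has_derivative (\<lambda>v. B (f x) (dd g x v) + B (dd f x v) (g x))) (at x)"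
    if "x \<in> S" for x
    using bounded_bilinear.FDERIV[OF assms(2) has_dd has_dd] Suc.prems that by simp
  have eq: "pdiff i (\<lambda>x. B (f x) (g x)) x = B (f x) (pdiff i g x) + B (pdiff i f x) (g x)"
    if "x \<in> S" for x i
    unfolding pdiff_def using dd_eqI[OF 1[OF that]] by simp
  \<comment> \<open>In each summand of the product rule one factor stays undifferentiated, so its
    order is lowered to \<open>n\<close> by \<open>Ck_on_Suc_imp\<close>.\<close>
  have "Ck_on n S (\<lambda>x. B (f x) (pdiff i g x) + B (pdiff i f x) (g x))" for i
    using Suc.IH[of f "pdiff i g"] Suc.IH[of "pdiff i f" g] Suc.prems
      Ck_on_Suc_imp[OF Suc.prems(1)] Ck_on_Suc_imp[OF Suc.prems(2)]
    by (intro Ck_on_add assms(1)) simp_all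
  then have "Ck_on n S (pdiff i (\<lambda>x. B (f x) (g x)))" for i
    using Ck_on_cong[OF assms(1)] eq by (metis (no_types, lifting))
  then show ?case using 1 by (auto simp: differentiable_def)
qed

lemma smooth_on_imp_differentiable: "smooth_on S f \<Longrightarrow> x \<in> S \<Longrightarrow> f differentiable (at x)"
  unfolding smooth_on_def by (metis Ck_on.simps(2))

lemma smooth_on_imp_continuous_on: "smooth_on S f \<Longrightarrow> continuous_on S f"
  unfolding smooth_on_def by (metis Ck_on.simps(1))

lemma smooth_on_pdiff: "smooth_on S f \<Longrightarrow> smooth_on S (pdiff i f)"
  unfolding smooth_on_def by (metis Ck_on.simps(2))

lemma smooth_on_iff:
  "smooth_on S f \<longleftrightarrow> (\<forall>x\<in>S. f differentiable (at x)) \<and> (\<forall>i. smooth_on S (pdiff i f))"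
  unfolding smooth_on_def by (metis Ck_on.simps(2) Ck_on_Suc_imp)

lemma smooth_on_cong:
  "open S \<Longrightarrow> (\<And>y. y \<in> S \<Longrightarrow> f y = g y) \<Longrightarrow> smooth_on S f \<Longrightarrow> smooth_on S g"
  unfolding smooth_on_def using Ck_on_cong by metis

lemma smooth_on_subset:
  assumes "smooth_on S f" "T \<subseteq> S" shows "smooth_on T f"
proof -
  have "Ck_on n S f \<Longrightarrow> Ck_on n T f" for n
    by (induction n arbitrary: f) (use assms(2) in \<open>auto intro: continuous_on_subset\<close>)
  then show ?thesis using assms(1) by (auto simp: smooth_on_def)
qed

lemma smooth_on_const: "smooth_on S (\<lambda>x. c)"
  by (simp add: smooth_on_def Ck_on_const)

lemma smooth_on_bounded_linear:
  "open S \<Longrightarrow> bounded_linear L \<Longrightarrow> smooth_on S f \<Longrightarrow> smooth_on S (\<lambda>x. L (f x))"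
  by (simp add: smooth_on_def Ck_on_bounded_linear)

lemma smooth_on_add: "open S \<Longrightarrow> smooth_on S f \<Longrightarrow> smooth_on S g \<Longrightarrow> smooth_on S (\<lambda>x. f x + g x)"
  by (simp add: smooth_on_def Ck_on_add)

lemma smooth_on_mult:
  fixes f g :: "pt \<Rightarrow> real"
  shows "open S \<Longrightarrow> smooth_on S f \<Longrightarrow> smooth_on S g \<Longrightarrow> smooth_on S (\<lambda>x. f x * g x)"
  by (simp add: smooth_on_def Ck_on_bilinear[OF _ bounded_bilinear_mult])

lemma smooth_on_scaleR:
  "open S \<Longrightarrow> smooth_on S f \<Longrightarrow> smooth_on S g \<Longrightarrow> smooth_on S (\<lambda>x. f x *\<^sub>R g x)"
  by (simp add: smooth_on_def Ck_on_bilinear[OF _ bounded_bilinear_scaleR])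

lemma smooth_on_minus: "open S \<Longrightarrow> smooth_on S f \<Longrightarrow> smooth_on S (\<lambda>x. - f x)"
  using smooth_on_bounded_linear[OF _ bounded_linear_minus[OF bounded_linear_ident]] by blast

lemma smooth_on_diff:
  "open S \<Longrightarrow> smooth_on S f \<Longrightarrow> smooth_on S g \<Longrightarrow> smooth_on S (\<lambda>x. f x - g x)"
  using smooth_on_add[of S f "\<lambda>x. - g x"] smooth_on_minus[of S g] by simp

lemma smooth_on_sum:
  "open S \<Longrightarrow> (\<And>i. i \<in> I \<Longrightarrow> smooth_on S (f i)) \<Longrightarrow> smooth_on S (\<lambda>x. \<Sum>i\<in>I. f i x)"
  by (induction I rule: infinite_finite_induct) (auto intro: smooth_on_const smooth_on_add)

lemma smooth_on_prod:
  fixes f :: "'i \<Rightarrow> pt \<Rightarrow> real"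
  shows "open S \<Longrightarrow> (\<And>i. i \<in> I \<Longrightarrow> smooth_on S (f i)) \<Longrightarrow> smooth_on S (\<lambda>x. \<Prod>i\<in>I. f i x)"
  by (induction I rule: infinite_finite_induct) (auto intro: smooth_on_const smooth_on_mult)

lemma smooth_on_nth: "open S \<Longrightarrow> smooth_on S f \<Longrightarrow> smooth_on S (\<lambda>x. f x $ k)"
  using smooth_on_bounded_linear[OF _ bounded_linear_vec_nth] by blast

lemma smooth_on_vec:
  fixes f :: "pt \<Rightarrow> pt"
  assumes "open S" "\<And>k. smooth_on S (\<lambda>x. f x $ k)" shows "smooth_on S f"
proof -
  have "smooth_on S (\<lambda>x. \<Sum>\<^sub>8k. f x $ k *\<^sub>R axis k (1::real))"
    by (intro smooth_on_sum smooth_on_scaleR assms smooth_on_const)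
  then show ?thesis by (simp flip: pt_expand)
qed

lemma has_derivative_compose_real:
  fixes g :: "real \<Rightarrow> real" and f :: "pt \<Rightarrow> real"
  assumes "f differentiable (at x)" "(g has_real_derivative d) (at (f x))"
  shows "((\<lambda>x. g (f x)) has_derivative (\<lambda>v. d * dd f x v)) (at x)"
  using has_derivative_compose[OF has_dd[OF assms(1)]] assms(2)
  unfolding has_field_derivative_def by blast

text \<open>The sequence \<open>h\<close> lists the successive derivatives of the outer function.
  The induction differentiates once and moves from \<open>h n\<close> to \<open>h (Suc n)\<close>; a
  constant sequence serves for \<open>exp\<close>.\<close>

lemma smooth_on_compose_real:
  fixes h :: "nat \<Rightarrow> real \<Rightarrow> real" and f :: "pt \<Rightarrow> real"
  assumes S: "open S" and f: "smooth_on S f"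
    and h: "\<And>x n. x \<in> S \<Longrightarrow> (h n has_real_derivative h (Suc n) (f x)) (at (f x))"
  shows "smooth_on S (\<lambda>x. h n (f x))"
  unfolding smooth_on_def
proof (intro allI)
  fix k show "Ck_on k S (\<lambda>x. h n (f x))"
  proof (induction k arbitrary: n)
    case 0
    have "((\<lambda>x. h n (f x)) has_derivative (\<lambda>v. h (Suc n) (f x) * dd f x v)) (at x)" if "x \<in> S" for x
      using has_derivative_compose_real[OF smooth_on_imp_differentiable[OF f that] h[OF that]] .
    then show ?case
      by (auto intro!: continuous_at_imp_continuous_on has_derivative_continuous)
  next
    case (Suc k)
    have 1: "((\<lambda>x. h n (f x)) has_derivative (\<lambda>v. h (Suc n) (f x) * dd f x v)) (at x)" if "x \<in> S" for x
      using has_derivative_compose_real[OF smooth_on_imp_differentiable[OF f that] h[OF that]] .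
    have eq: "pdiff i (\<lambda>x. h n (f x)) x = h (Suc n) (f x) * pdiff i f x" if "x \<in> S" for x i
      unfolding pdiff_def using dd_eqI[OF 1[OF that]] by simp
    have "Ck_on k S (\<lambda>x. h (Suc n) (f x) * pdiff i f x)" for i
      using smooth_on_pdiff[OF f] Suc.IH
      by (intro Ck_on_bilinear[OF S bounded_bilinear_mult]) (auto simp: smooth_on_def)
    then have "Ck_on k S (pdiff i (\<lambda>x. h n (f x)))" for i
      using Ck_on_cong[OF S] eq by (metis (no_types, lifting))
    then show ?case using 1 by (auto simp: differentiable_def)
  qed
qed

lemma smooth_on_exp:
  fixes f :: "pt \<Rightarrow> real"
  shows "open S \<Longrightarrow> smooth_on S f \<Longrightarrow> smooth_on S (\<lambda>x. exp (f x))"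
  using smooth_on_compose_real[of S f "\<lambda>n. exp"] by (auto intro: derivative_intros)

lemma smooth_on_inverse:
  fixes f :: "pt \<Rightarrow> real"
  assumes "open S" "smooth_on S f" "\<And>x. x \<in> S \<Longrightarrow> f x \<noteq> 0"
  shows "smooth_on S (\<lambda>x. inverse (f x))"
proof -
  \<comment> \<open>The \<open>n\<close>-th derivative of \<open>1/t\<close>.\<close>
  define h where "h n t = (-1) ^ n * fact n * inverse t ^ Suc n" for n and t :: real
  have "smooth_on S (\<lambda>x. h 0 (f x))"
  proof (rule smooth_on_compose_real[OF assms(1,2)])
    fix x n assume "x \<in> S"
    then have "f x \<noteq> 0" using assms(3) by blast
    from DERIV_cmult[OF DERIV_power[OF DERIV_inverse[OF this], of "Suc n"], of "(-1) ^ n * fact n"]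
    show "(h n has_real_derivative h (Suc n) (f x)) (at (f x))"
      unfolding h_def by (simp add: algebra_simps)
  qed
  then show ?thesis by (simp add: h_def)
qed

lemma smooth_on_det:
  fixes M :: "pt \<Rightarrow> real^8^8"
  assumes "open S" "\<And>i j. smooth_on S (\<lambda>x. M x $ i $ j)"
  shows "smooth_on S (\<lambda>x. det (M x))"
  unfolding det_def
  by (intro smooth_on_sum smooth_on_mult smooth_on_prod smooth_on_const assms)

text \<open>By Cramer's rule.\<close>

lemma smooth_on_inverse_matrix:
  fixes M N :: "pt \<Rightarrow> real^8^8"
  assumes S: "open S" and M: "\<And>i j. smooth_on S (\<lambda>x. M x $ i $ j)"
    and N: "\<And>x. x \<in> S \<Longrightarrow> M x ** N x = mat 1"
  shows "smooth_on S (\<lambda>x. N x $ i $ j)"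
proof -
  have d: "det (M x) \<noteq> 0" if "x \<in> S" for x
    using N[OF that] by (metis det_I det_mul mult_zero_left zero_neq_one)
  define C where "C x = (\<chi> a b. if b = i then axis j 1 $ a else M x $ a $ b)" for x
  have "N x $ i $ j = det (C x) * inverse (det (M x))" if "x \<in> S" for x
  proof -
    have "M x *v (column j (N x)) = axis j 1"
      using N[OF that] by (simp add: vec_eq_iff matrix_matrix_mult_def matrix_vector_mult_def column_def mat_def axis_def)
    then have "column j (N x) = (\<chi> k. det (\<chi> a b. if b = k then axis j 1 $ a else M x $ a $ b) / det (M x))"
      using cramer[OF d[OF that]] by blast
    then have "column j (N x) $ i = det (C x) / det (M x)" by (simp add: C_def)
    then show ?thesis by (simp add: column_def divide_inverse)
  qed
  moreover have "smooth_on S (\<lambda>x. det (C x) * inverse (det (M x)))"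
  proof (intro smooth_on_mult smooth_on_inverse smooth_on_det S M d)
    show "smooth_on S (\<lambda>x. C x $ a $ b)" for a b
      by (cases "b = i") (simp_all add: C_def smooth_on_const M)
  qed
  ultimately show ?thesis using smooth_on_cong[OF S] by (metis (no_types, lifting))
qed

text \<open>Symmetry of second derivatives: both mixed derivatives are limits of the same second
  difference quotient.\<close>

lemma second_difference:
  fixes f :: "pt \<Rightarrow> real" and h :: real
  assumes h: "0 < h" and S: "\<And>s t. 0 \<le> s \<Longrightarrow> s \<le> h \<Longrightarrow> 0 \<le> t \<Longrightarrow> t \<le> h \<Longrightarrow> x + s *\<^sub>R u + t *\<^sub>R v \<in> S"
    and f: "\<And>y. y \<in> S \<Longrightarrow> f differentiable (at y)"
    and f': "\<And>y. y \<in> S \<Longrightarrow> (\<lambda>z. dd f z u) differentiable (at y)"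
  shows "\<exists>s t. 0 < s \<and> s < h \<and> 0 < t \<and> t < h \<and>
     f (x + h *\<^sub>R u + h *\<^sub>R v) - f (x + h *\<^sub>R u) - f (x + h *\<^sub>R v) + f x
       = h * h * dd (\<lambda>z. dd f z u) (x + s *\<^sub>R u + t *\<^sub>R v) v"
proof -
  \<comment> \<open>The second difference of \<open>f\<close> is \<open>\<phi> h - \<phi> 0\<close>.
    One use of the mean value theorem differentiates along \<open>u\<close>, a second one along
    \<open>v\<close>.\<close>
  define \<phi> where "\<phi> s = f (x + s *\<^sub>R u + h *\<^sub>R v) - f (x + s *\<^sub>R u)" for s
  have line: "((\<lambda>s. f (z + s *\<^sub>R u)) has_real_derivative dd f (z + s *\<^sub>R u) u) (at s)"
    if "z + s *\<^sub>R u \<in> S" for z s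
  proof -
    have "((\<lambda>s. z + s *\<^sub>R u) has_derivative (\<lambda>r. r *\<^sub>R u)) (at s)"
      by (auto intro!: derivative_eq_intros)
    from has_derivative_compose[OF this has_dd[OF f[OF that]]]
    show ?thesis
      by (rule has_derivative_imp_has_field_derivative) (simp add: dd_scaleR f[OF that])
  qed
  have "\<exists>s. 0 < s \<and> s < h \<and> \<phi> h - \<phi> 0
      = (h - 0) * (dd f ((x + h *\<^sub>R v) + s *\<^sub>R u) u - dd f (x + s *\<^sub>R u) u)"
  proof (rule MVT2[OF h])
    fix s assume s: "0 \<le> s" "s \<le> h"
    have eq: "\<phi> = (\<lambda>s. f ((x + h *\<^sub>R v) + s *\<^sub>R u) - f (x + s *\<^sub>R u))"
      by (simp add: \<phi>_def fun_eq_iff add_ac)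
    have "(x + h *\<^sub>R v) + s *\<^sub>R u \<in> S" "x + s *\<^sub>R u \<in> S"
      using S[of s h] S[of s 0] s h by (auto simp: add_ac)
    then show "(\<phi> has_real_derivative dd f ((x + h *\<^sub>R v) + s *\<^sub>R u) u - dd f (x + s *\<^sub>R u) u) (at s)"
      unfolding eq by (intro DERIV_diff line)
  qed
  then obtain s where s: "0 < s" "s < h"
    and 1: "\<phi> h - \<phi> 0 = h * (dd f (x + s *\<^sub>R u + h *\<^sub>R v) u - dd f (x + s *\<^sub>R u) u)"
    by (auto simp: add_ac)
  have "\<exists>t. 0 < t \<and> t < h \<and> dd f (x + s *\<^sub>R u + h *\<^sub>R v) u - dd f (x + s *\<^sub>R u + 0 *\<^sub>R v) u
      = (h - 0) * dd (\<lambda>z. dd f z u) (x + s *\<^sub>R u + t *\<^sub>R v) v"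
  proof (rule MVT2[OF h])
    fix t assume t: "0 \<le> t" "t \<le> h"
    have in_S: "x + s *\<^sub>R u + t *\<^sub>R v \<in> S" using S[of s t] s t by simp
    have "((\<lambda>t. x + s *\<^sub>R u + t *\<^sub>R v) has_derivative (\<lambda>r. r *\<^sub>R v)) (at t)"
      by (auto intro!: derivative_eq_intros)
    from has_derivative_compose[OF this has_dd[OF f'[OF in_S]]]
    show "((\<lambda>t. dd f (x + s *\<^sub>R u + t *\<^sub>R v) u) has_real_derivative
        dd (\<lambda>z. dd f z u) (x + s *\<^sub>R u + t *\<^sub>R v) v) (at t)"
      by (rule has_derivative_imp_has_field_derivative) (simp add: dd_scaleR f'[OF in_S])
  qed
  then obtain t where "0 < t" "t < h"
    "dd f (x + s *\<^sub>R u + h *\<^sub>R v) u - dd f (x + s *\<^sub>R u) u = h * dd (\<lambda>z. dd f z u) (x + s *\<^sub>R u + t *\<^sub>R v) v"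
    by auto
  then show ?thesis using s 1 by (intro exI[of _ s] exI[of _ t]) (simp add: \<phi>_def)
qed

lemma dd_dd_commute:
  fixes f :: "pt \<Rightarrow> real"
  assumes "open S" "x \<in> S"
    and f: "\<And>y. y \<in> S \<Longrightarrow> f differentiable (at y)"
    and fu: "\<And>y. y \<in> S \<Longrightarrow> (\<lambda>z. dd f z u) differentiable (at y)"
    and fv: "\<And>y. y \<in> S \<Longrightarrow> (\<lambda>z. dd f z v) differentiable (at y)"
    and cu: "continuous_on S (\<lambda>y. dd (\<lambda>z. dd f z u) y v)"
    and cv: "continuous_on S (\<lambda>y. dd (\<lambda>z. dd f z v) y u)"
  shows "dd (\<lambda>z. dd f z u) x v = dd (\<lambda>z. dd f z v) x u"
proof (rule ccontr)
  let ?a = "\<lambda>y. dd (\<lambda>z. dd f z u) y v" and ?b = "\<lambda>y. dd (\<lambda>z. dd f z v) y u"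
  assume ne: "?a x \<noteq> ?b x"
  define e where "e = \<bar>?a x - ?b x\<bar> / 2"
  have e: "e > 0" using ne by (simp add: e_def)
  obtain r where r: "r > 0" "ball x r \<subseteq> S" using assms(1,2) open_contains_ball by blast
  have "isCont ?a x" "isCont ?b x"
    using cu cv assms(1,2) continuous_on_eq_continuous_at by blast+
  then obtain r1 r2 where r1: "r1 > 0" "\<And>y. dist y x < r1 \<Longrightarrow> dist (?a y) (?a x) < e"
    and r2: "r2 > 0" "\<And>y. dist y x < r2 \<Longrightarrow> dist (?b y) (?b x) < e"
    using e unfolding continuous_at_eps_delta by (metis (no_types, lifting))
  define q where "q = min r (min r1 r2)"
  have q: "q > 0" using r r1 r2 by (simp add: q_def)
  \<comment> \<open>Makes the whole parallelogram spanned by \<open>h u\<close> and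
    \<open>h v\<close> lie within distance \<open>q\<close> of \<open>x\<close>; the summand 1 keeps
    the quotient meaningful when both vectors vanish.\<close>
  define h where "h = q / (norm u + norm v + 1)"
  have pos: "norm u + norm v + 1 > 0" by (simp add: add_nonneg_pos)
  have h: "h > 0" using q pos by (simp add: h_def)
  have hq: "h * (norm u + norm v) < q"
  proof -
    have "h * (norm u + norm v + 1) = q" using pos unfolding h_def by (metis nonzero_eq_divide_eq less_irrefl)
    then show ?thesis using h by (simp add: algebra_simps)
  qed
  have near: "dist (x + s *\<^sub>R u + t *\<^sub>R v) x < q" if "0 \<le> s" "s \<le> h" "0 \<le> t" "t \<le> h" for s t
  proof -
    have "dist (x + s *\<^sub>R u + t *\<^sub>R v) x = norm (s *\<^sub>R u + t *\<^sub>R v)"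
      by (simp add: dist_norm add.assoc)
    also have "\<dots> \<le> s * norm u + t * norm v"
      using norm_triangle_ineq[of "s *\<^sub>R u" "t *\<^sub>R v"] that by simp
    also have "\<dots> \<le> h * norm u + h * norm v"
      using that by (intro add_mono mult_right_mono) auto
    finally show ?thesis using hq by (simp add: algebra_simps)
  qed
  have inS: "x + s *\<^sub>R u + t *\<^sub>R v \<in> S" if "0 \<le> s" "s \<le> h" "0 \<le> t" "t \<le> h" for s t
    using near[OF that] r(2) by (auto simp: q_def dist_commute)
  obtain s t where st: "0 < s" "s < h" "0 < t" "t < h" and
    A: "f (x + h *\<^sub>R u + h *\<^sub>R v) - f (x + h *\<^sub>R u) - f (x + h *\<^sub>R v) + f x = h * h * ?a (x + s *\<^sub>R u + t *\<^sub>R v)"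
    using second_difference[OF h inS f fu] by blast
  have inS': "x + s *\<^sub>R v + t *\<^sub>R u \<in> S" if "0 \<le> s" "s \<le> h" "0 \<le> t" "t \<le> h" for s t
    using inS[of t s] that by (simp add: add_ac)
  obtain s' t' where st': "0 < s'" "s' < h" "0 < t'" "t' < h" and
    "f (x + h *\<^sub>R v + h *\<^sub>R u) - f (x + h *\<^sub>R v) - f (x + h *\<^sub>R u) + f x = h * h * ?b (x + s' *\<^sub>R v + t' *\<^sub>R u)"
    using second_difference[OF h inS' f fv] by blast
  moreover have "x + h *\<^sub>R v + h *\<^sub>R u = x + h *\<^sub>R u + h *\<^sub>R v"
    "x + s' *\<^sub>R v + t' *\<^sub>R u = x + t' *\<^sub>R u + s' *\<^sub>R v" by (simp_all add: add_ac)
  ultimately have "h * h * ?a (x + s *\<^sub>R u + t *\<^sub>R v) = h * h * ?b (x + t' *\<^sub>R u + s' *\<^sub>R v)"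
    using A by (simp only:)
  then have "?a (x + s *\<^sub>R u + t *\<^sub>R v) = ?b (x + t' *\<^sub>R u + s' *\<^sub>R v)" using h by simp
  moreover have "dist (?a (x + s *\<^sub>R u + t *\<^sub>R v)) (?a x) < e"
    using near[of s t] st by (intro r1(2)) (simp add: q_def)
  moreover have "dist (?b (x + t' *\<^sub>R u + s' *\<^sub>R v)) (?b x) < e"
    using near[of t' s'] st' by (intro r2(2)) (simp add: q_def)
  ultimately show False by (simp add: e_def dist_real_def abs_if split: if_splits)
qed

lemma smooth_on_dd_const:
  assumes "open S" "smooth_on S f" shows "smooth_on S (\<lambda>x. dd f x v)"
proof -
  have "smooth_on S (\<lambda>x. \<Sum>\<^sub>8i. v $ i *\<^sub>R pdiff i f x)"
    by (intro smooth_on_sum smooth_on_scaleR smooth_on_const smooth_on_pdiff assms)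
  then show ?thesis
    by (rule smooth_on_cong[OF assms(1), rotated]) (simp add: dd_pdiff smooth_on_imp_differentiable[OF assms(2)])
qed

lemma smooth_dd_dd_commute:
  fixes f :: "pt \<Rightarrow> real"
  assumes "open S" "x \<in> S" "smooth_on S f"
  shows "dd (\<lambda>z. dd f z u) x v = dd (\<lambda>z. dd f z v) x u"
proof -
  note d = smooth_on_dd_const[OF assms(1)]
  show ?thesis
    by (intro dd_dd_commute[OF assms(1,2)] smooth_on_imp_differentiable[where S = S]
        smooth_on_imp_continuous_on d assms(3))
qed

subsection \<open>Sums over index lists\<close>

lemma UNIV_8: "(UNIV :: 8 set) = {0, 1, 2, 3, 4, 5, 6, 7}"
proof -
  have "card {0, 1, 2, 3, 4, 5, 6, 7 :: 8} = CARD(8)" by simp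
  then show ?thesis using card_subset_eq[OF finite subset_UNIV] by metis
qed

lemma exhaust_8: "(i::8) = 0 \<or> i = 1 \<or> i = 2 \<or> i = 3 \<or> i = 4 \<or> i = 5 \<or> i = 6 \<or> i = 7"
  using UNIV_8 by blast

lemma sum_8: "(\<Sum>i\<in>(UNIV::8 set). f i) = f 0 + f 1 + f 2 + f 3 + f 4 + f 5 + f 6 + (f 7 :: real)"
  unfolding UNIV_8 by (simp add: add.assoc)

lemma finite_lists_length: "finite {I :: 8 list. length I = n}"
  using finite_lists_length_eq[of "UNIV :: 8 set" n] by simp

lemma sum_lists_Suc:
  fixes F :: "8 list \<Rightarrow> real"
  shows "(\<Sum>I | length I = Suc n. F I) = (\<Sum>\<^sub>8i. \<Sum>I | length I = n. F (i # I))"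
proof -
  have "(\<Sum>\<^sub>8i. \<Sum>I | length I = n. F (i # I)) = (\<Sum>(i, I)\<in>UNIV \<times> {I. length I = n}. F (i # I))"
    by (simp add: sum.cartesian_product)
  also have "\<dots> = (\<Sum>I | length I = Suc n. F I)"
    by (rule sum.reindex_bij_witness[of _ "\<lambda>I. (hd I, tl I)" "\<lambda>(i, I). i # I"])
      (auto simp: length_Suc_conv)
  finally show ?thesis by simp
qed

lemma sum_lists_add:
  fixes F :: "8 list \<Rightarrow> real"
  shows "(\<Sum>I | length I = m + n. F I) = (\<Sum>I | length I = m. \<Sum>J | length J = n. F (I @ J))"
proof (induction m arbitrary: F)
  case 0 then show ?case by simp
next
  case (Suc m) then show ?case
    using sum_lists_Suc[of F "m + n"] sum_lists_Suc[of "\<lambda>I. \<Sum>J | length J = n. F (I @ J)" m] by simp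
qed

lemma comps_Nil: "comps L t [] = t []"
  by (simp add: comps_def)

lemma comps_Cons: "comps L t (i # I) = (\<Sum>\<^sub>8j. L i $ j * comps L (\<lambda>J. t (j # J)) I)"
  unfolding comps_def
  by (simp add: sum_lists_Suc lessThan_Suc_eq_insert_0 prod.reindex sum_distrib_left mult.assoc)

lemma comps_cong: "(\<And>J. length J = length I \<Longrightarrow> t J = s J) \<Longrightarrow> comps L t I = comps L s I"
  by (simp add: comps_def)

lemma comps_add: "comps L (\<lambda>J. t J + s J) I = comps L t I + comps L s I"
  by (simp add: comps_def sum.distrib algebra_simps)

lemma comps_cmult: "comps L (\<lambda>J. c * t J) I = c * comps L t I"
  by (simp add: comps_def sum_distrib_left algebra_simps)

lemma comps_sum: "comps L (\<lambda>J. \<Sum>a\<in>A. t a J) I = (\<Sum>a\<in>A. comps L (t a) I)"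
  unfolding comps_def sum_distrib_left by (rule sum.swap)

lemma comps_comps: "comps L (comps M t) I = comps (\<lambda>i. \<Sum>\<^sub>8j. L i $ j *\<^sub>R M j) t I"
proof (induction I arbitrary: t)
  case Nil then show ?case by (simp add: comps_Nil)
next
  case (Cons i I)
  have "comps L (comps M t) (i # I)
      = (\<Sum>\<^sub>8j k. L i $ j * M j $ k * comps L (comps M (\<lambda>J. t (k # J))) I)"
    by (simp add: comps_Cons comps_sum comps_cmult sum_distrib_left mult.assoc)
  also have "\<dots> = (\<Sum>\<^sub>8k. (\<Sum>\<^sub>8j. L i $ j * M j $ k) * comps L (comps M (\<lambda>J. t (k # J))) I)"
    by (subst sum.swap) (simp add: sum_distrib_right)
  finally show ?case by (simp add: comps_Cons Cons)
qed

lemma sum_axis: "(\<Sum>\<^sub>8j. axis a (1::real) $ j * f j) = f a"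
  by (simp add: axis_def if_distrib[where f = "\<lambda>z. z * _"] cong: if_cong)

lemma comps_std: "comps (\<lambda>i. axis i 1) t I = t I"
  by (induction I arbitrary: t) (simp_all add: comps_Nil comps_Cons sum_axis)

lemma comps_append:
  "comps L t (I @ J) = (\<Sum>K | length K = length I. (\<Prod>k<length I. L (I ! k) $ (K ! k)) * comps L (\<lambda>M. t (K @ M)) J)"
proof (induction I arbitrary: t)
  case Nil then show ?case by simp
next
  case (Cons i I)
  then show ?case
    by (simp add: comps_Cons sum_lists_Suc lessThan_Suc_eq_insert_0 prod.reindex sum_distrib_left mult.assoc)
qed

lemma permute_list_inv:
  assumes "\<sigma> permutes {..<length I}"
  shows "permute_list (inv \<sigma>) (permute_list \<sigma> I) = I" "permute_list \<sigma> (permute_list (inv \<sigma>) I) = I"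
  using permute_list_compose[OF permutes_inv[OF assms], of \<sigma>] permute_list_compose[OF assms, of "inv \<sigma>"]
  by (simp_all add: permutes_inv_o[OF assms])

lemma comps_permute:
  assumes "\<sigma> permutes {..<length I}"
  shows "comps L (\<lambda>J. t (permute_list \<sigma> J)) I = comps L t (permute_list \<sigma> I)"
proof -
  let ?n = "length I"
  have "(\<Sum>J | length J = ?n. (\<Prod>k<?n. L (I ! k) $ (J ! k)) * t (permute_list \<sigma> J))
      = (\<Sum>J | length J = ?n. (\<Prod>k<?n. L (permute_list \<sigma> I ! k) $ (J ! k)) * t J)"
  proof (rule sum.reindex_bij_witness[of _ "permute_list (inv \<sigma>)" "permute_list \<sigma>"])
    fix J :: "8 list" assume J: "J \<in> {J. length J = ?n}"
    show "permute_list (inv \<sigma>) (permute_list \<sigma> J) = J"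
      "permute_list \<sigma> (permute_list (inv \<sigma>) J) = J"
      using J assms permute_list_inv[of \<sigma> J] by simp_all
    show "(\<Prod>k<?n. L (permute_list \<sigma> I ! k) $ (permute_list \<sigma> J ! k)) * t (permute_list \<sigma> J)
        = (\<Prod>k<?n. L (I ! k) $ (J ! k)) * t (permute_list \<sigma> J)"
      using J assms prod.permute[OF assms, of "\<lambda>k. L (I ! k) $ (J ! k)"]
      by (simp add: permute_list_nth)
  qed simp_all
  then show ?thesis by (simp add: comps_def)
qed

text \<open>Naturality of the wedge product under pullback: each slot permutation passes through
  \<open>comps\<close> by \<open>comps_permute\<close>, and the remaining tensor product splits over
  \<open>take\<close> and \<open>drop\<close>.\<close>

lemma comps_wedge:
  assumes "p \<le> length I"
  shows "comps L (wedge p \<alpha> \<beta>) I = wedge p (comps L \<alpha>) (comps L \<beta>) I"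
proof -
  let ?n = "length I"
  have split: "comps L (\<lambda>J. \<alpha> (take p J) * \<beta> (drop p J)) J = comps L \<alpha> (take p J) * comps L \<beta> (drop p J)"
    if "length J = ?n" for J
  proof -
    have "comps L (\<lambda>J. \<alpha> (take p J) * \<beta> (drop p J)) (take p J @ drop p J)
      = (\<Sum>K | length K = p. (\<Prod>k<p. L (take p J ! k) $ (K ! k)) * (\<alpha> K * comps L \<beta> (drop p J)))"
      using that assms by (subst comps_append) (auto intro!: sum.cong simp: comps_cmult)
    also have "\<dots> = comps L \<alpha> (take p J) * comps L \<beta> (drop p J)"
      using that assms by (simp add: comps_def[of L \<alpha>] sum_distrib_right mult.assoc)
    finally show ?thesis by simp
  qed
  have "comps L (wedge p \<alpha> \<beta>) I = comps L (\<lambda>J. (\<Sum>\<sigma> | \<sigma> permutes {..<?n}. of_int (sign \<sigma>) *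
        (\<alpha> (take p (permute_list \<sigma> J)) * \<beta> (drop p (permute_list \<sigma> J)))) / (fact p * fact (?n - p))) I"
    by (intro comps_cong) (simp add: wedge_def mult.assoc)
  also have "\<dots> = (\<Sum>\<sigma> | \<sigma> permutes {..<?n}. of_int (sign \<sigma>) *
        comps L (\<lambda>J. \<alpha> (take p (permute_list \<sigma> J)) * \<beta> (drop p (permute_list \<sigma> J))) I) / (fact p * fact (?n - p))"
    using comps_cmult[of L "1 / (fact p * fact (?n - p))"]
    by (simp add: comps_sum comps_cmult field_simps)
  also have "\<dots> = wedge p (comps L \<alpha>) (comps L \<beta>) I"
    using comps_permute[of _ I L "\<lambda>J. \<alpha> (take p J) * \<beta> (drop p J)"] split
    by (simp add: wedge_def mult.assoc)
  finally show ?thesis .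
qed

subsection \<open>Alternating tensors\<close>

lemma alternatingD:
  "alternating k t \<Longrightarrow> length I = k \<Longrightarrow> \<sigma> permutes {..<k} \<Longrightarrow> t (permute_list \<sigma> I) = of_int (sign \<sigma>) * t I"
  by (simp add: alternating_def)

text \<open>Composing with \<open>\<tau>\<close> translates the sum over the permutation group and
  contributes the factor \<open>sign \<tau>\<close>.\<close>

lemma alternating_wedge: "alternating n (wedge p \<alpha> \<beta>)"
  unfolding alternating_def
proof (intro allI impI, elim conjE)
  fix I :: "8 list" and \<tau> assume n: "length I = n" and \<tau>: "\<tau> permutes {..<n}"
  define F where "F J = \<alpha> (take p J) * \<beta> (drop p J)" for J
  have "(\<Sum>\<sigma> | \<sigma> permutes {..<n}. of_int (sign \<sigma>) * F (permute_list \<sigma> (permute_list \<tau> I)))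
    = (\<Sum>\<sigma> | \<sigma> permutes {..<n}. of_int (sign (\<tau> \<circ> \<sigma>)) * of_int (sign \<tau>) * F (permute_list (\<tau> \<circ> \<sigma>) I))"
    using \<tau> n by (intro sum.cong)
      (auto simp: permute_list_compose sign_compose permutes_imp_permutation[of "{..<n}"] sign_idempotent
            simp flip: of_int_mult mult.assoc)
  also have "\<dots> = (\<Sum>\<sigma> | \<sigma> permutes {..<n}. of_int (sign \<sigma>) * of_int (sign \<tau>) * F (permute_list \<sigma> I))"
    by (rule sum.reindex_bij_witness[of _ "\<lambda>\<sigma>. inv \<tau> \<circ> \<sigma>" "\<lambda>\<sigma>. \<tau> \<circ> \<sigma>"])
      (use \<tau> in \<open>auto simp: permutes_compose permutes_inv permutes_inv_o o_assoc\<close>)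
  finally show "wedge p \<alpha> \<beta> (permute_list \<tau> I) = of_int (sign \<tau>) * wedge p \<alpha> \<beta> I"
    using n by (simp add: wedge_def F_def sum_distrib_left mult_ac)
qed

lemma alternating_comps: assumes "alternating k t" shows "alternating k (comps L t)"
  unfolding alternating_def
proof (intro allI impI, elim conjE)
  fix I :: "8 list" and \<sigma> assume *: "length I = k" "\<sigma> permutes {..<k}"
  then have "comps L t (permute_list \<sigma> I) = comps L (\<lambda>J. t (permute_list \<sigma> J)) I"
    by (simp add: comps_permute)
  also have "\<dots> = comps L (\<lambda>J. of_int (sign \<sigma>) * t J) I"
    using * by (intro comps_cong) (simp add: alternatingD[OF assms])
  finally show "comps L t (permute_list \<sigma> I) = of_int (sign \<sigma>) * comps L t I" by (simp add: comps_cmult)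
qed

lemma permute_list_transpose:
  assumes "i < length I" "j < length I"
  shows "permute_list (Transposition.transpose i j) I = I[i := I ! j, j := I ! i]"
  using assms by (intro nth_equalityI)
    (auto simp: permute_list_nth permutes_swap_id nth_list_update Transposition.transpose_def)

lemma alternating_swap:
  assumes "alternating k t" "length I = k" "i < k" "j < k" "i \<noteq> j"
  shows "t (I[i := I ! j, j := I ! i]) = - t I"
  using alternatingD[OF assms(1,2), of "Transposition.transpose i j"] assms(2-)
  by (simp add: permutes_swap_id permute_list_transpose sign_swap_id)

lemma alternating_repeated:
  assumes "alternating k t" "length I = k" "i < k" "j < k" "i \<noteq> j" "I ! i = I ! j"
  shows "t I = 0"
proof -
  have "I[i := I ! j, j := I ! i] = I" using assms(6) by (metis list_update_id)
  then show ?thesis using alternating_swap[OF assms(1-5)] by simp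
qed

lemma alternating_not_distinct:
  "alternating k t \<Longrightarrow> length I = k \<Longrightarrow> \<not> distinct I \<Longrightarrow> t I = 0"
  by (metis alternating_repeated distinct_conv_nth)

lemma alternating_swapI:
  assumes "\<And>I i j. length I = k \<Longrightarrow> i < k \<Longrightarrow> j < k \<Longrightarrow> i \<noteq> j \<Longrightarrow> t (I[i := I ! j, j := I ! i]) = - t I"
  shows "alternating k t"
  unfolding alternating_def
proof (intro allI impI, elim conjE)
  fix I :: "8 list" and \<sigma> assume len: "length I = k" and "\<sigma> permutes {..<k}"
  from \<open>\<sigma> permutes {..<k}\<close> finite_lessThan
  show "t (permute_list \<sigma> I) = of_int (sign \<sigma>) * t I"
    using len
  proof (induction arbitrary: I rule: permutes_induct)
    case id then show ?case by simp
  next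
    case (swap a b p)
    then have "permute_list (Transposition.transpose a b \<circ> p) I
        = permute_list p (I[a := I ! b, b := I ! a])"
      by (simp add: permute_list_compose permute_list_transpose)
    then have "t (permute_list (Transposition.transpose a b \<circ> p) I) = - of_int (sign p) * t I"
      using assms[OF swap.prems(1)] swap.hyps swap.IH[of "I[a := I ! b, b := I ! a]"] swap.prems by simp
    moreover have "sign (Transposition.transpose a b \<circ> p) = - sign p"
      using swap by (subst sign_compose) (auto simp: permutation_swap_id permutes_imp_permutation[of "{..<k}"] sign_swap_id)
    ultimately show ?case by (simp only: of_int_minus)
  qed
qed

text \<open>Adjacent transpositions suffice: exchanging two entries separated by \<open>zs\<close>
  is an odd number of adjacent exchanges, by induction on \<open>zs\<close>. In this form the
  condition is easy to check for tensors built by list operations, such as \<open>ext_d\<close> and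
  \<open>hstar\<close>.\<close>

lemma alternating_adjI:
  assumes "\<And>xs a b ys. length xs + length ys + 2 = k \<Longrightarrow> t (xs @ b # a # ys) = - t (xs @ a # b # ys)"
  shows "alternating k t"
proof (rule alternating_swapI)
  have move: "t (xs @ b # zs @ a # ys) = - t (xs @ a # zs @ b # ys)"
    if "length xs + length zs + length ys + 2 = k" for xs zs ys a b
    using that
  proof (induction zs arbitrary: xs)
    case Nil then show ?case using assms[of xs ys a b] by simp
  next
    case (Cons z zs)
    have "t (xs @ b # (z # zs) @ a # ys) = - t (xs @ z # b # zs @ a # ys)"
      using assms[of xs "zs @ a # ys" z b] Cons.prems by simp
    also have "\<dots> = t (xs @ z # a # zs @ b # ys)"
      using Cons.IH[of "xs @ [z]"] Cons.prems by simp
    also have "\<dots> = - t (xs @ a # (z # zs) @ b # ys)"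
      using assms[of xs "zs @ b # ys" a z] Cons.prems by simp
    finally show ?case .
  qed
  have less: "t (I[i := I ! j, j := I ! i]) = - t I" if "length I = k" "i < j" "j < k" for I :: "8 list" and i j
  proof -
    define xs zs ys where "xs = take i I" and "zs = take (j - Suc i) (drop (Suc i) I)" and "ys = drop (Suc j) I"
    have I: "I = xs @ I ! i # zs @ I ! j # ys" and "length xs = i" "length zs = j - Suc i"
    proof -
      have "drop (Suc i) I = zs @ drop (j - Suc i) (drop (Suc i) I)" 
        unfolding zs_def by (simp only: append_take_drop_id)
      also have "drop (j - Suc i) (drop (Suc i) I) = I ! j # ys"
        using that by (simp add: ys_def Cons_nth_drop_Suc)
      finally show "I = xs @ I ! i # zs @ I ! j # ys"
        using that id_take_nth_drop[of i I] by (simp add: xs_def)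
    qed (use that in \<open>simp_all add: xs_def zs_def\<close>)
    define a b where "a = I ! i" and "b = I ! j"
    have I': "I = xs @ a # zs @ b # ys" and ij: "i = length xs" "j = length xs + Suc (length zs)"
      using I that \<open>length xs = i\<close> \<open>length zs = j - Suc i\<close> by (auto simp: a_def b_def)
    have "I[i := b, j := a] = xs @ b # zs @ a # ys"
      unfolding I' ij by (simp add: list_update_append)
    moreover have "length xs + length zs + length ys + 2 = k"
      using arg_cong[OF I', of length] that(1) by simp
    ultimately show ?thesis using move[of xs zs ys b a] I' by (metis a_def b_def)
  qed
  fix I :: "8 list" and i j assume "length I = k" "i < k" "j < k" "i \<noteq> j"
  then show "t (I[i := I ! j, j := I ! i]) = - t I"
    using less[of I i j] less[of I j i] by (cases "i < j") (auto simp: list_update_swap)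
qed

text \<open>Laplace expansion of a wedge product with a 1-form.  Moving the first index into the slot of
  the index taken out keeps the sign constant.\<close>

lemma wedge_1_expand:
  assumes \<beta>: "alternating n \<beta>" and I: "length I = Suc n"
  shows "wedge 1 \<alpha> \<beta> I = \<alpha> [hd I] * \<beta> (tl I) - (\<Sum>b<n. \<alpha> [tl I ! b] * \<beta> ((tl I)[b := hd I]))"
proof -
  define \<gamma> where "\<gamma> J = \<alpha> (take 1 J) * \<beta> (drop 1 J)" for J
  have \<gamma>: "\<gamma> (permute_list q L) = of_int (sign q) * \<gamma> L"
    if "q permutes {1..<Suc n}" "length L = Suc n" for q L
    using that(1) finite_atLeastLessThan that(2)
  proof (induction arbitrary: L rule: permutes_induct)
    case id then show ?case by simp
  next
    case (swap a b p)
    have p: "p permutes {..<Suc n}" by (rule permutes_subset[OF swap.hyps(4)]) auto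
    obtain x K where L: "L = x # K" using swap.prems by (cases L) auto
    obtain a' b' where ab: "a = Suc a'" "b = Suc b'" "a' < n" "b' < n" "a' \<noteq> b'"
      using swap.hyps by (cases a; cases b) auto
    have "permute_list (Transposition.transpose a b \<circ> p) L = permute_list p (L[a := L ! b, b := L ! a])"
      using swap.hyps swap.prems p by (simp add: permute_list_compose permute_list_transpose)
    moreover have "\<gamma> (L[a := L ! b, b := L ! a]) = - \<gamma> L"
      using alternating_swap[OF \<beta>, of K a' b'] ab swap.prems by (simp add: \<gamma>_def L)
    ultimately have "\<gamma> (permute_list (Transposition.transpose a b \<circ> p) L) = - of_int (sign p) * \<gamma> L"
      using swap.IH[of "L[a := L ! b, b := L ! a]"] swap.prems by simp
    moreover have "sign (Transposition.transpose a b \<circ> p) = - sign p"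
      using swap.hyps by (subst sign_compose)
        (auto simp: permutation_swap_id permutes_imp_permutation[of "{1..<Suc n}"] sign_swap_id)
    ultimately show ?case by (simp only: of_int_minus)
  qed
  have ins: "{..<Suc n} = insert 0 {1..<Suc n}" by auto
  \<comment> \<open>Every permutation is uniquely \<open>transpose 0 b\<close> composed with some
    \<open>q\<close> that fixes slot 0. The \<open>fact n\<close> choices of \<open>q\<close>
    contribute equally, because \<open>\<gamma>\<close> changes by \<open>sign q\<close>, and they
    cancel the normalisation of \<open>wedge\<close>.\<close>
  have summand: "(\<Sum>q | q permutes {1..<Suc n}. of_int (sign (Transposition.transpose 0 b \<circ> q)) *
      \<gamma> (permute_list (Transposition.transpose 0 b \<circ> q) I))
    = fact n * ((if b = 0 then 1 else - 1) * \<gamma> (I[0 := I ! b, b := I ! 0]))"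
    if b: "b < Suc n" for b
  proof -
    have "of_int (sign (Transposition.transpose 0 b \<circ> q)) * \<gamma> (permute_list (Transposition.transpose 0 b \<circ> q) I)
      = (if b = 0 then 1 else - 1) * \<gamma> (I[0 := I ! b, b := I ! 0])" if q: "q permutes {1..<Suc n}" for q
    proof -
      have q': "q permutes {..<Suc n}" by (rule permutes_subset[OF q]) auto
      have "sign (Transposition.transpose 0 b \<circ> q) = (if b = 0 then 1 else - 1) * sign q"
        using q by (subst sign_compose)
          (auto simp: permutation_swap_id permutes_imp_permutation[of "{1..<Suc n}"] sign_swap_id)
      moreover have "\<gamma> (permute_list (Transposition.transpose 0 b \<circ> q) I) = of_int (sign q) * \<gamma> (I[0 := I ! b, b := I ! 0])"
        using \<gamma>[OF q] b I q' by (simp add: permute_list_compose permute_list_transpose)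
      ultimately show ?thesis by (simp flip: of_int_mult mult.assoc add: sign_idempotent)
    qed
    then show ?thesis by (simp add: card_permutations[OF refl])
  qed
  have "wedge 1 \<alpha> \<beta> I = (\<Sum>b<Suc n. (if b = 0 then 1 else - 1) * \<gamma> (I[0 := I ! b, b := I ! 0]))"
  proof -
    have "wedge 1 \<alpha> \<beta> I = (\<Sum>\<sigma> | \<sigma> permutes {..<Suc n}. of_int (sign \<sigma>) * \<gamma> (permute_list \<sigma> I)) / fact n"
      using I by (simp add: wedge_def \<gamma>_def mult.assoc)
    also have "(\<Sum>\<sigma> | \<sigma> permutes {..<Suc n}. of_int (sign \<sigma>) * \<gamma> (permute_list \<sigma> I))
      = (\<Sum>b<Suc n. \<Sum>q | q permutes {1..<Suc n}. of_int (sign (Transposition.transpose 0 b \<circ> q)) *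
          \<gamma> (permute_list (Transposition.transpose 0 b \<circ> q) I))"
      unfolding ins by (rule sum_over_permutations_insert) auto
    also have "\<dots> = (\<Sum>b<Suc n. fact n * ((if b = 0 then 1 else - 1) * \<gamma> (I[0 := I ! b, b := I ! 0])))"
      by (intro sum.cong refl summand) simp
    finally show ?thesis by (simp flip: sum_distrib_left)
  qed
  also have "\<dots> = \<gamma> (I[0 := I ! 0]) - (\<Sum>b<n. \<gamma> (I[0 := I ! Suc b, Suc b := I ! 0]))"
    by (simp add: sum.lessThan_Suc_shift sum_negf del: sum.lessThan_Suc)
  finally show ?thesis using I by (cases I) (simp_all add: \<gamma>_def)
qed

lemma alternating_1: "alternating 1 t"
  by (rule alternating_swapI) auto

text \<open>The coordinate coframe of the model space. Evaluating an adapted coframe on its dual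
  frame turns it into \<open>std\<close>, so all pointwise algebra takes place with
  \<open>std\<close>.\<close>

abbreviation std :: "8 \<Rightarrow> tensor" where
  "std \<equiv> \<lambda>i I. if I = [i] then 1 else 0"

lemma wedge_1_2: "wedge 1 \<alpha> \<beta> [a, b] = \<alpha> [a] * \<beta> [b] - \<alpha> [b] * \<beta> [a]"
  using wedge_1_expand[OF alternating_1, of "[a, b]" \<alpha> \<beta>] by (simp add: lessThan_Suc)

lemma wedge_1_3:
  "alternating 2 \<beta> \<Longrightarrow> wedge 1 \<alpha> \<beta> [a, b, c] = \<alpha> [a] * \<beta> [b, c] - \<alpha> [b] * \<beta> [a, c] - \<alpha> [c] * \<beta> [b, a]"
  using wedge_1_expand[of 2 \<beta> "[a, b, c]" \<alpha>] by (simp add: lessThan_Suc eval_nat_numeral)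

lemma wedge_1_4:
  "alternating 3 \<beta> \<Longrightarrow> wedge 1 \<alpha> \<beta> [a, b, c, d] =
     \<alpha> [a] * \<beta> [b, c, d] - \<alpha> [b] * \<beta> [a, c, d] - \<alpha> [c] * \<beta> [b, a, d] - \<alpha> [d] * \<beta> [b, c, a]"
  using wedge_1_expand[of 3 \<beta> "[a, b, c, d]" \<alpha>] by (simp add: lessThan_Suc eval_nat_numeral)

text \<open>Laplace expansion of a 4 by 4 determinant along two rows: minors of the first two
  covectors times complementary minors of the last two.\<close>

lemma e4_expand:
  "e4 e p q r s [i, j, k, l] =
     (let m = \<lambda>a b x y. e a [x] * e b [y] - e a [y] * e b [x] in
      m p q i j * m r s k l - m p q i k * m r s j l + m p q i l * m r s j k
      + m p q j k * m r s i l - m p q j l * m r s i k + m p q k l * m r s i j)"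
  unfolding e4_def Let_def
  by (simp add: wedge_1_4 wedge_1_3 wedge_1_2 alternating_wedge del: One_nat_def) (simp add: algebra_simps)

definition psi :: "8 \<Rightarrow> 8 \<Rightarrow> 8 \<Rightarrow> 8 \<Rightarrow> real" where
  "psi a b c d = spin7_model std [a, b, c, d]"

definition skew2 :: "(8 \<Rightarrow> 8 \<Rightarrow> real) \<Rightarrow> bool" where
  "skew2 \<alpha> \<longleftrightarrow> (\<forall>i j. \<alpha> j i = - \<alpha> i j)"

text \<open>Of the 24 terms of the determinant those with a given pair of covectors in the
  contracted slots are collected; skewness of \<open>\<alpha>\<close> merges the two orders of the
  pair, whence the factor 2.\<close>

lemma contr_e4:
  assumes "skew2 \<alpha>"
  shows "(\<Sum>\<^sub>8i j. \<alpha> i j * e4 std p q r s [i, j, k, l]) =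
    2 * (let m = \<lambda>a b. std a [k] * std b [l] - std a [l] * std b [k] in
      \<alpha> p q * m r s - \<alpha> p r * m q s + \<alpha> p s * m q r + \<alpha> q r * m p s - \<alpha> q s * m p r + \<alpha> r s * m p q)"
proof -
  have d: "(\<Sum>\<^sub>8i j. \<alpha> i j * (std a [i] * std b [j] * c)) = \<alpha> a b * c" for a b c
  proof -
    have "(\<Sum>\<^sub>8j. \<alpha> i j * (std a [i] * std b [j] * c)) = std a [i] * \<alpha> i b * c" for i
    proof -
      have "\<alpha> i j * (std a [i] * std b [j] * c) = (if j = b then std a [i] * \<alpha> i b * c else 0)" for j by simp
      then show ?thesis by simp
    qed
    moreover have "std a [i] * \<alpha> i b * c = (if i = a then \<alpha> a b * c else 0)" for i by simp
    ultimately show ?thesis by simp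
  qed
  have neg: "\<alpha> q p = - \<alpha> p q" "\<alpha> r p = - \<alpha> p r" "\<alpha> s p = - \<alpha> p s" "\<alpha> r q = - \<alpha> q r" "\<alpha> s q = - \<alpha> q s"
    "\<alpha> s r = - \<alpha> r s" using assms unfolding skew2_def by blast+
  let ?n = "\<lambda>a b. std a [k] * std b [l] - std a [l] * std b [k]"
  have "\<alpha> i j * e4 std p q r s [i, j, k, l] =
      \<alpha> i j * (std p [i] * std q [j] * ?n r s) - \<alpha> i j * (std q [i] * std p [j] * ?n r s)
    - \<alpha> i j * (std p [i] * std r [j] * ?n q s) + \<alpha> i j * (std r [i] * std p [j] * ?n q s)
    + \<alpha> i j * (std p [i] * std s [j] * ?n q r) - \<alpha> i j * (std s [i] * std p [j] * ?n q r)
    + \<alpha> i j * (std q [i] * std r [j] * ?n p s) - \<alpha> i j * (std r [i] * std q [j] * ?n p s)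
    - \<alpha> i j * (std q [i] * std s [j] * ?n p r) + \<alpha> i j * (std s [i] * std q [j] * ?n p r)
    + \<alpha> i j * (std r [i] * std s [j] * ?n p q) - \<alpha> i j * (std s [i] * std r [j] * ?n p q)" for i j
    unfolding e4_expand Let_def by (simp only: algebra_simps)
  then have "(\<Sum>\<^sub>8i j. \<alpha> i j * e4 std p q r s [i, j, k, l]) =
     \<alpha> p q * ?n r s - \<alpha> q p * ?n r s - \<alpha> p r * ?n q s + \<alpha> r p * ?n q s + \<alpha> p s * ?n q r - \<alpha> s p * ?n q r
    + \<alpha> q r * ?n p s - \<alpha> r q * ?n p s - \<alpha> q s * ?n p r + \<alpha> s q * ?n p r + \<alpha> r s * ?n p q - \<alpha> s r * ?n p q"
    by (simp only: sum.distrib sum_subtractf d)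
  then show ?thesis unfolding neg Let_def by (simp only: algebra_simps)
qed

subsection \<open>Contractions of the model 4-form\<close>

lemma alternating_spin7_model: "alternating 4 (spin7_model e)"
  unfolding alternating_def
proof (intro allI impI, elim conjE)
  fix I :: "8 list" and \<sigma> :: "nat \<Rightarrow> nat" assume *: "length I = 4" "\<sigma> permutes {..<4}"
  have "e4 e i j k l (permute_list \<sigma> I) = of_int (sign \<sigma>) * e4 e i j k l I" for i j k l
    unfolding e4_def by (rule alternatingD[OF alternating_wedge *])
  then show "spin7_model e (permute_list \<sigma> I) = of_int (sign \<sigma>) * spin7_model e I"
    unfolding spin7_model_def by (simp only: algebra_simps)
qed

lemma psi_swap:
  "psi b a c d = - psi a b c d" "psi a c b d = - psi a b c d" "psi a b d c = - psi a b c d"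
  using alternating_swap[OF alternating_spin7_model, of "[a, b, c, d]" 0 1 std]
    alternating_swap[OF alternating_spin7_model, of "[a, b, c, d]" 1 2 std]
    alternating_swap[OF alternating_spin7_model, of "[a, b, c, d]" 2 3 std]
  by (simp_all add: psi_def numeral_eq_Suc)

text \<open>The operator on 2-forms whose eigenspace for the eigenvalue 2 is spin(7).\<close>

definition pcontr :: "(8 \<Rightarrow> 8 \<Rightarrow> real) \<Rightarrow> 8 \<Rightarrow> 8 \<Rightarrow> real" where
  "pcontr \<alpha> k l = (\<Sum>\<^sub>8i j. \<alpha> i j * psi i j k l)"

lemma skew2D: "skew2 \<alpha> \<Longrightarrow> \<alpha> j i = - \<alpha> i j"
  unfolding skew2_def by blast

lemma skew2_zero: "skew2 \<alpha> \<Longrightarrow> \<alpha> i i = 0"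
  using skew2D[of \<alpha> i i] by simp

lemma skew2_pcontr: "skew2 (pcontr \<alpha>)"
  unfolding skew2_def
proof (intro allI)
  fix k l show "pcontr \<alpha> l k = - pcontr \<alpha> k l"
    unfolding pcontr_def by (simp add: psi_swap(3)[of _ _ l k] sum_negf)
qed

definition contr4 :: "(8 \<Rightarrow> 8 \<Rightarrow> real) \<Rightarrow> 8 \<Rightarrow> 8 \<Rightarrow> 8 \<Rightarrow> 8 \<Rightarrow> 8 \<Rightarrow> 8 \<Rightarrow> real" where
  "contr4 \<alpha> k l p q r s = (let m = \<lambda>a b. std a [k] * std b [l] - std a [l] * std b [k] in
      \<alpha> p q * m r s - \<alpha> p r * m q s + \<alpha> p s * m q r + \<alpha> q r * m p s - \<alpha> q s * m p r + \<alpha> r s * m p q)"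

lemma pcontr_model:
  assumes "skew2 \<alpha>"
  shows "pcontr \<alpha> k l = 2 * (let c = contr4 \<alpha> k l in
     - c 0 1 2 7 + c 0 2 3 6 - c 0 3 4 7 - c 0 5 6 7 + c 0 1 4 6 + c 0 2 4 5 - c 0 1 3 5
     - c 3 4 5 6 - c 1 4 5 7 - c 1 2 5 6 - c 1 2 3 4 - c 2 3 5 7 - c 1 3 6 7 + c 2 4 6 7)"
proof -
  have c: "(\<Sum>\<^sub>8i j. \<alpha> i j * e4 std p q r s [i, j, k, l]) = 2 * contr4 \<alpha> k l p q r s" for p q r s
    unfolding contr4_def by (rule contr_e4[OF assms])
  show ?thesis
    unfolding pcontr_def psi_def spin7_model_def Let_def
    by (simp only: right_diff_distrib distrib_left mult_minus_right sum.distrib sum_subtractf sum_negf c)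
qed

text \<open>Equality of numerals in the type \<open>8\<close> is arithmetic modulo 8. With its 56
  negative instances available as rewrite rules, the large tables below are evaluated by
  \<open>simp only\<close>.\<close>

lemma neq8:
  shows "((0::8) = 1) = False" "((0::8) = 2) = False" "((0::8) = 3) = False" "((0::8) = 4) = False" "((0::8) = 5) = False"
    "((0::8) = 6) = False" "((0::8) = 7) = False" "((1::8) = 0) = False" "((1::8) = 2) = False" "((1::8) = 3) = False"
    "((1::8) = 4) = False" "((1::8) = 5) = False" "((1::8) = 6) = False" "((1::8) = 7) = False" "((2::8) = 0) = False"
    "((2::8) = 1) = False" "((2::8) = 3) = False" "((2::8) = 4) = False" "((2::8) = 5) = False" "((2::8) = 6) = False"
    "((2::8) = 7) = False" "((3::8) = 0) = False" "((3::8) = 1) = False" "((3::8) = 2) = False" "((3::8) = 4) = False"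
    "((3::8) = 5) = False" "((3::8) = 6) = False" "((3::8) = 7) = False" "((4::8) = 0) = False" "((4::8) = 1) = False"
    "((4::8) = 2) = False" "((4::8) = 3) = False" "((4::8) = 5) = False" "((4::8) = 6) = False" "((4::8) = 7) = False"
    "((5::8) = 0) = False" "((5::8) = 1) = False" "((5::8) = 2) = False" "((5::8) = 3) = False" "((5::8) = 4) = False"
    "((5::8) = 6) = False" "((5::8) = 7) = False" "((6::8) = 0) = False" "((6::8) = 1) = False" "((6::8) = 2) = False"
    "((6::8) = 3) = False" "((6::8) = 4) = False" "((6::8) = 5) = False" "((6::8) = 7) = False" "((7::8) = 0) = False"
    "((7::8) = 1) = False" "((7::8) = 2) = False" "((7::8) = 3) = False" "((7::8) = 4) = False" "((7::8) = 5) = False"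
    "((7::8) = 6) = False"
  by simp_all

lemmas eval8 = list.inject neq8 simp_thms if_True if_False mult_zero_left mult_zero_right mult_1_left mult_1_right
  diff_zero diff_0 minus_zero add_0_left add_0_right diff_self minus_minus mult_minus_left mult_minus_right
  diff_minus_eq_add

text \<open>The 14 terms of the model form contain each of the 28 index pairs exactly three times,
  hence three summands per entry; each sign is that of the corresponding term after
  reordering.\<close>

lemma pcontr_table:
  assumes "skew2 \<alpha>"
  shows
    "pcontr \<alpha> 0 1 = 2 * (- \<alpha> 2 7 - \<alpha> 3 5 + \<alpha> 4 6)"
    "pcontr \<alpha> 0 2 = 2 * (\<alpha> 1 7 + \<alpha> 3 6 + \<alpha> 4 5)"
    "pcontr \<alpha> 0 3 = 2 * (\<alpha> 1 5 - \<alpha> 2 6 - \<alpha> 4 7)"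
    "pcontr \<alpha> 0 4 = 2 * (- \<alpha> 1 6 - \<alpha> 2 5 + \<alpha> 3 7)"
    "pcontr \<alpha> 0 5 = 2 * (- \<alpha> 1 3 + \<alpha> 2 4 - \<alpha> 6 7)"
    "pcontr \<alpha> 0 6 = 2 * (\<alpha> 1 4 + \<alpha> 2 3 + \<alpha> 5 7)"
    "pcontr \<alpha> 0 7 = 2 * (- \<alpha> 1 2 - \<alpha> 3 4 - \<alpha> 5 6)"
    "pcontr \<alpha> 1 2 = 2 * (- \<alpha> 0 7 - \<alpha> 3 4 - \<alpha> 5 6)"
    "pcontr \<alpha> 1 3 = 2 * (- \<alpha> 0 5 + \<alpha> 2 4 - \<alpha> 6 7)"
    "pcontr \<alpha> 1 4 = 2 * (\<alpha> 0 6 - \<alpha> 2 3 - \<alpha> 5 7)"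
    "pcontr \<alpha> 1 5 = 2 * (\<alpha> 0 3 + \<alpha> 2 6 + \<alpha> 4 7)"
    "pcontr \<alpha> 1 6 = 2 * (- \<alpha> 0 4 - \<alpha> 2 5 + \<alpha> 3 7)"
    "pcontr \<alpha> 1 7 = 2 * (\<alpha> 0 2 - \<alpha> 3 6 - \<alpha> 4 5)"
    "pcontr \<alpha> 2 3 = 2 * (\<alpha> 0 6 - \<alpha> 1 4 - \<alpha> 5 7)"
    "pcontr \<alpha> 2 4 = 2 * (\<alpha> 0 5 + \<alpha> 1 3 + \<alpha> 6 7)"
    "pcontr \<alpha> 2 5 = 2 * (- \<alpha> 0 4 - \<alpha> 1 6 + \<alpha> 3 7)"
    "pcontr \<alpha> 2 6 = 2 * (- \<alpha> 0 3 + \<alpha> 1 5 - \<alpha> 4 7)"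
    "pcontr \<alpha> 2 7 = 2 * (- \<alpha> 0 1 - \<alpha> 3 5 + \<alpha> 4 6)"
    "pcontr \<alpha> 3 4 = 2 * (- \<alpha> 0 7 - \<alpha> 1 2 - \<alpha> 5 6)"
    "pcontr \<alpha> 3 5 = 2 * (- \<alpha> 0 1 - \<alpha> 2 7 + \<alpha> 4 6)"
    "pcontr \<alpha> 3 6 = 2 * (\<alpha> 0 2 - \<alpha> 1 7 - \<alpha> 4 5)"
    "pcontr \<alpha> 3 7 = 2 * (\<alpha> 0 4 + \<alpha> 1 6 + \<alpha> 2 5)"
    "pcontr \<alpha> 4 5 = 2 * (\<alpha> 0 2 - \<alpha> 1 7 - \<alpha> 3 6)"
    "pcontr \<alpha> 4 6 = 2 * (\<alpha> 0 1 + \<alpha> 2 7 + \<alpha> 3 5)"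
    "pcontr \<alpha> 4 7 = 2 * (- \<alpha> 0 3 + \<alpha> 1 5 - \<alpha> 2 6)"
    "pcontr \<alpha> 5 6 = 2 * (- \<alpha> 0 7 - \<alpha> 1 2 - \<alpha> 3 4)"
    "pcontr \<alpha> 5 7 = 2 * (\<alpha> 0 6 - \<alpha> 1 4 - \<alpha> 2 3)"
    "pcontr \<alpha> 6 7 = 2 * (- \<alpha> 0 5 - \<alpha> 1 3 + \<alpha> 2 4)"
  unfolding pcontr_model[OF assms] Let_def contr4_def by (simp_all only: eval8) simp_all


definition skew3 :: "(8 \<Rightarrow> 8 \<Rightarrow> 8 \<Rightarrow> real) \<Rightarrow> bool" where
  "skew3 T \<longleftrightarrow> (\<forall>i j k. T j i k = - T i j k \<and> T i k j = - T i j k)"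

lemma skew3D: "skew3 T \<Longrightarrow> T j i k = - T i j k" "skew3 T \<Longrightarrow> T i k j = - T i j k"
  unfolding skew3_def by blast+

lemma skew3_skew2: "skew3 T \<Longrightarrow> skew2 (T i)"
  unfolding skew3_def skew2_def by blast

lemma skew3_zero: "skew3 T \<Longrightarrow> T i i k = 0" "skew3 T \<Longrightarrow> T i k k = 0"
  using skew3D(1)[of T i i k] skew3D(2)[of T i k k] by simp_all

text \<open>A rank function that lets the simplifier sort the indices of a skew array.\<close>

definition rank8 :: "8 \<Rightarrow> nat" where
  "rank8 i = (if i = 0 then 0 else if i = 1 then 1 else if i = 2 then 2 else if i = 3 then 3
     else if i = 4 then 4 else if i = 5 then 5 else if i = 6 then 6 else 7)"

lemma rank8_simps [simp]:
  "rank8 0 = 0" "rank8 1 = 1" "rank8 2 = 2" "rank8 3 = 3" "rank8 4 = 4" "rank8 5 = 5" "rank8 6 = 6" "rank8 7 = 7"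
  by (simp_all add: rank8_def neq8)

lemmas rank8_less = rank8_simps rel_simps num.simps simp_thms less_irrefl zero_less_one not_less_zero

lemma skew2_sort: "skew2 \<alpha> \<Longrightarrow> rank8 i < rank8 j \<Longrightarrow> \<alpha> j i = - \<alpha> i j"
  by (rule skew2D)

lemma skew3_sort:
  "skew3 T \<Longrightarrow> rank8 i < rank8 j \<Longrightarrow> T j i k = - T i j k"
  "skew3 T \<Longrightarrow> rank8 k < rank8 j \<Longrightarrow> T i j k = - T i k j"
  by (rule skew3D, assumption)+

lemma rank8_inj: "rank8 i = rank8 j \<Longrightarrow> i = j"
  using exhaust_8[of i] exhaust_8[of j] by auto

lemma skew2_eqI:
  assumes "skew2 \<alpha>" "skew2 \<beta>" "\<And>i j. rank8 i < rank8 j \<Longrightarrow> \<alpha> i j = \<beta> i j"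
  shows "\<alpha> i j = \<beta> i j"
proof (cases "rank8 i" "rank8 j" rule: linorder_cases)
  case greater
  then have "\<alpha> j i = \<beta> j i" by (rule assms(3))
  then show ?thesis using skew2D[OF assms(1), of i j] skew2D[OF assms(2), of i j] by linarith
qed (use assms rank8_inj[of i j] in \<open>auto simp: skew2_zero\<close>)

text \<open>Reduces an identity of 3-forms to the 56 increasing index triples, which can then be
  checked by the tables. The third index is inserted into the ordered first two, case by
  case.\<close>

lemma skew3_eqI:
  assumes S: "skew3 S" and T: "skew3 T"
    and eq: "\<And>i j k. rank8 i < rank8 j \<Longrightarrow> rank8 j < rank8 k \<Longrightarrow> S i j k = T i j k"
  shows "S i j k = T i j k"
proof -
  define D where "D i j k = S i j k - T i j k" for i j k
  have D: "skew3 D"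
    unfolding skew3_def
  proof (intro allI conjI)
    fix i j k show "D j i k = - D i j k" "D i k j = - D i j k"
      using skew3D[OF S, of j i k] skew3D[OF S, of i k j] skew3D[OF T, of j i k] skew3D[OF T, of i k j]
      by (simp_all add: D_def)
  qed
  have 1: "D i j k = 0" if "rank8 i < rank8 j" for i j k
  proof -
    consider "rank8 j < rank8 k" | "j = k" | "i = k" | "rank8 k < rank8 j" "rank8 i < rank8 k" | "rank8 k < rank8 i"
      using rank8_inj[of j k] rank8_inj[of i k] by linarith
    then show ?thesis
    proof cases
      case 1 then show ?thesis using eq that by (simp add: D_def)
    next
      case 2 then show ?thesis using skew3_zero[OF D] by simp
    next
      case 3 then show ?thesis using skew3_zero(1)[OF D, of i j] skew3D(2)[OF D, of i j i] by simp
    next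
      case 4 then show ?thesis using eq[of i k j] skew3D(2)[OF D, of i j k] by (simp add: D_def)
    next
      case 5 then show ?thesis
        using eq[of k i j] that skew3D(2)[OF D, of i j k] skew3D(1)[OF D, of i k j] by (simp add: D_def)
    qed
  qed
  have "D i j k = 0"
    using 1[of i j k] 1[of j i k] skew3D(1)[OF D, of i j k] skew3_zero(1)[OF D, of i k] rank8_inj[of i j]
    by (metis linorder_neqE_nat minus_zero)
  then show ?thesis by (simp add: D_def)
qed

text \<open>The 8-dimensional component of a 3-form, \<open>T i j k * psi i j k l\<close> summed
  over \<open>i\<close>, \<open>j\<close>, \<open>k\<close> (see \<open>tcontr_eq\<close>). For the
  torsion it is -7 times the Lee form.\<close>

definition tcontr :: "(8 \<Rightarrow> 8 \<Rightarrow> 8 \<Rightarrow> real) \<Rightarrow> 8 \<Rightarrow> real" where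
  "tcontr T l = (\<Sum>\<^sub>8i. pcontr (T i) i l)"

text \<open>With P for \<open>pcontr\<close> this is (P - 2)(P + 6) = 0: the eigenvalue is 2 on
  spin(7) and -6 on its 7-dimensional complement.\<close>

lemma pcontr_pcontr:
  assumes "skew2 \<alpha>"
  shows "pcontr (pcontr \<alpha>) k l = 12 * \<alpha> k l - 4 * pcontr \<alpha> k l"
proof -
  have "skew2 (\<lambda>k l. 12 * \<alpha> k l - 4 * pcontr \<alpha> k l)"
    using skew2D[OF assms] skew2D[OF skew2_pcontr] unfolding skew2_def
    by (metis minus_diff_eq minus_diff_minus mult_minus_right)
  moreover have "pcontr (pcontr \<alpha>) k l = 12 * \<alpha> k l - 4 * pcontr \<alpha> k l" if "rank8 k < rank8 l" for k l
    using exhaust_8[of k] exhaust_8[of l] that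
    by (elim disjE; hypsubst; simp only: rank8_less;
      simp only: pcontr_table[OF assms] pcontr_table[OF skew2_pcontr] skew2_sort[OF skew2_pcontr] rank8_less;
      simp)
  ultimately show ?thesis
    using skew2_eqI[OF skew2_pcontr, of "\<lambda>k l. 12 * \<alpha> k l - 4 * pcontr \<alpha> k l" "pcontr \<alpha>" k l] by simp
qed

lemma tcontr_table:
  assumes "skew3 T"
  shows
    "tcontr T 0 = 6 * (T 1 2 7 + T 1 3 5 - T 1 4 6 - T 2 3 6 - T 2 4 5 + T 3 4 7 + T 5 6 7)"
    "tcontr T 1 = 6 * (- T 0 2 7 - T 0 3 5 + T 0 4 6 + T 2 3 4 + T 2 5 6 + T 3 6 7 + T 4 5 7)"
    "tcontr T 2 = 6 * (T 0 1 7 + T 0 3 6 + T 0 4 5 - T 1 3 4 - T 1 5 6 + T 3 5 7 - T 4 6 7)"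
    "tcontr T 3 = 6 * (T 0 1 5 - T 0 2 6 - T 0 4 7 + T 1 2 4 - T 1 6 7 - T 2 5 7 + T 4 5 6)"
    "tcontr T 4 = 6 * (- T 0 1 6 - T 0 2 5 + T 0 3 7 - T 1 2 3 - T 1 5 7 + T 2 6 7 - T 3 5 6)"
    "tcontr T 5 = 6 * (- T 0 1 3 + T 0 2 4 - T 0 6 7 + T 1 2 6 + T 1 4 7 + T 2 3 7 + T 3 4 6)"
    "tcontr T 6 = 6 * (T 0 1 4 + T 0 2 3 + T 0 5 7 - T 1 2 5 + T 1 3 7 - T 2 4 7 - T 3 4 5)"
    "tcontr T 7 = 6 * (- T 0 1 2 - T 0 3 4 - T 0 5 6 - T 1 3 6 - T 1 4 5 - T 2 3 5 + T 2 4 6)"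
  unfolding tcontr_def sum_8
  by (simp_all only: pcontr_table[OF skew3_skew2[OF assms]] skew2_sort[OF skew2_pcontr] skew2_zero[OF skew2_pcontr]
      skew3_sort[OF assms] skew3_zero[OF assms] rank8_less) simp_all

text \<open>Both sides are Spin(7)-equivariant in \<open>T\<close>, and 3-forms have only two
  irreducible components, of dimensions 8 and 48, so such an identity amounts to two constants. The
  proof compares both sides on increasing triples.\<close>

lemma pcontr_cyclic:
  assumes "skew3 T"
  shows "pcontr (T s) k n + pcontr (T k) n s + pcontr (T n) s k
     = 2 * T s k n + (1/3) * (\<Sum>\<^sub>8l. tcontr T l * psi l s k n)"
proof -
  \<comment> \<open>A multiple of the 2-form \<open>t \<and> e_s\<close> with t =
    \<open>tcontr T\<close>. Its \<open>pcontr\<close> is the interior product in the last term of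
    the claim, so \<open>pcontr_table\<close> evaluates both sides.\<close>
  define \<tau> where "\<tau> s i j = (tcontr T i * (if j = s then 1 else 0) - tcontr T j * (if i = s then 1 else 0)) / 2" for s i j
  have \<tau>: "skew2 (\<tau> s)" for s unfolding skew2_def \<tau>_def by (simp add: field_simps)
  have single: "(\<Sum>\<^sub>8l. tcontr T l * psi l s k n) = pcontr (\<tau> s) k n" for s k n
  proof -
    have "\<tau> s i j * psi i j k n = (if j = s then tcontr T i * psi i s k n / 2 else 0)
        + (if i = s then tcontr T j * psi j s k n / 2 else 0)" for i j
      using psi_swap(1)[of i j k n] by (auto simp: \<tau>_def)
    then have "pcontr (\<tau> s) k n = (\<Sum>\<^sub>8i. tcontr T i * psi i s k n / 2) + (\<Sum>\<^sub>8j. tcontr T j * psi j s k n / 2)"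
      unfolding pcontr_def by (simp add: sum.distrib sum.swap[of _ UNIV UNIV])
    then show ?thesis by (simp flip: sum.distrib)
  qed
  let ?S = "\<lambda>s k n. pcontr (T s) k n + pcontr (T k) n s + pcontr (T n) s k"
  let ?R = "\<lambda>s k n. 2 * T s k n + (1/3) * (\<Sum>\<^sub>8l. tcontr T l * psi l s k n)"
  have sort: "?S s k n = ?R s k n" if "rank8 s < rank8 k" "rank8 k < rank8 n" for s k n
    unfolding single
    using that
    by (insert exhaust_8[of s] exhaust_8[of k], elim disjE; hypsubst; simp only: rank8_less;
      insert exhaust_8[of n], elim disjE; hypsubst; simp only: rank8_less;
      simp only: pcontr_table[OF skew3_skew2[OF assms]] pcontr_table[OF \<tau>] skew2_sort[OF skew2_pcontr] rank8_less;
      simp only: \<tau>_def eval8; simp only: tcontr_table[OF assms];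
      simp only: skew3_sort[OF assms] skew3_zero[OF assms] rank8_less; simp add: field_simps)
  have "skew3 ?S"
    unfolding skew3_def
  proof (intro allI conjI)
    fix s k n
    show "?S k s n = - ?S s k n" "?S s n k = - ?S s k n"
      using skew2D[OF skew2_pcontr[of "T s"], of k n] skew2D[OF skew2_pcontr[of "T k"], of n s]
        skew2D[OF skew2_pcontr[of "T n"], of s k] by simp_all
  qed
  moreover have "skew3 ?R"
    unfolding skew3_def
  proof (intro allI conjI)
    fix s k n
    show "?R k s n = - ?R s k n"
      by (simp add: psi_swap(2)[of _ k s] skew3D(1)[OF assms, of k s] sum_negf)
    show "?R s n k = - ?R s k n"
      by (simp add: psi_swap(3)[of _ _ n k] skew3D(2)[OF assms, of s n k] sum_negf)
  qed
  ultimately show ?thesis using skew3_eqI[of ?S ?R s k n] sort by blast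
qed

subsection \<open>The Hodge star in an orthonormal frame\<close>

definition rank_sorted :: "8 list \<Rightarrow> bool" where
  "rank_sorted I \<longleftrightarrow> sorted_wrt (<) (map rank8 I)"

text \<open>A list with a repeated index gives 0 on both sides, and any other list is sorted at the
  cost of the same sign on both sides.\<close>

lemma alternating_eqI:
  assumes s: "alternating k s" and t: "alternating k t"
    and eq: "\<And>I. length I = k \<Longrightarrow> rank_sorted I \<Longrightarrow> s I = t I" and I: "length I = k"
  shows "s I = t I"
proof (cases "distinct I")
  case False then show ?thesis
    using alternating_not_distinct[OF s I] alternating_not_distinct[OF t I] by simp
next
  case True
  define J where "J = sort_key rank8 I"
  have "inj_on rank8 (set J)" using rank8_inj by (meson inj_onI)
  then have J: "rank_sorted J"
    using True by (simp add: rank_sorted_def strict_sorted_iff J_def distinct_map)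
  have "mset J = mset I" by (simp add: J_def)
  then obtain \<sigma> where \<sigma>: "\<sigma> permutes {..<length I}" "permute_list \<sigma> I = J"
    by (rule mset_eq_permutation)
  have "of_int (sign \<sigma>) * s I = of_int (sign \<sigma>) * t I"
    using alternatingD[OF s I, of \<sigma>] alternatingD[OF t I, of \<sigma>] \<sigma> I eq[OF _ J] by (simp add: J_def)
  then show ?thesis using sign_nz by simp
qed

lemma rank8_less_8: "rank8 i < 8"
  by (simp add: rank8_def)

lemma rank_sorted_full:
  assumes "length I = 8" "rank_sorted I" shows "I = [0, 1, 2, 3, 4, 5, 6, 7]"
proof -
  have full: "map rank8 J = [0..<8]" if "length J = 8" "rank_sorted J" for J
  proof -
    have J: "sorted (map rank8 J)" "distinct (map rank8 J)"
      using that by (auto simp: rank_sorted_def strict_sorted_iff)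
    have "set (map rank8 J) \<subseteq> {..<8}" using rank8_less_8 by auto
    moreover have "card (set (map rank8 J)) = 8" using J(2) that(1) distinct_card by fastforce
    ultimately have "set (map rank8 J) = {..<8}" using card_subset_eq[of "{..<8::nat}"] by simp
    then have "set (map rank8 J) = set [0..<8]" by (simp add: atLeast_upt)
    then show ?thesis using J by (intro sorted_distinct_set_unique) auto
  qed
  have "map rank8 I = map rank8 [0, 1, 2, 3, 4, 5, 6, 7]"
    using full[OF assms] full[of "[0, 1, 2, 3, 4, 5, 6, 7]"] by (simp add: rank_sorted_def)
  then show ?thesis using map_injective[of rank8] rank8_inj by (metis injI)
qed

abbreviation eps :: tensor where "eps \<equiv> e8 std"

lemma alternating_eps: "alternating n (e8 e)"
  unfolding e8_def by (rule alternating_wedge)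

lemma wedge_std:
  assumes "\<And>n. alternating n \<beta>" "i \<notin> set I"
  shows "wedge 1 (std i) \<beta> (i # I) = \<beta> I"
proof -
  have "std i [I ! b] = 0" if "b < length I" for b using assms(2) that by auto
  then show ?thesis using wedge_1_expand[OF assms(1), of "i # I" "length I" "std i"] by simp
qed

lemma eps_id: "eps [0, 1, 2, 3, 4, 5, 6, 7] = 1"
  unfolding e8_def
  by (simp add: wedge_std[OF alternating_wedge] wedge_1_2 neq8 del: One_nat_def)

lemma alternating_mult_const: "alternating k t \<Longrightarrow> alternating k (\<lambda>I. c * t I)"
  unfolding alternating_def by (metis mult.left_commute)

lemma alternating_top:
  assumes "alternating 8 t" "length I = 8"
  shows "t I = t [0, 1, 2, 3, 4, 5, 6, 7] * eps I"
  by (rule alternating_eqI[OF assms(1) alternating_mult_const[OF alternating_eps] _ assms(2)])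
    (auto dest: rank_sorted_full simp: eps_id)

lemma eps_square:
  assumes "length I = 8" "distinct I" shows "eps I * eps I = 1"
proof -
  have "set I = UNIV"
    using assms distinct_card[of I] card_subset_eq[of UNIV "set I"] by simp
  then have "set I = set [0, 1, 2, 3, 4, 5, 6, 7]" by (simp add: UNIV_8)
  moreover have "distinct [0, 1, 2, 3, 4, 5, 6, 7 :: 8]"
    by (simp only: distinct.simps list.set insert_iff empty_iff neq8 simp_thms)
  ultimately have "mset I = mset [0, 1, 2, 3, 4, 5, 6, 7]"
    using assms(2) set_eq_iff_mset_eq_distinct by blast
  then obtain \<sigma> where \<sigma>: "\<sigma> permutes {..<length [0, 1, 2, 3, 4, 5, 6, 7 :: 8]}"
    "permute_list \<sigma> [0, 1, 2, 3, 4, 5, 6, 7] = I"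
    by (rule mset_eq_permutation)
  then have "eps I = of_int (sign \<sigma>)"
    using alternatingD[OF alternating_eps refl, of \<sigma> "[0, 1, 2, 3, 4, 5, 6, 7]" std] by (simp add: eps_id)
  then show ?thesis by (simp flip: of_int_mult)
qed

text \<open>Pullback by a matrix and by its transpose are adjoint. This transfers a frame from one
  factor of a full contraction to the other.\<close>

lemma sum_comps_adjoint:
  "(\<Sum>I | length I = n. comps L t I * s I) = (\<Sum>I | length I = n. t I * comps (\<lambda>i. \<chi> a. L a $ i) s I)"
proof -
  have "(\<Sum>I | length I = n. comps L t I * s I)
      = (\<Sum>I | length I = n. \<Sum>J | length J = n. (\<Prod>k<n. L (I ! k) $ (J ! k)) * t J * s I)"
    by (simp add: comps_def sum_distrib_right)
  also have "\<dots> = (\<Sum>J | length J = n. \<Sum>I | length I = n. (\<Prod>k<n. L (I ! k) $ (J ! k)) * t J * s I)"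
    by (rule sum.swap)
  also have "\<dots> = (\<Sum>I | length I = n. t I * comps (\<lambda>i. \<chi> a. L a $ i) s I)"
    by (simp add: comps_def sum_distrib_left mult_ac)
  finally show ?thesis .
qed

lemma orthonormal_frame_matrix:
  assumes "orthonormal_frame g E"
  shows "(\<chi> a i. E a $ i) ** (\<chi> j k. g [j, k]) ** transpose (\<chi> a i. E a $ i) = mat 1"
proof -
  have "((\<chi> a i. E a $ i) ** (\<chi> j k. g [j, k]) ** transpose (\<chi> a i. E a $ i)) $ a $ b = gdot g (E a) (E b)" for a b
    unfolding gdot_def
    by (subst sum.swap) (simp add: matrix_matrix_mult_def transpose_def sum_distrib_right sum_distrib_left mult_ac)
  then show ?thesis using assms by (simp add: vec_eq_iff orthonormal_frame_def mat_def)
qed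

text \<open>With the frame vectors as rows of a matrix M and the metric G, orthonormality reads M G
  M^T = 1, so the inverse metric is M^T M. This is how the inverse metric is removed from the Hodge
  star.\<close>

lemma matrix_inv_orthonormal_frame:
  assumes "orthonormal_frame g E"
  shows "matrix_inv (\<chi> j k. g [j, k]) = transpose (\<chi> a i. E a $ i) ** (\<chi> a i. E a $ i)"
proof -
  define M :: "real^8^8" where "M = (\<chi> a i. E a $ i)"
  define G :: "real^8^8" where "G = (\<chi> j k. g [j, k])"
  have 1: "M ** (G ** transpose M) = mat 1"
    using orthonormal_frame_matrix[OF assms] by (simp add: M_def G_def matrix_mul_assoc)
  then have "G ** transpose M ** M = mat 1" using matrix_left_right_inverse by blast
  then have 2: "G ** (transpose M ** M) = mat 1" by (simp add: matrix_mul_assoc)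
  then have "(transpose M ** M) ** G = mat 1" using matrix_left_right_inverse by blast
  moreover have "G ** matrix_inv G = mat 1"
    unfolding matrix_inv_def by (rule someI2[of _ "transpose M ** M"]) (use 2 calculation in auto)
  ultimately have "matrix_inv G = transpose M ** M"
    using matrix_mul_assoc[of "transpose M ** M" G "matrix_inv G"] by (simp add: matrix_mul_lid matrix_mul_rid)
  then show ?thesis by (simp add: M_def G_def)
qed

lemma raise_indices_frame:
  assumes "orthonormal_frame g E"
  shows "raise_indices g t = comps (\<lambda>i. \<chi> a. E a $ i) (comps E t)"
  unfolding raise_indices_def comps_comps fun_eq_iff
  by (intro allI, rule arg_cong[where f = "\<lambda>L. comps L t _"])
    (auto simp: matrix_inv_orthonormal_frame[OF assms] vec_eq_iff matrix_matrix_mult_def transpose_def fun_eq_iff)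

text \<open>The Hodge star in an oriented orthonormal frame.\<close>

definition hstar :: "tensor \<Rightarrow> tensor" where
  "hstar \<alpha> J = (\<Sum>I | length I = 8 - length J. \<alpha> I * eps (I @ J)) / fact (8 - length J)"

text \<open>Raising indices factors through the frame twice. One factor produces the frame
  components of \<open>\<alpha>\<close>, the other moves by \<open>sum_comps_adjoint\<close> to the
  volume form, whose frame components are \<open>eps\<close>.\<close>

lemma comps_hodge:
  assumes E: "orthonormal_frame g E" and vol: "\<And>I. length I = 8 \<Longrightarrow> comps E vol I = eps I"
    and J: "length J \<le> 8"
  shows "comps E (hodge g vol \<alpha>) J = hstar (comps E \<alpha>) J"
proof -
  let ?n = "8 - length J"
  have "comps E (hodge g vol \<alpha>) J
      = comps E (\<lambda>J. (\<Sum>I | length I = ?n. raise_indices g \<alpha> I * vol (I @ J)) / fact ?n) J"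
    by (intro comps_cong) (simp add: hodge_def)
  also have "\<dots> = (\<Sum>I | length I = ?n. raise_indices g \<alpha> I * comps E (\<lambda>J. vol (I @ J)) J) / fact ?n"
    using comps_cmult[of E "1 / fact ?n" "\<lambda>J. \<Sum>I | length I = ?n. raise_indices g \<alpha> I * vol (I @ J)" J]
    by (simp add: comps_sum comps_cmult)
  also have "(\<Sum>I | length I = ?n. raise_indices g \<alpha> I * comps E (\<lambda>J. vol (I @ J)) J)
      = (\<Sum>I | length I = ?n. comps E \<alpha> I * comps E (\<lambda>I. comps E (\<lambda>J. vol (I @ J)) J) I)"
    unfolding raise_indices_frame[OF E] sum_comps_adjoint by simp
  also have "\<dots> = (\<Sum>I | length I = ?n. comps E \<alpha> I * comps E vol (I @ J))"
  proof (intro sum.cong refl arg_cong2[where f = "(*)"])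
    fix I :: "8 list" assume "I \<in> {I. length I = ?n}"
    then show "comps E (\<lambda>I. comps E (\<lambda>J. vol (I @ J)) J) I = comps E vol (I @ J)"
      unfolding comps_append by (simp add: comps_def[of E _ I])
  qed
  also have "\<dots> = (\<Sum>I | length I = ?n. comps E \<alpha> I * eps (I @ J))"
    using vol J by (intro sum.cong) auto
  finally show ?thesis by (simp add: hstar_def)
qed

text \<open>Only lists that complete \<open>J\<close> to all eight indices survive. They are the
  \<open>fact p\<close> rearrangements of \<open>K\<close>, and the two signs of a rearrangement
  cancel.\<close>

lemma sum_alternating_pair:
  assumes s: "alternating p s" and t: "alternating (p + length J) t" and p: "p + length J = 8"
    and K: "length K = p" "distinct (K @ J)"
  shows "(\<Sum>I | length I = p. s I * t (I @ J)) = fact p * (s K * t (K @ J))"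
proof -
  have UN: "set K \<union> set J = UNIV" "set K \<inter> set J = {}"
    using K p distinct_card[of "K @ J"] card_subset_eq[of UNIV "set (K @ J)"] by auto
  let ?P = "{I. length I = p \<and> mset I = mset K}"
  have P: "s I * t (I @ J) = s K * t (K @ J)" if "I \<in> ?P" for I
  proof -
    have "mset I = mset K" using that by simp
    then obtain \<sigma> where \<sigma>: "\<sigma> permutes {..<length K}" "permute_list \<sigma> K = I"
      by (rule mset_eq_permutation)
    have \<sigma>': "\<sigma> permutes {..<length (K @ J)}" by (rule permutes_subset[OF \<sigma>(1)]) auto
    have "permute_list \<sigma> (K @ J) = I @ J"
    proof (rule nth_equalityI)
      fix i assume i: "i < length (permute_list \<sigma> (K @ J))"
      have "\<sigma> i < length K \<longleftrightarrow> i < length K" using permutes_in_image[OF \<sigma>(1), of i] by simp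
      moreover have "\<sigma> i = i" if "\<not> i < length K" using permutes_not_in[OF \<sigma>(1), of i] that by simp
      ultimately show "permute_list \<sigma> (K @ J) ! i = (I @ J) ! i"
        using i permute_list_nth[OF \<sigma>'] permute_list_nth[OF \<sigma>(1)] \<sigma>(2)[symmetric] by (auto simp: nth_append)
    qed (use that K in auto)
    then have "t (I @ J) = of_int (sign \<sigma>) * t (K @ J)"
      using alternatingD[OF t, of "K @ J" \<sigma>] \<sigma>' K by simp
    moreover have "s I = of_int (sign \<sigma>) * s K"
      using alternatingD[OF s K(1), of \<sigma>] \<sigma> K by simp
    moreover have "of_int (sign \<sigma>) * (of_int (sign \<sigma>) :: real) = 1" by (simp flip: of_int_mult)
    ultimately show ?thesis by (metis mult.assoc mult.commute mult_1)
  qed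
  have other: "s I * t (I @ J) = 0" if "length I = p" "I \<notin> ?P" for I
  proof (cases "distinct (I @ J)")
    case True
    then have "set I \<union> set J = UNIV" "set I \<inter> set J = {}"
      using that p distinct_card[of "I @ J"] card_subset_eq[of UNIV "set (I @ J)"] by auto
    then have "set I = set K" using UN by blast
    then have "mset I = mset K" using True K(2) by (simp add: set_eq_iff_mset_eq_distinct)
    then show ?thesis using that by simp
  next
    case False then show ?thesis using alternating_not_distinct[OF t, of "I @ J"] that by simp
  qed
  have "card ?P = fact p"
  proof -
    have "bij_betw (\<lambda>\<sigma>. permute_list \<sigma> K) {\<sigma>. \<sigma> permutes {..<p}} ?P"
      unfolding bij_betw_def
    proof (intro conjI inj_onI equalityI subsetI)
      fix \<sigma> \<tau> assume *: "\<sigma> \<in> {\<sigma>. \<sigma> permutes {..<p}}" "\<tau> \<in> {\<sigma>. \<sigma> permutes {..<p}}" and eq: "permute_list \<sigma> K = permute_list \<tau> K"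
      show "\<sigma> = \<tau>"
      proof
        fix i show "\<sigma> i = \<tau> i"
        proof (cases "i < p")
          case True
          then have "K ! \<sigma> i = K ! \<tau> i"
            using * K(1) permute_list_nth[of \<sigma> K i] permute_list_nth[of \<tau> K i] eq by simp
          moreover have "\<sigma> i < p" "\<tau> i < p"
            using True * permutes_in_image[of \<sigma> "{..<p}" i] permutes_in_image[of \<tau> "{..<p}" i] by auto
          ultimately show ?thesis using K by (simp add: nth_eq_iff_index_eq)
        next
          case False then show ?thesis using * by (simp add: permutes_not_in)
        qed
      qed
    next
      fix I assume "I \<in> (\<lambda>\<sigma>. permute_list \<sigma> K) ` {\<sigma>. \<sigma> permutes {..<p}}"
      then show "I \<in> ?P" using K(1) by auto
    next
      fix I assume "I \<in> ?P"
      then have "mset I = mset K" by simp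
      then obtain \<sigma> where "\<sigma> permutes {..<length K}" "permute_list \<sigma> K = I" by (rule mset_eq_permutation)
      then show "I \<in> (\<lambda>\<sigma>. permute_list \<sigma> K) ` {\<sigma>. \<sigma> permutes {..<p}}" using K(1) by auto
    qed
    then show ?thesis by (simp add: bij_betw_same_card[symmetric] card_permutations)
  qed
  moreover have "(\<Sum>I | length I = p. s I * t (I @ J)) = (\<Sum>I\<in>?P. s I * t (I @ J))"
    by (rule sum.mono_neutral_right) (use other finite_lists_length[of p] in auto)
  ultimately show ?thesis using P by simp
qed

lemma hstar_eq:
  assumes "alternating (length K) \<alpha>" "length K + length J = 8" "distinct (K @ J)"
  shows "hstar \<alpha> J = \<alpha> K * eps (K @ J)"
  using sum_alternating_pair[OF assms(1) alternating_eps assms(2) refl assms(3)] assms(2)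
  by (simp add: hstar_def flip: assms(2))

lemma alternating_hstar: "k \<le> 8 \<Longrightarrow> alternating k (hstar \<alpha>)"
proof (rule alternating_adjI)
  fix xs ys :: "8 list" and a b assume "k \<le> 8" and k: "length xs + length ys + 2 = k"
  have "eps (I @ xs @ b # a # ys) = - eps (I @ xs @ a # b # ys)" for I
    using alternating_swap[OF alternating_eps, of "I @ xs @ a # b # ys" _ "length (I @ xs)" "Suc (length (I @ xs))"]
    by (simp add: list_update_append nth_append)
  then show "hstar \<alpha> (xs @ b # a # ys) = - hstar \<alpha> (xs @ a # b # ys)"
    by (simp add: hstar_def sum_negf)
qed

lemma alternating_move:
  assumes "alternating k t" "length (xs @ y # zs) = k"
  shows "t (y # xs @ zs) = (-1) ^ length xs * t (xs @ y # zs)"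
  using assms(2)
proof (induction xs arbitrary: zs rule: rev_induct)
  case Nil then show ?case by simp
next
  case (snoc x xs)
  have "t (y # (xs @ [x]) @ zs) = (-1) ^ length xs * t (xs @ y # x # zs)"
    using snoc.IH[of "x # zs"] snoc.prems by simp
  also have "t (xs @ y # x # zs) = - t (xs @ x # y # zs)"
    using alternating_swap[OF assms(1), of "xs @ x # y # zs" "length xs" "Suc (length xs)"] snoc.prems
    by (simp add: list_update_append nth_append)
  finally show ?case by simp
qed

lemma eps_rotate:
  assumes "length A + length L = 8"
  shows "eps (A @ L) = (-1) ^ (length A * length L) * eps (L @ A)"
  using assms
proof (induction A arbitrary: L)
  case Nil then show ?case by simp
next
  case (Cons a A)
  have "eps ((a # A) @ L) = (-1) ^ length A * eps (A @ a # L)"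
    using alternating_move[OF alternating_eps, of A a L] by simp
  also have "eps (A @ (a # L)) = (-1) ^ (length A * Suc (length L)) * eps (a # L @ A)"
    using Cons.IH[of "a # L"] Cons.prems by simp
  also have "eps (a # L @ A) = (-1) ^ length L * eps (L @ a # A)"
    using alternating_move[OF alternating_eps, of L a A] by simp
  finally have "eps ((a # A) @ L) = (-1) ^ (2 * length A + length A * length L + length L) * eps (L @ a # A)"
    by (simp add: power_add mult_ac power_mult[symmetric] mult_2)
  moreover have "((-1 :: real) ^ length A) ^ 2 = 1" by (simp flip: power_mult)
  ultimately show ?case by (simp add: power_add power_mult mult.commute algebra_simps)
qed

lemma sum_wedge_alternating:
  assumes v: "alternating (p + q) v"
  shows "(\<Sum>J | length J = p + q. wedge p \<alpha> \<beta> J * v J)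
    = fact (p + q) / (fact p * fact q) * (\<Sum>A | length A = p. \<Sum>B | length B = q. \<alpha> A * \<beta> B * v (A @ B))"
proof -
  let ?n = "p + q"
  define F where "F J = \<alpha> (take p J) * \<beta> (drop p J)" for J
  have "(\<Sum>J | length J = ?n. (\<Sum>\<sigma> | \<sigma> permutes {..<?n}. of_int (sign \<sigma>) * F (permute_list \<sigma> J)) * v J)
    = (\<Sum>\<sigma> | \<sigma> permutes {..<?n}. \<Sum>J | length J = ?n. of_int (sign \<sigma>) * F (permute_list \<sigma> J) * v J)"
    unfolding sum_distrib_right by (rule sum.swap)
  also have "\<dots> = (\<Sum>\<sigma> | \<sigma> permutes {..<?n}. \<Sum>J | length J = ?n. F J * v J)"
  proof (rule sum.cong[OF refl])
    fix \<sigma> :: "nat \<Rightarrow> nat" assume "\<sigma> \<in> {\<sigma>. \<sigma> permutes {..<?n}}"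
    then have \<sigma>: "\<sigma> permutes {..<?n}" by simp
    have "(\<Sum>J | length J = ?n. of_int (sign \<sigma>) * F (permute_list \<sigma> J) * v J)
      = (\<Sum>J | length J = ?n. F (permute_list \<sigma> J) * v (permute_list \<sigma> J))"
      by (intro sum.cong) (use \<sigma> in \<open>auto simp: alternatingD[OF v]\<close>)
    also have "\<dots> = (\<Sum>J | length J = ?n. F J * v J)"
      by (rule sum.reindex_bij_witness[of _ "permute_list (inv \<sigma>)" "permute_list \<sigma>"])
        (use \<sigma> in \<open>auto simp: permute_list_inv\<close>)
    finally show "(\<Sum>J | length J = ?n. of_int (sign \<sigma>) * F (permute_list \<sigma> J) * v J) = (\<Sum>J | length J = ?n. F J * v J)" .
  qed
  also have "\<dots> = fact ?n * (\<Sum>A | length A = p. \<Sum>B | length B = q. \<alpha> A * \<beta> B * v (A @ B))"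
    by (simp add: card_permutations[OF refl] sum_lists_add F_def)
  finally show ?thesis
    by (simp add: wedge_def F_def mult.assoc sum_divide_distrib[symmetric] field_simps)
qed

text \<open>The double star in the Lee form is a plain contraction. The sign comes from moving 3
  indices past 5, and the constant is \<open>7! / (3! 4!) * 3! / 7! = 1/24\<close>.\<close>

lemma hstar_wedge_hstar:
  assumes \<omega>: "alternating 5 \<omega>"
  shows "hstar (wedge 3 (hstar \<omega>) \<beta>) [a] = - (\<Sum>B | length B = 4. \<beta> B * \<omega> (B @ [a])) / 24"
proof -
  have v: "alternating 7 (\<lambda>J. eps (J @ [a]))"
  proof (rule alternating_adjI)
    fix xs ys :: "8 list" and a' b assume "length xs + length ys + 2 = 7"
    then show "eps ((xs @ b # a' # ys) @ [a]) = - eps ((xs @ a' # b # ys) @ [a])"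
      using alternating_swap[OF alternating_eps, of "xs @ a' # b # ys @ [a]" _ "length xs" "Suc (length xs)"]
      by (simp add: list_update_append nth_append)
  qed
  have 1: "(\<Sum>A | length A = 3. hstar \<omega> A * eps (A @ B @ [a])) = - 6 * \<omega> (B @ [a])" if B: "length B = 4" for B
  proof (cases "distinct (B @ [a])")
    case False
    then have "eps (A @ B @ [a]) = 0" if "length A = 3" for A
      using alternating_not_distinct[OF alternating_eps, of "A @ B @ [a]" 8 std] that B by auto
    moreover have "\<omega> (B @ [a]) = 0"
      using alternating_not_distinct[OF \<omega>] False B by simp
    ultimately show ?thesis by simp
  next
    case True
    obtain A where A: "set A = - set (B @ [a])" "distinct A" using finite_distinct_list[OF finite] by metis
    have lenA: "length A = 3"
      using A True B distinct_card[OF A(2)] distinct_card[OF True] by (simp add: Compl_eq_Diff_UNIV card_Diff_subset)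
    have d: "distinct (A @ B @ [a])" "distinct ((B @ [a]) @ A)" using A True by auto
    have "(\<Sum>A | length A = 3. hstar \<omega> A * eps (A @ B @ [a])) = fact 3 * (hstar \<omega> A * eps (A @ B @ [a]))"
      using sum_alternating_pair[of 3 "hstar \<omega>" "B @ [a]" eps A] alternating_hstar[of 3 \<omega>] alternating_eps lenA d B
      by simp
    also have "hstar \<omega> A = \<omega> (B @ [a]) * eps ((B @ [a]) @ A)"
      by (rule hstar_eq) (use \<omega> B lenA d in simp_all)
    also have "eps (A @ B @ [a]) = - eps ((B @ [a]) @ A)"
      using eps_rotate[of A "B @ [a]"] lenA B by simp
    finally show ?thesis
      using eps_square[OF _ d(2)] lenA B by (simp add: fact_numeral mult.assoc)
  qed
  have "(\<Sum>J | length J = 7. wedge 3 (hstar \<omega>) \<beta> J * eps (J @ [a]))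
    = fact 7 / (fact 3 * fact 4) * (\<Sum>A | length A = 3. \<Sum>B | length B = 4. hstar \<omega> A * \<beta> B * eps ((A @ B) @ [a]))"
    using sum_wedge_alternating[of 3 4 "\<lambda>J. eps (J @ [a])" "hstar \<omega>" \<beta>] v by simp
  also have "(\<Sum>A | length A = 3. \<Sum>B | length B = 4. hstar \<omega> A * \<beta> B * eps ((A @ B) @ [a]))
    = (\<Sum>B | length B = 4. \<beta> B * (\<Sum>A | length A = 3. hstar \<omega> A * eps (A @ B @ [a])))"
    by (subst sum.swap) (simp add: sum_distrib_left mult_ac)
  also have "\<dots> = (\<Sum>B | length B = 4. - 6 * (\<beta> B * \<omega> (B @ [a])))"
    using 1 by (intro sum.cong) auto
  finally show ?thesis
    by (simp add: hstar_def[of "wedge 3 (hstar \<omega>) \<beta>" "[a]"] sum_distrib_left[symmetric] sum_negf fact_numeral)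
qed

definition skew4 :: "(8 \<Rightarrow> 8 \<Rightarrow> 8 \<Rightarrow> 8 \<Rightarrow> real) \<Rightarrow> bool" where
  "skew4 S \<longleftrightarrow> (\<forall>i. skew3 (S i)) \<and> (\<forall>i j k l. S j i k l = - S i j k l)"

lemma skew4_skew3: "skew4 S \<Longrightarrow> skew3 (S i)"
  unfolding skew4_def by blast

lemma skew4_sort:
  "skew4 S \<Longrightarrow> rank8 i < rank8 j \<Longrightarrow> S j i k l = - S i j k l"
  "skew4 S \<Longrightarrow> rank8 k < rank8 j \<Longrightarrow> S i j k l = - S i k j l"
  "skew4 S \<Longrightarrow> rank8 l < rank8 k \<Longrightarrow> S i j k l = - S i j l k"
  unfolding skew4_def skew3_def by blast+

lemma skew4_zero:
  assumes "skew4 S" shows "S i i k l = 0" "S i j j l = 0" "S i j k k = 0"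
proof -
  show "S i i k l = 0" using assms unfolding skew4_def by (metis equal_neg_zero)
qed (use skew3_zero[OF skew4_skew3[OF assms]] in simp_all)

text \<open>Each equality is a linear combination of the equations listed in its proof. The seven
  complementary pairs that occur in the model form come from the eight diagonal equations; each of
  the other 28 comes from off-diagonal equations whose four index pairs partition the eight
  indices.\<close>

lemma annihilator_table:
  assumes S: "skew4 S" and 0: "\<And>i m. tcontr (S i) m = 0"
  shows
    "S 4 5 6 7 = S 0 1 2 3" "S 3 5 6 7 = -S 0 1 2 4" "S 3 4 6 7 = S 0 1 2 5"
    "S 3 4 5 7 = -S 0 1 2 6" "S 2 5 6 7 = S 0 1 3 4" "S 2 4 5 7 = S 0 1 3 6"
    "S 2 4 5 6 = -S 0 1 3 7" "S 2 3 6 7 = S 0 1 4 5" "S 2 3 5 6 = S 0 1 4 7" "S 2 3 4 7 = S 0 1 5 6"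
    "S 2 3 4 6 = -S 0 1 5 7" "S 2 3 4 5 = S 0 1 6 7" "S 1 5 6 7 = -S 0 2 3 4"
    "S 1 4 6 7 = S 0 2 3 5" "S 1 4 5 6 = S 0 2 3 7" "S 1 3 5 7 = S 0 2 4 6" "S 1 3 5 6 = -S 0 2 4 7"
    "S 1 3 4 7 = -S 0 2 5 6" "S 1 3 4 6 = S 0 2 5 7" "S 1 3 4 5 = -S 0 2 6 7"
    "S 1 2 6 7 = S 0 3 4 5" "S 1 2 5 7 = -S 0 3 4 6" "S 1 2 4 7 = S 0 3 5 6"
    "S 1 2 4 6 = -S 0 3 5 7" "S 1 2 4 5 = S 0 3 6 7" "S 1 2 3 7 = -S 0 4 5 6"
    "S 1 2 3 6 = S 0 4 5 7" "S 1 2 3 5 = -S 0 4 6 7"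
    "S 3 4 5 6 = S 0 1 2 7" "S 2 4 6 7 = -S 0 1 3 5" "S 2 3 5 7 = -S 0 1 4 6"
    "S 1 4 5 7 = -S 0 2 3 6" "S 1 3 6 7 = -S 0 2 4 5" "S 1 2 5 6 = S 0 3 4 7"
    "S 1 2 3 4 = S 0 5 6 7"
proof -
  have e: "tcontr (S i) m = 0" for i m by (rule 0)
  note table = tcontr_table[OF skew4_skew3[OF S]] skew4_sort[OF S] skew4_zero[OF S] rank8_less
  show "S 4 5 6 7 = S 0 1 2 3"
    using e[of 0 4] e[of 4 0] e[of 1 6] e[of 6 1] e[of 2 5] e[of 5 2] e[of 3 7] e[of 7 3] by (simp only: table) (simp; linarith)
  show "S 3 5 6 7 = -S 0 1 2 4"
    using e[of 0 3] e[of 3 0] e[of 1 5] e[of 5 1] e[of 2 6] e[of 6 2] e[of 4 7] e[of 7 4] by (simp only: table) (simp; linarith)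
  show "S 3 4 6 7 = S 0 1 2 5"
    using e[of 0 6] e[of 6 0] e[of 1 4] e[of 4 1] e[of 2 3] e[of 3 2] e[of 5 7] e[of 7 5] by (simp only: table) (simp; linarith)
  show "S 3 4 5 7 = -S 0 1 2 6"
    using e[of 0 5] e[of 5 0] e[of 1 3] e[of 3 1] e[of 2 4] e[of 4 2] e[of 6 7] e[of 7 6] by (simp only: table) (simp; linarith)
  show "S 2 5 6 7 = S 0 1 3 4"
    using e[of 0 2] e[of 2 0] e[of 1 7] e[of 7 1] e[of 3 6] e[of 6 3] e[of 4 5] e[of 5 4] by (simp only: table) (simp; linarith)
  show "S 2 4 5 7 = S 0 1 3 6"
    using e[of 0 7] e[of 7 0] e[of 1 2] e[of 2 1] e[of 3 4] e[of 4 3] e[of 6 5] e[of 5 6] by (simp only: table) (simp; linarith)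
  show "S 2 4 5 6 = -S 0 1 3 7"
    using e[of 0 6] e[of 6 0] e[of 1 4] e[of 4 1] e[of 3 2] e[of 2 3] e[of 7 5] e[of 5 7] by (simp only: table) (simp; linarith)
  show "S 2 3 6 7 = S 0 1 4 5"
    using e[of 0 7] e[of 7 0] e[of 1 2] e[of 2 1] e[of 4 3] e[of 3 4] e[of 5 6] e[of 6 5] by (simp only: table) (simp; linarith)
  show "S 2 3 5 6 = S 0 1 4 7"
    using e[of 0 5] e[of 5 0] e[of 1 3] e[of 3 1] e[of 4 2] e[of 2 4] e[of 7 6] e[of 6 7] by (simp only: table) (simp; linarith)
  show "S 2 3 4 7 = S 0 1 5 6"
    using e[of 0 2] e[of 2 0] e[of 1 7] e[of 7 1] e[of 5 4] e[of 4 5] e[of 6 3] e[of 3 6] by (simp only: table) (simp; linarith)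
  show "S 2 3 4 6 = -S 0 1 5 7"
    using e[of 0 4] e[of 4 0] e[of 1 6] e[of 6 1] e[of 5 2] e[of 2 5] e[of 7 3] e[of 3 7] by (simp only: table) (simp; linarith)
  show "S 2 3 4 5 = S 0 1 6 7"
    using e[of 0 3] e[of 3 0] e[of 1 5] e[of 5 1] e[of 6 2] e[of 2 6] e[of 7 4] e[of 4 7] by (simp only: table) (simp; linarith)
  show "S 1 5 6 7 = -S 0 2 3 4"
    using e[of 0 1] e[of 1 0] e[of 2 7] e[of 7 2] e[of 3 5] e[of 5 3] e[of 4 6] e[of 6 4] by (simp only: table) (simp; linarith)
  show "S 1 4 6 7 = S 0 2 3 5"
    using e[of 0 7] e[of 7 0] e[of 2 1] e[of 1 2] e[of 3 4] e[of 4 3] e[of 5 6] e[of 6 5] by (simp only: table) (simp; linarith)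
  show "S 1 4 5 6 = S 0 2 3 7"
    using e[of 0 5] e[of 5 0] e[of 2 4] e[of 4 2] e[of 3 1] e[of 1 3] e[of 7 6] e[of 6 7] by (simp only: table) (simp; linarith)
  show "S 1 3 5 7 = S 0 2 4 6"
    using e[of 0 7] e[of 7 0] e[of 2 1] e[of 1 2] e[of 4 3] e[of 3 4] e[of 6 5] e[of 5 6] by (simp only: table) (simp; linarith)
  show "S 1 3 5 6 = -S 0 2 4 7"
    using e[of 0 6] e[of 6 0] e[of 2 3] e[of 3 2] e[of 4 1] e[of 1 4] e[of 7 5] e[of 5 7] by (simp only: table) (simp; linarith)
  show "S 1 3 4 7 = -S 0 2 5 6"
    using e[of 0 1] e[of 1 0] e[of 2 7] e[of 7 2] e[of 5 3] e[of 3 5] e[of 6 4] e[of 4 6] by (simp only: table) (simp; linarith)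
  show "S 1 3 4 6 = S 0 2 5 7"
    using e[of 0 3] e[of 3 0] e[of 2 6] e[of 6 2] e[of 5 1] e[of 1 5] e[of 7 4] e[of 4 7] by (simp only: table) (simp; linarith)
  show "S 1 3 4 5 = -S 0 2 6 7"
    using e[of 0 4] e[of 4 0] e[of 2 5] e[of 5 2] e[of 6 1] e[of 1 6] e[of 7 3] e[of 3 7] by (simp only: table) (simp; linarith)
  show "S 1 2 6 7 = S 0 3 4 5"
    using e[of 0 6] e[of 6 0] e[of 3 2] e[of 2 3] e[of 4 1] e[of 1 4] e[of 5 7] e[of 7 5] by (simp only: table) (simp; linarith)
  show "S 1 2 5 7 = -S 0 3 4 6"
    using e[of 0 5] e[of 5 0] e[of 3 1] e[of 1 3] e[of 4 2] e[of 2 4] e[of 6 7] e[of 7 6] by (simp only: table) (simp; linarith)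
  show "S 1 2 4 7 = S 0 3 5 6"
    using e[of 0 4] e[of 4 0] e[of 3 7] e[of 7 3] e[of 5 2] e[of 2 5] e[of 6 1] e[of 1 6] by (simp only: table) (simp; linarith)
  show "S 1 2 4 6 = -S 0 3 5 7"
    using e[of 0 2] e[of 2 0] e[of 3 6] e[of 6 3] e[of 5 4] e[of 4 5] e[of 7 1] e[of 1 7] by (simp only: table) (simp; linarith)
  show "S 1 2 4 5 = S 0 3 6 7"
    using e[of 0 1] e[of 1 0] e[of 3 5] e[of 5 3] e[of 6 4] e[of 4 6] e[of 7 2] e[of 2 7] by (simp only: table) (simp; linarith)
  show "S 1 2 3 7 = -S 0 4 5 6"
    using e[of 0 3] e[of 3 0] e[of 4 7] e[of 7 4] e[of 5 1] e[of 1 5] e[of 6 2] e[of 2 6] by (simp only: table) (simp; linarith)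
  show "S 1 2 3 6 = S 0 4 5 7"
    using e[of 0 1] e[of 1 0] e[of 4 6] e[of 6 4] e[of 5 3] e[of 3 5] e[of 7 2] e[of 2 7] by (simp only: table) (simp; linarith)
  show "S 1 2 3 5 = -S 0 4 6 7"
    using e[of 0 2] e[of 2 0] e[of 4 5] e[of 5 4] e[of 6 3] e[of 3 6] e[of 7 1] e[of 1 7] by (simp only: table) (simp; linarith)
  show "S 3 4 5 6 = S 0 1 2 7"
    using e[of 0 0] e[of 1 1] e[of 2 2] e[of 3 3] e[of 4 4] e[of 5 5] e[of 6 6] e[of 7 7] by (simp only: table) (simp; linarith)
  show "S 2 4 6 7 = -S 0 1 3 5"
    using e[of 0 0] e[of 1 1] e[of 2 2] e[of 3 3] e[of 4 4] e[of 5 5] e[of 6 6] e[of 7 7] by (simp only: table) (simp; linarith)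
  show "S 2 3 5 7 = -S 0 1 4 6"
    using e[of 0 0] e[of 1 1] e[of 2 2] e[of 3 3] e[of 4 4] e[of 5 5] e[of 6 6] e[of 7 7] by (simp only: table) (simp; linarith)
  show "S 1 4 5 7 = -S 0 2 3 6"
    using e[of 0 0] e[of 1 1] e[of 2 2] e[of 3 3] e[of 4 4] e[of 5 5] e[of 6 6] e[of 7 7] by (simp only: table) (simp; linarith)
  show "S 1 3 6 7 = -S 0 2 4 5"
    using e[of 0 0] e[of 1 1] e[of 2 2] e[of 3 3] e[of 4 4] e[of 5 5] e[of 6 6] e[of 7 7] by (simp only: table) (simp; linarith)
  show "S 1 2 5 6 = S 0 3 4 7"
    using e[of 0 0] e[of 1 1] e[of 2 2] e[of 3 3] e[of 4 4] e[of 5 5] e[of 6 6] e[of 7 7] by (simp only: table) (simp; linarith)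
  show "S 1 2 3 4 = S 0 5 6 7"
    using e[of 0 0] e[of 1 1] e[of 2 2] e[of 3 3] e[of 4 4] e[of 5 5] e[of 6 6] e[of 7 7] by (simp only: table) (simp; linarith)
qed

lemma psi_rotate: "psi b c a d = psi a b c d" "psi b c d a = - psi a b c d" "psi a c d b = psi a b c d"
  "psi c d a b = psi a b c d"
proof -
  show 1: "psi b c a d = psi a b c d" for a b c d
    using psi_swap(2)[of b c a d] psi_swap(1)[of b a c d] by linarith
  show 2: "psi b c d a = - psi a b c d" for a b c d
    using psi_swap(3)[of b c d a] 1[of b c a d] by linarith
  show "psi a c d b = psi a b c d" using psi_swap(3)[of a c d b] psi_swap(2)[of a c b d] by linarith
  show "psi c d a b = psi a b c d" using 2[of b c d a] 2[of c d a b] by linarith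
qed

lemma tcontr_eq: "tcontr T l = (\<Sum>\<^sub>8i j k. T i j k * psi i j k l)"
  by (simp add: tcontr_def pcontr_def psi_rotate(1)[of _ _ i for i])

lemma eps_sort:
  "rank8 b < rank8 a \<Longrightarrow> eps [a, b, c, d, p, q, r, s] = - eps [b, a, c, d, p, q, r, s]"
  "rank8 c < rank8 b \<Longrightarrow> eps [a, b, c, d, p, q, r, s] = - eps [a, c, b, d, p, q, r, s]"
  "rank8 d < rank8 c \<Longrightarrow> eps [a, b, c, d, p, q, r, s] = - eps [a, b, d, c, p, q, r, s]"
  "rank8 p < rank8 d \<Longrightarrow> eps [a, b, c, d, p, q, r, s] = - eps [a, b, c, p, d, q, r, s]"
  "rank8 q < rank8 p \<Longrightarrow> eps [a, b, c, d, p, q, r, s] = - eps [a, b, c, d, q, p, r, s]"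
  "rank8 r < rank8 q \<Longrightarrow> eps [a, b, c, d, p, q, r, s] = - eps [a, b, c, d, p, r, q, s]"
  "rank8 s < rank8 r \<Longrightarrow> eps [a, b, c, d, p, q, r, s] = - eps [a, b, c, d, p, q, s, r]"
  using alternating_swap[OF alternating_eps, of "[a, b, c, d, p, q, r, s]" 8 0 1]
    alternating_swap[OF alternating_eps, of "[a, b, c, d, p, q, r, s]" 8 1 2]
    alternating_swap[OF alternating_eps, of "[a, b, c, d, p, q, r, s]" 8 2 3]
    alternating_swap[OF alternating_eps, of "[a, b, c, d, p, q, r, s]" 8 3 4]
    alternating_swap[OF alternating_eps, of "[a, b, c, d, p, q, r, s]" 8 4 5]
    alternating_swap[OF alternating_eps, of "[a, b, c, d, p, q, r, s]" 8 5 6]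
    alternating_swap[OF alternating_eps, of "[a, b, c, d, p, q, r, s]" 8 6 7]
  by (simp_all add: numeral_eq_Suc)

lemma alternating_4_skew4:
  assumes "alternating 4 \<sigma>" shows "skew4 (\<lambda>i j k l. \<sigma> [i, j, k, l])"
  unfolding skew4_def skew3_def
proof (intro allI conjI)
  fix i j k l
  show "\<sigma> [i, k, j, l] = - \<sigma> [i, j, k, l]"
    using alternating_swap[OF assms, of "[i, j, k, l]" 1 2] by (simp add: numeral_eq_Suc)
  show "\<sigma> [i, j, l, k] = - \<sigma> [i, j, k, l]"
    using alternating_swap[OF assms, of "[i, j, k, l]" 2 3] by (simp add: numeral_eq_Suc)
  show "\<sigma> [j, i, k, l] = - \<sigma> [i, j, k, l]"
    using alternating_swap[OF assms, of "[i, j, k, l]" 0 1] by (simp add: numeral_eq_Suc)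
qed

text \<open>The signs in \<open>annihilator_table\<close> are exactly those of \<open>eps\<close>,
  so each of its 35 equalities says that \<open>hstar\<close> fixes both members of one
  complementary pair of components.\<close>

lemma hstar_annihilator:
  assumes \<sigma>: "alternating 4 \<sigma>"
    and 0: "\<And>i m. (\<Sum>\<^sub>8j k l. \<sigma> [i, j, k, l] * psi m j k l) = 0"
    and I: "length I = 4"
  shows "hstar \<sigma> I = \<sigma> I"
proof (rule alternating_eqI[OF alternating_hstar \<sigma> _ I])
  let ?S = "\<lambda>i j k l. \<sigma> [i, j, k, l]"
  note S = alternating_4_skew4[OF \<sigma>]
  have "tcontr (?S i) m = - (\<Sum>\<^sub>8j k l. \<sigma> [i, j, k, l] * psi m j k l)" for i m
    unfolding tcontr_eq by (simp add: psi_rotate(2)[of _ _ _ m] sum_negf)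
  then have z: "tcontr (?S i) m = 0" for i m using 0 by simp
  note table = annihilator_table[OF S z]
  have pair: "hstar \<sigma> [a, b, c, d] = \<sigma> [a, b, c, d] \<and> hstar \<sigma> [p, q, r, s] = \<sigma> [p, q, r, s]"
    if eq: "\<sigma> [p, q, r, s] = eps [p, q, r, s, a, b, c, d] * \<sigma> [a, b, c, d]" and d: "distinct [p, q, r, s, a, b, c, d]"
    for p q r s a b c d
  proof -
    have 1: "hstar \<sigma> [a, b, c, d] = \<sigma> [p, q, r, s] * eps [p, q, r, s, a, b, c, d]"
      using hstar_eq[of "[p, q, r, s]" \<sigma> "[a, b, c, d]"] \<sigma> d by (simp add: numeral_eq_Suc)
    have "hstar \<sigma> [p, q, r, s] = \<sigma> [a, b, c, d] * eps [a, b, c, d, p, q, r, s]"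
      using hstar_eq[of "[a, b, c, d]" \<sigma> "[p, q, r, s]"] \<sigma> d by (simp add: numeral_eq_Suc) blast
    moreover have "eps [a, b, c, d, p, q, r, s] = eps [p, q, r, s, a, b, c, d]"
      using eps_rotate[of "[a, b, c, d]" "[p, q, r, s]"] by simp
    moreover have "eps [p, q, r, s, a, b, c, d] * eps [p, q, r, s, a, b, c, d] = 1"
      using eps_square[OF _ d] by simp
    ultimately show ?thesis using 1 eq by (simp add: mult_ac)
  qed
  note pairs = pair[of 4 5 6 7 0 1 2 3] pair[of 3 5 6 7 0 1 2 4] pair[of 3 4 6 7 0 1 2 5]
    pair[of 3 4 5 7 0 1 2 6] pair[of 2 5 6 7 0 1 3 4] pair[of 2 4 5 7 0 1 3 6]
    pair[of 2 4 5 6 0 1 3 7] pair[of 2 3 6 7 0 1 4 5] pair[of 2 3 5 6 0 1 4 7]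
    pair[of 2 3 4 7 0 1 5 6] pair[of 2 3 4 6 0 1 5 7] pair[of 2 3 4 5 0 1 6 7]
    pair[of 1 5 6 7 0 2 3 4] pair[of 1 4 6 7 0 2 3 5] pair[of 1 4 5 6 0 2 3 7]
    pair[of 1 3 5 7 0 2 4 6] pair[of 1 3 5 6 0 2 4 7] pair[of 1 3 4 7 0 2 5 6]
    pair[of 1 3 4 6 0 2 5 7] pair[of 1 3 4 5 0 2 6 7] pair[of 1 2 6 7 0 3 4 5]
    pair[of 1 2 5 7 0 3 4 6] pair[of 1 2 4 7 0 3 5 6] pair[of 1 2 4 6 0 3 5 7]
    pair[of 1 2 4 5 0 3 6 7] pair[of 1 2 3 7 0 4 5 6] pair[of 1 2 3 6 0 4 5 7]
    pair[of 1 2 3 5 0 4 6 7] pair[of 3 4 5 6 0 1 2 7] pair[of 2 4 6 7 0 1 3 5]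
    pair[of 2 3 5 7 0 1 4 6] pair[of 1 4 5 7 0 2 3 6] pair[of 1 3 6 7 0 2 4 5]
    pair[of 1 2 5 6 0 3 4 7] pair[of 1 2 3 4 0 5 6 7]
  have dist: "distinct (x # xs) \<longleftrightarrow> x \<notin> set xs \<and> distinct xs" for x :: 8 and xs by simp
  note all = pairs[simplified table eps_sort rank8_less eps_id dist list.set insert_iff empty_iff neq8 distinct.simps, simplified]
  fix I :: "8 list" assume "length I = 4" "rank_sorted I"
  then obtain a b c d where I: "I = [a, b, c, d]" and lt: "rank8 a < rank8 b" "rank8 b < rank8 c" "rank8 c < rank8 d"
    by (auto simp: rank_sorted_def length_Suc_conv numeral_eq_Suc)
  show "hstar \<sigma> I = \<sigma> I"
    unfolding I
    by (insert lt exhaust_8[of a], elim disjE; hypsubst; insert exhaust_8[of b], elim disjE; hypsubst; simp only: rank8_less;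
      insert exhaust_8[of c], elim disjE; hypsubst; simp only: rank8_less;
      insert exhaust_8[of d], elim disjE; hypsubst; simp only: rank8_less all table)
qed simp

subsection \<open>Pointwise consequences of the instanton condition\<close>

lemma sum3_rotate:
  fixes f :: "8 \<Rightarrow> 8 \<Rightarrow> 8 \<Rightarrow> real"
  shows "(\<Sum>\<^sub>8i j k. f j k i) = (\<Sum>\<^sub>8i j k. f i j k)"
proof -
  have "(\<Sum>\<^sub>8i j k. f j k i) = (\<Sum>\<^sub>8j i k. f j k i)"
    by (rule sum.swap)
  also have "\<dots> = (\<Sum>\<^sub>8j k i. f j k i)"
    by (intro sum.cong refl sum.swap)
  finally show ?thesis .
qed

lemma skew2_sum_symmetric:
  assumes "skew2 \<alpha>" "\<And>i j. b j i = b i j" shows "(\<Sum>\<^sub>8i j. \<alpha> i j * (b i j :: real)) = 0"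
proof -
  have "(\<Sum>\<^sub>8i j. \<alpha> i j * b i j) = (\<Sum>\<^sub>8i j. \<alpha> j i * b j i)"
    by (rule sum.swap)
  also have "\<dots> = - (\<Sum>\<^sub>8i j. \<alpha> i j * b i j)"
  proof -
    have "\<alpha> j i * b j i = - (\<alpha> i j * b i j)" for i j
      using skew2D[OF assms(1), of j i] assms(2)[of j i] by simp
    then have "(\<Sum>\<^sub>8i j. \<alpha> j i * b j i) = (\<Sum>\<^sub>8i j. - (\<alpha> i j * b i j))"
      by (intro sum.cong refl)
    then show ?thesis by (simp only: sum_negf)
  qed
  finally show ?thesis by simp
qed

lemma sum4_swap:
  fixes f :: "8 \<Rightarrow> 8 \<Rightarrow> 8 \<Rightarrow> 8 \<Rightarrow> real"
  shows "(\<Sum>\<^sub>8s k i j. f s k i j) = (\<Sum>\<^sub>8s k i j. f i j s k)"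
proof -
  have "(\<Sum>\<^sub>8s k i j. f s k i j) = (\<Sum>\<^sub>8s i k j. f s k i j)"
    by (intro sum.cong refl sum.swap)
  also have "\<dots> = (\<Sum>\<^sub>8i s k j. f s k i j)"
    by (rule sum.swap)
  also have "\<dots> = (\<Sum>\<^sub>8i s j k. f s k i j)"
    by (intro sum.cong refl sum.swap)
  also have "\<dots> = (\<Sum>\<^sub>8i j s k. f s k i j)"
    by (intro sum.cong refl sum.swap)
  finally show ?thesis .
qed

text \<open>\<open>pcontr\<close> is a symmetric operator because
  \<open>psi i j k l = psi k l i j\<close>.\<close>

lemma pcontr_adjoint:
  "(\<Sum>\<^sub>8s k. \<alpha> s k * pcontr \<beta> s k) = (\<Sum>\<^sub>8s k. pcontr \<alpha> s k * \<beta> s k)"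
proof -
  have "(\<Sum>\<^sub>8s k. \<alpha> s k * pcontr \<beta> s k)
     = (\<Sum>\<^sub>8s k i j. \<alpha> s k * (\<beta> i j * psi i j s k))"
    by (simp only: pcontr_def sum_distrib_left)
  also have "\<dots> = (\<Sum>\<^sub>8s k i j. \<alpha> i j * (\<beta> s k * psi s k i j))"
    by (rule sum4_swap)
  moreover have "\<alpha> i j * (\<beta> s k * psi s k i j) = \<alpha> i j * psi i j s k * \<beta> s k" for i j s k
    using psi_rotate(4)[of s k i j] by simp
  ultimately show ?thesis by (simp only: pcontr_def sum_distrib_right)
qed

lemma pcontr_add: "pcontr (\<lambda>i j. \<alpha> i j + \<beta> i j) k l = pcontr \<alpha> k l + pcontr \<beta> k l"
  by (simp add: pcontr_def algebra_simps sum.distrib)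

lemma pcontr_cmult: "pcontr (\<lambda>i j. c * \<alpha> i j) k l = c * pcontr \<alpha> k l"
  by (simp add: pcontr_def sum_distrib_left mult.assoc)

lemma pcontr_sum: "pcontr (\<lambda>i j. \<Sum>a\<in>A. \<alpha> a i j) k l = (\<Sum>a\<in>A. pcontr (\<alpha> a) k l)"
proof -
  have "pcontr (\<lambda>i j. \<Sum>a\<in>A. \<alpha> a i j) k l = (\<Sum>\<^sub>8i. \<Sum>a\<in>A. \<Sum>\<^sub>8j. \<alpha> a i j * psi i j k l)"
    unfolding pcontr_def sum_distrib_right by (intro sum.cong refl sum.swap)
  also have "\<dots> = (\<Sum>a\<in>A. pcontr (\<alpha> a) k l)"
    unfolding pcontr_def by (rule sum.swap)
  finally show ?thesis .
qed

text \<open>Components in an adapted frame at one point: the torsion \<open>T\<close>, its covariant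
  derivative \<open>X\<close> with the direction first, and the curvature \<open>R\<close>.
  \<open>instanton\<close> puts the first index pair of \<open>R\<close> into spin(7) and
  \<open>holonomy\<close> the second. \<open>closed\<close> is the closedness of the Lee form,
  multiplied by -7 and rewritten with covariant derivatives, which brings in the torsion.\<close>

locale instanton_point =
  fixes T :: "8 \<Rightarrow> 8 \<Rightarrow> 8 \<Rightarrow> real" and X R :: "8 \<Rightarrow> 8 \<Rightarrow> 8 \<Rightarrow> 8 \<Rightarrow> real"
  assumes T: "skew3 T" and X: "\<And>m. skew3 (X m)"
    and R12: "\<And>i j k l. R j i k l = - R i j k l" and R34: "\<And>i j k l. R i j l k = - R i j k l"
    and bianchi: "\<And>i j k l. R i j k l + R j k i l + R k i j l = X i j k l + X j k i l + X k i j l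
       + (\<Sum>\<^sub>8s. T i j s * T s k l + T j k s * T s i l + T k i s * T s j l)"
    and instanton: "\<And>i j k l. pcontr (\<lambda>a b. R a b i j) k l = 2 * R k l i j"
    and holonomy: "\<And>i j k l. pcontr (R i j) k l = 2 * R i j k l"
    and closed: "\<And>i j. tcontr (X i) j - tcontr (X j) i = - (\<Sum>\<^sub>8s. T i j s * tcontr T s)"
begin

text \<open>\<open>N\<close> and \<open>S\<close> are the contractions with \<open>psi\<close> of
  the linear and the quadratic torsion term of the Bianchi identity (see \<open>N_eq\<close>,
  \<open>S_eq\<close>). \<open>d\<close> is the divergence of the torsion, \<open>G\<close> its
  contraction with \<open>tcontr T\<close>, and \<open>\<rho>\<close> the Ricci trace of the
  curvature up to the sign convention.\<close>

definition N where "N l m = (\<Sum>\<^sub>8i. pcontr (X i l) i m)"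
definition S where "S l m = (\<Sum>\<^sub>8k s. T k l s * pcontr (T s) k m)"
definition d where "d i k = (\<Sum>\<^sub>8j. X j j i k)"
definition G where "G i j = (\<Sum>\<^sub>8s. T i j s * tcontr T s)"
definition \<rho> where "\<rho> i l = (\<Sum>\<^sub>8n. R i n l n)"

lemma T_cyc: "T j k i = T i j k"
  using skew3D[OF T] by metis

lemma X_cyc: "X m j k i = X m i j k"
  using skew3D[OF X] by metis

lemma skew_d: "skew2 d"
  unfolding skew2_def
proof (intro allI)
  fix i k
  have "X j j k i = - X j j i k" for j by (rule skew3D(2)[OF X])
  then show "d k i = - d i k" by (simp only: d_def sum_negf)
qed

lemma skew_G: "skew2 G"
  unfolding skew2_def
proof (intro allI)
  fix i k
  have "T k i s * tcontr T s = - (T i k s * tcontr T s)" for s using skew3D(1)[OF T, of k i s] by simp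
  then show "G k i = - G i k" by (simp only: G_def sum_negf)
qed

lemma N_eq: "N l m = (\<Sum>\<^sub>8i j k. X i j k l * psi i j k m)"
  unfolding N_def pcontr_def
  by (intro sum.cong refl) (simp add: X_cyc[of _ _ _ l] psi_rotate(1))

lemma S_eq: "S l m = (\<Sum>\<^sub>8i j k. (\<Sum>\<^sub>8s. T i j s * T s k l) * psi i j k m)"
proof -
  have "S l m = (\<Sum>\<^sub>8k s i j. T i j s * T s k l * psi i j k m)"
  proof -
    have "T k l s * (T s i j * psi i j k m) = T i j s * T s k l * psi i j k m" for k s i j
      using T_cyc[of k l s] T_cyc[of i j s] by simp
    then show ?thesis by (simp only: S_def pcontr_def sum_distrib_left)
  qed
  also have "\<dots> = (\<Sum>\<^sub>8k i s j. T i j s * T s k l * psi i j k m)"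
    by (intro sum.cong refl sum.swap)
  also have "\<dots> = (\<Sum>\<^sub>8k i j s. T i j s * T s k l * psi i j k m)"
    by (intro sum.cong refl sum.swap)
  finally show ?thesis
    using sum3_rotate[of "\<lambda>i j k. \<Sum>\<^sub>8s. T i j s * T s k l * psi i j k m"] by (simp add: sum_distrib_right)
qed

text \<open>Rotating the first three indices does not change \<open>psi\<close>, so the three cyclic
  terms have equal sums.\<close>

lemma cyclic_sum:
  "(\<Sum>\<^sub>8i j k. (f i j k + f j k i + f k i j) * psi i j k m)
    = 3 * (\<Sum>\<^sub>8i j k. f i j k * psi i j k m)"
proof -
  let ?F = "\<lambda>i j k. f i j k * psi i j k m"
  have "(f i j k + f j k i + f k i j) * psi i j k m = ?F i j k + ?F j k i + ?F k i j" for i j k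
    by (simp add: algebra_simps psi_rotate(1))
  then show ?thesis
    using sum3_rotate[of ?F] sum3_rotate[of "\<lambda>i j k. ?F j k i"] by (simp add: sum.distrib)
qed

text \<open>Contract the Bianchi identity with \<open>psi i j k m\<close>. On the curvature side
  \<open>instanton\<close> acts on the pair \<open>i j\<close> and leaves
  \<open>2 * R k m k l\<close>, a trace of the curvature; the factor 3 of \<open>cyclic_sum\<close>
  cancels.\<close>

lemma ricci_instanton: "2 * \<rho> m l = N l m + S l m"
proof -
  have "3 * (\<Sum>\<^sub>8i j k. R i j k l * psi i j k m) = 3 * N l m + 3 * S l m"
    unfolding N_eq S_eq cyclic_sum[symmetric] bianchi
    by (simp add: sum.distrib algebra_simps)
  moreover have "(\<Sum>\<^sub>8i j k. R i j k l * psi i j k m) = (\<Sum>\<^sub>8k. pcontr (\<lambda>i j. R i j k l) k m)"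
    using sum3_rotate[of "\<lambda>i j k. R i j k l * psi i j k m"] by (simp add: pcontr_def)
  moreover have "\<dots> = 2 * \<rho> m l"
    unfolding instanton \<rho>_def sum_distrib_left
    by (intro sum.cong refl) (simp add: R12[of _ m] R34[of _ _ l])
  ultimately show ?thesis by simp
qed

text \<open>The classical combination of four Bianchi identities, here with signs + + - -. The
  quadratic torsion terms cancel in it, so the defect of pair symmetry is linear in the derivative
  of the torsion.\<close>

lemma pair_exchange: "2 * R i j k l - 2 * R k l i j = X i j k l - X j i k l - X k i j l + X l i j k"
proof -
  let ?\<sigma> = "\<lambda>i j k l. \<Sum>\<^sub>8s. T i j s * T s k l + T j k s * T s i l + T k i s * T s j l"
  have \<sigma>: "?\<sigma> i j k l + ?\<sigma> j k l i - ?\<sigma> k l i j - ?\<sigma> l i j k = 0"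
    unfolding sum.distrib[symmetric] sum_subtractf[symmetric]
  proof (intro sum.neutral ballI)
    fix s
    have p: "T s a b = T a b s" "T b a s = - T a b s" for a b
      by (rule T_cyc[symmetric], rule skew3D(1)[OF T])
    show "T i j s * T s k l + T j k s * T s i l + T k i s * T s j l
      + (T j k s * T s l i + T k l s * T s j i + T l j s * T s k i)
      - (T k l s * T s i j + T l i s * T s k j + T i k s * T s l j)
      - (T l i s * T s j k + T i j s * T s l k + T j l s * T s i k) = 0"
      unfolding p(1) p(2)[of j i] p(2)[of k i] p(2)[of l i] p(2)[of k j] p(2)[of l j] p(2)[of l k]
      by (simp add: algebra_simps)
  qed
  have r: "R k l j i = - R k l i j" "R j k l i = - R j k i l" "R l i k j = - R l i j k" "R i j l k = - R i j k l"
    by (rule R34)+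
  have flip: "R b a e c = R a b c e" for a b c e
    using R12[where i = a and j = b and k = e and l = c] R34[where i = a and j = b and k = c and l = e] by simp
  have r': "R l j k i = R j l i k" "R i k l j = R k i j l"
    by (rule flip)+
  have x: "X i k l j = X i j k l" "X j k l i = X j i k l" "X l j k i = X l i j k"
    by (rule X_cyc)+
  have x': "X j l i k = X j i k l" "X k l i j = X k i j l"
    by (rule X_cyc[symmetric])+
  have x'': "X i j l k = - X i j k l" "X l i k j = - X l i j k" "X k i l j = - X k i j l"
    by (rule skew3D(2)[OF X])+
  have x3: "X j k i l = - X j i k l" "X k l j i = X k i l j"
    by (rule skew3D(1)[OF X], rule X_cyc)
  show ?thesis
    using bianchi[of i j k l] bianchi[of j k l i] bianchi[of k l i j] bianchi[of l i j k] \<sigma>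
    unfolding r r' x x' x3 x'' by linarith
qed

text \<open>The trace of \<open>pair_exchange\<close> over \<open>j = l\<close>, where two of the
  four derivative terms have a repeated index.\<close>

lemma ricci_skew: "\<rho> i k - \<rho> k i = - d i k"
proof -
  have *: "2 * R i j k j - 2 * R k j i j = - 2 * X j j i k" for j
    using pair_exchange[of i j k j] skew3_zero[OF X] X_cyc[of j i k j] skew3D(1)[OF X, of j i j k]
      skew3D(2)[OF X, of i j k j] skew3D(1)[OF X, of i k j j] skew3_zero[OF X, of i k k] X_cyc[of i j k j] 
    by simp
  have "R i j k j - R k j i j = - X j j i k" for j using *[of j] by linarith
  then show ?thesis by (simp add: \<rho>_def d_def sum_subtractf[symmetric] sum_negf)
qed

lemma contr_X: "(\<Sum>\<^sub>8a k l. X i a k l * psi j a k l) = - tcontr (X i) j"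
  unfolding tcontr_eq by (simp add: psi_rotate(2)[of _ _ _ j] sum_negf)

lemma contr_X_N:
  "(\<Sum>\<^sub>8a k l. X a i k l * psi j a k l) = - N i j"
  "(\<Sum>\<^sub>8a k l. X k i a l * psi j a k l) = N i j"
  "(\<Sum>\<^sub>8a k l. X l i a k * psi j a k l) = - N i j"
proof -
  show 1: "(\<Sum>\<^sub>8a k l. X a i k l * psi j a k l) = - N i j"
    unfolding N_eq by (simp add: psi_rotate(2)[of _ _ _ j] sum_negf X_cyc[of _ _ _ i])
  have "(\<Sum>\<^sub>8a k l. X k i a l * psi j a k l)
      = (\<Sum>\<^sub>8a k l. X a i k l * psi j k a l)"
    by (rule sum.swap)
  moreover have "X a i k l * psi j k a l = - (X a i k l * psi j a k l)" for a k l
    using psi_swap(2)[of j k a l] by simp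
  ultimately show "(\<Sum>\<^sub>8a k l. X k i a l * psi j a k l) = N i j"
    using 1 by (simp only: sum_negf)
  have "(\<Sum>\<^sub>8a k l. X l i a k * psi j a k l)
      = (\<Sum>\<^sub>8a k l. X a i k l * psi j k l a)"
    using sum3_rotate[of "\<lambda>a k l. X l i a k * psi j a k l"] by simp
  then show "(\<Sum>\<^sub>8a k l. X l i a k * psi j a k l) = - N i j"
    using 1 by (simp only: psi_rotate(3))
qed

text \<open>Contract \<open>pair_exchange\<close> with \<open>psi j a k l\<close>. The curvature
  terms are evaluated by \<open>holonomy\<close> and \<open>instanton\<close> respectively and
  combine to four times the skew part of \<open>\<rho>\<close>, that is to
  \<open>-4 * d\<close>.\<close>

lemma N_formula: "N i j = 4 * d i j - tcontr (X i) j"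
proof -
  have "(\<Sum>\<^sub>8a k l. (2 * R i a k l - 2 * R k l i a) * psi j a k l)
     = 2 * (\<Sum>\<^sub>8a. pcontr (R i a) j a - pcontr (\<lambda>k l. R k l i a) j a)"
    by (simp add: pcontr_def psi_rotate(4)[of _ _ j] sum_distrib_left sum_subtractf[symmetric] algebra_simps)
  also have "\<dots> = 4 * (\<rho> i j - \<rho> j i)"
    unfolding instanton holonomy by (simp add: \<rho>_def sum_subtractf sum_distrib_left algebra_simps)
  finally have "4 * (\<rho> i j - \<rho> j i) = (\<Sum>\<^sub>8a k l.
      (X i a k l - X a i k l - X k i a l + X l i a k) * psi j a k l)"
    unfolding pair_exchange ..
  also have "\<dots> = - tcontr (X i) j - N i j"
    using contr_X[of i j] contr_X_N[of i j] by (simp add: algebra_simps sum.distrib sum_subtractf)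
  finally show ?thesis using ricci_skew[of i j] by simp
qed

lemma N_skew_part: "N l m - N m l = 8 * d l m + G l m"
  using N_formula[of l m] N_formula[of m l] closed[of l m] skew2D[OF skew_d, of m l] by (simp add: G_def)

text \<open>Apply \<open>pcontr_cyclic\<close> to each 3-form \<open>X i\<close> and trace the
  direction against the first slot. The three cyclic terms become \<open>pcontr d\<close> and the
  two halves of the skew part of \<open>N\<close>.\<close>

lemma pcontr_d: "pcontr d l m = 10 * d l m + G l m + (1/6) * pcontr G l m"
proof -
  have "(\<Sum>\<^sub>8i. pcontr (X i i) l m + pcontr (X i l) m i + pcontr (X i m) i l)
     = (\<Sum>\<^sub>8i. 2 * X i i l m + (1/3) * (\<Sum>\<^sub>8a. tcontr (X i) a * psi a i l m))"
    by (intro sum.cong refl pcontr_cyclic X)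
  moreover have "(\<Sum>\<^sub>8i. pcontr (X i i) l m) = pcontr d l m"
    unfolding d_def pcontr_sum ..
  moreover have "(\<Sum>\<^sub>8i. pcontr (X i l) m i) = - N l m"
    by (simp add: N_def skew2D[OF skew2_pcontr, of _ m i for i] sum_negf)
  \<comment> \<open>Exchanging \<open>i\<close> and \<open>a\<close> changes the sign of
    \<open>psi\<close>, so only the skew part of \<open>tcontr (X i) a\<close> counts, and
    \<open>closed\<close> turns that into \<open>G\<close>.\<close>
  moreover have "(\<Sum>\<^sub>8i a. tcontr (X i) a * psi a i l m) = (1/2) * pcontr G l m"
  proof -
    let ?Z = "\<Sum>\<^sub>8i a. tcontr (X i) a * psi a i l m"
    have Z1: "?Z = (\<Sum>\<^sub>8i a. tcontr (X a) i * psi i a l m)"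
      by (rule sum.swap)
    have "tcontr (X i) a * psi a i l m = - tcontr (X i) a * psi i a l m" for i a
      using psi_swap(1)[of a i l m] by simp
    then have Z2: "?Z = (\<Sum>\<^sub>8i a. - tcontr (X i) a * psi i a l m)"
      by (simp only:)
    have "tcontr (X a) i * psi i a l m + - tcontr (X i) a * psi i a l m = G i a * psi i a l m" for i a
    proof -
      have G: "G i a = tcontr (X a) i - tcontr (X i) a" using closed[of i a] by (simp add: G_def)
      show ?thesis unfolding G by (simp add: algebra_simps)
    qed
    then have "?Z + ?Z = pcontr G l m"
      by (subst Z1, subst Z2) (simp only: pcontr_def sum.distrib[symmetric])
    then show ?thesis by simp
  qed
  ultimately have "pcontr d l m - N l m + N m l = 2 * d l m + (1/6) * pcontr G l m"
    by (simp add: sum.distrib N_def[of m l] d_def sum_distrib_left[symmetric] sum_divide_distrib[symmetric])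
  then show ?thesis using N_skew_part[of l m] by simp
qed

definition \<tau> where "\<tau> s k m = (\<Sum>\<^sub>8l. tcontr T l * psi l s k m)"

lemma cyclic: "pcontr (T s) k m + pcontr (T k) m s + pcontr (T m) s k = 2 * T s k m + (1/3) * \<tau> s k m"
  unfolding \<tau>_def by (rule pcontr_cyclic[OF T])

text \<open>Relabelling the sum shows that \<open>S\<close> is the contraction of \<open>T\<close>
  with either of two terms of the cyclic identity; adding both expressions trades them for the third
  term.\<close>

lemma S_formula: "2 * S l m = (\<Sum>\<^sub>8s k. T s k l * (2 * T s k m + (1/3) * \<tau> s k m - pcontr (T m) s k))"
proof -
  have 1: "S l m = (\<Sum>\<^sub>8s k. T s k l * pcontr (T s) k m)"
    unfolding S_def by (subst sum.swap) (simp add: T_cyc)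
  have "S l m = (\<Sum>\<^sub>8s k. T k s l * pcontr (T k) s m)"
    unfolding 1 by (rule sum.swap)
  also have "\<dots> = (\<Sum>\<^sub>8s k. T s k l * pcontr (T k) m s)"
    by (intro sum.cong refl) (metis skew3D(1)[OF T] skew2D[OF skew2_pcontr] minus_mult_minus)
  finally have "2 * S l m = (\<Sum>\<^sub>8s k. T s k l * (pcontr (T s) k m + pcontr (T k) m s))"
    using 1 by (simp add: algebra_simps sum.distrib)
  moreover have "pcontr (T s) k m + pcontr (T k) m s = 2 * T s k m + (1/3) * \<tau> s k m - pcontr (T m) s k" for s k
    using cyclic[of s k m] by simp
  ultimately show ?thesis by simp
qed

lemma G_cyc: "(\<Sum>\<^sub>8a. tcontr T a * T a l m) = G l m" "(\<Sum>\<^sub>8a. T s k a * tcontr T a) = G s k"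
  unfolding G_def by (simp_all add: T_cyc mult.commute)

lemma pcontr_G: "(\<Sum>\<^sub>8a. tcontr T a * pcontr (T a) l m) = pcontr G l m"
proof -
  have "pcontr G l m = pcontr (\<lambda>i j. \<Sum>\<^sub>8a. tcontr T a * T a i j) l m"
    using G_cyc(1) by (simp add: pcontr_def)
  then show ?thesis by (simp add: pcontr_sum pcontr_cmult)
qed

lemma \<tau>_t: "(\<Sum>\<^sub>8a. tcontr T a * \<tau> a l m) = 0" "(\<Sum>\<^sub>8a. \<tau> l m a * tcontr T a) = 0"
proof -
  have z: "(\<Sum>\<^sub>8a b. psi b a l m * (tcontr T a * tcontr T b)) = 0"
    by (rule skew2_sum_symmetric, unfold skew2_def, intro allI, rule psi_swap(1), rule mult.commute)
  show 1: "(\<Sum>\<^sub>8a. tcontr T a * \<tau> a l m) = 0"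
    using z by (simp add: \<tau>_def sum_distrib_left mult_ac)
  have "\<tau> l m a = \<tau> a l m" for a
    unfolding \<tau>_def by (simp add: psi_rotate(3)[of _ l m a for l])
  then show "(\<Sum>\<^sub>8a. \<tau> l m a * tcontr T a) = 0" using 1 by (simp add: mult.commute)
qed

text \<open>In \<open>S_formula\<close> the term quadratic in \<open>T\<close> alone is symmetric in
  \<open>l\<close> and \<open>m\<close>, and so is the one with \<open>pcontr (T m)\<close>, by
  \<open>pcontr_adjoint\<close>. Only the \<open>\<tau>\<close> term has a skew part, and
  \<open>cyclic\<close> reduces it to \<open>G\<close>.\<close>

lemma S_skew_part: "S l m - S m l = (1/6) * (pcontr G l m - 2 * G l m)"
proof -
  let ?A = "\<lambda>l m. \<Sum>\<^sub>8s k. T s k l * \<tau> s k m"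
  let ?B = "\<lambda>l m. \<Sum>\<^sub>8s k. T s k l * T s k m"
  let ?C = "\<lambda>l m. \<Sum>\<^sub>8s k. T s k l * pcontr (T m) s k"
  have S: "2 * S l m = 2 * ?B l m + (1/3) * ?A l m - ?C l m" for l m
    unfolding S_formula by (simp add: algebra_simps sum.distrib sum_subtractf sum_distrib_left)
  have B: "?B l m = ?B m l" by (simp add: mult.commute)
  have C: "?C l m = ?C m l"
    using pcontr_adjoint[of "T l" "T m"] by (simp add: T_cyc mult.commute)
  have A: "?A l m = (\<Sum>\<^sub>8a. tcontr T a * pcontr (T l) a m)" for l m
  proof -
    have "?A l m = (\<Sum>\<^sub>8s k a. tcontr T a * (T l s k * psi s k a m))"
    proof -
      have "T s k l * (tcontr T a * psi a s k m) = tcontr T a * (T l s k * psi s k a m)" for s k a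
        using T_cyc[of s k l] psi_rotate(1)[of s k a m] by simp
      then show ?thesis by (simp only: \<tau>_def sum_distrib_left)
    qed
    also have "\<dots> = (\<Sum>\<^sub>8a s k. tcontr T a * (T l s k * psi s k a m))"
      by (rule sum3_rotate[of "\<lambda>s k a. tcontr T a * (T l s k * psi s k a m)", symmetric])
    finally show ?thesis by (simp add: pcontr_def sum_distrib_left)
  qed
  have "pcontr (T l) a m - pcontr (T m) a l = pcontr (T a) l m - 2 * T a l m - (1/3) * \<tau> a l m" for a
    using cyclic[of a l m] skew2D[OF skew2_pcontr[of "T l"], of a m] by simp
  then have "?A l m - ?A m l = (\<Sum>\<^sub>8a. tcontr T a * (pcontr (T a) l m - 2 * T a l m - (1/3) * \<tau> a l m))"
    unfolding A by (simp flip: sum_subtractf right_diff_distrib)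
  also have "\<dots> = pcontr G l m - 2 * G l m"
  proof -
    have "(\<Sum>\<^sub>8a. tcontr T a * (pcontr (T a) l m - 2 * T a l m - (1/3) * \<tau> a l m))
      = (\<Sum>\<^sub>8a. tcontr T a * pcontr (T a) l m) - 2 * (\<Sum>\<^sub>8a. tcontr T a * T a l m)
        - (1/3) * (\<Sum>\<^sub>8a. tcontr T a * \<tau> a l m)"
      by (simp add: algebra_simps sum.distrib sum_subtractf sum_distrib_left)
    then show ?thesis using G_cyc(1)[of l m] pcontr_G[of l m] \<tau>_t(1)[of l m] by simp
  qed
  finally show ?thesis using S[of l m] S[of m l] B C by simp
qed

text \<open>The skew part of \<open>\<rho>\<close> computed twice: once by
  \<open>ricci_skew\<close>, once from the skew parts of \<open>N\<close> and
  \<open>S\<close>.\<close>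

lemma d_formula: "6 * d l m = - (2/3) * G l m - (1/6) * pcontr G l m"
proof -
  have "2 * (\<rho> m l - \<rho> l m) = 2 * d l m"
    using ricci_skew[of m l] skew2D[OF skew_d, of m l] by simp
  then show ?thesis
    using ricci_instanton[of m l] ricci_instanton[of l m] N_skew_part[of l m] S_skew_part[of l m] by simp
qed

text \<open>Write P for \<open>pcontr\<close>. Applying P to \<open>d_formula\<close> gives
  \<open>6 P d = -2 G\<close>, since P P = 12 - 4 P removes the P G terms. Substituting
  \<open>d_formula\<close> into \<open>pcontr_d\<close> gives
  \<open>6 P d = -(2/3) (G + P G)\<close>. Hence P G = 2 G, that is \<open>G\<close> lies in
  spin(7).\<close>

lemma pcontr_G_eq: "pcontr G l m = 2 * G l m"
proof -
  have "pcontr (\<lambda>i j. 6 * d i j) l m = pcontr (\<lambda>i j. - (2/3) * G i j + - (1/6) * pcontr G i j) l m"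
    by (simp add: d_formula)
  then have "6 * pcontr d l m = - (2/3) * pcontr G l m + - (1/6) * pcontr (pcontr G) l m"
    by (simp only: pcontr_add pcontr_cmult)
  then show ?thesis
    using pcontr_d[of l m] d_formula[of l m] pcontr_pcontr[OF skew_G, of l m] by (simp add: field_simps)
qed

text \<open>Evaluate \<open>2 \<rho> = N + S\<close> twice on t = \<open>tcontr T\<close>. In
  \<open>N\<close> the skew \<open>d\<close> drops out; \<open>S\<close> drops out because it
  contributes the pairing of \<open>G\<close> with \<open>2 G - pcontr G\<close>. Only the symmetric
  derivative term is left.\<close>

lemma ricci_lee:
  "(\<Sum>\<^sub>8m l. \<rho> m l * (tcontr T m * tcontr T l))
    = - (1/2) * (\<Sum>\<^sub>8l m. tcontr (X l) m * (tcontr T l * tcontr T m))"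
proof -
  let ?t = "tcontr T"
  have "2 * (\<Sum>\<^sub>8l m. S l m * (?t l * ?t m))
      = (\<Sum>\<^sub>8s k. G s k * (2 * G s k - pcontr G s k))"
  proof -
    have "2 * (\<Sum>\<^sub>8l m. S l m * (?t l * ?t m))
      = (\<Sum>\<^sub>8l m. (2 * S l m) * (?t l * ?t m))"
      by (simp add: sum_distrib_left mult.assoc)
    also have "\<dots> = (\<Sum>\<^sub>8l m s k.
        (T s k l * ?t l) * ((2 * T s k m + (1/3) * \<tau> s k m - pcontr (T m) s k) * ?t m))"
      unfolding S_formula sum_distrib_right by (intro sum.cong refl) (simp only: mult_ac)
    also have "\<dots> = (\<Sum>\<^sub>8s k l m.
        (T s k l * ?t l) * ((2 * T s k m + (1/3) * \<tau> s k m - pcontr (T m) s k) * ?t m))"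
      by (rule sum4_swap)
    also have "\<dots> = (\<Sum>\<^sub>8s k. (\<Sum>\<^sub>8l. T s k l * ?t l) *
        (\<Sum>\<^sub>8m. (2 * T s k m + (1/3) * \<tau> s k m - pcontr (T m) s k) * ?t m))"
      by (simp only: sum_product)
    also have "\<dots> = (\<Sum>\<^sub>8s k. G s k * (2 * G s k - pcontr G s k))"
    proof -
      have "(\<Sum>\<^sub>8m. (2 * T s k m + (1/3) * \<tau> s k m - pcontr (T m) s k) * ?t m)
        = 2 * (\<Sum>\<^sub>8m. T s k m * ?t m) + (1/3) * (\<Sum>\<^sub>8m. \<tau> s k m * ?t m) - (\<Sum>\<^sub>8m. ?t m * pcontr (T m) s k)" for s k
        by (simp add: algebra_simps sum.distrib sum_subtractf sum_distrib_left)
      then show ?thesis using G_cyc(2) pcontr_G \<tau>_t(2) by simp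
    qed
    finally show ?thesis .
  qed
  then have S0: "(\<Sum>\<^sub>8l m. S l m * (?t l * ?t m)) = 0" by (simp add: pcontr_G_eq)
  have d0: "(\<Sum>\<^sub>8l m. d l m * (?t l * ?t m)) = 0"
    by (rule skew2_sum_symmetric[OF skew_d]) simp
  have "2 * (\<Sum>\<^sub>8m l. \<rho> m l * (?t m * ?t l)) = (\<Sum>\<^sub>8l m. (2 * \<rho> m l) * (?t l * ?t m))"
    by (subst sum.swap) (simp add: sum_distrib_left mult_ac)
  also have "\<dots> = 4 * (\<Sum>\<^sub>8l m. d l m * (?t l * ?t m))
      - (\<Sum>\<^sub>8l m. tcontr (X l) m * (?t l * ?t m)) + (\<Sum>\<^sub>8l m. S l m * (?t l * ?t m))"
    unfolding ricci_instanton N_formula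
    by (simp add: algebra_simps sum.distrib sum_subtractf sum_distrib_left)
  finally show ?thesis using S0 d0 by simp
qed

text \<open>Here \<open>closed\<close> forces \<open>G = 0\<close>, then \<open>d_formula\<close>
  gives \<open>d = 0\<close> and \<open>N_formula\<close> gives \<open>N = 0\<close>. The four
  contractions in the claim are \<open>tcontr (X i)\<close> and copies of \<open>N\<close>, up to
  sign.\<close>

lemma annihilates:
  assumes "\<And>i j. tcontr (X i) j = 0"
  shows "(\<Sum>\<^sub>8j k l. (X i j k l + X j k i l + X k i j l - X l i j k) * psi m j k l) = 0"
proof -
  have "G l m = 0" for l m using closed[of l m] assms by (simp add: G_def)
  then have "d l m = 0" for l m using d_formula[of l m] by (simp add: pcontr_def)
  then have N0: "N i m = 0" by (simp add: N_formula assms)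
  have "X j k i l = - X j i k l" for j k l by (rule skew3D(1)[OF X])
  then show ?thesis
    using contr_X[of i m] contr_X_N[of i m] N0 assms
    by (simp add: algebra_simps sum.distrib sum_subtractf sum_negf)
qed

end

subsection \<open>Evaluation of tensors on vectors\<close>

text \<open>Evaluation on arbitrary vectors instead of members of an indexed family:
  \<open>comps L t I\<close> is \<open>tev t (map L I)\<close>. In this form the arguments may vary
  from point to point and be differentiated.\<close>

primrec tev :: "tensor \<Rightarrow> pt list \<Rightarrow> real" where
  "tev t [] = t []"
| "tev t (v # vs) = (\<Sum>\<^sub>8i. v $ i * tev (\<lambda>J. t (i # J)) vs)"

lemma comps_tev: "comps L t I = tev t (map L I)"
  by (induction I arbitrary: t) (simp_all add: comps_Nil comps_Cons)

lemma tev_cong: "(\<And>I. length I = length vs \<Longrightarrow> t I = s I) \<Longrightarrow> tev t vs = tev s vs"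
proof (induction vs arbitrary: t s)
  case (Cons v vs)
  have "tev (\<lambda>J. t (i # J)) vs = tev (\<lambda>J. s (i # J)) vs" for i
    by (rule Cons.IH) (simp add: Cons.prems)
  then show ?case by simp
qed simp

lemma tev_add: "tev (\<lambda>J. t J + s J) vs = tev t vs + tev s vs"
  by (induction vs arbitrary: t s) (simp_all add: distrib_left sum.distrib)

lemma tev_cmult: "tev (\<lambda>J. c * t J) vs = c * tev t vs"
  by (induction vs arbitrary: t) (simp_all add: sum_distrib_left mult.left_commute)

lemma tev_minus: "tev (\<lambda>J. - t J) vs = - tev t vs"
  using tev_cmult[of "-1" t vs] by simp

lemma tev_diff: "tev (\<lambda>J. t J - s J) vs = tev t vs - tev s vs"
  using tev_add[of t "\<lambda>J. - s J" vs] by (simp add: tev_minus)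

lemma tev_sum: "tev (\<lambda>J. \<Sum>a\<in>A. t a J) vs = (\<Sum>a\<in>A. tev (t a) vs)"
proof (induction vs arbitrary: t)
  case (Cons v vs)
  then show ?case by (simp add: sum_distrib_left) (rule sum.swap)
qed simp

lemma tev_zero: "(\<And>I. length I = length vs \<Longrightarrow> t I = 0) \<Longrightarrow> tev t vs = 0"
  using tev_cong[of vs t "\<lambda>I. 0"] tev_cmult[of 0 t vs] by simp

lemma tev_axis: "tev t (map (\<lambda>i. axis i 1) I) = t I"
  using comps_std[of t I] by (simp add: comps_tev)

lemma tev_comps: "tev (comps L t) vs = tev t (map (\<lambda>v. \<Sum>\<^sub>8i. v $ i *\<^sub>R L i) vs)"
proof (induction vs arbitrary: t)
  case (Cons v vs)
  have "tev (\<lambda>J. comps L t (i # J)) vs = (\<Sum>\<^sub>8j. L i $ j * tev (\<lambda>J. t (j # J)) (map (\<lambda>v. \<Sum>\<^sub>8i. v $ i *\<^sub>R L i) vs))" for i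
    by (simp add: comps_Cons tev_sum tev_cmult Cons)
  then have "tev (comps L t) (v # vs) = (\<Sum>\<^sub>8i j. v $ i * L i $ j * tev (\<lambda>J. t (j # J)) (map (\<lambda>v. \<Sum>\<^sub>8i. v $ i *\<^sub>R L i) vs))"
    by (simp add: sum_distrib_left mult.assoc)
  also have "\<dots> = (\<Sum>\<^sub>8j i. v $ i * L i $ j * tev (\<lambda>J. t (j # J)) (map (\<lambda>v. \<Sum>\<^sub>8i. v $ i *\<^sub>R L i) vs))"
    by (rule sum.swap)
  finally show ?case by (simp add: sum_distrib_right)
qed (simp add: comps_Nil)

lemma linear_tev: "linear (\<lambda>v. tev t (xs @ v # ys))"
proof (induction xs arbitrary: t)
  case Nil
  show ?case by (rule linearI) (simp_all add: distrib_right sum.distrib sum_distrib_left mult.assoc)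
next
  case (Cons x xs)
  show ?case
    by (rule linearI)
      (simp_all add: linear_add[OF Cons] linear_cmul[OF Cons] distrib_left sum.distrib sum_distrib_left mult.left_commute)
qed

lemma linear_tev_update:
  assumes "k < length vs" shows "linear (\<lambda>v. tev t (vs[k := v]))"
  using linear_tev[of t "take k vs" "drop (Suc k) vs"] assms by (simp add: upd_conv_take_nth_drop)

lemmas tev_update_add = linear_add[OF linear_tev_update]
  and tev_update_scaleR = linear_cmul[OF linear_tev_update]
  and tev_update_sum = linear_sum[OF linear_tev_update]
  and tev_update_diff = linear_diff[OF linear_tev_update]

lemma alternating_adj:
  assumes "alternating k t" "length xs + length ys + 2 = k"
  shows "t (xs @ b # a # ys) = - t (xs @ a # b # ys)"
proof -
  let ?I = "xs @ a # b # ys"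
  have "?I[length xs := b, Suc (length xs) := a] = xs @ b # a # ys" by (simp add: list_update_append)
  moreover have "?I ! length xs = a" "?I ! Suc (length xs) = b" by (simp_all add: nth_append)
  moreover have "t (?I[length xs := ?I ! Suc (length xs), Suc (length xs) := ?I ! length xs]) = - t ?I"
    by (rule alternating_swap[OF assms(1)]) (use assms(2) in auto)
  ultimately show ?thesis by (simp only:)
qed

lemma tev_adj:
  assumes "\<And>I J i j. length I = length xs \<Longrightarrow> length J = length ys \<Longrightarrow> t (I @ j # i # J) = - t (I @ i # j # J)"
  shows "tev t (xs @ b # a # ys) = - tev t (xs @ a # b # ys)"
  using assms
proof (induction xs arbitrary: t)
  case Nil
  have "tev t (b # a # ys) = (\<Sum>\<^sub>8i j. b $ i * (a $ j * tev (\<lambda>J. t (i # j # J)) ys))"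
    by (simp add: sum_distrib_left)
  also have "\<dots> = (\<Sum>\<^sub>8i j. b $ j * (a $ i * tev (\<lambda>J. t (j # i # J)) ys))"
    by (rule sum.swap)
  also have "\<dots> = (\<Sum>\<^sub>8i j. - (a $ i * (b $ j * tev (\<lambda>J. t (i # j # J)) ys)))"
  proof (intro sum.cong refl)
    fix i j
    have "tev (\<lambda>J. t (j # i # J)) ys = tev (\<lambda>J. - t (i # j # J)) ys"
    proof (rule tev_cong)
      fix J :: "8 list" assume "length J = length ys"
      then have "t ([] @ j # i # J) = - t ([] @ i # j # J)" by (intro Nil) simp_all
      then show "t (j # i # J) = - t (i # j # J)" by (simp only: append_Nil)
    qed
    then show "b $ j * (a $ i * tev (\<lambda>J. t (j # i # J)) ys) = - (a $ i * (b $ j * tev (\<lambda>J. t (i # j # J)) ys))"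
      by (simp add: tev_minus)
  qed
  finally show ?case by (simp add: sum_negf sum_distrib_left)
next
  case (Cons x xs)
  have "tev (\<lambda>J. t (i # J)) (xs @ b # a # ys) = - tev (\<lambda>J. t (i # J)) (xs @ a # b # ys)" for i
  proof (rule Cons.IH)
    fix I J :: "8 list" and k l assume "length I = length xs" "length J = length ys"
    then have "t ((i # I) @ l # k # J) = - t ((i # I) @ k # l # J)" by (intro Cons.prems) simp_all
    then show "t (i # I @ l # k # J) = - t (i # I @ k # l # J)" by (simp only: append_Cons)
  qed
  then show ?case by (simp add: sum_negf)
qed

lemma tev_alternating_adj:
  "alternating k t \<Longrightarrow> length xs + length ys + 2 = k \<Longrightarrow> tev t (xs @ b # a # ys) = - tev t (xs @ a # b # ys)"
  by (rule tev_adj) (rule alternating_adj, auto)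

lemma gdot_tev: "gdot g u v = tev g [u, v]"
  by (simp add: gdot_def sum_distrib_left mult_ac)

text \<open>The Leibniz rule, by induction over the arguments: one term for the tensor and one for
  each moving argument.\<close>

lemma has_derivative_tev:
  fixes As :: "(pt \<Rightarrow> pt) list"
  assumes "\<And>I. length I = length As \<Longrightarrow> (\<lambda>y. t y I) differentiable (at x)"
    and "\<And>A. A \<in> set As \<Longrightarrow> A differentiable (at x)"
  shows "((\<lambda>y. tev (t y) (map (\<lambda>A. A y) As)) has_derivative
      (\<lambda>v. tev (\<lambda>I. dd (\<lambda>y. t y I) x v) (map (\<lambda>A. A x) As) +
           (\<Sum>k<length As. tev (t x) ((map (\<lambda>A. A x) As)[k := dd (As ! k) x v])))) (at x)"
  using assms
proof (induction As arbitrary: t)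
  case Nil then show ?case using has_dd[of "\<lambda>y. t y []" x] by simp
next
  case (Cons A As)
  let ?M = "\<lambda>y. map (\<lambda>A. A y) As"
  have A: "((\<lambda>y. A y $ i) has_derivative (\<lambda>v. dd A x v $ i)) (at x)" for i
    by (rule bounded_linear.has_derivative[OF bounded_linear_vec_nth has_dd]) (simp add: Cons.prems(2))
  have 1: "((\<lambda>y. tev (\<lambda>J. t y (i # J)) (?M y)) has_derivative
      (\<lambda>v. tev (\<lambda>I. dd (\<lambda>y. t y (i # I)) x v) (?M x) +
           (\<Sum>k<length As. tev (\<lambda>J. t x (i # J)) ((?M x)[k := dd (As ! k) x v])))) (at x)" for i
    using Cons.IH[of "\<lambda>y J. t y (i # J)"] Cons.prems by simp
  have "((\<lambda>y. \<Sum>\<^sub>8i. A y $ i * tev (\<lambda>J. t y (i # J)) (?M y)) has_derivative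
      (\<lambda>v. \<Sum>\<^sub>8i. A x $ i * (tev (\<lambda>I. dd (\<lambda>y. t y (i # I)) x v) (?M x) +
           (\<Sum>k<length As. tev (\<lambda>J. t x (i # J)) ((?M x)[k := dd (As ! k) x v])))
         + dd A x v $ i * tev (\<lambda>J. t x (i # J)) (?M x))) (at x)"
    by (intro has_derivative_sum has_derivative_mult A 1)
  moreover have "(\<Sum>\<^sub>8i. A x $ i * (tev (\<lambda>I. dd (\<lambda>y. t y (i # I)) x v) (?M x) +
           (\<Sum>k<length As. tev (\<lambda>J. t x (i # J)) ((?M x)[k := dd (As ! k) x v])))
         + dd A x v $ i * tev (\<lambda>J. t x (i # J)) (?M x))
      = tev (\<lambda>I. dd (\<lambda>y. t y I) x v) (map (\<lambda>A. A x) (A # As)) +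
           (\<Sum>k<length (A # As). tev (t x) ((map (\<lambda>A. A x) (A # As))[k := dd ((A # As) ! k) x v]))" for v
  proof -
    have "(\<Sum>k<length As. \<Sum>\<^sub>8i. A x $ i * tev (\<lambda>J. t x (i # J)) ((?M x)[k := dd (As ! k) x v]))
      = (\<Sum>\<^sub>8i. \<Sum>k<length As. A x $ i * tev (\<lambda>J. t x (i # J)) ((?M x)[k := dd (As ! k) x v]))"
      by (rule sum.swap)
    then show ?thesis
      by (simp add: sum.lessThan_Suc_shift distrib_left sum.distrib sum_distrib_left del: sum.lessThan_Suc)
  qed
  ultimately show ?case by simp
qed

lemma differentiable_tev:
  fixes As :: "(pt \<Rightarrow> pt) list"
  assumes "\<And>I. length I = length As \<Longrightarrow> (\<lambda>y. t y I) differentiable (at x)"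
    and "\<And>A. A \<in> set As \<Longrightarrow> A differentiable (at x)"
  shows "(\<lambda>y. tev (t y) (map (\<lambda>A. A y) As)) differentiable (at x)"
  using has_derivative_tev[of As t x] assms unfolding differentiable_def by blast

lemma dd_const: "dd (\<lambda>y. c) x v = 0"
  by (rule dd_eqI) (rule has_derivative_const)

lemma dd_tev_const:
  assumes "\<And>I. length I = length vs \<Longrightarrow> (\<lambda>y. t y I) differentiable (at x)"
  shows "dd (\<lambda>y. tev (t y) vs) x v = tev (\<lambda>I. dd (\<lambda>y. t y I) x v) vs"
    and "(\<lambda>y. tev (t y) vs) differentiable (at x)"
proof -
  have *: "((\<lambda>y. tev (t y) (map (\<lambda>A. A y) (map (\<lambda>v (y::pt). v) vs))) has_derivative
      (\<lambda>v. tev (\<lambda>I. dd (\<lambda>y. t y I) x v) (map (\<lambda>A. A x) (map (\<lambda>v (y::pt). v) vs)) +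
           (\<Sum>k<length (map (\<lambda>v (y::pt). v) vs). tev (t x) ((map (\<lambda>A. A x) (map (\<lambda>v (y::pt). v) vs))[k := dd (map (\<lambda>v (y::pt). v) vs ! k) x v])))) (at x)"
  proof (rule has_derivative_tev[of "map (\<lambda>v (y::pt). v) vs" t x])
    show "(\<lambda>y. t y I) differentiable (at x)" if "length I = length (map (\<lambda>v (y::pt). v) vs)" for I
      using that assms by simp
    show "A differentiable (at x)" if "A \<in> set (map (\<lambda>v (y::pt). v) vs)" for A
      using that by auto
  qed
  have "tev (t x) (vs[k := 0]) = 0" if "k < length vs" for k
    using linear_0[OF linear_tev_update[OF that]] by simp
  then have "((\<lambda>y. tev (t y) vs) has_derivative (\<lambda>v. tev (\<lambda>I. dd (\<lambda>y. t y I) x v) vs)) (at x)"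
    using * by (simp add: o_def dd_const)
  then show "dd (\<lambda>y. tev (t y) vs) x v = tev (\<lambda>I. dd (\<lambda>y. t y I) x v) vs"
    "(\<lambda>y. tev (t y) vs) differentiable (at x)"
    using dd_eqI differentiable_def by blast+
qed

lemma dd_tev:
  fixes As :: "(pt \<Rightarrow> pt) list"
  assumes "\<And>I. length I = length As \<Longrightarrow> (\<lambda>y. t y I) differentiable (at x)"
    and "\<And>A. A \<in> set As \<Longrightarrow> A differentiable (at x)"
  shows "dd (\<lambda>y. tev (t y) (map (\<lambda>A. A y) As)) x v =
      dd (\<lambda>y. tev (t y) (map (\<lambda>A. A x) As)) x v +
      (\<Sum>k<length As. tev (t x) ((map (\<lambda>A. A x) As)[k := dd (As ! k) x v]))"
  using dd_eqI[OF has_derivative_tev[of As t x]] dd_tev_const(1)[of "map (\<lambda>A. A x) As" t x v] assms by simp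

lemma smooth_on_tev:
  assumes "open S" "\<And>I. length I = length As \<Longrightarrow> smooth_on S (\<lambda>y. t y I)"
    and "\<And>A. A \<in> set As \<Longrightarrow> smooth_on S A"
  shows "smooth_on S (\<lambda>y. tev (t y) (map (\<lambda>A. A y) As))"
  using assms(2,3)
proof (induction As arbitrary: t)
  case (Cons A As)
  have "smooth_on S (\<lambda>y. tev (\<lambda>J. t y (i # J)) (map (\<lambda>A. A y) As))" for i
    using Cons.IH[of "\<lambda>y J. t y (i # J)"] Cons.prems by simp
  then show ?case
    using Cons.prems(2) by (auto intro!: smooth_on_sum smooth_on_mult smooth_on_nth assms(1))
qed simp

lemma smooth_on_tev_const:
  assumes "open S" "\<And>I. length I = length vs \<Longrightarrow> smooth_on S (\<lambda>y. t y I)"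
  shows "smooth_on S (\<lambda>y. tev (t y) vs)"
proof -
  have "smooth_on S A" if "A \<in> set (map (\<lambda>v y. v) vs)" for A
    using that by (auto simp: smooth_on_const)
  then show ?thesis using smooth_on_tev[OF assms(1), of "map (\<lambda>v y. v) vs" t] assms(2) by (simp add: o_def)
qed

lemma tev_extract:
  assumes "j < length vs"
  shows "tev (\<lambda>I. F (I ! j) (take j I @ drop (Suc j) I)) vs
    = (\<Sum>\<^sub>8i. vs ! j $ i * tev (F i) (take j vs @ drop (Suc j) vs))"
  using assms
proof (induction j arbitrary: vs F)
  case 0 then show ?case by (cases vs) auto
next
  case (Suc j)
  then obtain v ws where vs: "vs = v # ws" "j < length ws" by (cases vs) auto
  have "tev (\<lambda>I. F (I ! Suc j) (take (Suc j) I @ drop (Suc (Suc j)) I)) vs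
    = (\<Sum>\<^sub>8k i. v $ k * (ws ! j $ i * tev (\<lambda>M. F i (k # M)) (take j ws @ drop (Suc j) ws)))"
    using Suc.IH[OF vs(2), of "\<lambda>i M. F i (k # M)" for k] by (simp add: vs(1) sum_distrib_left)
  also have "\<dots> = (\<Sum>\<^sub>8i k. v $ k * (ws ! j $ i * tev (\<lambda>M. F i (k # M)) (take j ws @ drop (Suc j) ws)))"
    by (rule sum.swap)
  finally show ?case by (simp add: vs(1) sum_distrib_left mult_ac)
qed

text \<open>The invariant formula for the exterior derivative on constant vector fields, whose
  brackets vanish. Multilinearity in the index taken out, \<open>tev_extract\<close>, passes from
  coordinate vectors to arbitrary ones.\<close>

lemma tev_ext_d:
  assumes "\<And>I. Suc (length I) = length vs \<Longrightarrow> (\<lambda>y. \<omega> y I) differentiable (at x)"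
  shows "tev (ext_d \<omega> x) vs =
    (\<Sum>j<length vs. (-1) ^ j * dd (\<lambda>y. tev (\<omega> y) (take j vs @ drop (Suc j) vs)) x (vs ! j))"
proof -
  have "tev (ext_d \<omega> x) vs
      = tev (\<lambda>I. \<Sum>j<length vs. (-1) ^ j * pdiff (I ! j) (\<lambda>y. \<omega> y (take j I @ drop (Suc j) I)) x) vs"
    by (rule tev_cong) (simp add: ext_d_def)
  also have "\<dots> = (\<Sum>j<length vs. (-1) ^ j * tev (\<lambda>I. pdiff (I ! j) (\<lambda>y. \<omega> y (take j I @ drop (Suc j) I)) x) vs)"
    by (simp add: tev_sum tev_cmult)
  also have "\<dots> = (\<Sum>j<length vs. (-1) ^ j * dd (\<lambda>y. tev (\<omega> y) (take j vs @ drop (Suc j) vs)) x (vs ! j))"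
  proof (intro sum.cong refl arg_cong2[where f = "(*)"])
    fix j assume "j \<in> {..<length vs}"
    then have j: "j < length vs" by simp
    let ?vs = "take j vs @ drop (Suc j) vs"
    have d: "(\<lambda>y. \<omega> y I) differentiable (at x)" if "length I = length ?vs" for I
      using assms that j by simp
    have "tev (\<lambda>I. pdiff (I ! j) (\<lambda>y. \<omega> y (take j I @ drop (Suc j) I)) x) vs
        = (\<Sum>\<^sub>8i. vs ! j $ i * tev (\<lambda>I. pdiff i (\<lambda>y. \<omega> y I) x) ?vs)"
      by (rule tev_extract[OF j])
    also have "\<dots> = tev (\<lambda>I. \<Sum>\<^sub>8i. vs ! j $ i * pdiff i (\<lambda>y. \<omega> y I) x) ?vs"
      by (simp add: tev_sum tev_cmult)
    also have "\<dots> = tev (\<lambda>I. dd (\<lambda>y. \<omega> y I) x (vs ! j)) ?vs"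
      by (rule tev_cong) (simp add: dd_pdiff[OF d])
    also have "\<dots> = dd (\<lambda>y. tev (\<omega> y) ?vs) x (vs ! j)"
      by (rule dd_tev_const(1)[OF d, symmetric])
    finally show "tev (\<lambda>I. pdiff (I ! j) (\<lambda>y. \<omega> y (take j I @ drop (Suc j) I)) x) vs
        = dd (\<lambda>y. tev (\<omega> y) ?vs) x (vs ! j)" .
  qed
  finally show ?thesis .
qed

subsection \<open>Connections in a chart\<close>

definition Gam :: "christoffel \<Rightarrow> pt \<Rightarrow> pt \<Rightarrow> pt \<Rightarrow> pt" where
  "Gam G x u v = (\<Sum>\<^sub>8i j. (u $ i * v $ j) *\<^sub>R G x i j)"

definition Tor :: "christoffel \<Rightarrow> pt \<Rightarrow> pt \<Rightarrow> pt \<Rightarrow> pt" where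
  "Tor G x u v = Gam G x u v - Gam G x v u"

text \<open>The curvature on constant vector fields, where the bracket term vanishes; see
  \<open>curv_const\<close>.\<close>

definition Rm :: "christoffel \<Rightarrow> pt \<Rightarrow> pt \<Rightarrow> pt \<Rightarrow> pt \<Rightarrow> pt" where
  "Rm G x u v w = dd (\<lambda>y. Gam G y v w) x u - dd (\<lambda>y. Gam G y u w) x v
     + Gam G x u (Gam G x v w) - Gam G x v (Gam G x u w)"

lemma linear_Gam: "linear (\<lambda>u. Gam G x u v)" "linear (\<lambda>v. Gam G x u v)"
  unfolding Gam_def
  by (rule linearI; simp add: algebra_simps sum.distrib scaleR_sum_right)+

lemmas Gam_bilinear =
  linear_add[OF linear_Gam(1)] linear_add[OF linear_Gam(2)] linear_cmul[OF linear_Gam(1)] linear_cmul[OF linear_Gam(2)]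
  linear_diff[OF linear_Gam(1)] linear_diff[OF linear_Gam(2)] linear_neg[OF linear_Gam(1)] linear_neg[OF linear_Gam(2)]
  linear_0[OF linear_Gam(1)] linear_0[OF linear_Gam(2)]

lemma linear_Tor: "linear (\<lambda>u. Tor G x u v)" "linear (\<lambda>v. Tor G x u v)"
  unfolding Tor_def by (intro linear_compose_sub linear_Gam)+

lemma Gam_axis: "Gam G x (axis i 1) (axis j 1) = G x i j"
proof -
  have "(axis i (1::real) $ k * axis j 1 $ l) *\<^sub>R G x k l = (if l = j then if k = i then G x i j else 0 else 0)" for k l
    by (simp add: axis_def)
  then show ?thesis by (simp add: Gam_def)
qed

lemma smooth_on_Gam:
  assumes "open S" "\<And>i j. smooth_on S (\<lambda>x. G x i j)" "smooth_on S u" "smooth_on S v"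
  shows "smooth_on S (\<lambda>x. Gam G x (u x) (v x))"
  unfolding Gam_def
  by (intro smooth_on_sum smooth_on_scaleR smooth_on_mult smooth_on_nth assms)

lemma cov_Gam: "cov G X Y x = dd Y x (X x) + Gam G x (X x) (Y x)"
  by (simp add: cov_def Gam_def)

lemma cov_const: "cov G (\<lambda>x. u) (\<lambda>x. v) = (\<lambda>x. Gam G x u v)"
  by (simp add: cov_Gam fun_eq_iff dd_const)

lemma lie_bracket_const: "lie_bracket (\<lambda>x. u) (\<lambda>x. v) = (\<lambda>x. 0)"
  by (simp add: lie_bracket_def fun_eq_iff dd_const)

lemma curv_const: "curv G (\<lambda>x. u) (\<lambda>x. v) (\<lambda>x. w) x = Rm G x u v w"
  unfolding curv_def cov_const lie_bracket_const
  by (simp add: cov_Gam Rm_def dd_const Gam_bilinear)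

lemma linear_gdot: "linear (\<lambda>u. gdot g u v)" "linear (\<lambda>v. gdot g u v)"
  using linear_tev[of g "[]" "[v]"] linear_tev[of g "[u]" "[]"] by (simp_all add: gdot_tev)

lemma tev_trilinear:
  assumes "\<And>i j k. t [i, j, k] = B (axis i 1) (axis j 1) (axis k 1)"
    and "\<And>v w. linear (\<lambda>u. B u v w)" "\<And>u w. linear (\<lambda>v. B u v w)" "\<And>u v. linear (\<lambda>w. B u v w)"
  shows "tev t [u, v, w] = B u v w"
proof -
  have "B u v w = (\<Sum>\<^sub>8i. u $ i * B (axis i 1) v w)"
    using linear_pt_expand[OF assms(2)[of v w], of u] by simp
  moreover have "B (axis i 1) v w = (\<Sum>\<^sub>8j. v $ j * B (axis i 1) (axis j 1) w)" for i
    using linear_pt_expand[OF assms(3)[of "axis i 1" w], of v] by simp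
  moreover have "B (axis i 1) (axis j 1) w = (\<Sum>\<^sub>8k. w $ k * B (axis i 1) (axis j 1) (axis k 1))" for i j
    using linear_pt_expand[OF assms(4)[of "axis i 1" "axis j 1"], of w] by simp
  ultimately show ?thesis by (simp add: assms(1))
qed

lemma tev_quadrilinear:
  assumes "\<And>i j k l. t [i, j, k, l] = B (axis i 1) (axis j 1) (axis k 1) (axis l 1)"
    and "\<And>v w z. linear (\<lambda>u. B u v w z)" "\<And>u w z. linear (\<lambda>v. B u v w z)"
      "\<And>u v z. linear (\<lambda>w. B u v w z)" "\<And>u v w. linear (\<lambda>z. B u v w z)"
  shows "tev t [u, v, w, z] = B u v w z"
proof -
  have "B u v w z = (\<Sum>\<^sub>8i. u $ i * B (axis i 1) v w z)"
    using linear_pt_expand[OF assms(2)[of v w z], of u] by simp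
  moreover have "B (axis i 1) v w z = tev (\<lambda>J. t (i # J)) [v, w, z]" for i
    by (rule tev_trilinear[symmetric]) (rule assms)+
  ultimately show ?thesis by simp
qed

lemma tev_torsion: "tev (torsion g \<Gamma> c x) [u, v, w] = gdot (g c x) (Tor (\<Gamma> c) x u v) w"
proof (rule tev_trilinear)
  show "torsion g \<Gamma> c x [i, j, k] = gdot (g c x) (Tor (\<Gamma> c) x (axis i 1) (axis j 1)) (axis k 1)" for i j k
    by (simp add: torsion_def coord_def cov_const lie_bracket_const Tor_def)
qed (rule linear_compose[OF linear_Tor(1) linear_gdot(1), unfolded o_def]
  linear_compose[OF linear_Tor(2) linear_gdot(1), unfolded o_def] linear_gdot(2))+

locale chart_connection =
  fixes U :: "pt set" and c :: "'a chart" and \<Gamma> :: "'a chart \<Rightarrow> christoffel"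
  assumes open_U: "open U" and smooth_\<Gamma>: "\<And>i j. smooth_on U (\<lambda>x. \<Gamma> c x i j)"
begin

abbreviation "gam \<equiv> Gam (\<Gamma> c)"
abbreviation "tor \<equiv> Tor (\<Gamma> c)"
abbreviation "rm \<equiv> Rm (\<Gamma> c)"

lemma smooth_gam: "smooth_on U (\<lambda>x. gam x u v)"
  by (rule smooth_on_Gam[OF open_U smooth_\<Gamma> smooth_on_const smooth_on_const])

lemma differentiable_gam: "x \<in> U \<Longrightarrow> (\<lambda>y. gam y u v) differentiable (at x)"
  by (rule smooth_on_imp_differentiable[OF smooth_gam])

lemma dd_gam_linear:
  assumes "x \<in> U"
  shows "linear (\<lambda>v. dd (\<lambda>y. gam y v w) x u)" "linear (\<lambda>w. dd (\<lambda>y. gam y v w) x u)"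
proof -
  have d: "((\<lambda>y. gam y v w) has_derivative dd (\<lambda>y. gam y v w) x) (at x)" for v w
    by (rule has_dd[OF differentiable_gam[OF assms]])
  show "linear (\<lambda>v. dd (\<lambda>y. gam y v w) x u)"
  proof (rule linearI)
    show "dd (\<lambda>y. gam y (a + b) w) x u = dd (\<lambda>y. gam y a w) x u + dd (\<lambda>y. gam y b w) x u" for a b
      unfolding Gam_bilinear by (rule dd_eqI) (intro has_derivative_add d)
    show "dd (\<lambda>y. gam y (r *\<^sub>R a) w) x u = r *\<^sub>R dd (\<lambda>y. gam y a w) x u" for r a
      unfolding Gam_bilinear by (rule dd_eqI) (intro has_derivative_scaleR_right d)
  qed
  show "linear (\<lambda>w. dd (\<lambda>y. gam y v w) x u)"
  proof (rule linearI)
    show "dd (\<lambda>y. gam y v (a + b)) x u = dd (\<lambda>y. gam y v a) x u + dd (\<lambda>y. gam y v b) x u" for a b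
      unfolding Gam_bilinear by (rule dd_eqI) (intro has_derivative_add d)
    show "dd (\<lambda>y. gam y v (r *\<^sub>R a)) x u = r *\<^sub>R dd (\<lambda>y. gam y v a) x u" for r a
      unfolding Gam_bilinear by (rule dd_eqI) (intro has_derivative_scaleR_right d)
  qed
qed

lemma linear_rm:
  assumes "x \<in> U"
  shows "linear (\<lambda>u. rm x u v w)" "linear (\<lambda>v. rm x u v w)" "linear (\<lambda>w. rm x u v w)"
proof -
  have o: "linear f \<Longrightarrow> linear g \<Longrightarrow> linear (\<lambda>x. g (f x))" for f g :: "pt \<Rightarrow> pt"
    using linear_compose[of f g] by (simp add: o_def)
  note l = linear_compose_add linear_compose_sub dd_gam_linear[OF assms] linear_dd[OF differentiable_gam[OF assms]]
    linear_Gam o[OF linear_Gam(1) linear_Gam(2)] o[OF linear_Gam(2) linear_Gam(2)]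
  show "linear (\<lambda>u. rm x u v w)" "linear (\<lambda>v. rm x u v w)" "linear (\<lambda>w. rm x u v w)"
    unfolding Rm_def by (intro l)+
qed

lemma tev_curvature:
  assumes "x \<in> U"
  shows "tev (curvature g \<Gamma> c x) [u, v, w, z] = gdot (g c x) (rm x u v w) z"
proof (rule tev_quadrilinear)
  show "curvature g \<Gamma> c x [i, j, k, l] = gdot (g c x) (rm x (axis i 1) (axis j 1) (axis k 1)) (axis l 1)" for i j k l
    by (simp add: curvature_def coord_def curv_const)
qed (rule linear_compose[OF linear_rm(1)[OF assms] linear_gdot(1), unfolded o_def]
  linear_compose[OF linear_rm(2)[OF assms] linear_gdot(1), unfolded o_def]
  linear_compose[OF linear_rm(3)[OF assms] linear_gdot(1), unfolded o_def] linear_gdot(2))+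

end

lemma tev_subst:
  assumes "k < length vs"
  shows "tev (\<lambda>J. \<Sum>\<^sub>8l. M (J ! k) $ l * t (J[k := l])) vs = tev t (vs[k := \<Sum>\<^sub>8i. vs ! k $ i *\<^sub>R M i])"
  using assms
proof (induction k arbitrary: vs t)
  case 0
  then obtain v ws where vs: "vs = v # ws" by (cases vs) auto
  show ?case
    by (simp add: vs tev_sum tev_cmult sum_distrib_left sum_distrib_right mult.assoc)
next
  case (Suc k)
  then obtain v ws where vs: "vs = v # ws" "k < length ws" by (cases vs) auto
  show ?case using Suc.IH[OF vs(2), of "\<lambda>J. t (i # J)" for i] by (simp add: vs(1))
qed

lemma dd_sum:
  fixes f :: "'i \<Rightarrow> pt \<Rightarrow> 'b::real_normed_vector"
  assumes "\<And>i. i \<in> I \<Longrightarrow> f i differentiable (at x)"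
  shows "dd (\<lambda>y. \<Sum>i\<in>I. f i y) x v = (\<Sum>i\<in>I. dd (f i) x v)"
  by (rule dd_eqI) (intro has_derivative_sum has_dd assms)

lemma dd_add_fun:
  "f differentiable (at x) \<Longrightarrow> g differentiable (at x) \<Longrightarrow> dd (\<lambda>y. f y + g y) x v = dd f x v + dd g x v"
  by (rule dd_eqI) (intro has_derivative_add has_dd)

lemma dd_diff_fun:
  "f differentiable (at x) \<Longrightarrow> g differentiable (at x) \<Longrightarrow> dd (\<lambda>y. f y - g y) x v = dd f x v - dd g x v"
  by (rule dd_eqI) (intro has_derivative_diff has_dd)

lemma dd_cmult_fun:
  fixes f :: "pt \<Rightarrow> real"
  shows "f differentiable (at x) \<Longrightarrow> dd (\<lambda>y. r * f y) x v = r * dd f x v"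
  by (rule dd_eqI) (intro has_derivative_mult_right has_dd)

lemma dd_tev_slot:
  assumes t: "\<And>I. length I = length vs \<Longrightarrow> (\<lambda>y. t y I) differentiable (at x)"
    and A: "A differentiable (at x)" and k: "k < length vs"
  shows "dd (\<lambda>y. tev (t y) (vs[k := A y])) x v = dd (\<lambda>y. tev (t y) (vs[k := A x])) x v + tev (t x) (vs[k := dd A x v])"
    and "(\<lambda>y. tev (t y) (vs[k := A y])) differentiable (at x)"
proof -
  define As where "As = (map (\<lambda>v y. v) vs)[k := A]"
  have m: "map (\<lambda>A. A y) As = vs[k := A y]" for y
    by (simp add: As_def map_update o_def)
  have diff: "B differentiable (at x)" if "B \<in> set As" for B
    using that A set_update_subset_insert[of "map (\<lambda>v y. v) vs" k A] by (auto simp: As_def)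
  have len: "length As = length vs" by (simp add: As_def)
  have "tev (t x) ((vs[k := A x])[j := dd (As ! j) x v]) = (if j = k then tev (t x) (vs[k := dd A x v]) else 0)"
    if "j < length vs" for j
  proof (cases "j = k")
    case False
    then have "dd (As ! j) x v = 0" using that by (simp add: As_def dd_const)
    then show ?thesis using False linear_0[OF linear_tev_update, of j "vs[k := A x]" "t x"] that by simp
  qed (use that in \<open>simp add: As_def\<close>)
  then have "(\<Sum>j<length As. tev (t x) ((map (\<lambda>A. A x) As)[j := dd (As ! j) x v])) = tev (t x) (vs[k := dd A x v])"
    using k by (simp add: m len)
  then show "dd (\<lambda>y. tev (t y) (vs[k := A y])) x v = dd (\<lambda>y. tev (t y) (vs[k := A x])) x v + tev (t x) (vs[k := dd A x v])"
    using dd_tev[of As t x v] t diff by (simp add: m len)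
  show "(\<lambda>y. tev (t y) (vs[k := A y])) differentiable (at x)"
    using differentiable_tev[of As t x] t diff by (simp add: m len)
qed

context chart_connection
begin

text \<open>The coordinate definition of \<open>nabla\<close>, extended to arbitrary constant
  vectors by multilinearity.\<close>

lemma tev_nabla:
  assumes "\<And>I. length I = length vs \<Longrightarrow> (\<lambda>y. t c y I) differentiable (at x)"
  shows "tev (nabla \<Gamma> t c x) (u # vs) =
    dd (\<lambda>y. tev (t c y) vs) x u - (\<Sum>k<length vs. tev (t c x) (vs[k := gam x u (vs ! k)]))"
proof -
  have 1: "tev (\<lambda>J. nabla \<Gamma> t c x (m # J)) vs = tev (\<lambda>J. pdiff m (\<lambda>y. t c y J) x) vs
      - (\<Sum>k<length vs. tev (t c x) (vs[k := \<Sum>\<^sub>8i. vs ! k $ i *\<^sub>R \<Gamma> c x m i]))" for m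
  proof -
    have "tev (\<lambda>J. nabla \<Gamma> t c x (m # J)) vs = tev (\<lambda>J. pdiff m (\<lambda>y. t c y J) x -
       (\<Sum>k<length vs. \<Sum>\<^sub>8l. \<Gamma> c x m (J ! k) $ l * t c x (J[k := l]))) vs"
      by (rule tev_cong) (simp add: nabla_def)
    also have "\<dots> = tev (\<lambda>J. pdiff m (\<lambda>y. t c y J) x) vs
      - (\<Sum>k<length vs. tev (\<lambda>J. \<Sum>\<^sub>8l. \<Gamma> c x m (J ! k) $ l * t c x (J[k := l])) vs)"
      by (simp only: tev_diff tev_sum[where A = "{..<length vs}"])
    finally show ?thesis by (simp add: tev_subst)
  qed
  have 2: "(\<Sum>\<^sub>8m. u $ m * tev (\<lambda>J. pdiff m (\<lambda>y. t c y J) x) vs) = dd (\<lambda>y. tev (t c y) vs) x u"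
  proof -
    have "(\<Sum>\<^sub>8m. u $ m * tev (\<lambda>J. pdiff m (\<lambda>y. t c y J) x) vs) = tev (\<lambda>J. \<Sum>\<^sub>8m. u $ m * pdiff m (\<lambda>y. t c y J) x) vs"
      by (simp add: tev_sum tev_cmult)
    also have "\<dots> = tev (\<lambda>J. dd (\<lambda>y. t c y J) x u) vs"
      by (rule tev_cong) (simp add: dd_pdiff assms)
    finally show ?thesis using dd_tev_const(1)[of vs "t c" x u] assms by simp
  qed
  have 3: "(\<Sum>\<^sub>8m. u $ m * (\<Sum>k<length vs. tev (t c x) (vs[k := \<Sum>\<^sub>8i. vs ! k $ i *\<^sub>R \<Gamma> c x m i])))
      = (\<Sum>k<length vs. tev (t c x) (vs[k := gam x u (vs ! k)]))"
  proof -
    have "(\<Sum>\<^sub>8m. u $ m * tev (t c x) (vs[k := \<Sum>\<^sub>8i. vs ! k $ i *\<^sub>R \<Gamma> c x m i]))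
        = tev (t c x) (vs[k := gam x u (vs ! k)])" if "k < length vs" for k
    proof -
      have "gam x u (vs ! k) = (\<Sum>\<^sub>8m. u $ m *\<^sub>R (\<Sum>\<^sub>8i. vs ! k $ i *\<^sub>R \<Gamma> c x m i))"
        by (simp add: Gam_def scaleR_sum_right)
      then show ?thesis by (simp add: tev_update_sum[OF that] tev_update_scaleR[OF that])
    qed
    moreover have "(\<Sum>\<^sub>8m. u $ m * (\<Sum>k<length vs. tev (t c x) (vs[k := \<Sum>\<^sub>8i. vs ! k $ i *\<^sub>R \<Gamma> c x m i])))
        = (\<Sum>k<length vs. \<Sum>\<^sub>8m. u $ m * tev (t c x) (vs[k := \<Sum>\<^sub>8i. vs ! k $ i *\<^sub>R \<Gamma> c x m i]))"
      unfolding sum_distrib_left by (rule sum.swap)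
    ultimately show ?thesis by simp
  qed
  show ?thesis
    by (simp add: 1 right_diff_distrib sum_subtractf 2 3)
qed

lemma smooth_on_nabla:
  assumes "\<And>I. length I = k \<Longrightarrow> smooth_on U (\<lambda>y. t c y I)" "length I = Suc k"
  shows "smooth_on U (\<lambda>y. nabla \<Gamma> t c y I)"
  unfolding nabla_def Let_def
  by (intro smooth_on_diff smooth_on_sum smooth_on_mult smooth_on_nth smooth_on_pdiff open_U smooth_\<Gamma> assms(1))
    (use assms(2) in auto)

lemma parallel_dd:
  assumes "\<And>I. length I = length vs \<Longrightarrow> (\<lambda>y. t c y I) differentiable (at x)"
    and "\<And>I. length I = Suc (length vs) \<Longrightarrow> nabla \<Gamma> t c x I = 0"
  shows "dd (\<lambda>y. tev (t c y) vs) x u = (\<Sum>k<length vs. tev (t c x) (vs[k := gam x u (vs ! k)]))"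
  using tev_nabla[where t = t and vs = vs and x = x and u = u] tev_zero[of "u # vs" "nabla \<Gamma> t c x"] assms by simp

text \<open>These are the terms of a second derivative in which the two connection terms hit
  different slots. Their symmetry makes them cancel in a commutator.\<close>

lemma sum_off_diagonal_swap:
  fixes vs :: "pt list"
  shows "(\<Sum>k<length vs. \<Sum>j\<in>{..<length vs} - {k}. tev s (vs[k := a k, j := b j]))
    = (\<Sum>k<length vs. \<Sum>j\<in>{..<length vs} - {k}. tev s (vs[k := b k, j := a j]))"
proof -
  let ?n = "length vs"
  have "(\<Sum>k<?n. \<Sum>j\<in>{..<?n} - {k}. tev s (vs[k := a k, j := b j]))
      = (\<Sum>k<?n. \<Sum>j<?n. if j = k then 0 else tev s (vs[k := a k, j := b j]))"
    by (intro sum.cong refl sum.mono_neutral_cong_left) auto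
  also have "\<dots> = (\<Sum>j<?n. \<Sum>k<?n. if j = k then 0 else tev s (vs[k := a k, j := b j]))"
    by (rule sum.swap)
  also have "\<dots> = (\<Sum>k<?n. \<Sum>j<?n. if j = k then 0 else tev s (vs[k := b k, j := a j]))"
    by (intro sum.cong refl) (auto simp: list_update_swap)
  also have "\<dots> = (\<Sum>k<?n. \<Sum>j\<in>{..<?n} - {k}. tev s (vs[k := b k, j := a j]))"
    by (intro sum.cong refl sum.mono_neutral_cong_right) auto
  finally show ?thesis .
qed

text \<open>The curvature annihilates a parallel tensor: differentiate its parallelism once more.\<close>

lemma curvature_parallel:
  assumes t: "\<And>I. length I = length vs \<Longrightarrow> smooth_on U (\<lambda>y. t c y I)"
    and par: "\<And>y I. y \<in> U \<Longrightarrow> length I = Suc (length vs) \<Longrightarrow> nabla \<Gamma> t c y I = 0"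
    and x: "x \<in> U"
  shows "(\<Sum>k<length vs. tev (t c x) (vs[k := rm x w u (vs ! k)])) = 0"
proof -
  let ?n = "length vs"
  let ?t = "\<lambda>ws. tev (t c x) ws"
  have d: "(\<lambda>y. t c y I) differentiable (at y)" if "length I = ?n" "y \<in> U" for I y
    using smooth_on_imp_differentiable[OF t] that by blast
  have second: "dd (\<lambda>y. dd (\<lambda>z. tev (t c z) vs) y u) x w
      = (\<Sum>k<?n. ?t (vs[k := gam x w (gam x u (vs ! k))]))
      + (\<Sum>k<?n. \<Sum>j\<in>{..<?n} - {k}. ?t (vs[k := gam x u (vs ! k), j := gam x w (vs ! j)]))
      + (\<Sum>k<?n. ?t (vs[k := dd (\<lambda>y. gam y u (vs ! k)) x w]))" for u w
  proof -
    have "dd (\<lambda>y. dd (\<lambda>z. tev (t c z) vs) y u) x w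
        = dd (\<lambda>y. \<Sum>k<?n. tev (t c y) (vs[k := gam y u (vs ! k)])) x w"
      by (rule arg_cong[OF dd_cong_open[OF open_U x], THEN fun_cong, where f1 = "\<lambda>F. F"]) (simp add: parallel_dd d par)
    also have "\<dots> = (\<Sum>k<?n. dd (\<lambda>y. tev (t c y) (vs[k := gam y u (vs ! k)])) x w)"
      by (rule dd_sum) (auto intro!: dd_tev_slot d x differentiable_gam)
    also have "\<dots> = (\<Sum>k<?n. (\<Sum>j<?n. ?t (vs[k := gam x u (vs ! k), j := gam x w (vs[k := gam x u (vs ! k)] ! j)]))
        + ?t (vs[k := dd (\<lambda>y. gam y u (vs ! k)) x w]))"
    proof (intro sum.cong refl)
      fix k assume k: "k \<in> {..<?n}"
      have "dd (\<lambda>y. tev (t c y) (vs[k := gam x u (vs ! k)])) x w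
        = (\<Sum>j<?n. ?t (vs[k := gam x u (vs ! k), j := gam x w (vs[k := gam x u (vs ! k)] ! j)]))"
        using parallel_dd[of "vs[k := gam x u (vs ! k)]" t x w] d x par by simp
      then show "dd (\<lambda>y. tev (t c y) (vs[k := gam y u (vs ! k)])) x w
        = (\<Sum>j<?n. ?t (vs[k := gam x u (vs ! k), j := gam x w (vs[k := gam x u (vs ! k)] ! j)]))
        + ?t (vs[k := dd (\<lambda>y. gam y u (vs ! k)) x w])"
        using dd_tev_slot(1)[of vs "t c" x "\<lambda>y. gam y u (vs ! k)" k w] d x differentiable_gam k by simp
    qed
    also have "\<dots> = (\<Sum>k<?n. ?t (vs[k := gam x w (gam x u (vs ! k))])
      + (\<Sum>j\<in>{..<?n} - {k}. ?t (vs[k := gam x u (vs ! k), j := gam x w (vs ! j)]))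
      + ?t (vs[k := dd (\<lambda>y. gam y u (vs ! k)) x w]))"
      by (intro sum.cong refl arg_cong2[where f = "(+)"]) (subst sum.remove[where A = "{..<?n}"], auto intro!: sum.cong)
    finally show ?thesis by (simp add: sum.distrib)
  qed
  \<comment> \<open>Equality of mixed derivatives: the cross terms cancel, and what is left in each
    slot is \<open>rm\<close>.\<close>
  have "dd (\<lambda>y. dd (\<lambda>z. tev (t c z) vs) y u) x w = dd (\<lambda>y. dd (\<lambda>z. tev (t c z) vs) y w) x u"
    by (rule smooth_dd_dd_commute[OF open_U x]) (rule smooth_on_tev_const[OF open_U t])
  then have "(\<Sum>k<?n. ?t (vs[k := gam x w (gam x u (vs ! k))])) + (\<Sum>k<?n. ?t (vs[k := dd (\<lambda>y. gam y u (vs ! k)) x w]))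
      - (\<Sum>k<?n. ?t (vs[k := gam x u (gam x w (vs ! k))])) - (\<Sum>k<?n. ?t (vs[k := dd (\<lambda>y. gam y w (vs ! k)) x u])) = 0"
    using second[of u w] second[of w u] sum_off_diagonal_swap[where vs = vs and s = "t c x" and a = "\<lambda>k. gam x u (vs ! k)" and b = "\<lambda>j. gam x w (vs ! j)"]
    by simp
  moreover have "?t (vs[k := rm x w u (vs ! k)]) = ?t (vs[k := gam x w (gam x u (vs ! k))])
      + ?t (vs[k := dd (\<lambda>y. gam y u (vs ! k)) x w])
      - ?t (vs[k := gam x u (gam x w (vs ! k))]) - ?t (vs[k := dd (\<lambda>y. gam y w (vs ! k)) x u])" if "k < ?n" for k
    unfolding Rm_def by (simp add: tev_update_diff[OF that] tev_update_add[OF that])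
  ultimately show ?thesis by (simp add: sum.distrib sum_subtractf)
qed

end

section \<open>Orthonormal expansions and quadratic identities of the model form\<close>

lemma orthonormal_expand:
  assumes "orthonormal_frame g E"
  shows "v = (\<Sum>\<^sub>8b. gdot g v (E b) *\<^sub>R E b)"
proof -
  define M :: "real^8^8" where "M = (\<chi> a i. E a $ i)"
  define G :: "real^8^8" where "G = (\<chi> j k. g [j, k])"
  have "M ** (G ** transpose M) = mat 1"
    using orthonormal_frame_matrix[OF assms] by (simp add: M_def G_def matrix_mul_assoc)
  \<comment> \<open>A right inverse of a square matrix is a left inverse; the transpose of the
    resulting identity is the expansion, written in coordinates.\<close>
  then have "G ** transpose M ** M = mat 1" using matrix_left_right_inverse by blast
  then have "transpose (G ** transpose M ** M) = mat 1" by (simp add: transpose_mat)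
  then have 1: "(\<Sum>\<^sub>8j. (G ** transpose M ** M) $ j $ i * v $ j) = v $ i" for i
    by (simp add: transpose_def vec_eq_iff mat_def if_distrib[where f = "\<lambda>z. z * _"] cong: if_cong) 
  show ?thesis
  proof (simp add: vec_eq_iff, intro allI)
    fix i
    have "v $ i = (\<Sum>\<^sub>8j b k. g [j, k] * E b $ k * E b $ i * v $ j)"
      using 1[of i] by (simp add: matrix_matrix_mult_def M_def G_def transpose_def sum_distrib_right)
    also have "\<dots> = (\<Sum>\<^sub>8b j k. g [j, k] * E b $ k * E b $ i * v $ j)"
      by (rule sum.swap)
    finally show "v $ i = (\<Sum>\<^sub>8b. gdot g v (E b) * E b $ i)"
      by (simp add: gdot_def sum_distrib_left sum_distrib_right mult_ac)
  qed
qed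

abbreviation delta :: "8 \<Rightarrow> 8 \<Rightarrow> real" where "delta i j \<equiv> if i = j then 1 else 0"

text \<open>\<open>pcontr_pcontr\<close> for the elementary 2-form \<open>\<alpha>\<close> of the
  indices \<open>i\<close> and \<open>s\<close>, whose \<open>pcontr\<close> is
  \<open>2 * psi i s\<close>.\<close>

lemma psi_psi:
  "(\<Sum>\<^sub>8k l. psi i s k l * psi k l m j)
    = 6 * (delta i m * delta s j - delta i j * delta s m) - 4 * psi i s m j"
proof -
  define \<alpha> where "\<alpha> a b = delta i a * delta s b - delta i b * delta s a" for a b
  have \<alpha>: "skew2 \<alpha>" by (simp add: skew2_def \<alpha>_def)
  have p: "pcontr \<alpha> k l = 2 * psi i s k l" for k l
  proof -
    have "\<alpha> a b * psi a b k l = (if a = i then if b = s then psi i s k l else 0 else 0)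
        - (if a = s then if b = i then psi s i k l else 0 else 0)" for a b
      by (auto simp: \<alpha>_def)
    moreover have "(\<Sum>\<^sub>8b. if a = i then if b = s then psi i s k l else 0 else 0) = (if a = i then psi i s k l else 0)"
      "(\<Sum>\<^sub>8b. if a = s then if b = i then psi s i k l else 0 else 0) = (if a = s then psi s i k l else 0)" for a
      by (auto)
    ultimately have "pcontr \<alpha> k l = psi i s k l - psi s i k l"
      unfolding pcontr_def by (simp add: sum_subtractf)
    then show ?thesis using psi_swap(1)[of s i k l] by simp
  qed
  have "2 * (\<Sum>\<^sub>8k l. psi i s k l * psi k l m j) = pcontr (pcontr \<alpha>) m j"
    by (simp add: pcontr_def[of "pcontr \<alpha>"] p sum_distrib_left mult.assoc)
  then show ?thesis using pcontr_pcontr[OF \<alpha>, of m j] p[of m j] by (simp add: \<alpha>_def)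
qed

text \<open>The trace of \<open>psi_psi\<close>; 42 is 6 times 8 - 1.\<close>

lemma psi_psi3: "(\<Sum>\<^sub>8j k l. psi i j k l * psi m j k l) = 42 * delta i m"
proof -
  have "(\<Sum>\<^sub>8k l. psi i j k l * psi m j k l) = 6 * (delta i m - delta i j * delta j m)" for j
  proof -
    have z: "psi i j m j = 0" using psi_swap(3)[of i j j m] psi_swap(2)[of i j j m] psi_swap(2)[of i m j j]  psi_swap(3)[of i m j j] by simp
    have e: "\<forall>k l. psi m j k l = psi k l m j" using psi_rotate(4)[of m j] by simp
    have "(\<Sum>\<^sub>8k l. psi i j k l * psi m j k l) = (\<Sum>\<^sub>8k l. psi i j k l * psi k l m j)"
      by (simp only: e)
    then show ?thesis using psi_psi[of i j m j] z by simp
  qed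
  moreover have "(\<Sum>\<^sub>8j. delta i j * delta j m) = delta i m" by (simp add: if_distrib[where f = "\<lambda>z. z * _"] cong: if_cong)
  ultimately show ?thesis by (simp add: sum_subtractf sum_distrib_left[symmetric])
qed

text \<open>The hypothesis \<open>act\<close> says that \<open>\<alpha>\<close>, as an infinitesimal rotation, annihilates the model form.\<close>

lemma stabilizer_pcontr:
  assumes \<alpha>: "skew2 \<alpha>"
    and act: "\<And>i j k l. (\<Sum>\<^sub>8s. \<alpha> i s * psi s j k l + \<alpha> j s * psi i s k l + \<alpha> k s * psi i j s l + \<alpha> l s * psi i j k s) = 0"
  shows "pcontr \<alpha> m n = 2 * \<alpha> m n"
proof -
  define C where "C i m = (\<Sum>\<^sub>8j s. \<alpha> j s * (\<Sum>\<^sub>8k l. psi i s k l * psi m j k l))" for i m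
  have C: "C i m = - 6 * \<alpha> i m - 4 * pcontr \<alpha> i m" for i m
  proof -
    have "(\<Sum>\<^sub>8k l. psi i s k l * psi m j k l) = 6 * (delta i m * delta s j - delta i j * delta s m) - 4 * psi i s m j" for s j
    proof -
      have e: "\<forall>k l. psi m j k l = psi k l m j" using psi_rotate(4)[of m j] by simp
      show ?thesis unfolding psi_psi[of i s m j, symmetric] by (simp only: e)
    qed
    then have "C i m = (\<Sum>\<^sub>8j s. \<alpha> j s * (6 * (delta i m * delta s j - delta i j * delta s m) - 4 * psi i s m j))"
      by (simp add: C_def)
    also have "\<dots> = (\<Sum>\<^sub>8j s. (if s = j then 6 * delta i m * \<alpha> j j else 0)
        - (if s = m then if j = i then 6 * \<alpha> i m else 0 else 0) - 4 * (\<alpha> j s * psi j s i m))"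
    proof (intro sum.cong refl)
      fix j s
      have "psi i s m j = psi j s i m"
        using psi_rotate(4)[of i s m j] psi_swap(1)[of m j i s] psi_swap(2)[of j m i s] psi_swap(3)[of j i m s] psi_swap(2)[of j i s m]
        by simp
      then show "\<alpha> j s * (6 * (delta i m * delta s j - delta i j * delta s m) - 4 * psi i s m j)
        = (if s = j then 6 * delta i m * \<alpha> j j else 0)
        - (if s = m then if j = i then 6 * \<alpha> i m else 0 else 0) - 4 * (\<alpha> j s * psi j s i m)"
        by (auto simp: algebra_simps)
    qed
    also have "\<dots> = - 6 * \<alpha> i m - 4 * pcontr \<alpha> i m"
      by (simp add: sum_subtractf pcontr_def sum_distrib_left sum_negf skew2_zero[OF \<alpha>])
    finally show ?thesis .
  qed
  \<comment> \<open>Contract the hypothesis with \<open>psi n j k l\<close>. The first term gives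
    \<open>42 \<alpha>\<close>, the other three agree and give \<open>C\<close> each, so
    \<open>42 \<alpha> + 3 (-6 \<alpha> - 4 pcontr \<alpha>) = 0\<close>.\<close>
  have "0 = (\<Sum>\<^sub>8j k l s.
      (\<alpha> m s * psi s j k l + \<alpha> j s * psi m s k l + \<alpha> k s * psi m j s l + \<alpha> l s * psi m j k s) * psi n j k l)"
    using act[of m] by (simp flip: sum_distrib_right)
  also have "\<dots> = (\<Sum>\<^sub>8j k l s. \<alpha> m s * psi s j k l * psi n j k l)
     + (\<Sum>\<^sub>8j k l s. \<alpha> j s * psi m s k l * psi n j k l)
     + (\<Sum>\<^sub>8j k l s. \<alpha> k s * psi m j s l * psi n j k l)
     + (\<Sum>\<^sub>8j k l s. \<alpha> l s * psi m j k s * psi n j k l)"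
    by (simp add: distrib_right sum.distrib)
  also have "(\<Sum>\<^sub>8j k l s. \<alpha> m s * psi s j k l * psi n j k l) = 42 * \<alpha> m n"
  proof -
    have "(\<Sum>\<^sub>8j k l s. \<alpha> m s * psi s j k l * psi n j k l)
      = (\<Sum>\<^sub>8s j k l. \<alpha> m s * psi s j k l * psi n j k l)"
      by (subst sum.swap, subst (3) sum.swap, subst (2) sum.swap) (rule refl)
    also have "\<dots> = (\<Sum>\<^sub>8s. \<alpha> m s * (42 * delta s n))"
      by (simp flip: psi_psi3 add: sum_distrib_left mult.assoc)
    also have "\<dots> = (\<Sum>\<^sub>8s. if s = n then 42 * \<alpha> m n else 0)"
      by (intro sum.cong refl) auto
    finally show ?thesis by simp
  qed
  also have "(\<Sum>\<^sub>8j k l s. \<alpha> k s * psi m j s l * psi n j k l)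
      = (\<Sum>\<^sub>8j k l s. \<alpha> j s * psi m s k l * psi n j k l)"
  proof -
    have "\<alpha> k s * psi m j s l * psi n j k l = \<alpha> k s * psi m s j l * psi n k j l" for j k l s
      using psi_swap(2)[of m j s l] psi_swap(2)[of n j k l] by simp
    then have "(\<Sum>\<^sub>8j k l s. \<alpha> k s * psi m j s l * psi n j k l)
      = (\<Sum>\<^sub>8j k l s. \<alpha> k s * psi m s j l * psi n k j l)"
      by (intro sum.cong refl)
    also have "\<dots> = (\<Sum>\<^sub>8j k l s. \<alpha> j s * psi m s k l * psi n j k l)"
      by (rule sum.swap)
    finally show ?thesis .
  qed
  also have "(\<Sum>\<^sub>8j k l s. \<alpha> l s * psi m j k s * psi n j k l)
      = (\<Sum>\<^sub>8j k l s. \<alpha> j s * psi m s k l * psi n j k l)"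
  proof -
    have "\<alpha> l s * psi m j k s * psi n j k l = \<alpha> l s * psi m s j k * psi n l j k" for j k l s
      using psi_rotate(3)[of m j k s] psi_rotate(3)[of n j k l] by simp
    then have "(\<Sum>\<^sub>8j k l s. \<alpha> l s * psi m j k s * psi n j k l)
      = (\<Sum>\<^sub>8j k l s. \<alpha> l s * psi m s j k * psi n l j k)"
      by (intro sum.cong refl)
    also have "\<dots> = (\<Sum>\<^sub>8j k l s. \<alpha> j s * psi m s k l * psi n j k l)"
      by (rule sum3_rotate[of "\<lambda>j k l. \<Sum>\<^sub>8s. \<alpha> l s * psi m s j k * psi n l j k", symmetric])
    finally show ?thesis .
  qed
  also have "(\<Sum>\<^sub>8j k l s. \<alpha> j s * psi m s k l * psi n j k l) = C m n"
  proof -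
    have "(\<Sum>\<^sub>8k l s. \<alpha> j s * psi m s k l * psi n j k l)
      = (\<Sum>\<^sub>8s k l. \<alpha> j s * psi m s k l * psi n j k l)" for j
      using sum3_rotate[of "\<lambda>k l s. \<alpha> j s * psi m s k l * psi n j k l"] by simp
    then show ?thesis by (simp add: C_def sum_distrib_left mult.assoc)
  qed
  finally show ?thesis using C[of m n] by simp
qed

section \<open>Metric connections with skew torsion and the Bianchi identity\<close>

locale metric_connection = chart_connection U c \<Gamma>
  for U c and \<Gamma> :: "'a chart \<Rightarrow> christoffel" +
  fixes g :: "'a field"
  assumes smooth_g: "\<And>I. length I = 2 \<Longrightarrow> smooth_on U (\<lambda>x. g c x I)"
    and sym_g: "\<And>x i j. x \<in> U \<Longrightarrow> g c x [i, j] = g c x [j, i]"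
    and parallel_g: "\<And>x I. x \<in> U \<Longrightarrow> length I = 3 \<Longrightarrow> nabla \<Gamma> g c x I = 0"
    and smooth_T: "\<And>I. length I = 3 \<Longrightarrow> smooth_on U (\<lambda>x. torsion g \<Gamma> c x I)"
    and alternating_T: "\<And>x. x \<in> U \<Longrightarrow> alternating 3 (torsion g \<Gamma> c x)"
begin

lemma gdot_sym: "x \<in> U \<Longrightarrow> gdot (g c x) u v = gdot (g c x) v u"
  unfolding gdot_def by (subst sum.swap) (simp add: sym_g[of x] mult_ac cong: sum.cong)

lemma dd_metric:
  "x \<in> U \<Longrightarrow> dd (\<lambda>y. tev (g c y) [v, w]) x u = tev (g c x) [gam x u v, w] + tev (g c x) [v, gam x u w]"
  using parallel_dd[of "[v, w]" g x u] smooth_on_imp_differentiable[OF smooth_g] parallel_g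
  by (simp add: lessThan_Suc numeral_eq_Suc)

lemma smooth_tor: "smooth_on U (\<lambda>y. tor y u v)"
  unfolding Tor_def by (intro smooth_on_diff open_U smooth_gam)

lemma nabla_torsion:
  assumes x: "x \<in> U"
  shows "tev (nabla \<Gamma> (torsion g \<Gamma>) c x) [u, v, w, z] = gdot (g c x)
    (gam x u (tor x v w) + dd (\<lambda>y. tor y v w) x u - tor x (gam x u v) w - tor x v (gam x u w)) z"
proof -
  let ?T = "\<lambda>a b d. tev (torsion g \<Gamma> c x) [a, b, d]"
  have "tev (nabla \<Gamma> (torsion g \<Gamma>) c x) [u, v, w, z] = dd (\<lambda>y. tev (torsion g \<Gamma> c y) [v, w, z]) x u
      - ?T (gam x u v) w z - ?T v (gam x u w) z - ?T v w (gam x u z)"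
    using tev_nabla[where t = "torsion g \<Gamma>" and vs = "[v, w, z]" and x = x and u = u]
      smooth_on_imp_differentiable[OF smooth_T x] by (simp add: lessThan_Suc numeral_eq_Suc)
  also have "(\<lambda>y. tev (torsion g \<Gamma> c y) [v, w, z]) = (\<lambda>y. tev (g c y) ([0, z][0 := tor y v w]))"
    by (simp only: tev_torsion gdot_tev list_update.simps nat.case)
  also have "dd (\<lambda>y. tev (g c y) ([0, z][0 := tor y v w])) x u
      = dd (\<lambda>y. tev (g c y) [tor x v w, z]) x u + tev (g c x) [dd (\<lambda>y. tor y v w) x u, z]"
    using dd_tev_slot(1)[of "[0, z]" "g c" x "\<lambda>y. tor y v w" 0 u] smooth_on_imp_differentiable[OF smooth_g x]
      smooth_on_imp_differentiable[OF smooth_tor x]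
    by (simp del: tev.simps)
  also have "dd (\<lambda>y. tev (g c y) [tor x v w, z]) x u = gdot (g c x) (gam x u (tor x v w)) z + gdot (g c x) (tor x v w) (gam x u z)"
    unfolding gdot_tev by (rule dd_metric[OF x])
  finally show ?thesis
    by (simp add: tev_torsion linear_add[OF linear_gdot(1)] linear_diff[OF linear_gdot(1)] gdot_tev[symmetric] del: tev.simps)
qed

text \<open>An identity between connection coefficients and their first derivatives: the derivatives
  of \<open>gam\<close> in the cyclic sum of \<open>rm\<close> pair up to derivatives of
  \<open>tor\<close>, and the products match after expansion.\<close>

lemma bianchi_vectors:
  assumes x: "x \<in> U"
  shows "rm x u v w + rm x v w u + rm x w u v
    = (gam x u (tor x v w) + dd (\<lambda>y. tor y v w) x u - tor x (gam x u v) w - tor x v (gam x u w))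
    + (gam x v (tor x w u) + dd (\<lambda>y. tor y w u) x v - tor x (gam x v w) u - tor x w (gam x v u))
    + (gam x w (tor x u v) + dd (\<lambda>y. tor y u v) x w - tor x (gam x w u) v - tor x u (gam x w v))
    + tor x (tor x u v) w + tor x (tor x v w) u + tor x (tor x w u) v"
proof -
  have d: "dd (\<lambda>y. tor y a b) x d = dd (\<lambda>y. gam y a b) x d - dd (\<lambda>y. gam y b a) x d" for a b d
    unfolding Tor_def by (rule dd_diff_fun) (rule differentiable_gam[OF x])+
  show ?thesis unfolding d unfolding Rm_def Tor_def Gam_bilinear by (simp add: algebra_simps)
qed

lemma bianchi:
  assumes x: "x \<in> U"
  shows "gdot (g c x) (rm x u v w) z + gdot (g c x) (rm x v w u) z + gdot (g c x) (rm x w u v) z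
    = tev (nabla \<Gamma> (torsion g \<Gamma>) c x) [u, v, w, z] + tev (nabla \<Gamma> (torsion g \<Gamma>) c x) [v, w, u, z]
    + tev (nabla \<Gamma> (torsion g \<Gamma>) c x) [w, u, v, z]
    + tev (torsion g \<Gamma> c x) [tor x u v, w, z] + tev (torsion g \<Gamma> c x) [tor x v w, u, z] + tev (torsion g \<Gamma> c x) [tor x w u, v, z]"
  unfolding nabla_torsion[OF x] tev_torsion linear_add[OF linear_gdot(1), symmetric] bianchi_vectors[OF x]
  by (simp add: add_ac)

lemma rm_skew12: "rm x v u w = - rm x u v w"
  by (simp add: Rm_def)

lemma rm_skew34:
  assumes x: "x \<in> U"
  shows "gdot (g c x) (rm x u v z) w = - gdot (g c x) (rm x u v w) z"
  using curvature_parallel[of "[w, z]" g x u v] smooth_g parallel_g x gdot_sym[OF x, of w "rm x u v z"]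
  by (simp add: lessThan_Suc numeral_eq_Suc gdot_tev)

end

declare tev.simps(2) [simp del]

lemma permute_list_update:
  assumes "\<sigma> permutes {..<length I}" "k < length I"
  shows "(permute_list \<sigma> I)[k := l] = permute_list \<sigma> (I[\<sigma> k := l])"
proof (rule nth_equalityI)
  fix i assume "i < length ((permute_list \<sigma> I)[k := l])"
  then have i: "i < length I" by simp
  have "\<sigma> i = \<sigma> k \<longleftrightarrow> i = k" using permutes_inj[OF assms(1)] by (auto dest: injD)
  moreover have "\<sigma> i < length I" using permutes_in_image[OF assms(1), of i] i by simp
  ultimately show "(permute_list \<sigma> I)[k := l] ! i = permute_list \<sigma> (I[\<sigma> k := l]) ! i"
    using assms i by (auto simp: permute_list_nth nth_list_update)
qed simp

text \<open>A slot permutation commutes with the derivative, and it only reindexes the sum of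
  correction terms over the slots.\<close>

lemma alternating_nabla:
  assumes S: "open S" "x \<in> S" and alt: "\<And>y. y \<in> S \<Longrightarrow> alternating k (t c y)"
    and t: "\<And>I. length I = k \<Longrightarrow> (\<lambda>y. t c y I) differentiable (at x)"
  shows "alternating k (\<lambda>J. nabla \<Gamma> t c x (m # J))"
  unfolding alternating_def
proof (intro allI impI, elim conjE)
  fix I :: "8 list" and \<sigma> assume I: "length I = k" and \<sigma>: "\<sigma> permutes {..<k}"
  have p: "pdiff m (\<lambda>y. t c y (permute_list \<sigma> I)) x = of_int (sign \<sigma>) * pdiff m (\<lambda>y. t c y I) x"
  proof -
    have "pdiff m (\<lambda>y. t c y (permute_list \<sigma> I)) x = pdiff m (\<lambda>y. of_int (sign \<sigma>) * t c y I) x"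
      by (rule pdiff_cong_open[OF S]) (rule alternatingD[OF alt I \<sigma>])
    also have "\<dots> = of_int (sign \<sigma>) * pdiff m (\<lambda>y. t c y I) x"
      unfolding pdiff_def by (rule dd_cmult_fun[OF t[OF I]])
    finally show ?thesis .
  qed
  have "(\<Sum>j<k. \<Sum>\<^sub>8l. \<Gamma> c x m (permute_list \<sigma> I ! j) $ l * t c x ((permute_list \<sigma> I)[j := l]))
      = (\<Sum>j<k. \<Sum>\<^sub>8l. \<Gamma> c x m (I ! \<sigma> j) $ l * (of_int (sign \<sigma>) * t c x (I[\<sigma> j := l])))"
  proof (intro sum.cong refl arg_cong2[where f = "(*)"])
    fix j l assume "j \<in> {..<k}"
    then have j: "j < length I" using I by simp
    show "\<Gamma> c x m (permute_list \<sigma> I ! j) $ l = \<Gamma> c x m (I ! \<sigma> j) $ l"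
      using j \<sigma> I by (simp add: permute_list_nth)
    show "t c x ((permute_list \<sigma> I)[j := l]) = of_int (sign \<sigma>) * t c x (I[\<sigma> j := l])"
      using permute_list_update[of \<sigma> I j l] \<sigma> I j alternatingD[OF alt[OF S(2)], of "I[\<sigma> j := l]" \<sigma>] by simp
  qed
  also have "\<dots> = (\<Sum>j<k. \<Sum>\<^sub>8l. \<Gamma> c x m (I ! j) $ l * (of_int (sign \<sigma>) * t c x (I[j := l])))"
    using sum.permute[OF \<sigma>, of "\<lambda>j. \<Sum>\<^sub>8l. \<Gamma> c x m (I ! j) $ l * (of_int (sign \<sigma>) * t c x (I[j := l]))"]
    by (simp add: o_def)
  also have "\<dots> = of_int (sign \<sigma>) * (\<Sum>j<k. \<Sum>\<^sub>8l. \<Gamma> c x m (I ! j) $ l * t c x (I[j := l]))"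
    by (simp add: sum_distrib_left mult.left_commute)
  finally show "nabla \<Gamma> t c x (m # permute_list \<sigma> I) = of_int (sign \<sigma>) * nabla \<Gamma> t c x (m # I)"
    using I by (simp add: nabla_def p right_diff_distrib)
qed

text \<open>When neighbours at positions \<open>p\<close> and \<open>p + 1\<close> are exchanged,
  the two summands that remove them change places with opposite signs; every other summand changes
  sign because the form alternates.\<close>

lemma alternating_ext_d:
  assumes S: "open S" "x \<in> S" and alt: "\<And>y. y \<in> S \<Longrightarrow> alternating k (\<omega> y)"
    and \<omega>: "\<And>I. length I = k \<Longrightarrow> (\<lambda>y. \<omega> y I) differentiable (at x)"
  shows "alternating (Suc k) (ext_d \<omega> x)"
proof (rule alternating_adjI)
  fix xs ys :: "8 list" and a b assume "length xs + length ys + 2 = Suc k"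
  then have len: "length xs + length ys + 1 = k" by simp
  define p where "p = length xs"
  define F where "F I j = (-1) ^ j * pdiff (I ! j) (\<lambda>y. \<omega> y (take j I @ drop (Suc j) I)) x" for I :: "8 list" and j
  let ?I = "xs @ a # b # ys" and ?J = "xs @ b # a # ys" and ?n = "Suc k"
  have minus: "pdiff i (\<lambda>y. \<omega> y I) x = - pdiff i (\<lambda>y. \<omega> y J) x"
    if "\<And>y. y \<in> S \<Longrightarrow> \<omega> y I = - \<omega> y J" "length J = k" for i I J
    using pdiff_cong_open[OF S that(1)] dd_cmult_fun[OF \<omega>[OF that(2)], of "-1"] by (simp add: pdiff_def)
  have other: "F ?J j = - F ?I j" if j: "j < ?n" "j \<noteq> p" "j \<noteq> Suc p" for j
  proof (cases "j < p")
    case True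
    then have "take j ?J @ drop (Suc j) ?J = (take j xs @ drop (Suc j) xs) @ b # a # ys"
      "take j ?I @ drop (Suc j) ?I = (take j xs @ drop (Suc j) xs) @ a # b # ys" "?J ! j = ?I ! j"
      by (simp_all add: p_def nth_append)
    moreover have "\<omega> y ((take j xs @ drop (Suc j) xs) @ b # a # ys) = - \<omega> y ((take j xs @ drop (Suc j) xs) @ a # b # ys)" if "y \<in> S" for y
      by (rule alternating_adj[OF alt[OF that]]) (use True len p_def in auto)
    ultimately show ?thesis unfolding F_def using minus True len
      by (simp only: F_def) (subst minus, simp_all add: p_def)
  next
    case False
    then obtain m where m: "j = p + 2 + m" using j by (metis add_2_eq_Suc' add_Suc le_Suc_ex linorder_not_less nat_less_le Suc_leI)
    then have "take j ?J @ drop (Suc j) ?J = xs @ b # a # (take m ys @ drop (Suc m) ys)"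
      "take j ?I @ drop (Suc j) ?I = xs @ a # b # (take m ys @ drop (Suc m) ys)" "?J ! j = ?I ! j"
      by (simp_all add: p_def nth_append numeral_eq_Suc)
    moreover have "\<omega> y (xs @ b # a # (take m ys @ drop (Suc m) ys)) = - \<omega> y (xs @ a # b # (take m ys @ drop (Suc m) ys))" if "y \<in> S" for y
      by (rule alternating_adj[OF alt[OF that]]) (use len m j p_def in auto)
    ultimately show ?thesis unfolding F_def using len m j
      by (simp only: F_def) (subst minus, simp_all add: p_def)
  qed
  have ends: "F ?J p = - F ?I (Suc p)" "F ?J (Suc p) = - F ?I p"
    by (simp_all add: F_def p_def nth_append)
  have split: "sum G {..<?n} = sum G ({..<?n} - {p, Suc p}) + G p + G (Suc p)" for G :: "nat \<Rightarrow> real"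
  proof -
    have "{p, Suc p} \<subseteq> {..<?n}" using len by (auto simp: p_def)
    then show ?thesis using sum.subset_diff[of "{p, Suc p}" "{..<?n}" G] by simp
  qed
  have "sum (F ?J) ({..<?n} - {p, Suc p}) = (\<Sum>j\<in>{..<?n} - {p, Suc p}. - F ?I j)"
    by (rule sum.cong) (auto intro: other)
  then have "sum (F ?J) {..<?n} = - sum (F ?I) {..<?n}"
    unfolding split by (simp add: ends sum_negf)
  moreover have "ext_d \<omega> x ?J = sum (F ?J) {..<?n}" "ext_d \<omega> x ?I = sum (F ?I) {..<?n}"
    using len by (simp_all add: ext_d_def F_def)
  ultimately show "ext_d \<omega> x ?J = - ext_d \<omega> x ?I" by simp
qed

lemma sum_mult_delta:
  fixes f :: "8 \<Rightarrow> real"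
  shows "(\<Sum>\<^sub>8d. f d * (if d = b then 1 else 0)) = f b" "(\<Sum>\<^sub>8d. f d * (if b = d then 1 else 0)) = f b"
proof -
  have "f d * (if d = b then 1 else 0) = (if d = b then f b else 0)" for d by simp
  then show 1: "(\<Sum>\<^sub>8d. f d * (if d = b then 1 else 0)) = f b" by simp
  then show "(\<Sum>\<^sub>8d. f d * (if b = d then 1 else 0)) = f b" by (simp only: eq_commute[of b])
qed

lemma sum_skew:
  fixes F :: "8 \<Rightarrow> 8 \<Rightarrow> real"
  assumes "\<And>a b. A b a = - A a b"
  shows "(\<Sum>\<^sub>8i b. A i b * F b i) = - (\<Sum>\<^sub>8i b. A i b * F i b)"
proof -
  have "(\<Sum>\<^sub>8i b. A i b * F b i) = (\<Sum>\<^sub>8i b. A b i * F i b)"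
    by (rule sum.swap)
  also have "\<dots> = (\<Sum>\<^sub>8i b. - (A i b * F i b))"
    by (intro sum.cong refl) (subst assms, simp)
  finally show ?thesis by (simp add: sum_negf)
qed

text \<open>Infinitesimal equivariance of \<open>tcontr\<close>: by skewness \<open>A\<close> is
  moved from each slot of \<open>T\<close> to the matching slot of \<open>psi\<close>, and since
  \<open>A\<close> annihilates \<open>psi\<close> the total equals its action on the free
  index.\<close>

lemma tcontr_stabilizer:
  fixes T :: "8 \<Rightarrow> 8 \<Rightarrow> 8 \<Rightarrow> real"
  assumes skew: "\<And>a b. A b a = - A a b"
    and act: "\<And>i j k l. (\<Sum>\<^sub>8s. A i s * psi s j k l + A j s * psi i s k l + A k s * psi i j s l + A l s * psi i j k s) = 0"
  shows "(\<Sum>\<^sub>8i j k. (\<Sum>\<^sub>8b. A i b * T b j k + A j b * T i b k + A k b * T i j b) * psi i j k l)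
    = (\<Sum>\<^sub>8b. A l b * tcontr T b)"
proof -
  have r1: "(\<Sum>\<^sub>8i j k. H i j k) = (\<Sum>\<^sub>8j k i. H i j k)"
    and r2: "(\<Sum>\<^sub>8i j k. H i j k) = (\<Sum>\<^sub>8i k j. H i j k)"
    for H :: "8 \<Rightarrow> 8 \<Rightarrow> 8 \<Rightarrow> real"
    using sum3_rotate[of "\<lambda>j k i. H i j k"] by (simp, intro sum.cong refl sum.swap)
  have 1: "(\<Sum>\<^sub>8i j k b. A i b * (T b j k * psi i j k l))
    = - (\<Sum>\<^sub>8i j k b. A i b * (T i j k * psi b j k l))"
  proof -
    have "(\<Sum>\<^sub>8i j k b. A i b * (T b j k * psi i j k l))
      = (\<Sum>\<^sub>8j k i b. A i b * (T b j k * psi i j k l))"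
      by (rule r1)
    also have "\<dots> = (\<Sum>\<^sub>8j k. - (\<Sum>\<^sub>8i b. A i b * (T i j k * psi b j k l)))"
      by (intro sum.cong refl) (rule sum_skew[OF skew, where F = "\<lambda>b i. T b j k * psi i j k l" for j k])
    also have "\<dots> = - (\<Sum>\<^sub>8i j k b. A i b * (T i j k * psi b j k l))"
      unfolding sum_negf neg_equal_iff_equal by (rule r1[symmetric])
    finally show ?thesis .
  qed
  have 2: "(\<Sum>\<^sub>8i j k b. A j b * (T i b k * psi i j k l))
    = - (\<Sum>\<^sub>8i j k b. A j b * (T i j k * psi i b k l))"
  proof -
    have "(\<Sum>\<^sub>8i j k b. A j b * (T i b k * psi i j k l))
      = (\<Sum>\<^sub>8i k j b. A j b * (T i b k * psi i j k l))"
      by (rule r2)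
    also have "\<dots> = (\<Sum>\<^sub>8i k. - (\<Sum>\<^sub>8j b. A j b * (T i j k * psi i b k l)))"
      by (intro sum.cong refl) (rule sum_skew[OF skew, where F = "\<lambda>b j. T i b k * psi i j k l" for i k])
    also have "\<dots> = - (\<Sum>\<^sub>8i j k b. A j b * (T i j k * psi i b k l))"
      unfolding sum_negf neg_equal_iff_equal by (rule r2[symmetric])
    finally show ?thesis .
  qed
  have 3: "(\<Sum>\<^sub>8i j k b. A k b * (T i j b * psi i j k l))
    = - (\<Sum>\<^sub>8i j k b. A k b * (T i j k * psi i j b l))"
  proof -
    have "(\<Sum>\<^sub>8i j k b. A k b * (T i j b * psi i j k l))
      = (\<Sum>\<^sub>8i j. - (\<Sum>\<^sub>8k b. A k b * (T i j k * psi i j b l)))"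
      by (intro sum.cong refl) (rule sum_skew[OF skew, where F = "\<lambda>b k. T i j b * psi i j k l" for i j])
    then show ?thesis by (simp only: sum_negf)
  qed
  have 4: "(\<Sum>\<^sub>8i j k b. A l b * (T i j k * psi i j k b)) = (\<Sum>\<^sub>8b. A l b * tcontr T b)"
  proof -
    have "(\<Sum>\<^sub>8i j k b. A l b * (T i j k * psi i j k b))
      = (\<Sum>\<^sub>8i b j k. A l b * (T i j k * psi i j k b))"
      by (rule sum.cong[OF refl]) (rule r1[symmetric])
    also have "\<dots> = (\<Sum>\<^sub>8b i j k. A l b * (T i j k * psi i j k b))"
      by (rule sum.swap)
    finally show ?thesis by (simp only: tcontr_eq sum_distrib_left)
  qed
  have "0 = (\<Sum>\<^sub>8i j k. T i j k *
      (\<Sum>\<^sub>8s. A i s * psi s j k l + A j s * psi i s k l + A k s * psi i j s l + A l s * psi i j k s))"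
    by (simp only: act mult_zero_right sum.neutral_const)
  also have "\<dots> = (\<Sum>\<^sub>8i j k b. A i b * (T i j k * psi b j k l))
     + (\<Sum>\<^sub>8i j k b. A j b * (T i j k * psi i b k l))
     + (\<Sum>\<^sub>8i j k b. A k b * (T i j k * psi i j b l))
     + (\<Sum>\<^sub>8i j k b. A l b * (T i j k * psi i j k b))"
    by (simp only: distrib_left sum_distrib_left sum.distrib mult.left_commute[of "T i j k" for i j k])
  moreover have "(\<Sum>\<^sub>8i j k. (\<Sum>\<^sub>8b. A i b * T b j k + A j b * T i b k + A k b * T i j b) * psi i j k l)
    = (\<Sum>\<^sub>8i j k b. A i b * (T b j k * psi i j k l))
     + (\<Sum>\<^sub>8i j k b. A j b * (T i b k * psi i j k l))
     + (\<Sum>\<^sub>8i j k b. A k b * (T i j b * psi i j k l))"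
    by (simp only: distrib_right sum_distrib_right sum.distrib mult.assoc)
  ultimately show ?thesis using 1 2 3 4 by linarith
qed

section \<open>Adapted frames and their connection form\<close>

locale adapted_frame = metric_connection U c \<Gamma> g
  for U c and \<Gamma> :: "'a chart \<Rightarrow> christoffel" and g +
  fixes \<Psi> vol :: "'a field" and E :: "8 \<Rightarrow> pt \<Rightarrow> pt"
  assumes smooth_\<Psi>: "\<And>I. length I = 4 \<Longrightarrow> smooth_on U (\<lambda>x. \<Psi> c x I)"
    and smooth_vol: "\<And>I. length I = 8 \<Longrightarrow> smooth_on U (\<lambda>x. vol c x I)"
    and parallel_\<Psi>: "\<And>x I. x \<in> U \<Longrightarrow> length I = 5 \<Longrightarrow> nabla \<Gamma> \<Psi> c x I = 0"
    and alternating_\<Psi>: "\<And>x. x \<in> U \<Longrightarrow> alternating 4 (\<Psi> c x)"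
    and alternating_vol: "\<And>x. x \<in> U \<Longrightarrow> alternating 8 (vol c x)"
    and smooth_E: "\<And>a. smooth_on U (E a)"
    and frame: "\<And>x. x \<in> U \<Longrightarrow> orthonormal_frame (g c x) (\<lambda>a. E a x)"
    and frame_\<Psi>: "\<And>x I. x \<in> U \<Longrightarrow> length I = 4 \<Longrightarrow> comps (\<lambda>a. E a x) (\<Psi> c x) I = spin7_model std I"
    and frame_vol: "\<And>x I. x \<in> U \<Longrightarrow> length I = 8 \<Longrightarrow> comps (\<lambda>a. E a x) (vol c x) I = eps I"
begin

abbreviation "fr x I \<equiv> map (\<lambda>a. E a x) I"

text \<open>The connection form of the frame: the covariant derivative of \<open>E a\<close> along
  \<open>u\<close> is the sum of \<open>A x u a b *\<^sub>R E b x\<close> over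
  \<open>b\<close>.\<close>

definition A where "A x u a b = gdot (g c x) (dd (E a) x u + gam x u (E a x)) (E b x)"

lemma gdot_frame: "x \<in> U \<Longrightarrow> gdot (g c x) (E a x) (E b x) = (if a = b then 1 else 0)"
  using frame by (simp add: orthonormal_frame_def)

lemma expand: "x \<in> U \<Longrightarrow> v = (\<Sum>\<^sub>8b. gdot (g c x) v (E b x) *\<^sub>R E b x)"
  by (rule orthonormal_expand[OF frame])

lemma differentiable_E: "x \<in> U \<Longrightarrow> E a differentiable (at x)"
  by (rule smooth_on_imp_differentiable[OF smooth_E])

lemma frame_cov: "x \<in> U \<Longrightarrow> dd (E a) x u + gam x u (E a x) = (\<Sum>\<^sub>8b. A x u a b *\<^sub>R E b x)"
  unfolding A_def by (rule expand)

text \<open>The frame moves, so the derivative of a frame component is the component of the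
  covariant derivative plus one connection-form term per index. Every differentiation of frame
  components passes through this identity.\<close>

lemma frame_dd:
  assumes x: "x \<in> U" and t: "\<And>J. length J = length I \<Longrightarrow> (\<lambda>y. t c y J) differentiable (at x)"
  shows "dd (\<lambda>y. tev (t c y) (fr y I)) x u = tev (nabla \<Gamma> t c x) (u # fr x I)
    + (\<Sum>k<length I. \<Sum>\<^sub>8b. A x u (I ! k) b * tev (t c x) (fr x (I[k := b])))"
proof -
  have d: "B differentiable (at x)" if "B \<in> set (map E I)" for B
    using that differentiable_E[OF x] by auto
  have "dd (\<lambda>y. tev (t c y) (map (\<lambda>A. A y) (map E I))) x u
      = dd (\<lambda>y. tev (t c y) (map (\<lambda>A. A x) (map E I))) x u
      + (\<Sum>k<length (map E I). tev (t c x) ((map (\<lambda>A. A x) (map E I))[k := dd (map E I ! k) x u]))"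
    by (rule dd_tev) (use t d in simp_all)
  then have "dd (\<lambda>y. tev (t c y) (fr y I)) x u = dd (\<lambda>y. tev (t c y) (fr x I)) x u
      + (\<Sum>k<length I. tev (t c x) ((fr x I)[k := dd (E (I ! k)) x u]))"
    by (simp add: o_def)
  also have "dd (\<lambda>y. tev (t c y) (fr x I)) x u = tev (nabla \<Gamma> t c x) (u # fr x I)
      + (\<Sum>k<length I. tev (t c x) ((fr x I)[k := gam x u (E (I ! k) x)]))"
    using tev_nabla[where t = t and vs = "fr x I" and x = x and u = u] t by simp
  finally have "dd (\<lambda>y. tev (t c y) (fr y I)) x u = tev (nabla \<Gamma> t c x) (u # fr x I)
      + (\<Sum>k<length I. tev (t c x) ((fr x I)[k := dd (E (I ! k)) x u + gam x u (E (I ! k) x)]))"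
    by (simp add: tev_update_add sum.distrib)
  also have "(\<Sum>k<length I. tev (t c x) ((fr x I)[k := dd (E (I ! k)) x u + gam x u (E (I ! k) x)]))
      = (\<Sum>k<length I. \<Sum>\<^sub>8b. A x u (I ! k) b * tev (t c x) (fr x (I[k := b])))"
    by (intro sum.cong refl) (simp add: frame_cov[OF x] tev_update_sum tev_update_scaleR map_update)
  finally show ?thesis .
qed

lemma A_skew: assumes x: "x \<in> U" shows "A x u b a = - A x u a b"
proof -
  have "dd (\<lambda>y. tev (g c y) (fr y [a, b])) x u = dd (\<lambda>y. if a = b then 1 else 0) x u"
    by (rule arg_cong[where f = "\<lambda>F. F u"], rule dd_cong_open[OF open_U x])
      (simp add: gdot_tev[symmetric] gdot_frame)
  then have "0 = tev (nabla \<Gamma> g c x) (u # fr x [a, b])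
    + (\<Sum>k<length [a, b]. \<Sum>\<^sub>8d. A x u ([a, b] ! k) d * tev (g c x) (fr x ([a, b][k := d])))"
    using frame_dd[OF x, of "[a, b]" g u] smooth_on_imp_differentiable[OF smooth_g x] by (simp add: dd_const)
  moreover have "tev (nabla \<Gamma> g c x) (u # fr x [a, b]) = 0"
    by (rule tev_zero) (rule parallel_g[OF x], simp)
  moreover have "(\<Sum>k<length [a, b]. \<Sum>\<^sub>8d. A x u ([a, b] ! k) d * tev (g c x) (fr x ([a, b][k := d])))
    = (\<Sum>\<^sub>8d. A x u a d * gdot (g c x) (E d x) (E b x)) + (\<Sum>\<^sub>8d. A x u b d * gdot (g c x) (E a x) (E d x))"
    by (simp add: lessThan_Suc gdot_tev)
  ultimately show ?thesis
    unfolding gdot_frame[OF x] sum_mult_delta by linarith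
qed

lemma tev_\<Psi>: "x \<in> U \<Longrightarrow> tev (\<Psi> c x) [E i x, E j x, E k x, E l x] = psi i j k l"
  using frame_\<Psi>[of x "[i, j, k, l]"] by (simp add: comps_tev psi_def)

text \<open>The frame components of the parallel form \<open>\<Psi>\<close> are constant, so their
  derivative leaves only the action of the connection form: it takes values in the stabilizer
  algebra of \<open>psi\<close>.\<close>

lemma A_stabilizer:
  assumes x: "x \<in> U"
  shows "(\<Sum>\<^sub>8s. A x u i s * psi s j k l + A x u j s * psi i s k l + A x u k s * psi i j s l + A x u l s * psi i j k s) = 0"
proof -
  have "dd (\<lambda>y. tev (\<Psi> c y) (fr y [i, j, k, l])) x u = dd (\<lambda>y. psi i j k l) x u"
    by (rule arg_cong[where f = "\<lambda>F. F u"], rule dd_cong_open[OF open_U x]) (simp add: tev_\<Psi>)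
  then have "0 = tev (nabla \<Gamma> \<Psi> c x) (u # fr x [i, j, k, l])
    + (\<Sum>n<length [i, j, k, l]. \<Sum>\<^sub>8d. A x u ([i, j, k, l] ! n) d * tev (\<Psi> c x) (fr x ([i, j, k, l][n := d])))"
    using frame_dd[OF x, of "[i, j, k, l]" \<Psi> u] smooth_on_imp_differentiable[OF smooth_\<Psi> x] by (simp add: dd_const)
  moreover have "tev (nabla \<Gamma> \<Psi> c x) (u # fr x [i, j, k, l]) = 0"
    by (rule tev_zero) (rule parallel_\<Psi>[OF x], simp)
  ultimately show ?thesis
    by (simp add: lessThan_Suc numeral_eq_Suc tev_\<Psi>[OF x] sum.distrib)
qed

definition Tf where "Tf x i j k = tev (torsion g \<Gamma> c x) [E i x, E j x, E k x]"
definition Xf where "Xf x u i j k = tev (nabla \<Gamma> (torsion g \<Gamma>) c x) [u, E i x, E j x, E k x]"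

lemma tev_skew3:
  assumes "alternating 3 t" shows "skew3 (\<lambda>i j k. tev t [f i, f j, f k])"
proof -
  have "tev t [b, a, z] = - tev t [a, b, z]" "tev t [z, b, a] = - tev t [z, a, b]" for a b z
    using tev_alternating_adj[OF assms, of "[]" "[z]" b a] tev_alternating_adj[OF assms, of "[z]" "[]" b a] by simp_all
  then show ?thesis unfolding skew3_def by blast
qed

lemma Tf_skew: "x \<in> U \<Longrightarrow> skew3 (Tf x)"
  unfolding Tf_def by (rule tev_skew3[OF alternating_T])

lemma Xf_skew: assumes "x \<in> U" shows "skew3 (Xf x u)"
proof -
  have "alternating 3 (\<lambda>J. nabla \<Gamma> (torsion g \<Gamma>) c x (m # J))" for m
    by (rule alternating_nabla[OF open_U assms]) (simp_all add: alternating_T smooth_on_imp_differentiable[OF smooth_T assms])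
  note s = skew3D[OF tev_skew3[OF this, where f = "\<lambda>i. E i x"]]
  have "tev (nabla \<Gamma> (torsion g \<Gamma>) c x) [u, E j x, E i x, E k x] = - tev (nabla \<Gamma> (torsion g \<Gamma>) c x) [u, E i x, E j x, E k x]" for i j k
    unfolding tev.simps(2)[of _ u] sum_negf[symmetric]
    by (rule sum.cong[OF refl]) (subst s(1), rule mult_minus_right)
  moreover have "tev (nabla \<Gamma> (torsion g \<Gamma>) c x) [u, E i x, E k x, E j x] = - tev (nabla \<Gamma> (torsion g \<Gamma>) c x) [u, E i x, E j x, E k x]" for i j k
    unfolding tev.simps(2)[of _ u] sum_negf[symmetric]
    by (rule sum.cong[OF refl]) (subst s(2), rule mult_minus_right)
  ultimately show ?thesis
    unfolding skew3_def Xf_def by blast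
qed

lemma tor_frame: "x \<in> U \<Longrightarrow> tor x (E i x) (E j x) = (\<Sum>\<^sub>8s. Tf x i j s *\<^sub>R E s x)"
  unfolding Tf_def tev_torsion by (rule expand)

text \<open>Contraction with \<open>psi\<close> commutes with covariant differentiation: by
  \<open>tcontr_stabilizer\<close> the connection terms of the three torsion indices combine into
  the one of a 1-form.\<close>

lemma tcontr_dd:
  assumes x: "x \<in> U"
  shows "dd (\<lambda>y. tcontr (Tf y) l) x u = tcontr (Xf x u) l + (\<Sum>\<^sub>8b. A x u l b * tcontr (Tf x) b)"
    "(\<lambda>y. tcontr (Tf y) l) differentiable (at x)"
proof -
  have 0: "(\<lambda>y. Tf y i j k) differentiable (at x)" for i j k
    using differentiable_tev[of "[E i, E j, E k]" "torsion g \<Gamma> c" x]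
      smooth_on_imp_differentiable[OF smooth_T x] differentiable_E[OF x]
    by (auto simp: Tf_def)
  then show "(\<lambda>y. tcontr (Tf y) l) differentiable (at x)"
    unfolding tcontr_eq by (intro differentiable_sum differentiable_mult ballI) (auto simp: differentiable_const)
  have "dd (\<lambda>y. tcontr (Tf y) l) x u = (\<Sum>\<^sub>8i j k. dd (\<lambda>y. Tf y i j k) x u * psi i j k l)"
    unfolding tcontr_eq
    by (rule dd_eqI) (intro has_derivative_sum has_derivative_mult_left has_dd 0)
  also have "\<dots> = (\<Sum>\<^sub>8i j k. (Xf x u i j k
     + (\<Sum>\<^sub>8b. A x u i b * Tf x b j k + A x u j b * Tf x i b k + A x u k b * Tf x i j b)) * psi i j k l)"
  proof (intro sum.cong refl arg_cong2[where f = "(*)"])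
    fix i j k
    show "dd (\<lambda>y. Tf y i j k) x u = Xf x u i j k
      + (\<Sum>\<^sub>8b. A x u i b * Tf x b j k + A x u j b * Tf x i b k + A x u k b * Tf x i j b)"
      using frame_dd[OF x, of "[i, j, k]" "torsion g \<Gamma>" u] smooth_on_imp_differentiable[OF smooth_T x]
      by (simp add: Tf_def Xf_def lessThan_Suc numeral_eq_Suc sum.distrib)
  qed
  also have "\<dots> = tcontr (Xf x u) l + (\<Sum>\<^sub>8i j k.
      (\<Sum>\<^sub>8b. A x u i b * Tf x b j k + A x u j b * Tf x i b k + A x u k b * Tf x i j b) * psi i j k l)"
    by (simp only: tcontr_eq distrib_right sum.distrib)
  finally show "dd (\<lambda>y. tcontr (Tf y) l) x u = tcontr (Xf x u) l + (\<Sum>\<^sub>8b. A x u l b * tcontr (Tf x) b)"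
    using tcontr_stabilizer[of "A x u", OF A_skew[OF x] A_stabilizer[OF x]] by simp
qed

end

section \<open>The Lee form as a contraction of the torsion\<close>

definition adapted_at :: "tensor \<Rightarrow> tensor \<Rightarrow> tensor \<Rightarrow> (8 \<Rightarrow> pt) \<Rightarrow> bool" where
  "adapted_at G V P E \<longleftrightarrow> orthonormal_frame G E \<and>
     (\<forall>I. length I = 4 \<longrightarrow> comps E P I = spin7_model std I) \<and> (\<forall>I. length I = 8 \<longrightarrow> comps E V I = eps I)"

lemma wedge_cong:
  assumes "\<And>I. length I = p \<Longrightarrow> \<alpha> I = \<alpha>' I" "\<And>I. length I = q \<Longrightarrow> \<beta> I = \<beta>' I" "length I = p + q"
  shows "wedge p \<alpha> \<beta> I = wedge p \<alpha>' \<beta>' I"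
  unfolding wedge_def
  by (intro arg_cong2[where f = "(/)"] sum.cong refl arg_cong2[where f = "(*)"]) (use assms in auto)

text \<open>Both Hodge stars become \<open>hstar\<close>, and \<open>hstar_wedge_hstar\<close>
  evaluates them; 168 is 7 from the definition of the Lee form times 24.\<close>

lemma lee_frame:
  assumes E: "adapted_at (g c x) (vol c x) (\<Psi> c x) E" and alt: "alternating 5 (ext_d (\<Psi> c) x)"
  shows "comps E (lee_form g vol \<Psi> c x) [a]
    = (\<Sum>B | length B = 4. comps E (ext_d (\<Psi> c) x) (B @ [a]) * spin7_model std B) / 168"
proof -
  let ?\<omega> = "ext_d (\<Psi> c) x" and ?h = "hodge (g c x) (vol c x)"
  have h: "comps E (?h \<alpha>) J = hstar (comps E \<alpha>) J" if "length J \<le> 8" for \<alpha> J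
    using comps_hodge[of "g c x" E "vol c x" J \<alpha>] E that by (simp add: adapted_at_def)
  have w: "comps E (wedge 3 (?h ?\<omega>) (\<Psi> c x)) I = wedge 3 (hstar (comps E ?\<omega>)) (spin7_model std) I" if "length I = 7" for I
  proof -
    have "comps E (wedge 3 (?h ?\<omega>) (\<Psi> c x)) I = wedge 3 (comps E (?h ?\<omega>)) (comps E (\<Psi> c x)) I"
      by (rule comps_wedge) (simp add: that)
    also have "\<dots> = wedge 3 (hstar (comps E ?\<omega>)) (spin7_model std) I"
      by (rule wedge_cong[where q = 4]) (use E that h in \<open>auto simp: adapted_at_def\<close>)
    finally show ?thesis .
  qed
  have "comps E (lee_form g vol \<Psi> c x) [a] = - (1 / 7) * comps E (?h (wedge 3 (?h ?\<omega>) (\<Psi> c x))) [a]"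
    unfolding comps_cmult[symmetric] by (rule comps_cong) (simp add: lee_form_def star_def)
  also have "comps E (?h (wedge 3 (?h ?\<omega>) (\<Psi> c x))) [a] = hstar (comps E (wedge 3 (?h ?\<omega>) (\<Psi> c x))) [a]"
    by (rule h) simp
  also have "\<dots> = hstar (wedge 3 (hstar (comps E ?\<omega>)) (spin7_model std)) [a]"
    unfolding hstar_def[of _ "[a]"] by (intro arg_cong2[where f = "(/)"] sum.cong refl) (use w in simp)
  also have "\<dots> = - (\<Sum>B | length B = 4. spin7_model std B * comps E ?\<omega> (B @ [a])) / 24"
    by (rule hstar_wedge_hstar[OF alternating_comps[OF alt]])
  finally show ?thesis by (simp add: mult.commute)
qed

lemma sum_lists_4:
  fixes F :: "8 list \<Rightarrow> real"
  shows "(\<Sum>B | length B = 4. F B) = (\<Sum>\<^sub>8i j k l. F [i, j, k, l])"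
  using sum_lists_Suc[where n = "Suc (Suc (Suc 0))" and F = F] by (simp add: sum_lists_Suc numeral_eq_Suc)

lemma psi_sum_swap:
  fixes F :: "8 \<Rightarrow> 8 \<Rightarrow> 8 \<Rightarrow> 8 \<Rightarrow> real"
  shows "(\<Sum>\<^sub>8i j k l. F j i k l * psi i j k l)
      = - (\<Sum>\<^sub>8i j k l. F i j k l * psi i j k l)"
    and "(\<Sum>\<^sub>8i j k l. F i k j l * psi i j k l)
      = - (\<Sum>\<^sub>8i j k l. F i j k l * psi i j k l)"
    and "(\<Sum>\<^sub>8i j k l. F i j l k * psi i j k l)
      = - (\<Sum>\<^sub>8i j k l. F i j k l * psi i j k l)"
proof -
  have n: "x * psi i j k l = - (x * psi j i k l)" "x * psi i j k l = - (x * psi i k j l)" "x * psi i j k l = - (x * psi i j l k)"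
    for x i j k l
    using psi_swap(1)[of i j k l] psi_swap(2)[of i j k l] psi_swap(3)[of i j k l] by simp_all
  have "(\<Sum>\<^sub>8i j k l. F j i k l * psi i j k l)
      = (\<Sum>\<^sub>8i j k l. F i j k l * psi j i k l)"
    by (rule sum.swap)
  also have "\<dots> = (\<Sum>\<^sub>8i j k l. - (F i j k l * psi i j k l))"
    by (intro sum.cong refl n(1))
  finally show "(\<Sum>\<^sub>8i j k l. F j i k l * psi i j k l)
      = - (\<Sum>\<^sub>8i j k l. F i j k l * psi i j k l)"
    by (simp only: sum_negf)
  have "(\<Sum>\<^sub>8i j k l. F i k j l * psi i j k l)
      = (\<Sum>\<^sub>8i j k l. F i j k l * psi i k j l)"
    by (rule sum.cong[OF refl], rule sum.swap)
  also have "\<dots> = (\<Sum>\<^sub>8i j k l. - (F i j k l * psi i j k l))"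
    by (intro sum.cong refl n(2))
  finally show "(\<Sum>\<^sub>8i j k l. F i k j l * psi i j k l)
      = - (\<Sum>\<^sub>8i j k l. F i j k l * psi i j k l)"
    by (simp only: sum_negf)
  have "(\<Sum>\<^sub>8i j k l. F i j l k * psi i j k l)
      = (\<Sum>\<^sub>8i j k l. F i j k l * psi i j l k)"
    by (rule sum.cong[OF refl], rule sum.cong[OF refl], rule sum.swap)
  also have "\<dots> = (\<Sum>\<^sub>8i j k l. - (F i j k l * psi i j k l))"
    by (intro sum.cong refl n(3))
  finally show "(\<Sum>\<^sub>8i j k l. F i j l k * psi i j k l)
      = - (\<Sum>\<^sub>8i j k l. F i j k l * psi i j k l)"
    by (simp only: sum_negf)
qed

text \<open>Each term arises from the first by relabelling the summation indices, and
  \<open>psi\<close> returns exactly the sign with which the term enters. So the six, respectively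
  four, terms contribute equally.\<close>

lemma psi_sum_pairs:
  fixes H K :: "8 \<Rightarrow> 8 \<Rightarrow> 8 \<Rightarrow> 8 \<Rightarrow> real"
  shows "(\<Sum>\<^sub>8i j k l. (H i j k l - H i k j l + H i l j k + H j k i l - H j l i k + H k l i j) * psi i j k l)
      = 6 * (\<Sum>\<^sub>8i j k l. H i j k l * psi i j k l)"
    and "(\<Sum>\<^sub>8i j k l. (K i j k l - K j i k l + K k i j l - K l i j k) * psi i j k l)
      = 4 * (\<Sum>\<^sub>8i j k l. K i j k l * psi i j k l)"
proof -
  let ?S = "\<lambda>F :: 8 \<Rightarrow> 8 \<Rightarrow> 8 \<Rightarrow> 8 \<Rightarrow> real. \<Sum>\<^sub>8i j k l. F i j k l * psi i j k l"
  note s1 = psi_sum_swap(1) and s2 = psi_sum_swap(2) and s3 = psi_sum_swap(3)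
  have a: "?S (\<lambda>i j k l. H i k j l) = - ?S H" by (rule s2)
  have b: "?S (\<lambda>i j k l. H i l j k) = ?S H"
    using s2[of "\<lambda>i j k l. H i l j k"] s3[of "\<lambda>i j k l. H i k j l"] a by linarith
  have c: "?S (\<lambda>i j k l. H j k i l) = ?S H"
    using s1[of "\<lambda>i j k l. H i k j l"] a by linarith
  have d: "?S (\<lambda>i j k l. H j l i k) = - ?S H"
    using s1[of "\<lambda>i j k l. H i l j k"] b by linarith
  have e: "?S (\<lambda>i j k l. H k l i j) = ?S H"
    using s2[of "\<lambda>i j k l. H j l i k"] d by linarith
  show "?S (\<lambda>i j k l. H i j k l - H i k j l + H i l j k + H j k i l - H j l i k + H k l i j) = 6 * ?S H"
    unfolding distrib_right left_diff_distrib sum.distrib sum_subtractf a b c d e by simp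
  have a': "?S (\<lambda>i j k l. K j i k l) = - ?S K" by (rule s1)
  have b': "?S (\<lambda>i j k l. K k i j l) = ?S K"
    using s2[of "\<lambda>i j k l. K j i k l"] a' by linarith
  have c': "?S (\<lambda>i j k l. K l i j k) = - ?S K"
    using s3[of "\<lambda>i j k l. K k i j l"] b' by linarith
  show "?S (\<lambda>i j k l. K i j k l - K j i k l + K k i j l - K l i j k) = 4 * ?S K"
    unfolding distrib_right left_diff_distrib sum.distrib sum_subtractf a' b' c' by simp
qed

context adapted_frame
begin

lemma adapted: "x \<in> U \<Longrightarrow> adapted_at (g c x) (vol c x) (\<Psi> c x) (\<lambda>a. E a x)"
  using frame frame_\<Psi> frame_vol by (simp add: adapted_at_def)

text \<open>Parallelism replaces each derivative of \<open>\<Psi>\<close> by insertions of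
  \<open>gam\<close>. The insertions for the same two arguments in opposite order pair up to
  \<open>tor\<close>, one term for each of the ten pairs of arguments.\<close>

lemma ext_d_\<Psi>:
  assumes x: "x \<in> U"
  shows "tev (ext_d (\<Psi> c) x) [p, q, r, s, v] =
    tev (\<Psi> c x) [tor x p q, r, s, v] - tev (\<Psi> c x) [tor x p r, q, s, v] + tev (\<Psi> c x) [tor x p s, q, r, v]
    - tev (\<Psi> c x) [tor x p v, q, r, s] + tev (\<Psi> c x) [tor x q r, p, s, v] - tev (\<Psi> c x) [tor x q s, p, r, v]
    + tev (\<Psi> c x) [tor x q v, p, r, s] + tev (\<Psi> c x) [tor x r s, p, q, v] - tev (\<Psi> c x) [tor x r v, p, q, s]
    + tev (\<Psi> c x) [tor x s v, p, q, r]"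
proof -
  let ?Q = "\<lambda>a b d e. tev (\<Psi> c x) [a, b, d, e]"
  have diff: "length I = 4 \<Longrightarrow> (\<lambda>y. \<Psi> c y I) differentiable (at x)" for I
    by (rule smooth_on_imp_differentiable[OF smooth_\<Psi> x])
  have s1: "?Q b a d e = - ?Q a b d e" for a b d e
    using tev_alternating_adj[OF alternating_\<Psi>[OF x], of "[]" "[d, e]" b a] by simp
  have s2: "?Q d b a e = - ?Q d a b e" for a b d e
    using tev_alternating_adj[OF alternating_\<Psi>[OF x], of "[d]" "[e]" b a] by simp
  have s3: "?Q d e b a = - ?Q d e a b" for a b d e
    using tev_alternating_adj[OF alternating_\<Psi>[OF x], of "[d, e]" "[]" b a] by simp
  have d0: "dd (\<lambda>y. tev (\<Psi> c y) [w0, w1, w2, w3]) x u = ?Q (gam x u w0) w1 w2 w3 + ?Q w0 (gam x u w1) w2 w3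
      + ?Q w0 w1 (gam x u w2) w3 + ?Q w0 w1 w2 (gam x u w3)" for w0 w1 w2 w3 u
    using parallel_dd[of "[w0, w1, w2, w3]" \<Psi> x u] diff parallel_\<Psi>[OF x]
    by (simp add: lessThan_Suc numeral_eq_Suc)
  have d: "dd (\<lambda>y. tev (\<Psi> c y) [w0, w1, w2, w3]) x u = ?Q (gam x u w0) w1 w2 w3 - ?Q (gam x u w1) w0 w2 w3
      + ?Q (gam x u w2) w0 w1 w3 - ?Q (gam x u w3) w0 w1 w2" for w0 w1 w2 w3 u
    using d0[of w0 w1 w2 w3 u] s1[of w0 "gam x u w1" w2 w3] s2[of w0 w1 "gam x u w2" w3] s1[of w0 "gam x u w2" w1 w3]
      s3[of w0 w1 w2 "gam x u w3"] s2[of w0 w1 "gam x u w3" w2] s1[of w0 "gam x u w3" w1 w2] by linarith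
  have lin: "?Q (tor x a b) w0 w1 w2 = ?Q (gam x a b) w0 w1 w2 - ?Q (gam x b a) w0 w1 w2" for a b w0 w1 w2
    using linear_diff[OF linear_tev[of "\<Psi> c x" "[]" "[w0, w1, w2]"], of "gam x a b" "gam x b a"] by (simp add: Tor_def)
  have "tev (ext_d (\<Psi> c) x) [p, q, r, s, v] =
    dd (\<lambda>y. tev (\<Psi> c y) [q, r, s, v]) x p - dd (\<lambda>y. tev (\<Psi> c y) [p, r, s, v]) x q
    + dd (\<lambda>y. tev (\<Psi> c y) [p, q, s, v]) x r - dd (\<lambda>y. tev (\<Psi> c y) [p, q, r, v]) x s
    + dd (\<lambda>y. tev (\<Psi> c y) [p, q, r, s]) x v"
    using tev_ext_d[of "[p, q, r, s, v]" "\<Psi> c" x] diff by (simp add: lessThan_Suc numeral_eq_Suc)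
  then show ?thesis unfolding d lin by linarith
qed

lemma alternating_ext_d_\<Psi>: "x \<in> U \<Longrightarrow> alternating 5 (ext_d (\<Psi> c) x)"
  using alternating_ext_d[OF open_U, of x 4 "\<Psi> c"] alternating_\<Psi> smooth_on_imp_differentiable[OF smooth_\<Psi>]
  by simp

text \<open>Of the ten torsion terms of \<open>d\<Psi>\<close>, the six with two contracted slots give \<open>-4 t\<close> each, where \<open>t\<close> is the
  contraction of the torsion with the model form; the four with the free slot vanish.\<close>

lemma lee_tcontr:
  assumes x: "x \<in> U"
  shows "tev (lee_form g vol \<Psi> c x) [E a x] = - (1 / 7) * tcontr (Tf x) a"
proof -
  note skew = Tf_skew[OF x]
  define H where "H i j k l = (\<Sum>\<^sub>8s. Tf x i j s * psi s k l a)" for i j k l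
  define K where "K i j k l = - (\<Sum>\<^sub>8s. Tf x i a s * psi s j k l)" for i j k l
  have Q: "tev (\<Psi> c x) [tor x (E i x) (E j x), E k x, E l x, E m x] = (\<Sum>\<^sub>8s. Tf x i j s * psi s k l m)" for i j k l m
    using linear_sum[OF linear_tev[of "\<Psi> c x" "[]" "[E k x, E l x, E m x]"], of "\<lambda>s. Tf x i j s *\<^sub>R E s x" UNIV]
      linear_cmul[OF linear_tev[of "\<Psi> c x" "[]" "[E k x, E l x, E m x]"]]
    by (simp add: tor_frame[OF x] tev_\<Psi>[OF x])
  have d: "comps (\<lambda>a. E a x) (ext_d (\<Psi> c) x) [i, j, k, l, a]
    = (H i j k l - H i k j l + H i l j k + H j k i l - H j l i k + H k l i j) + (K i j k l - K j i k l + K k i j l - K l i j k)" for i j k l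
    by (simp add: comps_tev ext_d_\<Psi>[OF x] Q H_def K_def)
  have sH: "(\<Sum>\<^sub>8i j k l. H i j k l * psi i j k l) = - 4 * tcontr (Tf x) a"
  proof -
    have p: "(\<Sum>\<^sub>8k l. psi i j k l * psi s k l a) = - (6 * (delta i a * delta j s - delta i s * delta j a)) - 4 * psi i j s a" for i j s
    proof -
      have e: "\<forall>k l. psi s k l a = - psi k l a s" using psi_rotate(2)[of _ _ a s] by (metis minus_minus)
      have "(\<Sum>\<^sub>8k l. psi i j k l * psi s k l a) = - (\<Sum>\<^sub>8k l. psi i j k l * psi k l a s)"
        by (simp only: e mult_minus_right sum_negf)
      then show ?thesis using psi_psi[of i j a s] psi_swap(3)[of i j a s] by simp
    qed
    have "(\<Sum>\<^sub>8k l. H i j k l * psi i j k l) = (\<Sum>\<^sub>8s. Tf x i j s * (- (6 * (delta i a * delta j s - delta i s * delta j a)) - 4 * psi i j s a))" for i j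
    proof -
      have "(\<Sum>\<^sub>8k l. H i j k l * psi i j k l) = (\<Sum>\<^sub>8k l s. Tf x i j s * (psi i j k l * psi s k l a))"
        unfolding H_def sum_distrib_right by (intro sum.cong refl) simp
      also have "\<dots> = (\<Sum>\<^sub>8s k l. Tf x i j s * (psi i j k l * psi s k l a))"
        using sum3_rotate[of "\<lambda>k l s. Tf x i j s * (psi i j k l * psi s k l a)"] by simp
      finally show ?thesis by (simp only: p sum_distrib_left[symmetric])
    qed
    moreover have "Tf x i j s * (- (6 * (delta i a * delta j s - delta i s * delta j a)) - 4 * psi i j s a) = - 4 * (Tf x i j s * psi i j s a)" for i j s
      using skew3_zero[OF skew] skew3D(1)[OF skew, of s j s] skew3D(2)[OF skew, of j s s] by auto
    ultimately show ?thesis by (simp add: tcontr_eq sum_distrib_left)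
  qed
  have sK: "(\<Sum>\<^sub>8i j k l. K i j k l * psi i j k l) = 0"
  proof -
    have "(\<Sum>\<^sub>8j k l. K i j k l * psi i j k l) = 0" for i
    proof -
      have "(\<Sum>\<^sub>8j k l. K i j k l * psi i j k l)
        = - (\<Sum>\<^sub>8j k l s. Tf x i a s * (psi i j k l * psi s j k l))"
        unfolding K_def sum_distrib_right mult_minus_left sum_negf neg_equal_iff_equal by (intro sum.cong refl) simp
      also have "(\<Sum>\<^sub>8j k l s. Tf x i a s * (psi i j k l * psi s j k l))
        = (\<Sum>\<^sub>8j s k l. Tf x i a s * (psi i j k l * psi s j k l))"
        by (rule sum.cong[OF refl]) (rule sum3_rotate[symmetric])
      also have "\<dots> = (\<Sum>\<^sub>8s j k l. Tf x i a s * (psi i j k l * psi s j k l))"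
        by (rule sum.swap)
      also have "\<dots> = (\<Sum>\<^sub>8s. Tf x i a s * (42 * delta i s))"
        by (simp only: psi_psi3 sum_distrib_left[symmetric])
      also have "\<dots> = 0"
        using skew3D(1)[OF skew, of i a i] skew3D(2)[OF skew, of a i i] skew3_zero[OF skew] by (intro sum.neutral) auto
      finally show ?thesis by simp
    qed
    then show ?thesis by (simp only: sum.neutral_const)
  qed
  have "(\<Sum>B | length B = 4. comps (\<lambda>a. E a x) (ext_d (\<Psi> c) x) (B @ [a]) * spin7_model std B)
    = (\<Sum>\<^sub>8i j k l. (H i j k l - H i k j l + H i l j k + H j k i l - H j l i k + H k l i j) * psi i j k l)
    + (\<Sum>\<^sub>8i j k l. (K i j k l - K j i k l + K k i j l - K l i j k) * psi i j k l)"
    unfolding sum_lists_4 append.simps d psi_def[symmetric] distrib_right[of _ _ "psi i j k l" for i j k l] sum.distrib by simp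
  \<comment> \<open>Six times -4. Divided by the 168 of \<open>lee_frame\<close> this gives the
    constant -1/7.\<close>
  then have "(\<Sum>B | length B = 4. comps (\<lambda>a. E a x) (ext_d (\<Psi> c) x) (B @ [a]) * spin7_model std B) = - 24 * tcontr (Tf x) a"
    unfolding psi_sum_pairs sH sK by simp
  then show ?thesis
    using lee_frame[where g = g and c = c and x = x and vol = vol and \<Psi> = \<Psi> and a = a, OF adapted[OF x] alternating_ext_d_\<Psi>[OF x]]
    by (simp add: comps_tev)
qed

end

section \<open>The volume form in a frame and the Lee vector field\<close>

lemma comps_inject:
  assumes E: "orthonormal_frame G E" and eq: "\<And>I. length I = k \<Longrightarrow> comps E s I = comps E t I" and I: "length I = k"
  shows "s I = t I"
proof -
  define M where "M i = (\<chi> b. gdot G (axis i 1) (E b))" for i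
  have "(\<Sum>\<^sub>8j. M i $ j *\<^sub>R E j) = axis i 1" for i
    unfolding M_def using orthonormal_expand[OF E, of "axis i 1"] by simp
  then have "comps M (comps E r) I = r I" for r
    by (simp add: comps_comps comps_std)
  moreover have "comps M (comps E s) I = comps M (comps E t) I"
    by (rule comps_cong) (simp add: eq I)
  ultimately show ?thesis by simp
qed

lemma tev_move:
  assumes "alternating k t" "length xs + length zs + 1 = k"
  shows "tev t (v # xs @ zs) = (-1) ^ length xs * tev t (xs @ v # zs)"
  using assms(2)
proof (induction xs arbitrary: zs rule: rev_induct)
  case (snoc x xs)
  then have "tev t (v # xs @ x # zs) = (-1) ^ length xs * tev t (xs @ v # x # zs)" by simp
  also have "tev t (xs @ v # x # zs) = - tev t (xs @ x # v # zs)"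
    by (rule tev_alternating_adj[OF assms(1)]) (use snoc.prems in simp)
  finally show ?case by simp
qed simp

abbreviation L8 :: "8 list" where "L8 \<equiv> [0, 1, 2, 3, 4, 5, 6, 7]"

lemma sum_L8: "(\<Sum>j<8. f (L8 ! j)) = (\<Sum>\<^sub>8a. f a :: real)"
  by (simp add: sum_8 lessThan_Suc numeral_eq_Suc)

lemma L8: "length L8 = 8" "distinct L8" "set L8 = UNIV"
  by (simp, simp only: distinct.simps list.set insert_iff empty_iff neq8 simp_thms, simp only: list.set UNIV_8)

lemma L8_obtain: obtains m where "m < 8" "b = L8 ! m"
proof -
  have "b \<in> set L8" by (simp only: L8 UNIV_I)
  then obtain m where "m < length L8" "L8 ! m = b" unfolding in_set_conv_nth by blast
  then show thesis by (intro that[of m]) (simp_all only: L8)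
qed

lemma L8_inj: "j < 8 \<Longrightarrow> k < 8 \<Longrightarrow> L8 ! j = L8 ! k \<longleftrightarrow> j = k"
  by (rule nth_eq_iff_index_eq[OF L8(2)]) (simp_all only: L8)

lemma eps_repeated: "length I = 8 \<Longrightarrow> i < 8 \<Longrightarrow> j < 8 \<Longrightarrow> i \<noteq> j \<Longrightarrow> I ! i = I ! j \<Longrightarrow> eps I = 0"
  by (rule alternating_repeated[OF alternating_eps])

lemma eps_update1: "j < 8 \<Longrightarrow> eps (L8[j := b]) = (if b = L8 ! j then 1 else 0)"
proof (cases "b = L8 ! j")
  case True then show ?thesis by (simp only: list_update_id eps_id simp_thms if_True)
next
  case False
  assume j: "j < 8"
  obtain m where m: "m < 8" "b = L8 ! m" by (rule L8_obtain)
  then have "m \<noteq> j" using False by auto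
  then have "eps (L8[j := b]) = 0"
    using m j by (intro eps_repeated[of _ j m]) (simp_all only: length_list_update L8 nth_list_update_eq nth_list_update_neq)
  then show ?thesis using False by simp
qed

text \<open>The determinant of the identity matrix with two rows replaced, hence a 2 by 2 minor; the
  cases follow which slots the new entries belong to.\<close>

lemma eps_update2:
  assumes "j < 8" "k < 8" "j \<noteq> k"
  shows "eps (L8[j := b, k := d]) = (if b = L8 ! j then 1 else 0) * (if d = L8 ! k then 1 else 0)
     - (if b = L8 ! k then 1 else 0) * (if d = L8 ! j then 1 else 0)"
proof -
  obtain m where m: "m < 8" "b = L8 ! m" by (rule L8_obtain)
  obtain n where n: "n < 8" "d = L8 ! n" by (rule L8_obtain)
  note nth = not_False_eq_True length_list_update L8 nth_list_update_eq nth_list_update_neq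
  have inj: "(b = L8 ! i) = (m = i)" "(d = L8 ! i) = (n = i)" if "i < 8" for i
    unfolding m n by (rule L8_inj; use m n that in simp)+
  consider "m = j" "n = k" | "m = k" "n = j" | "m \<noteq> j" "m \<noteq> k" | "n \<noteq> j" "n \<noteq> k" | "m = n" by metis
  then show ?thesis
  proof cases
    case 1
    then have "L8[j := b, k := d] = L8" using m n by (simp only: list_update_id)
    then show ?thesis using 1 assms by (simp only: eps_id inj) simp
  next
    case 2
    then have "eps (L8[j := b, k := d]) = - eps L8"
      using m n assms alternating_swap[OF alternating_eps, of L8 8 j k] L8 by simp
    then show ?thesis using 2 assms by (simp only: eps_id inj) simp
  next
    case 3
    then have "eps (L8[j := b, k := d]) = 0"
      using m assms by (intro eps_repeated[of _ j m]) (simp_all only: nth not_sym)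
    then show ?thesis using 3 assms by (simp only: inj) simp
  next
    case 4
    then have "eps (L8[j := b, k := d]) = 0"
      using n assms by (intro eps_repeated[of _ k n]) (simp_all only: nth not_sym)
    then show ?thesis using 4 assms by (simp only: inj) simp
  next
    case 5
    then have "eps (L8[j := b, k := d]) = 0"
      using m n assms by (intro eps_repeated[of _ j k]) (simp_all only: nth not_sym)
    then show ?thesis using 5 assms by (simp only: inj) auto
  qed
qed

context adapted_frame
begin

text \<open>A top-degree form has one independent component. It is constantly 1 in the frame, and
  its correction terms are diagonal entries of the skew connection form.\<close>

lemma nabla_vol:
  assumes x: "x \<in> U" and J: "length J = 9" shows "nabla \<Gamma> vol c x J = 0"
proof -
  obtain m I where mI: "J = m # I" "length I = 8" using J by (cases J) auto
  have diff: "length I = 8 \<Longrightarrow> (\<lambda>y. vol c y I) differentiable (at x)" for I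
    by (rule smooth_on_imp_differentiable[OF smooth_vol x])
  let ?s = "\<lambda>I. nabla \<Gamma> vol c x (m # I)"
  have alt: "alternating 8 ?s"
    by (rule alternating_nabla[OF open_U x]) (simp_all add: alternating_vol diff)
  have v: "tev (vol c y) (fr y I) = eps I" if "y \<in> U" "length I = 8" for y I
    using frame_vol[OF that] by (simp add: comps_tev)
  have "tev (nabla \<Gamma> vol c x) (u # fr x L8) = 0" for u
  proof -
    have "dd (\<lambda>y. tev (vol c y) (fr y L8)) x u = dd (\<lambda>y. 1) x u"
      by (rule arg_cong[where f = "\<lambda>F. F u"], rule dd_cong_open[OF open_U x]) (simp only: v L8 eps_id)
    moreover have "(\<Sum>k<length L8. \<Sum>\<^sub>8b. A x u (L8 ! k) b * tev (vol c x) (fr x (L8[k := b]))) = 0"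
    proof (rule sum.neutral, rule ballI)
      fix k assume "k \<in> {..<length L8}"
      then have k: "k < 8" by (simp only: L8 lessThan_iff)
      have "(\<Sum>\<^sub>8b. A x u (L8 ! k) b * tev (vol c x) (fr x (L8[k := b]))) = A x u (L8 ! k) (L8 ! k)"
        by (simp only: v[OF x] L8 length_list_update eps_update1[OF k] sum_mult_delta)
      then show "(\<Sum>\<^sub>8b. A x u (L8 ! k) b * tev (vol c x) (fr x (L8[k := b]))) = 0"
        using A_skew[OF x, of u "L8 ! k" "L8 ! k"] by linarith
    qed
    ultimately show ?thesis
      using frame_dd[OF x, of L8 vol u] diff by (simp only: L8 dd_const add_0_right)
  qed
  then have "comps (\<lambda>a. E a x) ?s L8 = 0"
    using tev.simps(2)[of "nabla \<Gamma> vol c x" "axis m 1" "fr x L8"]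
    by (simp only: comps_tev sum_axis)
  then have z: "comps (\<lambda>a. E a x) ?s I = 0" if "length I = 8" for I
    using alternating_top[OF alternating_comps[OF alt] that] by simp
  have 0: "comps (\<lambda>a. E a x) (\<lambda>I. 0) I = 0" for I by (simp add: comps_def)
  have "?s I = 0"
    by (rule comps_inject[where t = "\<lambda>I. 0" and s = ?s, OF frame[OF x] _ mI(2)]) (simp only: z 0)
  then show ?thesis by (simp add: mI)
qed

lemma vol_update1:
  assumes x: "x \<in> U" and j: "j < 8"
  shows "tev (vol c x) ((fr x L8)[j := V]) = gdot (g c x) V (E (L8 ! j) x)"
proof -
  have len: "j < length (fr x L8)" using j by (simp only: length_map L8)
  have "tev (vol c x) ((fr x L8)[j := V]) = tev (vol c x) ((fr x L8)[j := (\<Sum>\<^sub>8b. gdot (g c x) V (E b x) *\<^sub>R E b x)])"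
    using expand[OF x, of V] by simp
  also have "\<dots> = (\<Sum>\<^sub>8b. gdot (g c x) V (E b x) * tev (vol c x) (fr x (L8[j := b])))"
    by (simp only: tev_update_sum[OF len] tev_update_scaleR[OF len] map_update real_scaleR_def)
  also have "\<dots> = (\<Sum>\<^sub>8b. gdot (g c x) V (E b x) * (if b = L8 ! j then 1 else 0))"
    using frame_vol[OF x] by (simp only: comps_tev[symmetric] L8 length_list_update eps_update1[OF j])
  finally show ?thesis by (simp only: sum_mult_delta)
qed

lemma vol_update2:
  assumes x: "x \<in> U" and j: "j < 8" "k < 8" "j \<noteq> k"
  shows "tev (vol c x) ((fr x L8)[j := V, k := W])
    = gdot (g c x) V (E (L8 ! j) x) * gdot (g c x) W (E (L8 ! k) x) - gdot (g c x) V (E (L8 ! k) x) * gdot (g c x) W (E (L8 ! j) x)"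
proof -
  let ?v = "\<lambda>b. gdot (g c x) V (E b x)" and ?w = "\<lambda>d. gdot (g c x) W (E d x)"
  have len': "i < 8 \<Longrightarrow> i < length ((fr x L8)[n := B])" for i n B by (simp only: length_list_update length_map L8)
  have "tev (vol c x) ((fr x L8)[j := V, k := W]) = tev (vol c x) ((fr x L8)[k := W, j := (\<Sum>\<^sub>8b. ?v b *\<^sub>R E b x)])"
    using expand[OF x, of V] list_update_swap[OF j(3), of "fr x L8" V W] by simp
  also have "\<dots> = (\<Sum>\<^sub>8b. ?v b * tev (vol c x) ((fr x (L8[j := b]))[k := (\<Sum>\<^sub>8d. ?w d *\<^sub>R E d x)]))"
    using expand[OF x, of W] list_update_swap[OF j(3), of "fr x L8" "E b x" W for b]
    by (simp only: tev_update_sum[OF len'[OF j(1)]] tev_update_scaleR[OF len'[OF j(1)]] map_update real_scaleR_def)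
  also have "\<dots> = (\<Sum>\<^sub>8b. ?v b * (\<Sum>\<^sub>8d. ?w d * tev (vol c x) (fr x (L8[j := b, k := d]))))"
    by (simp only: tev_update_sum[OF len'[OF j(2)]] tev_update_scaleR[OF len'[OF j(2)]] map_update real_scaleR_def)
  also have "\<dots> = (\<Sum>\<^sub>8b d. (?v b * (if b = L8 ! j then 1 else 0)) * (?w d * (if d = L8 ! k then 1 else 0))
     - (?v b * (if b = L8 ! k then 1 else 0)) * (?w d * (if d = L8 ! j then 1 else 0)))"
    unfolding sum_distrib_left
    using frame_vol[OF x] by (intro sum.cong refl) (simp only: comps_tev[symmetric] L8 length_list_update eps_update2[OF j] algebra_simps)
  finally show ?thesis
    by (simp only: sum_subtractf sum_product[symmetric] sum_mult_delta)
qed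

abbreviation "\<theta> \<equiv> lee_form g vol \<Psi>"

definition t where "t a x = tev (\<theta> c x) [E a x]"
definition sharp where "sharp x = (\<Sum>\<^sub>8a. t a x *\<^sub>R E a x)"
abbreviation "N x v w \<equiv> tev (nabla \<Gamma> \<theta> c x) [v, w]"

lemma t_tcontr: "x \<in> U \<Longrightarrow> t a x = - (1 / 7) * tcontr (Tf x) a"
  unfolding t_def by (rule lee_tcontr)

text \<open>\<open>lee_tcontr\<close> expresses the components by the torsion and the frame, which
  are smooth; so no smoothness of the inverse metric inside the Hodge star has to be
  established.\<close>

lemma smooth_t: "smooth_on U (t a)"
proof (rule smooth_on_cong[OF open_U])
  show "- (1 / 7) * tcontr (Tf x) a = t a x" if "x \<in> U" for x using t_tcontr[OF that] by simp
  have "smooth_on U (\<lambda>x. tev (torsion g \<Gamma> c x) (map (\<lambda>B. B x) [E i, E j, E k]))" for i j k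
    by (rule smooth_on_tev[OF open_U]) (auto intro: smooth_T smooth_E)
  then show "smooth_on U (\<lambda>x. - (1 / 7) * tcontr (Tf x) a)"
    unfolding tcontr_eq Tf_def
    by (intro smooth_on_mult smooth_on_sum smooth_on_const open_U) simp
qed

lemma smooth_sharp: "smooth_on U sharp"
  unfolding sharp_def[abs_def] by (intro smooth_on_sum smooth_on_scaleR open_U smooth_t smooth_E)

lemma linear_theta: "linear (\<lambda>v. tev (\<theta> c x) [v])"
  using linear_tev[of "\<theta> c x" "[]" "[]"] by simp

text \<open>\<open>sharp\<close> is the metric dual of the Lee form. Read backwards, this identity
  gives the coordinate components of the form from smooth data.\<close>

lemma gdot_sharp: assumes x: "x \<in> U" shows "gdot (g c x) v (sharp x) = tev (\<theta> c x) [v]"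
proof -
  have "tev (\<theta> c x) [v] = tev (\<theta> c x) [\<Sum>\<^sub>8b. gdot (g c x) v (E b x) *\<^sub>R E b x]"
    using expand[OF x, of v] by simp
  also have "\<dots> = (\<Sum>\<^sub>8b. gdot (g c x) v (E b x) * t b x)"
    by (simp add: linear_sum[OF linear_theta] linear_cmul[OF linear_theta] t_def)
  finally show ?thesis
    by (simp add: sharp_def linear_sum[OF linear_gdot(2)] linear_cmul[OF linear_gdot(2)] mult.commute)
qed

lemma smooth_theta: assumes "length I = 1" shows "smooth_on U (\<lambda>x. \<theta> c x I)"
proof -
  obtain i where I: "I = [i]" using assms by (auto simp: length_Suc_conv)
  have *: "smooth_on U (\<lambda>x. tev (g c x) (map (\<lambda>B. B x) [\<lambda>x. axis i 1, sharp]))"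
    by (rule smooth_on_tev[OF open_U]) (auto intro: smooth_g smooth_sharp smooth_on_const)
  have "tev (\<theta> c x) (map (\<lambda>i. axis i 1) [i]) = \<theta> c x [i]" for x by (rule tev_axis)
  then show ?thesis
    unfolding I using gdot_sharp by (intro smooth_on_cong[OF open_U _ *]) (simp add: gdot_tev[symmetric])
qed

lemma diff_theta: "x \<in> U \<Longrightarrow> length I = 1 \<Longrightarrow> (\<lambda>y. \<theta> c y I) differentiable (at x)"
  by (rule smooth_on_imp_differentiable[OF smooth_theta])

lemma dd_theta: "x \<in> U \<Longrightarrow> dd (\<lambda>y. tev (\<theta> c y) [v]) x u = N x u v + tev (\<theta> c x) [gam x u v]"
  using tev_nabla[where t = \<theta> and vs = "[v]" and x = x and u = u] diff_theta[of x] by (simp add: lessThan_Suc)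

lemma dd_t: "x \<in> U \<Longrightarrow> dd (t a) x u = N x u (E a x) + (\<Sum>\<^sub>8b. A x u a b * t b x)"
  using frame_dd[of x "[a]" \<theta> u] diff_theta[of x] by (simp add: lessThan_Suc t_def[abs_def])

lemma diff_t: "x \<in> U \<Longrightarrow> t a differentiable (at x)"
  by (rule smooth_on_imp_differentiable[OF smooth_t])

text \<open>Differentiate \<open>t_tcontr\<close> in two ways; the connection-form terms on both
  sides are the same and drop out.\<close>

lemma N_tcontr: assumes x: "x \<in> U" shows "N x u (E a x) = - (1 / 7) * tcontr (Xf x u) a"
proof -
  have "dd (t a) x u = dd (\<lambda>y. - (1 / 7) * tcontr (Tf y) a) x u"
    by (rule arg_cong[where f = "\<lambda>F. F u"], rule dd_cong_open[OF open_U x]) (simp add: t_tcontr)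
  also have "\<dots> = - (1 / 7) * (tcontr (Xf x u) a + (\<Sum>\<^sub>8b. A x u a b * tcontr (Tf x) b))"
    by (simp only: dd_cmult_fun[OF tcontr_dd(2)[OF x]] tcontr_dd(1)[OF x])
  also have "\<dots> = - (1 / 7) * tcontr (Xf x u) a + (\<Sum>\<^sub>8b. A x u a b * t b x)"
    by (simp add: t_tcontr[OF x] distrib_left sum_distrib_left sum_negf mult.left_commute)
  finally show ?thesis using dd_t[OF x, of a u] by simp
qed

text \<open>Raising the index commutes with the metric connection: the connection terms from the
  coefficients \<open>t\<close> and from the frame cancel by \<open>A_skew\<close>.\<close>

lemma cov_sharp:
  assumes x: "x \<in> U"
  shows "dd sharp x u + gam x u (sharp x) = (\<Sum>\<^sub>8a. N x u (E a x) *\<^sub>R E a x)"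
proof -
  have "dd sharp x u = (\<Sum>\<^sub>8a. t a x *\<^sub>R dd (E a) x u + dd (t a) x u *\<^sub>R E a x)"
    unfolding sharp_def[abs_def]
    by (rule dd_eqI) (intro has_derivative_sum has_derivative_scaleR has_dd diff_t[OF x] differentiable_E[OF x])
  moreover have "gam x u (sharp x) = (\<Sum>\<^sub>8a. t a x *\<^sub>R gam x u (E a x))"
    by (simp add: sharp_def linear_sum[OF linear_Gam(2)] Gam_bilinear)
  ultimately have "dd sharp x u + gam x u (sharp x)
      = (\<Sum>\<^sub>8a. dd (t a) x u *\<^sub>R E a x) + (\<Sum>\<^sub>8a. t a x *\<^sub>R (dd (E a) x u + gam x u (E a x)))"
    by (simp add: sum.distrib scaleR_add_right)
  also have "(\<Sum>\<^sub>8a. t a x *\<^sub>R (dd (E a) x u + gam x u (E a x))) = (\<Sum>\<^sub>8a b. (t a x * A x u a b) *\<^sub>R E b x)"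
    by (simp add: frame_cov[OF x] scaleR_sum_right)
  also have "\<dots> = (\<Sum>\<^sub>8b a. (t a x * A x u a b) *\<^sub>R E b x)"
    by (rule sum.swap)
  also have "\<dots> = (\<Sum>\<^sub>8a. (- (\<Sum>\<^sub>8b. A x u a b * t b x)) *\<^sub>R E a x)"
  proof (rule sum.cong[OF refl])
    fix b
    have "(\<Sum>\<^sub>8a. t a x * A x u a b) = - (\<Sum>\<^sub>8a. A x u b a * t a x)"
      unfolding sum_negf[symmetric] by (rule sum.cong[OF refl]) (simp add: A_skew[OF x, of u b] mult.commute)
    then show "(\<Sum>\<^sub>8a. (t a x * A x u a b) *\<^sub>R E b x) = (- (\<Sum>\<^sub>8a. A x u b a * t a x)) *\<^sub>R E b x"
      by (simp add: scaleR_sum_left[symmetric])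
  qed
  finally show ?thesis by (simp add: dd_t[OF x] scaleR_add_left sum.distrib scaleR_minus_left sum_negf)
qed

end

section \<open>Coclosedness of the Lee form as a vanishing trace\<close>

locale instanton_chart = adapted_frame U c \<Gamma> g \<Psi> vol E
  for U c and \<Gamma> :: "'a chart \<Rightarrow> christoffel" and g \<Psi> vol E +
  assumes closed: "\<And>x I. x \<in> U \<Longrightarrow> length I = 2 \<Longrightarrow> ext_d (\<theta> c) x I = 0"
    and coclosed: "\<And>x. x \<in> U \<Longrightarrow> codiff (g c) (vol c) (\<theta> c) x [] = 0"
    and instanton: "\<And>x i j k l. x \<in> U \<Longrightarrow>
      pcontr (\<lambda>a b. gdot (g c x) (rm x (E a x) (E b x) (E i x)) (E j x)) k l
        = 2 * gdot (g c x) (rm x (E k x) (E l x) (E i x)) (E j x)"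
begin

text \<open>The star of a 1-form is the interior product of the volume form with the dual vector
  field. This turns the codifferential into a divergence.\<close>

lemma star_theta:
  assumes y: "y \<in> U" and J: "length J = 7"
  shows "star (g c) (vol c) (\<theta> c) y J = (\<Sum>\<^sub>8i. sharp y $ i * vol c y (i # J))"
proof (rule comps_inject[OF frame[OF y] _ J])
  fix J :: "8 list" assume J: "length J = 7"
  let ?C = "comps (\<lambda>a. E a y)"
  have "?C (star (g c) (vol c) (\<theta> c) y) J = hstar (?C (\<theta> c y)) J"
    unfolding star_def by (rule comps_hodge[OF frame[OF y] frame_vol[OF y]]) (simp_all add: J)
  also have "\<dots> = (\<Sum>\<^sub>8a. t a y * eps (a # J))"
    using sum_lists_Suc[where n = 0 and F = "\<lambda>I. ?C (\<theta> c y) I * eps (I @ J)"]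
    by (simp add: hstar_def J t_def comps_tev)
  also have "\<dots> = (\<Sum>\<^sub>8a. t a y * tev (vol c y) (E a y # fr y J))"
    using frame_vol[OF y, of "a # J" for a] J by (simp add: comps_tev)
  also have "\<dots> = tev (vol c y) (sharp y # fr y J)"
    using linear_sum[OF linear_tev[of "vol c y" "[]" "fr y J"], of "\<lambda>a. t a y *\<^sub>R E a y" UNIV]
      linear_cmul[OF linear_tev[of "vol c y" "[]" "fr y J"]]
    by (simp add: sharp_def)
  also have "\<dots> = ?C (\<lambda>J. \<Sum>\<^sub>8i. sharp y $ i * vol c y (i # J)) J"
    by (simp add: comps_tev tev_sum tev_cmult tev.simps(2))
  finally show "?C (star (g c) (vol c) (\<theta> c) y) J = ?C (\<lambda>J. \<Sum>\<^sub>8i. sharp y $ i * vol c y (i # J)) J" .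
qed

lemma tev_contraction:
  "tev (\<lambda>J. \<Sum>\<^sub>8i. V $ i * s (i # J)) vs = tev s (V # vs)"
  by (simp add: tev_sum tev_cmult tev.simps(2))

text \<open>The possible discrepancy between the codifferential and the trace of the covariant
  derivative for a connection with torsion. By \<open>vol_update2\<close> it is the pairing of the
  Lee form with the trace \<open>Tf x a b b\<close> of the torsion, which vanishes by
  skewness.\<close>

lemma divergence_sharp:
  assumes x: "x \<in> U"
  shows "(\<Sum>j<8. \<Sum>k\<in>{..<8} - {j}. tev (vol c x) ((fr x L8)[j := sharp x, k := gam x (E (L8 ! j) x) (E (L8 ! k) x)])) = 0"
proof -
  define \<gamma> where "\<gamma> a b d = gdot (g c x) (gam x (E a x) (E b x)) (E d x)" for a b d
  have s: "gdot (g c x) (sharp x) (E a x) = t a x" for a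
    using gdot_sharp[OF x, of "E a x"] gdot_sym[OF x] by (simp add: t_def)
  have "(\<Sum>j<8. \<Sum>k\<in>{..<8} - {j}. tev (vol c x) ((fr x L8)[j := sharp x, k := gam x (E (L8 ! j) x) (E (L8 ! k) x)]))
    = (\<Sum>j<8. \<Sum>k\<in>{..<8} - {j}. t (L8 ! j) x * \<gamma> (L8 ! j) (L8 ! k) (L8 ! k) - t (L8 ! k) x * \<gamma> (L8 ! j) (L8 ! k) (L8 ! j))"
    unfolding \<gamma>_def s[symmetric] by (intro sum.cong refl vol_update2[OF x]) auto
  also have "\<dots> = (\<Sum>j<8. \<Sum>k<8. t (L8 ! j) x * \<gamma> (L8 ! j) (L8 ! k) (L8 ! k) - t (L8 ! k) x * \<gamma> (L8 ! j) (L8 ! k) (L8 ! j))"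
    by (rule sum.cong[OF refl], rule sum.mono_neutral_left) auto
  also have "\<dots> = (\<Sum>\<^sub>8a b. t a x * \<gamma> a b b - t b x * \<gamma> a b a)"
    unfolding sum_L8[of "\<lambda>b. t a x * \<gamma> a b b - t b x * \<gamma> a b a" for a] by (rule sum_L8)
  also have "\<dots> = (\<Sum>\<^sub>8a b. t a x * \<gamma> a b b) - (\<Sum>\<^sub>8a b. t b x * \<gamma> a b a)"
    by (simp only: sum_subtractf)
  also have "(\<Sum>\<^sub>8a b. t b x * \<gamma> a b a) = (\<Sum>\<^sub>8a b. t a x * \<gamma> b a b)"
    by (rule sum.swap)
  also have "(\<Sum>\<^sub>8a b. t a x * \<gamma> a b b) - (\<Sum>\<^sub>8a b. t a x * \<gamma> b a b)
    = (\<Sum>\<^sub>8a b. t a x * Tf x a b b)"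
    by (simp add: Tf_def tev_torsion Tor_def linear_diff[OF linear_gdot(1)] \<gamma>_def sum_subtractf right_diff_distrib)
  also have "\<dots> = 0" by (simp add: skew3_zero[OF Tf_skew[OF x]])
  finally show ?thesis .
qed

text \<open>Evaluate \<open>d\<close> of the star of the Lee form on the full frame. As
  \<open>vol\<close> is parallel, differentiating \<open>sharp\<close> yields the trace of the
  covariant derivative plus the sum of \<open>divergence_sharp\<close>.\<close>

lemma trace_N: assumes x: "x \<in> U" shows "(\<Sum>\<^sub>8a. N x (E a x) (E a x)) = 0"
proof -
  define \<sigma> where "\<sigma> y J = (\<Sum>\<^sub>8i. sharp y $ i * vol c y (i # J))" for y J
  let ?v = "fr x L8"
  have len: "length ?v = 8" by (simp only: length_map L8)
  have nth: "?v ! j = E (L8 ! j) x" if "j < 8" for j using that by (intro nth_map) (simp only: L8)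
  have smooth_\<sigma>: "smooth_on U (\<lambda>y. \<sigma> y J)" if "length J = 7" for J
    unfolding \<sigma>_def using that
    by (intro smooth_on_sum smooth_on_mult smooth_on_nth open_U smooth_sharp smooth_vol) simp
  have diff_\<sigma>: "(\<lambda>y. \<sigma> y J) differentiable (at y)" if "length J = 7" "y \<in> U" for J y
    by (rule smooth_on_imp_differentiable[OF smooth_\<sigma>[OF that(1)] that(2)])
  have alt_\<sigma>: "alternating 7 (\<sigma> y)" if "y \<in> U" for y
  proof (rule alternating_adjI)
    fix xs ys :: "8 list" and a b assume "length xs + length ys + 2 = 7"
    then have "vol c y ((i # xs) @ b # a # ys) = - vol c y ((i # xs) @ a # b # ys)" for i
      by (intro alternating_adj[OF alternating_vol[OF that]]) simp
    then show "\<sigma> y (xs @ b # a # ys) = - \<sigma> y (xs @ a # b # ys)"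
      by (simp add: \<sigma>_def sum_negf)
  qed
  have ext: "ext_d (star (g c) (vol c) (\<theta> c)) x I = ext_d \<sigma> x I" if "length I = 8" for I
    unfolding ext_d_def
  proof (intro sum.cong refl arg_cong2[where f = "(*)"] pdiff_cong_open[OF open_U x])
    fix j y assume "j \<in> {..<length I}" "y \<in> U"
    then show "star (g c) (vol c) (\<theta> c) y (take j I @ drop (Suc j) I) = \<sigma> y (take j I @ drop (Suc j) I)"
      unfolding \<sigma>_def using that by (intro star_theta) simp_all
  qed
  have alt: "alternating 8 (ext_d \<sigma> x)"
    using alternating_ext_d[OF open_U x alt_\<sigma>] diff_\<sigma>[OF _ x] by simp
  have "0 = comps (\<lambda>a. E a x) (hodge (g c x) (vol c x) (ext_d (star (g c) (vol c) (\<theta> c)) x)) []"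
    using coclosed[OF x] by (simp add: codiff_def star_def comps_Nil)
  also have "\<dots> = hstar (comps (\<lambda>a. E a x) (ext_d (star (g c) (vol c) (\<theta> c)) x)) []"
    by (rule comps_hodge[OF frame[OF x] frame_vol[OF x]]) simp_all
  also have "\<dots> = (\<Sum>I | length I = 8. comps (\<lambda>a. E a x) (ext_d (star (g c) (vol c) (\<theta> c)) x) I * eps I) / fact 8"
    by (simp add: hstar_def)
  also have "\<dots> = (\<Sum>I | length I = 8. comps (\<lambda>a. E a x) (ext_d \<sigma> x) I * eps I) / fact 8"
  proof -
    have "comps (\<lambda>a. E a x) (ext_d (star (g c) (vol c) (\<theta> c)) x) I = comps (\<lambda>a. E a x) (ext_d \<sigma> x) I" if "length I = 8" for I
      by (rule comps_cong) (simp add: ext that)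
    then show ?thesis by simp
  qed
  also have "\<dots> = comps (\<lambda>a. E a x) (ext_d \<sigma> x) L8"
    using sum_alternating_pair[of 8 "comps (\<lambda>a. E a x) (ext_d \<sigma> x)" "[]" eps L8] alternating_comps[OF alt] alternating_eps L8 eps_id
    by simp
  also have "\<dots> = (\<Sum>j<8. (-1) ^ j * dd (\<lambda>y. tev (\<sigma> y) (take j ?v @ drop (Suc j) ?v)) x (E (L8 ! j) x))"
  proof -
    have "length I = 7" if "Suc (length I) = length ?v" for I :: "8 list" using that len by simp
    then have "tev (ext_d \<sigma> x) ?v = (\<Sum>j<length ?v. (-1) ^ j * dd (\<lambda>y. tev (\<sigma> y) (take j ?v @ drop (Suc j) ?v)) x (?v ! j))"
      by (intro tev_ext_d diff_\<sigma>[OF _ x])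
    also have "\<dots> = (\<Sum>j<8. (-1) ^ j * dd (\<lambda>y. tev (\<sigma> y) (take j ?v @ drop (Suc j) ?v)) x (E (L8 ! j) x))"
      unfolding len by (rule sum.cong[OF refl]) (simp only: nth lessThan_iff)
    finally show ?thesis by (simp only: comps_tev)
  qed
  \<comment> \<open>Moving \<open>sharp\<close> from the front to slot \<open>j\<close> costs
    \<open>(-1) ^ j\<close>, which cancels the sign of the exterior derivative.\<close>
  also have "\<dots> = (\<Sum>j<8. dd (\<lambda>y. tev (vol c y) (?v[j := sharp y])) x (E (L8 ! j) x))"
  proof (rule sum.cong[OF refl])
    fix j :: nat assume "j \<in> {..<8}"
    then have j: "j < 8" by simp
    have m: "tev (\<sigma> y) (take j ?v @ drop (Suc j) ?v) = (-1) ^ j * tev (vol c y) (?v[j := sharp y])" if "y \<in> U" for y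
    proof -
      have "tev (\<sigma> y) (take j ?v @ drop (Suc j) ?v) = tev (vol c y) (sharp y # take j ?v @ drop (Suc j) ?v)"
        unfolding \<sigma>_def by (rule tev_contraction)
      also have "\<dots> = (-1) ^ length (take j ?v) * tev (vol c y) (take j ?v @ sharp y # drop (Suc j) ?v)"
        by (rule tev_move[OF alternating_vol[OF that]]) (use j len in \<open>simp del: list.map\<close>)
      finally show ?thesis using j len by (simp add: upd_conv_take_nth_drop del: list.map)
    qed
    have d: "(\<lambda>y. tev (vol c y) (?v[j := sharp y])) differentiable (at x)"
      using dd_tev_slot(2)[of ?v "vol c" x sharp j] len j smooth_on_imp_differentiable[OF smooth_vol x]
        smooth_on_imp_differentiable[OF smooth_sharp x] by (simp del: list.map)
    have "dd (\<lambda>y. tev (\<sigma> y) (take j ?v @ drop (Suc j) ?v)) x (E (L8 ! j) x)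
        = dd (\<lambda>y. (-1) ^ j * tev (vol c y) (?v[j := sharp y])) x (E (L8 ! j) x)"
      by (rule arg_cong[where f = "\<lambda>F. F (E (L8 ! j) x)"], rule dd_cong_open[OF open_U x]) (rule m)
    also have "\<dots> = (-1) ^ j * dd (\<lambda>y. tev (vol c y) (?v[j := sharp y])) x (E (L8 ! j) x)"
      by (rule dd_cmult_fun[OF d])
    finally show "(-1) ^ j * dd (\<lambda>y. tev (\<sigma> y) (take j ?v @ drop (Suc j) ?v)) x (E (L8 ! j) x)
        = dd (\<lambda>y. tev (vol c y) (?v[j := sharp y])) x (E (L8 ! j) x)"
      by (simp del: list.map flip: power_mult_distrib add: mult.assoc[symmetric])
  qed
  \<comment> \<open>The other arguments are frozen at \<open>x\<close>, so parallelism of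
    \<open>vol\<close> inserts \<open>gam\<close> into every slot. In slot \<open>j\<close> it
    completes the derivative of \<open>sharp\<close> to a covariant one, which
    \<open>cov_sharp\<close> evaluates; the other slots form the sum over \<open>k\<close>.\<close>
  also have "\<dots> = (\<Sum>j<8. N x (E (L8 ! j) x) (E (L8 ! j) x)
      + (\<Sum>k\<in>{..<8} - {j}. tev (vol c x) (?v[j := sharp x, k := gam x (E (L8 ! j) x) (E (L8 ! k) x)])))"
  proof (rule sum.cong[OF refl])
    fix j :: nat assume "j \<in> {..<8}"
    then have j: "j < 8" by simp
    let ?e = "E (L8 ! j) x"
    have j': "j < length ?v" using j len by simp
    have "dd (\<lambda>y. tev (vol c y) (?v[j := sharp y])) x ?e
      = dd (\<lambda>y. tev (vol c y) (?v[j := sharp x])) x ?e + tev (vol c x) (?v[j := dd sharp x ?e])"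
      using len smooth_on_imp_differentiable[OF smooth_vol x]
      by (intro dd_tev_slot(1) j' smooth_on_imp_differentiable[OF smooth_sharp x]) (simp del: list.map)
    also have "dd (\<lambda>y. tev (vol c y) (?v[j := sharp x])) x ?e
      = (\<Sum>k<8. tev (vol c x) (?v[j := sharp x, k := gam x ?e (?v[j := sharp x] ! k)]))"
    proof -
      have l: "length (?v[j := sharp x]) = 8" by (simp only: length_list_update len)
      have "length I = 9" if "length I = Suc (length (?v[j := sharp x]))" for I :: "8 list" using that l by simp
      then have "dd (\<lambda>y. tev (vol c y) (?v[j := sharp x])) x ?e
        = (\<Sum>k<length (?v[j := sharp x]). tev (vol c x) (?v[j := sharp x, k := gam x ?e (?v[j := sharp x] ! k)]))"
        by (intro parallel_dd nabla_vol[OF x] smooth_on_imp_differentiable[OF smooth_vol x]) (simp_all only: l)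
      then show ?thesis by (simp only: l)
    qed
    also have "\<dots> = tev (vol c x) (?v[j := sharp x, j := gam x ?e (?v[j := sharp x] ! j)])
      + (\<Sum>k\<in>{..<8} - {j}. tev (vol c x) (?v[j := sharp x, k := gam x ?e (?v[j := sharp x] ! k)]))"
      by (rule sum.remove) (use j in auto)
    also have "?v[j := sharp x, j := gam x ?e (?v[j := sharp x] ! j)] = ?v[j := gam x ?e (sharp x)]"
      using j' by (simp only: list_update_overwrite nth_list_update_eq)
    also have "(\<Sum>k\<in>{..<8} - {j}. tev (vol c x) (?v[j := sharp x, k := gam x ?e (?v[j := sharp x] ! k)]))
      = (\<Sum>k\<in>{..<8} - {j}. tev (vol c x) (?v[j := sharp x, k := gam x ?e (E (L8 ! k) x)]))"
    proof (rule sum.cong[OF refl])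
      fix k assume "k \<in> {..<8} - {j}"
      then have k: "k < 8" "j \<noteq> k" by auto
      have "?v[j := sharp x] ! k = E (L8 ! k) x"
        by (rule trans[OF nth_list_update_neq[OF k(2)] nth[OF k(1)]])
      then show "tev (vol c x) (?v[j := sharp x, k := gam x ?e (?v[j := sharp x] ! k)])
        = tev (vol c x) (?v[j := sharp x, k := gam x ?e (E (L8 ! k) x)])" by (simp only:)
    qed
    also have "tev (vol c x) (?v[j := gam x ?e (sharp x)]) + (\<Sum>k\<in>{..<8} - {j}. tev (vol c x) (?v[j := sharp x, k := gam x ?e (E (L8 ! k) x)]))
        + tev (vol c x) (?v[j := dd sharp x ?e])
      = tev (vol c x) (?v[j := dd sharp x ?e + gam x ?e (sharp x)])
        + (\<Sum>k\<in>{..<8} - {j}. tev (vol c x) (?v[j := sharp x, k := gam x ?e (E (L8 ! k) x)]))"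
      by (simp only: tev_update_add[OF j'] add_ac)
    also have "tev (vol c x) (?v[j := dd sharp x ?e + gam x ?e (sharp x)]) = gdot (g c x) (\<Sum>\<^sub>8a. N x ?e (E a x) *\<^sub>R E a x) ?e"
      by (simp only: cov_sharp[OF x] vol_update1[OF x j])
    also have "\<dots> = N x ?e ?e"
      by (simp only: linear_sum[OF linear_gdot(1)] linear_cmul[OF linear_gdot(1)] gdot_frame[OF x] real_scaleR_def sum_mult_delta)
    finally show "dd (\<lambda>y. tev (vol c y) (?v[j := sharp y])) x ?e
      = N x ?e ?e + (\<Sum>k\<in>{..<8} - {j}. tev (vol c x) (?v[j := sharp x, k := gam x ?e (E (L8 ! k) x)]))" .
  qed
  also have "\<dots> = (\<Sum>\<^sub>8a. N x (E a x) (E a x))"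
    by (simp only: sum.distrib divergence_sharp[OF x] sum_L8[of "\<lambda>a. N x (E a x) (E a x)"] add_0_right)
  finally show ?thesis by simp
qed

end

section \<open>The Bochner formula for the squared length of the Lee form\<close>

context instanton_chart
begin

abbreviation "Z x u v w \<equiv> tev (nabla \<Gamma> (nabla \<Gamma> \<theta>) c x) [u, v, w]"

lemma smooth_N: "length I = 2 \<Longrightarrow> smooth_on U (\<lambda>y. nabla \<Gamma> \<theta> c y I)"
  by (rule smooth_on_nabla[where k = 1]) (simp_all add: smooth_theta)

lemma diff_N: "x \<in> U \<Longrightarrow> length I = 2 \<Longrightarrow> (\<lambda>y. nabla \<Gamma> \<theta> c y I) differentiable (at x)"
  by (rule smooth_on_imp_differentiable[OF smooth_N])

lemma N_linear: "linear (\<lambda>v. N x v w)" "linear (\<lambda>w. N x v w)"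
  using linear_tev[of "nabla \<Gamma> \<theta> c x" "[]" "[w]"] linear_tev[of "nabla \<Gamma> \<theta> c x" "[v]" "[]"] by simp_all

lemmas N_add = linear_add[OF N_linear(1)] linear_add[OF N_linear(2)] linear_diff[OF N_linear(1)] linear_diff[OF N_linear(2)]

lemma Z_eq: "x \<in> U \<Longrightarrow> Z x u v w = dd (\<lambda>y. N y v w) x u - N x (gam x u v) w - N x v (gam x u w)"
  using tev_nabla[where t = "nabla \<Gamma> \<theta>" and vs = "[v, w]" and x = x and u = u] diff_N[of x]
  by (simp add: lessThan_Suc numeral_eq_Suc)

lemma diff_N_const: "x \<in> U \<Longrightarrow> (\<lambda>y. N y v w) differentiable (at x)"
  using dd_tev_const(2)[of "[v, w]" "nabla \<Gamma> \<theta> c" x] diff_N[of x] by simp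

lemma diff_sharp: "x \<in> U \<Longrightarrow> sharp differentiable (at x)"
  by (rule smooth_on_imp_differentiable[OF smooth_sharp])

text \<open>Commuting two covariant derivatives of a 1-form. The second one also differentiates the
  slot of the first, which leaves the torsion term.\<close>

lemma ricci_identity:
  assumes x: "x \<in> U"
  shows "Z x w v z - Z x v w z = - tev (\<theta> c x) [rm x w v z] - N x (tor x w v) z"
proof -
  have Z: "Z x w v z = dd (\<lambda>y. dd (\<lambda>y. tev (\<theta> c y) [z]) y v) x w - N x w (gam x v z) - tev (\<theta> c x) [gam x w (gam x v z)]
      - tev (\<theta> c x) [dd (\<lambda>y. gam y v z) x w] - N x (gam x w v) z - N x v (gam x w z)" for w v
  proof -
    have f: "dd (\<lambda>y. tev (\<theta> c y) [gam y v z]) x w = dd (\<lambda>y. tev (\<theta> c y) [gam x v z]) x w + tev (\<theta> c x) [dd (\<lambda>y. gam y v z) x w]"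
      "(\<lambda>y. tev (\<theta> c y) [gam y v z]) differentiable (at x)"
      using dd_tev_slot(1)[of "[0]" "\<theta> c" x "\<lambda>y. gam y v z" 0 w] dd_tev_slot(2)[of "[0]" "\<theta> c" x "\<lambda>y. gam y v z" 0] diff_theta[OF x] differentiable_gam[OF x] by simp_all
    have "smooth_on U (\<lambda>y. tev (\<theta> c y) [z])"
      using smooth_on_tev_const[OF open_U, of "[z]" "\<theta> c"] smooth_theta by simp
    from smooth_on_imp_differentiable[OF smooth_on_dd_const[OF open_U this] x]
    have d: "(\<lambda>y. dd (\<lambda>y. tev (\<theta> c y) [z]) y v) differentiable (at x)" .
    have "dd (\<lambda>y. N y v z) x w = dd (\<lambda>y. dd (\<lambda>y. tev (\<theta> c y) [z]) y v - tev (\<theta> c y) [gam y v z]) x w"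
      by (rule arg_cong[where f = "\<lambda>F. F w"], rule dd_cong_open[OF open_U x]) (simp add: dd_theta)
    also have "\<dots> = dd (\<lambda>y. dd (\<lambda>y. tev (\<theta> c y) [z]) y v) x w - dd (\<lambda>y. tev (\<theta> c y) [gam y v z]) x w"
      by (rule dd_diff_fun[OF d f(2)])
    finally show ?thesis by (simp add: Z_eq[OF x] f(1) dd_theta[OF x])
  qed
  have s: "dd (\<lambda>y. dd (\<lambda>y. tev (\<theta> c y) [z]) y v) x w = dd (\<lambda>y. dd (\<lambda>y. tev (\<theta> c y) [z]) y w) x v"
    by (rule smooth_dd_dd_commute[OF open_U x])
      (use smooth_on_tev_const[OF open_U, of "[z]" "\<theta> c"] smooth_theta in simp)
  have r: "tev (\<theta> c x) [rm x w v z] = tev (\<theta> c x) [dd (\<lambda>y. gam y v z) x w] - tev (\<theta> c x) [dd (\<lambda>y. gam y w z) x v]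
      + tev (\<theta> c x) [gam x w (gam x v z)] - tev (\<theta> c x) [gam x v (gam x w z)]"
    unfolding Rm_def by (simp only: linear_add[OF linear_theta] linear_diff[OF linear_theta])
  have "N x (tor x w v) z = N x (gam x w v) z - N x (gam x v w) z"
    unfolding Tor_def by (simp only: N_add)
  then show ?thesis unfolding Z r s by linarith
qed

text \<open>The partial derivatives in \<open>d\<close> are covariant ones up to \<open>gam\<close>
  terms, and antisymmetrising \<open>gam\<close> gives the torsion.\<close>

lemma closed_N:
  assumes x: "x \<in> U" shows "N x v w - N x w v = - tev (torsion g \<Gamma> c x) [v, w, sharp x]"
proof -
  have "tev (ext_d (\<theta> c) x) [v, w] = 0"
    by (rule tev_zero) (simp add: closed[OF x])
  then have "dd (\<lambda>y. tev (\<theta> c y) [w]) x v - dd (\<lambda>y. tev (\<theta> c y) [v]) x w = 0"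
    using tev_ext_d[of "[v, w]" "\<theta> c" x] diff_theta[OF x] by (simp add: lessThan_Suc numeral_eq_Suc)
  then have "N x v w - N x w v = - (tev (\<theta> c x) [gam x v w] - tev (\<theta> c x) [gam x w v])"
    by (simp add: dd_theta[OF x])
  then show ?thesis
    by (simp only: tev_torsion gdot_sharp[OF x] Tor_def linear_diff[OF linear_theta])
qed

text \<open>The covariant derivative of \<open>closed_N\<close>; the last term comes from
  differentiating \<open>sharp\<close>.\<close>

lemma closed_Z:
  assumes x: "x \<in> U"
  shows "Z x u v w - Z x u w v = - tev (nabla \<Gamma> (torsion g \<Gamma>) c x) [u, v, w, sharp x]
    - tev (torsion g \<Gamma> c x) [v, w, dd sharp x u + gam x u (sharp x)]"
proof -
  let ?T = "\<lambda>a b d. tev (torsion g \<Gamma> c x) [a, b, d]"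
  have dT: "length I = 3 \<Longrightarrow> (\<lambda>y. torsion g \<Gamma> c y I) differentiable (at x)" for I
    by (rule smooth_on_imp_differentiable[OF smooth_T x])
  have s: "dd (\<lambda>y. tev (torsion g \<Gamma> c y) [v, w, sharp y]) x u = dd (\<lambda>y. tev (torsion g \<Gamma> c y) [v, w, sharp x]) x u + ?T v w (dd sharp x u)"
    "(\<lambda>y. tev (torsion g \<Gamma> c y) [v, w, sharp y]) differentiable (at x)"
    using dd_tev_slot(1)[of "[v, w, 0]" "torsion g \<Gamma> c" x sharp 2 u] dd_tev_slot(2)[of "[v, w, 0]" "torsion g \<Gamma> c" x sharp 2] dT diff_sharp[OF x] by (simp_all add: numeral_eq_Suc)
  have "dd (\<lambda>y. N y v w) x u - dd (\<lambda>y. N y w v) x u = dd (\<lambda>y. N y v w - N y w v) x u"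
    by (rule dd_diff_fun[symmetric]) (rule diff_N_const[OF x])+
  also have "\<dots> = dd (\<lambda>y. (-1) * tev (torsion g \<Gamma> c y) [v, w, sharp y]) x u"
    by (rule arg_cong[where f = "\<lambda>F. F u"], rule dd_cong_open[OF open_U x]) (simp add: closed_N)
  also have "\<dots> = - dd (\<lambda>y. tev (torsion g \<Gamma> c y) [v, w, sharp y]) x u"
    by (subst dd_cmult_fun[OF s(2)]) simp
  also have "\<dots> = - (tev (nabla \<Gamma> (torsion g \<Gamma>) c x) [u, v, w, sharp x] + ?T (gam x u v) w (sharp x) + ?T v (gam x u w) (sharp x)
      + ?T v w (gam x u (sharp x)) + ?T v w (dd sharp x u))"
    using tev_nabla[where t = "torsion g \<Gamma>" and vs = "[v, w, sharp x]" and x = x and u = u] dT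
    by (simp add: s(1) lessThan_Suc numeral_eq_Suc)
  finally have "dd (\<lambda>y. N y v w) x u - dd (\<lambda>y. N y w v) x u = - tev (nabla \<Gamma> (torsion g \<Gamma>) c x) [u, v, w, sharp x]
      - ?T (gam x u v) w (sharp x) - ?T v (gam x u w) (sharp x) - ?T v w (gam x u (sharp x)) - ?T v w (dd sharp x u)" by simp
  moreover have "?T v w (dd sharp x u + gam x u (sharp x)) = ?T v w (dd sharp x u) + ?T v w (gam x u (sharp x))"
    using linear_add[OF linear_tev[of "torsion g \<Gamma> c x" "[v, w]" "[]"]] by simp
  ultimately show ?thesis
    using closed_N[OF x, of "gam x u v" w] closed_N[OF x, of v "gam x u w"] unfolding Z_eq[OF x] by linarith
qed

text \<open>The derivative of \<open>trace_N\<close>. The two connection terms cancel because the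
  connection form is skew.\<close>

lemma trace_Z: assumes x: "x \<in> U" shows "(\<Sum>\<^sub>8a. Z x u (E a x) (E a x)) = 0"
proof -
  have d: "dd (\<lambda>y. N y (E a y) (E a y)) x u = Z x u (E a x) (E a x)
      + ((\<Sum>\<^sub>8b. A x u a b * N x (E b x) (E a x)) + (\<Sum>\<^sub>8b. A x u a b * N x (E a x) (E b x)))" for a
    using frame_dd[OF x, of "[a, a]" "nabla \<Gamma> \<theta>" u] diff_N[OF x] by (simp add: lessThan_Suc numeral_eq_Suc)
  have diff: "(\<lambda>y. N y (E a y) (E a y)) differentiable (at x)" for a
    using differentiable_tev[of "[E a, E a]" "nabla \<Gamma> \<theta> c" x] diff_N[OF x] differentiable_E[OF x] by auto
  have "(\<Sum>\<^sub>8a. dd (\<lambda>y. N y (E a y) (E a y)) x u) = dd (\<lambda>y. \<Sum>\<^sub>8a. N y (E a y) (E a y)) x u"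
    by (rule dd_sum[symmetric]) (rule diff)
  also have "\<dots> = dd (\<lambda>y. 0) x u"
    by (rule arg_cong[where f = "\<lambda>F. F u"], rule dd_cong_open[OF open_U x]) (rule trace_N)
  finally have "(\<Sum>\<^sub>8a. dd (\<lambda>y. N y (E a y) (E a y)) x u) = 0" by (simp only: dd_const)
  moreover have "(\<Sum>\<^sub>8a b. A x u a b * N x (E b x) (E a x)) = - (\<Sum>\<^sub>8a b. A x u a b * N x (E a x) (E b x))"
    by (rule sum_skew[where F = "\<lambda>b a. N x (E b x) (E a x)"]) (rule A_skew[OF x])
  ultimately show ?thesis by (simp add: d sum.distrib)
qed

definition Rf where "Rf x i j k l = gdot (g c x) (rm x (E i x) (E j x) (E k x)) (E l x)"

text \<open>Connects the analysis with the pointwise algebra. \<open>holonomy\<close> follows from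
  \<open>curvature_parallel\<close> for \<open>\<Psi>\<close> and \<open>stabilizer_pcontr\<close>;
  \<open>closed\<close> is \<open>closed_N\<close> multiplied by -7.\<close>

lemma point: assumes x: "x \<in> U" shows "instanton_point (Tf x) (\<lambda>m. Xf x (E m x)) (Rf x)"
proof
  show "skew3 (Tf x)" "skew3 (Xf x (E m x))" for m by (rule Tf_skew[OF x] Xf_skew[OF x])+
  show "Rf x j i k l = - Rf x i j k l" for i j k l
    unfolding Rf_def using rm_skew12[of x "E j x" "E i x" "E k x"] by (simp add: linear_neg[OF linear_gdot(1)])
  show 34: "Rf x i j l k = - Rf x i j k l" for i j k l
    unfolding Rf_def by (rule rm_skew34[OF x])
  show "Rf x i j k l + Rf x j k i l + Rf x k i j l = Xf x (E i x) j k l + Xf x (E j x) k i l + Xf x (E k x) i j l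
       + (\<Sum>\<^sub>8s. Tf x i j s * Tf x s k l + Tf x j k s * Tf x s i l + Tf x k i s * Tf x s j l)" for i j k l
  proof -
    have T: "tev (torsion g \<Gamma> c x) [tor x (E a x) (E b x), E d x, E e x] = (\<Sum>\<^sub>8s. Tf x a b s * Tf x s d e)" for a b d e
      using linear_sum[OF linear_tev[of "torsion g \<Gamma> c x" "[]" "[E d x, E e x]"], of "\<lambda>s. Tf x a b s *\<^sub>R E s x" UNIV]
        linear_cmul[OF linear_tev[of "torsion g \<Gamma> c x" "[]" "[E d x, E e x]"]]
      by (simp add: tor_frame[OF x] Tf_def)
    show ?thesis
      using bianchi[OF x, of "E i x" "E j x" "E k x" "E l x"] by (simp add: Rf_def Xf_def T sum.distrib)
  qed
  show "pcontr (\<lambda>a b. Rf x a b i j) k l = 2 * Rf x k l i j" for i j k l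
    unfolding Rf_def by (rule instanton[OF x])
  show "pcontr (Rf x i j) k l = 2 * Rf x i j k l" for i j k l
  proof (rule stabilizer_pcontr)
    show "skew2 (Rf x i j)" unfolding skew2_def using 34 by blast
    fix p q r s
    have lin: "tev (\<Psi> c x) (vs[n := rm x (E i x) (E j x) (E m x)]) = (\<Sum>\<^sub>8s. Rf x i j m s * tev (\<Psi> c x) (vs[n := E s x]))"
      if "n < length vs" for vs n m
      using expand[OF x, of "rm x (E i x) (E j x) (E m x)"] tev_update_sum[OF that, of "\<Psi> c x" "\<lambda>s. Rf x i j m s *\<^sub>R E s x" UNIV]
      by (simp add: Rf_def tev_update_scaleR[OF that])
    show "(\<Sum>\<^sub>8s'. Rf x i j p s' * psi s' q r s + Rf x i j q s' * psi p s' r s + Rf x i j r s' * psi p q s' s + Rf x i j s s' * psi p q r s') = 0"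
      using curvature_parallel[of "[E p x, E q x, E r x, E s x]" \<Psi> x "E i x" "E j x"] smooth_\<Psi> parallel_\<Psi> x
        lin[of 0 "[E p x, E q x, E r x, E s x]" p] lin[of 1 "[E p x, E q x, E r x, E s x]" q]
        lin[of 2 "[E p x, E q x, E r x, E s x]" r] lin[of 3 "[E p x, E q x, E r x, E s x]" s]
      by (simp add: lessThan_Suc numeral_eq_Suc tev_\<Psi>[OF x] sum.distrib)
  qed
  show "tcontr (Xf x (E i x)) j - tcontr (Xf x (E j x)) i = - (\<Sum>\<^sub>8s. Tf x i j s * tcontr (Tf x) s)" for i j
  proof -
    have "tev (torsion g \<Gamma> c x) [E i x, E j x, sharp x] = (\<Sum>\<^sub>8s. t s x * Tf x i j s)"
      using linear_sum[OF linear_tev[of "torsion g \<Gamma> c x" "[E i x, E j x]" "[]"], of "\<lambda>s. t s x *\<^sub>R E s x" UNIV]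
        linear_cmul[OF linear_tev[of "torsion g \<Gamma> c x" "[E i x, E j x]" "[]"]]
      by (simp add: sharp_def Tf_def)
    also have "\<dots> = - (1 / 7) * (\<Sum>\<^sub>8s. Tf x i j s * tcontr (Tf x) s)"
      by (simp only: t_tcontr[OF x] sum_distrib_left mult_ac)
    finally show ?thesis
      using closed_N[OF x, of "E i x" "E j x"] by (simp add: N_tcontr[OF x])
  qed
qed

definition u where "u x = (\<Sum>\<^sub>8a. (t a x)\<^sup>2)"

lemma dd_u: assumes x: "x \<in> U" shows "dd u x v = 2 * N x v (sharp x)"
proof -
  have "dd u x v = (\<Sum>\<^sub>8a. t a x * dd (t a) x v + dd (t a) x v * t a x)"
    unfolding u_def[abs_def] power2_eq_square
    by (rule dd_eqI) (intro has_derivative_sum has_derivative_mult has_dd diff_t[OF x])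
  also have "\<dots> = 2 * (\<Sum>\<^sub>8a. t a x * N x v (E a x)) + 2 * (\<Sum>\<^sub>8a b. A x v a b * (t b x * t a x))"
    by (simp add: dd_t[OF x] distrib_left distrib_right sum.distrib sum_distrib_left sum_distrib_right mult_ac)
  also have "(\<Sum>\<^sub>8a b. A x v a b * (t b x * t a x)) = 0"
  proof (rule skew2_sum_symmetric)
    show "skew2 (A x v)" unfolding skew2_def using A_skew[OF x] by blast
    show "t i x * t j x = t j x * t i x" for i j by (rule mult.commute)
  qed
  also have "(\<Sum>\<^sub>8a. t a x * N x v (E a x)) = N x v (sharp x)"
    by (simp add: sharp_def linear_sum[OF N_linear(2)] linear_cmul[OF N_linear(2)])
  finally show ?thesis by simp
qed

lemma dd_dd_u:
  assumes x: "x \<in> U"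
  shows "dd (\<lambda>y. dd u y v) x w = 2 * Z x w v (sharp x) + dd u x (gam x w v) + 2 * (\<Sum>\<^sub>8a. N x w (E a x) * N x v (E a x))"
proof -
  have s: "dd (\<lambda>y. N y v (sharp y)) x w = dd (\<lambda>y. N y v (sharp x)) x w + N x v (dd sharp x w)"
    "(\<lambda>y. N y v (sharp y)) differentiable (at x)"
    using dd_tev_slot(1)[of "[v, 0]" "nabla \<Gamma> \<theta> c" x sharp 1 w] dd_tev_slot(2)[of "[v, 0]" "nabla \<Gamma> \<theta> c" x sharp 1] diff_N[OF x] diff_sharp[OF x] by simp_all
  have "dd (\<lambda>y. dd u y v) x w = dd (\<lambda>y. 2 * N y v (sharp y)) x w"
    by (rule arg_cong[where f = "\<lambda>F. F w"], rule dd_cong_open[OF open_U x]) (rule dd_u)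
  also have "\<dots> = 2 * dd (\<lambda>y. N y v (sharp x)) x w + 2 * N x v (dd sharp x w)"
    by (simp add: dd_cmult_fun[OF s(2)] s(1))
  also have "\<dots> = 2 * Z x w v (sharp x) + 2 * N x (gam x w v) (sharp x) + 2 * N x v (dd sharp x w + gam x w (sharp x))"
    using Z_eq[OF x, of w v "sharp x"] by (simp add: N_add)
  also have "N x v (dd sharp x w + gam x w (sharp x)) = (\<Sum>\<^sub>8a. N x w (E a x) * N x v (E a x))"
    by (simp add: cov_sharp[OF x] linear_sum[OF N_linear(2)] linear_cmul[OF N_linear(2)])
  finally show ?thesis by (simp add: dd_u[OF x])
qed

text \<open>The second derivative is rearranged until its trace falls on \<open>trace_Z\<close>. The
  torsion terms picked up on the way cancel, and the curvature term is \<open>\<rho>\<close> on the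
  Lee direction, which \<open>ricci_lee\<close> converts into a first-order expression.\<close>

lemma trace_Z_sharp:
  assumes x: "x \<in> U"
  shows "(\<Sum>\<^sub>8a. Z x (E a x) (E a x) (sharp x)) = - (7 / 2) * N x (sharp x) (sharp x)"
proof -
  interpret p: instanton_point "Tf x" "\<lambda>m. Xf x (E m x)" "Rf x" by (rule point[OF x])
  let ?s = "sharp x" and ?T = "\<lambda>a b d. tev (torsion g \<Gamma> c x) [a, b, d]"
  define S where "S a b = ?T (E a x) ?s (E b x)" for a b
  have T_skew: "?T b a d = - ?T a b d" "?T a d b = - ?T a b d" for a b d
    using tev_alternating_adj[OF alternating_T[OF x], of "[]" "[d]" b a] tev_alternating_adj[OF alternating_T[OF x], of "[a]" "[]" d b] by simp_all
  have S_skew: "S b a = - S a b" for a b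
    unfolding S_def using T_skew(2)[of ?s "E b x" "E a x"] T_skew(1)[of ?s "E a x" "E b x"] T_skew(1)[of ?s "E b x" "E a x"] by linarith
  have X0: "tev (nabla \<Gamma> (torsion g \<Gamma>) c x) [w, v, ?s, ?s] = 0" for v w
  proof -
    have "alternating 3 (\<lambda>J. nabla \<Gamma> (torsion g \<Gamma>) c x (m # J))" for m
      by (rule alternating_nabla[OF open_U x]) (simp_all add: alternating_T smooth_on_imp_differentiable[OF smooth_T x])
    from tev_alternating_adj[OF this, where xs = "[v]" and ys = "[]" and a = "?s" and b = "?s"] show ?thesis
      by (simp add: tev.simps(2)[of _ w])
  qed
  \<comment> \<open>\<open>closed_Z\<close> exchanges the last two arguments and
    \<open>ricci_identity\<close> the first two. The two sums are transposes of each other, so with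
    \<open>S\<close> skew they cancel after summation over \<open>a\<close>.\<close>
  have 1: "Z x (E a x) (E a x) ?s = Z x ?s (E a x) (E a x) - tev (\<theta> c x) [rm x (E a x) ?s (E a x)]
      - (\<Sum>\<^sub>8b. S a b * N x (E b x) (E a x)) - (\<Sum>\<^sub>8b. S a b * N x (E a x) (E b x))" for a
  proof -
    have "?T (E a x) ?s (dd sharp x (E a x) + gam x (E a x) ?s) = (\<Sum>\<^sub>8b. S a b * N x (E a x) (E b x))"
      using linear_sum[OF linear_tev[of "torsion g \<Gamma> c x" "[E a x, ?s]" "[]"], of "\<lambda>b. N x (E a x) (E b x) *\<^sub>R E b x" UNIV]
        linear_cmul[OF linear_tev[of "torsion g \<Gamma> c x" "[E a x, ?s]" "[]"]]
      by (simp add: cov_sharp[OF x] S_def mult.commute)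
    moreover have "N x (tor x (E a x) ?s) (E a x) = (\<Sum>\<^sub>8b. S a b * N x (E b x) (E a x))"
    proof -
      have "N x (tor x (E a x) ?s) (E a x) = N x (\<Sum>\<^sub>8b. gdot (g c x) (tor x (E a x) ?s) (E b x) *\<^sub>R E b x) (E a x)"
        using expand[OF x, of "tor x (E a x) ?s"] by simp
      then show ?thesis
        by (simp add: linear_sum[OF N_linear(1)] linear_cmul[OF N_linear(1)] S_def tev_torsion)
    qed
    ultimately show ?thesis
      using closed_Z[OF x, of "E a x" "E a x" ?s] ricci_identity[OF x, of "E a x" ?s "E a x"] X0[of "E a x" "E a x"] by linarith
  qed
  have "(\<Sum>\<^sub>8a b. S a b * N x (E b x) (E a x)) = - (\<Sum>\<^sub>8a b. S a b * N x (E a x) (E b x))"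
    by (rule sum_skew[where F = "\<lambda>b a. N x (E b x) (E a x)"]) (rule S_skew)
  then have "(\<Sum>\<^sub>8a. Z x (E a x) (E a x) ?s) = - (\<Sum>\<^sub>8a. tev (\<theta> c x) [rm x (E a x) ?s (E a x)])"
    unfolding 1 by (simp add: sum_subtractf trace_Z[OF x])
  also have "(\<Sum>\<^sub>8a. tev (\<theta> c x) [rm x (E a x) ?s (E a x)]) = (\<Sum>\<^sub>8a m n. t m x * t n x * Rf x m a n a)"
  proof (rule sum.cong[OF refl])
    fix a
    have "tev (\<theta> c x) [rm x (E a x) ?s (E a x)] = gdot (g c x) (rm x (E a x) ?s (E a x)) ?s"
      by (rule gdot_sharp[OF x, symmetric])
    also have "\<dots> = gdot (g c x) (\<Sum>\<^sub>8m. t m x *\<^sub>R rm x (E a x) (E m x) (E a x)) ?s"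
      by (rule arg_cong[where f = "\<lambda>v. gdot (g c x) v ?s"])
        (simp add: sharp_def linear_sum[OF linear_rm(2)[OF x]] linear_cmul[OF linear_rm(2)[OF x]])
    also have "\<dots> = (\<Sum>\<^sub>8n m. t m x * t n x * Rf x a m a n)"
      by (simp add: sharp_def linear_sum[OF linear_gdot(1)] linear_cmul[OF linear_gdot(1)] linear_sum[OF linear_gdot(2)]
        linear_cmul[OF linear_gdot(2)] Rf_def sum_distrib_left mult_ac)
    also have "\<dots> = (\<Sum>\<^sub>8m n. t m x * t n x * Rf x a m a n)"
      by (rule sum.swap)
    also have "\<dots> = (\<Sum>\<^sub>8m n. t m x * t n x * Rf x m a n a)"
      using p.R12 p.R34 by (intro sum.cong refl) (metis minus_minus)
    finally show "tev (\<theta> c x) [rm x (E a x) ?s (E a x)] = (\<Sum>\<^sub>8m n. t m x * t n x * Rf x m a n a)" .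
  qed
  also have "\<dots> = (\<Sum>\<^sub>8m n a. t m x * t n x * Rf x m a n a)"
    by (rule sum3_rotate[of "\<lambda>m n a. t m x * t n x * Rf x m a n a"])
  also have "\<dots> = (\<Sum>\<^sub>8m n. p.\<rho> m n * (tcontr (Tf x) m * tcontr (Tf x) n)) / 49"
    by (simp add: p.\<rho>_def t_tcontr[OF x] sum_distrib_left sum_divide_distrib mult_ac)
  also have "\<dots> = - (1 / 2) * (\<Sum>\<^sub>8l m. tcontr (Xf x (E l x)) m * (tcontr (Tf x) l * tcontr (Tf x) m)) / 49"
    by (simp only: p.ricci_lee)
  \<comment> \<open>The two factors \<open>tcontr (Tf x)\<close> are -7 times the Lee form and
    absorb the 49; the factor \<open>tcontr (Xf x (E l x))\<close> is -7 times its derivative, and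
    \<open>(-1/2) * (-7) = 7/2\<close>.\<close>
  also have "\<dots> = (7 / 2) * (\<Sum>\<^sub>8l m. t l x * (t m x * N x (E l x) (E m x)))"
    by (simp add: t_tcontr[OF x] N_tcontr[OF x] sum_distrib_left sum_divide_distrib mult_ac)
  also have "(\<Sum>\<^sub>8l m. t l x * (t m x * N x (E l x) (E m x))) = N x ?s ?s"
    by (subst sum.swap) (simp add: sharp_def linear_sum[OF N_linear(1)] linear_cmul[OF N_linear(1)]
        linear_sum[OF N_linear(2)] linear_cmul[OF N_linear(2)] sum_distrib_left mult_ac)
  finally show ?thesis by simp
qed

text \<open>By \<open>ricci_lee\<close> the Ricci term is a derivative of \<open>u\<close> along the Lee field, so it joins the first-order part.\<close>

lemma bochner:
  assumes x: "x \<in> U"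
  shows "(\<Sum>\<^sub>8a. dd (\<lambda>y. dd u y (E a x)) x (E a x))
    = dd u x ((\<Sum>\<^sub>8a. gam x (E a x) (E a x)) - (7 / 2) *\<^sub>R sharp x) + 2 * (\<Sum>\<^sub>8a b. (N x (E a x) (E b x))\<^sup>2)"
proof -
  have "dd u x ((\<Sum>\<^sub>8a. gam x (E a x) (E a x)) - (7 / 2) *\<^sub>R sharp x)
     = (\<Sum>\<^sub>8a. dd u x (gam x (E a x) (E a x))) - (7 / 2) * dd u x (sharp x)"
    by (simp add: dd_u[OF x] N_add linear_sum[OF N_linear(1)] linear_cmul[OF N_linear(1)] sum_distrib_left)
  then show ?thesis
    using trace_Z_sharp[OF x]
    by (simp add: dd_dd_u[OF x] sum.distrib dd_u[OF x, of "sharp x"] power2_eq_square flip: sum_distrib_left)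
qed

end

subsection \<open>Hopf's maximum principle\<close>

lemma smooth_on_id: "smooth_on S (\<lambda>x::pt. x)"
proof -
  have "pdiff i (\<lambda>x::pt. x) = (\<lambda>x. axis i 1)" for i
    by (auto simp: pdiff_def fun_eq_iff)
  then show ?thesis unfolding smooth_on_iff[of S "\<lambda>x. x"] by (simp add: smooth_on_const)
qed

lemma second_derivative_test:
  fixes f :: "pt \<Rightarrow> real"
  assumes S: "open S" "q \<in> S" and f: "smooth_on S f" and max: "\<And>y. y \<in> S \<Longrightarrow> f y \<le> f q"
  shows "dd f q v = 0" "dd (\<lambda>y. dd f y v) q v \<le> 0"
proof -
  have diff: "f differentiable (at y)" if "y \<in> S" for y
    by (rule smooth_on_imp_differentiable[OF f that])
  have diff2: "(\<lambda>y. dd f y v) differentiable (at q)"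
    using smooth_on_dd_const[OF S(1) f, of v] S(2) by (rule smooth_on_imp_differentiable)
  have "dd f q = (\<lambda>v. 0)"
    by (rule differential_zero_maxmin[OF S(2) S(1) has_dd[OF diff[OF S(2)]]]) (use max in auto)
  then show 0: "dd f q v = 0" by simp
  have line: "((\<lambda>s. q + s *\<^sub>R v) has_derivative (\<lambda>h. h *\<^sub>R v)) (at s)" for s :: real
    by (auto intro!: derivative_eq_intros)
  have real: "((\<lambda>s. h (q + s *\<^sub>R v)) has_real_derivative dd h (q + s *\<^sub>R v) v) (at s)"
    if "h differentiable (at (q + s *\<^sub>R v))" for h :: "pt \<Rightarrow> real" and s
  proof -
    have "((\<lambda>s. h (q + s *\<^sub>R v)) has_derivative (\<lambda>r. dd h (q + s *\<^sub>R v) (r *\<^sub>R v))) (at s)"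
      by (rule has_derivative_compose[OF line has_dd[OF that]])
    then show ?thesis
      by (simp add: has_field_derivative_def dd_scaleR[OF that] mult.commute[of _ "dd h (q + s *\<^sub>R v) v"])
  qed
  show "dd (\<lambda>y. dd f y v) q v \<le> 0"
  proof (rule ccontr)
    assume "\<not> dd (\<lambda>y. dd f y v) q v \<le> 0"
    then have pos: "0 < dd (\<lambda>y. dd f y v) q v" by simp
    have "((\<lambda>s. dd f (q + s *\<^sub>R v) v) has_real_derivative dd (\<lambda>y. dd f y v) q v) (at 0)"
      using real[of "\<lambda>y. dd f y v" 0] diff2 by simp
    from DERIV_pos_inc_right[OF this pos] obtain d where d: "d > 0" "\<And>h. 0 < h \<Longrightarrow> h < d \<Longrightarrow> 0 < dd f (q + h *\<^sub>R v) v"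
      using 0 by auto
    have "continuous (at 0) (\<lambda>s::real. q + s *\<^sub>R v)" by (intro continuous_intros)
    then have "\<forall>\<^sub>F s in at 0. q + s *\<^sub>R v \<in> S"
      unfolding continuous_at using topological_tendstoD[OF _ S(1)] S(2) by force
    then obtain e where e: "e > 0" "\<And>s. s \<noteq> 0 \<Longrightarrow> \<bar>s\<bar> < e \<Longrightarrow> q + s *\<^sub>R v \<in> S"
      by (auto simp: eventually_at)
    define b where "b = min d e / 2"
    have b: "0 < b" "b < d" "b < e" using d(1) e(1) by (auto simp: b_def)
    have inS: "q + s *\<^sub>R v \<in> S" if "0 \<le> s" "s \<le> b" for s
      using e(2)[of s] S(2) that b by (cases "s = 0") auto
    obtain s where "0 < s" "s < b" "f (q + b *\<^sub>R v) - f (q + 0 *\<^sub>R v) = (b - 0) * dd f (q + s *\<^sub>R v) v"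
      using MVT2[of 0 b "\<lambda>s. f (q + s *\<^sub>R v)" "\<lambda>s. dd f (q + s *\<^sub>R v) v"] b(1) real[OF diff[OF inS]] by blast
    moreover from this have "0 < b * dd f (q + s *\<^sub>R v) v" using d(2)[of s] b by (intro mult_pos_pos) auto
    ultimately have "f q < f (q + b *\<^sub>R v)" by simp
    then show False using max[OF inS[of b]] b by simp
  qed
qed

text \<open>Hopf's comparison function. In its second derivative the term with
  \<open>\<alpha>\<^sup>2\<close> dominates for large \<open>\<alpha>\<close> in directions not
  orthogonal to \<open>x - z\<close>.\<close>

lemma gauss_barrier:
  fixes z :: pt and \<alpha> :: real
  defines "\<phi> \<equiv> \<lambda>x. exp (- \<alpha> * ((x - z) \<bullet> (x - z)))"
  shows "open S \<Longrightarrow> smooth_on S \<phi>"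
    and "dd \<phi> x v = - 2 * \<alpha> * ((x - z) \<bullet> v) * \<phi> x"
    and "dd (\<lambda>y. dd \<phi> y v) x v = \<phi> x * (4 * \<alpha>\<^sup>2 * ((x - z) \<bullet> v)\<^sup>2 - 2 * \<alpha> * (v \<bullet> v))"
proof -
  show "smooth_on S \<phi>" if "open S"
  proof -
    have "smooth_on S (\<lambda>x. \<Sum>\<^sub>8i. (x $ i - z $ i) * (x $ i - z $ i))"
      by (intro smooth_on_sum smooth_on_mult smooth_on_diff smooth_on_nth smooth_on_id smooth_on_const that)
    then have "smooth_on S (\<lambda>x. (x - z) \<bullet> (x - z))" by (simp add: inner_vec_def)
    then show ?thesis unfolding \<phi>_def
      by (intro smooth_on_exp smooth_on_mult smooth_on_const that)
  qed
  have 1: "dd \<phi> x v = - 2 * \<alpha> * ((x - z) \<bullet> v) * \<phi> x" for x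
    unfolding \<phi>_def
    by (rule dd_eqI) (auto intro!: derivative_eq_intros simp: inner_commute algebra_simps)
  then show "dd \<phi> x v = - 2 * \<alpha> * ((x - z) \<bullet> v) * \<phi> x" .
  have "\<phi> differentiable (at x)"
    unfolding \<phi>_def by (auto intro!: derivative_eq_intros simp: differentiable_def)
  then have d: "(\<phi> has_derivative dd \<phi> x) (at x)" by (rule has_dd)
  have "dd (\<lambda>y. - 2 * \<alpha> * ((y - z) \<bullet> v) * \<phi> y) x v
    = - 2 * \<alpha> * ((x - z) \<bullet> v) * dd \<phi> x v + - 2 * \<alpha> * (v \<bullet> v) * \<phi> x"
    by (rule dd_eqI) (auto intro!: derivative_eq_intros d simp: algebra_simps)
  then show "dd (\<lambda>y. dd \<phi> y v) x v = \<phi> x * (4 * \<alpha>\<^sup>2 * ((x - z) \<bullet> v)\<^sup>2 - 2 * \<alpha> * (v \<bullet> v))"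
    unfolding 1 by (simp add: power2_eq_square algebra_simps)
qed

text \<open>If \<open>u < M\<close> somewhere near \<open>x0\<close>, a ball inside the region
  \<open>u < M\<close> touches the set \<open>u = M\<close> at a point \<open>p\<close>. Adding a
  small multiple of the Gaussian centred in that ball creates an interior maximum near
  \<open>p\<close>, where the differential inequality contradicts the second derivative test.
  \<open>span\<close> is the ellipticity of the operator.\<close>

lemma hopf_maximum_principle:
  fixes u :: "pt \<Rightarrow> real" and F :: "8 \<Rightarrow> pt \<Rightarrow> pt" and B :: "pt \<Rightarrow> pt"
  assumes W: "open W" and u: "smooth_on W u" and F: "\<And>a. continuous_on W (F a)" and B: "continuous_on W B"
    and span: "\<And>x v. x \<in> W \<Longrightarrow> (\<And>a. F a x \<bullet> v = 0) \<Longrightarrow> v = 0"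
    and L: "\<And>x. x \<in> W \<Longrightarrow> dd u x (B x) \<le> (\<Sum>\<^sub>8a. dd (\<lambda>y. dd u y (F a x)) x (F a x))"
    and max: "\<And>x. x \<in> W \<Longrightarrow> u x \<le> M" and x0: "x0 \<in> W" "u x0 = M"
  shows "\<exists>r>0. \<forall>y\<in>ball x0 r. y \<in> W \<and> u y = M"
proof -
  obtain r' where r': "r' > 0" "ball x0 r' \<subseteq> W" using W x0 open_contains_ball by blast
  \<comment> \<open>For \<open>y\<close> within \<open>r\<close> of \<open>x0\<close> the nearest
    contact point is within \<open>2 * r\<close> of \<open>x0\<close>, and the small ball around
    that point stays within \<open>3 * r\<close>.\<close>
  define r where "r = r' / 3"
  have r: "r > 0" "ball x0 (3 * r) \<subseteq> W" using r' by (auto simp: r_def)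
  have "u y = M" if y: "y \<in> ball x0 r" for y
  proof (rule ccontr)
    assume ne: "u y \<noteq> M"
    have sub: "cball x0 (2 * r) \<subseteq> W" using r by (auto simp: subset_iff)
    define S where "S = {x \<in> cball x0 (2 * r). u x = M}"
    have cu: "continuous_on W u" by (rule smooth_on_imp_continuous_on[OF u])
    have "closed S"
    proof -
      have "closedin (top_of_set (cball x0 (2 * r))) S"
        using continuous_closedin_preimage_constant[OF continuous_on_subset[OF cu sub], of M] by (simp add: S_def)
      then show ?thesis using closedin_closed_trans closed_cball by blast
    qed
    moreover have "x0 \<in> S" using x0 r by (simp add: S_def)
    ultimately obtain p where p: "p \<in> S" "\<And>q. q \<in> S \<Longrightarrow> dist y p \<le> dist y q"
      using distance_attains_inf[of S y] by blast
    define \<rho> where "\<rho> = dist y p"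
    have \<rho>r: "\<rho> < r" using p(2)[OF \<open>x0 \<in> S\<close>] y by (simp add: \<rho>_def dist_commute)
    have \<rho>0: "\<rho> > 0" using p(1) ne by (auto simp: \<rho>_def S_def)
    have inside: "u q < M" if "dist y q < \<rho>" for q
    proof -
      have "dist x0 q < 2 * r" using dist_triangle[of x0 q y] that y \<rho>r by simp
      then have "q \<in> W" "q \<notin> S" "q \<in> cball x0 (2 * r)" using sub p(2)[of q] that by (auto simp: \<rho>_def)
      then show ?thesis using max[of q] by (auto simp: S_def)
    qed
    \<comment> \<open>The ball of half the radius about the midpoint touches the larger ball only at
      \<open>p\<close>, so all its other points, boundary included, have
      \<open>u < M\<close>.\<close>
    define z where "z = p + (1/2) *\<^sub>R (y - p)"
    define R where "R = \<rho> / 2"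
    have R: "R > 0" "dist z p = R"
      using \<rho>0 by (simp_all add: R_def z_def \<rho>_def dist_norm)
    have ball_z: "u q < M" if "dist z q \<le> R" "q \<noteq> p" for q
    proof (rule inside)
      let ?a = "q - p" and ?n = "y - p"
      have nn: "?n \<bullet> ?n = \<rho>\<^sup>2" by (simp add: \<rho>_def dist_norm power2_norm_eq_inner)
      have "(dist z q)\<^sup>2 \<le> R\<^sup>2" using that(1) by (simp add: power_mono)
      moreover have "(dist z q)\<^sup>2 = ?a \<bullet> ?a - ?a \<bullet> ?n + (?n \<bullet> ?n) / 4"
        unfolding dist_norm power2_norm_eq_inner z_def by (simp add: algebra_simps inner_commute) (simp add: field_simps)
      ultimately have 1: "?a \<bullet> ?a \<le> ?a \<bullet> ?n" unfolding nn R_def by (simp add: power_divide)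
      have "(dist y q)\<^sup>2 = ?a \<bullet> ?a - 2 * (?a \<bullet> ?n) + ?n \<bullet> ?n"
        unfolding dist_norm power2_norm_eq_inner by (simp add: algebra_simps inner_commute)
      moreover have "?a \<bullet> ?a > 0" using that(2) by simp
      ultimately have "(dist y q)\<^sup>2 < \<rho>\<^sup>2" using 1 nn by linarith
      then show "dist y q < \<rho>" using \<rho>0 by (simp add: power2_less_imp_less)
    qed
    \<comment> \<open>Keeps \<open>z\<close> outside \<open>cball p s\<close>, so that
      \<open>P\<close> below has a positive minimum there.\<close>
    define s where "s = R / 2"
    have s: "s > 0" "s < R" using R by (simp_all add: s_def)
    have pW: "dist x0 p < 2 * r" using dist_triangle[of x0 p y] y \<rho>r by (simp add: \<rho>_def)
    have K: "cball p s \<subseteq> W"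
    proof
      fix q assume "q \<in> cball p s"
      then have "dist x0 q < 3 * r" using dist_triangle[of x0 q p] pW \<rho>r s by (simp add: s_def R_def)
      then show "q \<in> W" using r by auto
    qed
    have zK: "x \<noteq> z" if "x \<in> cball p s" for x using that R s by (auto simp: dist_commute)
    \<comment> \<open>With L the sum of the second derivatives along \<open>F a\<close> minus the
      derivative along \<open>B\<close>, these give
      \<open>L \<phi> = 2 \<alpha> \<phi> (2 \<alpha> P - Q)\<close>.\<close>
    define P where "P x = (\<Sum>\<^sub>8a. ((x - z) \<bullet> F a x)\<^sup>2)" for x
    define Q where "Q x = (\<Sum>\<^sub>8a. F a x \<bullet> F a x) - (x - z) \<bullet> B x" for x
    note cont = continuous_on_subset[OF F K] continuous_on_subset[OF B K]
    have "continuous_on (cball p s) P" unfolding P_def[abs_def] by (intro continuous_intros cont)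
    then obtain x1 where x1: "x1 \<in> cball p s" "\<And>x. x \<in> cball p s \<Longrightarrow> P x1 \<le> P x"
      using continuous_attains_inf[of "cball p s" P] s by fastforce
    have "continuous_on (cball p s) Q" unfolding Q_def[abs_def] by (intro continuous_intros cont)
    then obtain x2 where x2: "x2 \<in> cball p s" "\<And>x. x \<in> cball p s \<Longrightarrow> Q x \<le> Q x2"
      using continuous_attains_sup[of "cball p s" Q] s by fastforce
    have "P x1 > 0"
    proof (rule ccontr)
      assume "\<not> P x1 > 0"
      then have "P x1 = 0" using sum_nonneg[of UNIV "\<lambda>a. ((x1 - z) \<bullet> F a x1)\<^sup>2"] by (simp add: P_def)
      then have "F a x1 \<bullet> (x1 - z) = 0" for a
        using sum_nonneg_eq_0_iff[of UNIV "\<lambda>a. ((x1 - z) \<bullet> F a x1)\<^sup>2"] by (simp add: P_def inner_commute)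
      then show False using span[of x1 "x1 - z"] x1(1) K zK[OF x1(1)] by auto
    qed
    \<comment> \<open>Chosen so that \<open>2 \<alpha> P\<close> exceeds the maximum of
      \<open>Q\<close> on the whole small ball, which makes \<open>L \<phi>\<close> positive
      there.\<close>
    define \<alpha> where "\<alpha> = (\<bar>Q x2\<bar> + 1) / (2 * P x1)"
    have \<alpha>: "\<alpha> > 0" "2 * \<alpha> * P x1 = \<bar>Q x2\<bar> + 1" using \<open>P x1 > 0\<close> by (auto simp: \<alpha>_def)
    define \<phi> where "\<phi> = (\<lambda>x. exp (- \<alpha> * ((x - z) \<bullet> (x - z))))"
    note \<phi> = gauss_barrier[where \<alpha> = \<alpha> and z = z, folded \<phi>_def]
    have \<phi>1: "\<phi> x \<le> 1" for x using \<alpha> by (simp add: \<phi>_def)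
    have D: "\<exists>m<M. \<forall>x. x \<in> sphere p s \<inter> cball z R \<longrightarrow> u x \<le> m"
    proof (cases "sphere p s \<inter> cball z R = {}")
      case False
      have "continuous_on (sphere p s \<inter> cball z R) u"
        by (rule continuous_on_subset[OF cu]) (use K in auto)
      moreover have "compact (sphere p s \<inter> cball z R)" by (intro compact_Int compact_sphere compact_cball)
      ultimately obtain x where "x \<in> sphere p s \<inter> cball z R" "\<forall>y\<in>sphere p s \<inter> cball z R. u y \<le> u x"
        using continuous_attains_sup[of "sphere p s \<inter> cball z R" u] False by blast
      moreover from this have "u x < M" using s by (intro ball_z) auto
      ultimately show ?thesis by blast
    qed (auto intro!: exI[of _ "M - 1"])
    then obtain m where m: "m < M" "\<And>x. x \<in> sphere p s \<Longrightarrow> x \<in> cball z R \<Longrightarrow> u x \<le> m" by blast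
    \<comment> \<open>Half the gap: since \<open>\<phi> \<le> 1\<close>, the perturbed function
      stays below \<open>M\<close> on the part of the sphere where \<open>u \<le> m\<close>.\<close>
    define \<epsilon> where "\<epsilon> = (M - m) / 2"
    have \<epsilon>: "\<epsilon> > 0" "m + \<epsilon> < M" using m(1) by (simp_all add: \<epsilon>_def field_simps)
    define f where "f x = u x + \<epsilon> * \<phi> x" for x
    have smooth_f: "smooth_on W f" unfolding f_def[abs_def]
      by (intro smooth_on_add smooth_on_mult smooth_on_const W u \<phi>(1))
    obtain q where q: "q \<in> cball p s" "\<And>x. x \<in> cball p s \<Longrightarrow> f x \<le> f q"
      using continuous_attains_sup[of "cball p s" f] continuous_on_subset[OF smooth_on_imp_continuous_on[OF smooth_f] K] s
      by fastforce
    have fp: "f p = M + \<epsilon> * \<phi> p" using p(1) by (simp add: f_def S_def)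
    have \<phi>0: "\<phi> p > 0" by (simp add: \<phi>_def)
    have "q \<in> ball p s"
    proof (rule ccontr)
      assume "q \<notin> ball p s"
      then have qs: "q \<in> sphere p s" using q(1) by simp
      \<comment> \<open>On the cap inside the ball about \<open>z\<close> the gap
        \<open>M - m\<close> decides; outside it \<open>u \<le> M\<close> still holds while
        \<open>\<phi>\<close> is smaller than at \<open>p\<close>, which lies on the boundary of
        that ball.\<close>
      have "f q < f p"
      proof (cases "q \<in> cball z R")
        case True
        then have "f q \<le> m + \<epsilon> * 1" unfolding f_def using m(2)[OF qs] \<phi>1[of q] \<epsilon>(1) by (intro add_mono mult_left_mono) auto
        then show ?thesis using fp \<epsilon> mult_pos_pos[OF \<epsilon>(1) \<phi>0] by simp
      next
        case False
        then have "R\<^sup>2 < (dist z q)\<^sup>2" using R by (intro power_strict_mono) auto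
        then have "\<phi> q < \<phi> p"
          using \<alpha>(1) R(2) by (simp add: \<phi>_def dist_norm norm_minus_commute power2_norm_eq_inner[symmetric])
        moreover have "u q \<le> M" using max K q(1) by auto
        ultimately show ?thesis using fp \<epsilon>(1) by (simp add: f_def add_le_less_mono)
      qed
      then show False using q(2)[of p] s by simp
    qed
    moreover have "smooth_on (ball p s) f" by (rule smooth_on_subset[OF smooth_f]) (use K in auto)
    ultimately have test: "dd f q v = 0" "dd (\<lambda>y. dd f y v) q v \<le> 0" for v
      using second_derivative_test[of "ball p s" q f v] q(2) by auto
    have qW: "q \<in> W" using q(1) K by auto
    have du: "u differentiable (at y)" "\<phi> differentiable (at y)" if "y \<in> W" for y
      using smooth_on_imp_differentiable[OF u that] smooth_on_imp_differentiable[OF \<phi>(1)[OF W] that] by auto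
    have df: "dd f y v = dd u y v + \<epsilon> * dd \<phi> y v" if "y \<in> W" for y v
      unfolding f_def[abs_def] by (rule dd_eqI) (intro has_derivative_add has_derivative_mult_right has_dd du[OF that])
    have ddf: "dd (\<lambda>y. dd f y v) q v = dd (\<lambda>y. dd u y v) q v + \<epsilon> * dd (\<lambda>y. dd \<phi> y v) q v" for v
    proof -
      have "dd (\<lambda>y. dd f y v) q v = dd (\<lambda>y. dd u y v + \<epsilon> * dd \<phi> y v) q v"
        by (rule arg_cong[where f = "\<lambda>F. F v"], rule dd_cong_open[OF W qW]) (rule df)
      also have "\<dots> = dd (\<lambda>y. dd u y v) q v + \<epsilon> * dd (\<lambda>y. dd \<phi> y v) q v"
        by (rule dd_eqI) (intro has_derivative_add has_derivative_mult_right has_dd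
          smooth_on_imp_differentiable[OF smooth_on_dd_const[OF W u] qW] smooth_on_imp_differentiable[OF smooth_on_dd_const[OF W \<phi>(1)[OF W]] qW])
      finally show ?thesis .
    qed
    have "(\<Sum>\<^sub>8a. dd (\<lambda>y. dd u y (F a q)) q (F a q) + \<epsilon> * dd (\<lambda>y. dd \<phi> y (F a q)) q (F a q)) \<le> 0"
      unfolding ddf[symmetric] by (rule sum_nonpos) (rule test(2))
    then have "(\<Sum>\<^sub>8a. dd (\<lambda>y. dd u y (F a q)) q (F a q)) + \<epsilon> * (\<Sum>\<^sub>8a. dd (\<lambda>y. dd \<phi> y (F a q)) q (F a q)) \<le> 0"
      by (simp add: sum.distrib sum_distrib_left)
    moreover have "dd u q (B q) = - (\<epsilon> * dd \<phi> q (B q))" using test(1)[of "B q"] df[OF qW] by simp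
    ultimately have "\<epsilon> * ((\<Sum>\<^sub>8a. dd (\<lambda>y. dd \<phi> y (F a q)) q (F a q)) - dd \<phi> q (B q)) \<le> 0"
      using L[OF qW] by (simp add: right_diff_distrib)
    moreover have "(\<Sum>\<^sub>8a. dd (\<lambda>y. dd \<phi> y (F a q)) q (F a q)) - dd \<phi> q (B q) = \<phi> q * (2 * \<alpha> * (2 * \<alpha> * P q - Q q))"
    proof -
      have "dd (\<lambda>y. dd \<phi> y v) q v = \<phi> q * (4 * \<alpha>\<^sup>2 * ((q - z) \<bullet> v)\<^sup>2 - 2 * \<alpha> * (v \<bullet> v))" for v
        using gauss_barrier(3)[where z = z and \<alpha> = \<alpha> and v = v and x = q] by (simp only: \<phi>_def)
      then have "(\<Sum>\<^sub>8a. dd (\<lambda>y. dd \<phi> y (F a q)) q (F a q)) = \<phi> q * (4 * \<alpha>\<^sup>2 * P q - 2 * \<alpha> * (\<Sum>\<^sub>8a. F a q \<bullet> F a q))"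
        by (simp only: P_def sum_distrib_left[symmetric] sum_subtractf)
      moreover have "dd \<phi> q (B q) = - 2 * \<alpha> * ((q - z) \<bullet> B q) * \<phi> q"
        using gauss_barrier(2)[where z = z and \<alpha> = \<alpha> and x = q and v = "B q"] by (simp only: \<phi>_def)
      ultimately show ?thesis by (simp add: Q_def power2_eq_square right_diff_distrib left_diff_distrib)
    qed
    moreover have "2 * \<alpha> * P x1 \<le> 2 * \<alpha> * P q" using x1(2)[OF q(1)] \<alpha>(1) by simp
    then have "0 < 2 * \<alpha> * P q - Q q" using \<alpha>(2) x2(2)[OF q(1)] by linarith
    moreover have "\<phi> q > 0" by (simp add: \<phi>_def)
    ultimately show False using \<epsilon>(1) \<alpha>(1) by (simp add: mult_le_0_iff)
  qed
  moreover have "y \<in> W" if "y \<in> ball x0 r" for y using that r by auto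
  ultimately show ?thesis using r(1) by blast
qed

subsection \<open>Adapted coframes\<close>

lemma comps_wedge1:
  assumes \<alpha>: "\<And>i. comps L \<alpha> [i] = \<alpha>' [i]" and \<beta>: "\<And>J. length J = q \<Longrightarrow> comps L \<beta> J = \<beta>' J"
    and I: "length I = Suc q"
  shows "comps L (wedge 1 \<alpha> \<beta>) I = wedge 1 \<alpha>' \<beta>' I"
proof -
  have "comps L \<alpha> J = \<alpha>' J" if "length J = 1" for J
    using that \<alpha> by (auto simp: length_Suc_conv)
  then show ?thesis
    using I \<beta> by (subst comps_wedge) (auto intro!: wedge_cong[where q = q])
qed

lemma comps_e4:
  assumes e: "\<And>a i. comps L (e a) [i] = e' a [i]" and I: "length I = 4"
  shows "comps L (e4 e p q r s) I = e4 e' p q r s I"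
proof -
  have s: "comps L (e s) J = e' s J" if "length J = 1" for J
    using that e by (auto simp: length_Suc_conv)
  note w = comps_wedge1[where \<alpha>' = "e' a" for a, OF e]
  show ?thesis
    unfolding e4_def
    by (rule w[where q = 3], rule w[where q = 2], rule w[where q = 1], rule s) (use I in simp_all)
qed

lemma comps_e8:
  assumes e: "\<And>a i. comps L (e a) [i] = e' a [i]" and I: "length I = 8"
  shows "comps L (e8 e) I = e8 e' I"
proof -
  have s: "comps L (e s) J = e' s J" if "length J = 1" for J s
    using that e by (auto simp: length_Suc_conv)
  note w = comps_wedge1[where \<alpha>' = "e' a" for a, OF e]
  show ?thesis
    unfolding e8_def
    by (rule w[where q = 7], rule w[where q = 6], rule w[where q = 5], rule w[where q = 4],
      rule w[where q = 3], rule w[where q = 2], rule w[where q = 1], rule s) (use I in simp_all)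
qed

lemma comps_spin7_model:
  assumes e: "\<And>a i. comps L (e a) [i] = e' a [i]" and I: "length I = 4"
  shows "comps L (spin7_model e) I = spin7_model e' I"
  unfolding spin7_model_def[abs_def]
  by (simp only: comps_tev tev_add tev_diff tev_minus) (simp only: comps_tev[symmetric] comps_e4[where e' = e', OF e I])

lemma comps_scale: "comps (\<lambda>i. r *\<^sub>R L i) t I = r ^ length I * comps L t I"
  by (induction I arbitrary: t) (simp_all add: comps_Nil comps_Cons sum_distrib_left mult_ac)

text \<open>Scaling the coframe is pulling back by a multiple of the identity, so this is a case of
  the naturality of the model form.\<close>

lemma spin7_model_scale:
  assumes "length I = 4" shows "spin7_model (\<lambda>a I. r * e a I) I = r ^ 4 * spin7_model e I"
proof -
  have "comps (\<lambda>i. r *\<^sub>R axis i 1) (e a) [i] = r * e a [i]" for a i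
    by (simp only: comps_scale comps_std) simp
  then have "comps (\<lambda>i. r *\<^sub>R axis i 1) (spin7_model e) I = spin7_model (\<lambda>a I. r * e a I) I"
    by (rule comps_spin7_model[OF _ assms])
  then show ?thesis by (simp only: comps_scale comps_std assms)
qed

text \<open>Along the dual frame the coframe becomes \<open>std\<close>, and wedge products are
  natural; hence both forms take their model values and the metric becomes the identity.\<close>

lemma adapted_at_dual:
  assumes dual: "\<And>a b. (\<Sum>\<^sub>8i. E a $ i * e b [i]) = (if a = b then 1 else 0)"
    and G: "\<And>i j. G [i, j] = (\<Sum>\<^sub>8a. e a [i] * e a [j])"
    and V: "\<And>I. length I = 8 \<Longrightarrow> V I = e8 e I" and P: "\<And>I. length I = 4 \<Longrightarrow> P I = spin7_model e I"
  shows "adapted_at G V P E"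
proof -
  have std: "comps E (e b) [a] = std b [a]" for a b
    using dual[of a b] by (simp add: comps_Cons comps_Nil)
  have "gdot G (E a) (E b) = (if a = b then 1 else 0)" for a b
  proof -
    have "gdot G (E a) (E b) = (\<Sum>\<^sub>8i j d. (E a $ i * e d [i]) * (E b $ j * e d [j]))"
      by (simp add: gdot_def G sum_distrib_right sum_distrib_left mult_ac)
    also have "\<dots> = (\<Sum>\<^sub>8d i j. (E a $ i * e d [i]) * (E b $ j * e d [j]))"
      by (rule sum3_rotate[symmetric])
    also have "\<dots> = (\<Sum>\<^sub>8d. (if a = d then 1 else 0) * (if b = d then 1 else 0))"
      by (simp only: sum_product[symmetric] dual)
    finally show ?thesis by (simp only: sum_mult_delta)
  qed
  moreover have "comps E P I = spin7_model std I" if "length I = 4" for I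
  proof -
    have "comps E P I = comps E (spin7_model e) I" by (rule comps_cong) (simp add: P that)
    also have "\<dots> = spin7_model std I" by (rule comps_spin7_model[OF std that])
    finally show ?thesis .
  qed
  moreover have "comps E V I = eps I" if "length I = 8" for I
  proof -
    have "comps E V I = comps E (e8 e) I" by (rule comps_cong) (simp add: V that)
    also have "\<dots> = eps I" by (rule comps_e8[OF std that])
    finally show ?thesis .
  qed
  ultimately show ?thesis unfolding adapted_at_def orthonormal_frame_def by blast
qed

lemma dual_frame:
  assumes "local_coframe c W e"
  obtains E :: "8 \<Rightarrow> pt \<Rightarrow> pt" where "\<And>a. smooth_on W (E a)"
    "\<And>x a b. x \<in> W \<Longrightarrow> (\<Sum>\<^sub>8i. E a x $ i * e b x [i]) = (if a = b then 1 else 0)"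
proof -
  define M :: "pt \<Rightarrow> real^8^8" where "M x = (\<chi> a i. e a x [i])" for x
  \<comment> \<open>An inverse chosen point by point; its smooth dependence on the point comes from
    \<open>smooth_on_inverse_matrix\<close>.\<close>
  define N where "N x = (SOME N. M x ** N = mat 1)" for x
  have W: "open W" using assms by (simp add: local_coframe_def)
  have MN: "M x ** N x = mat 1" if "x \<in> W" for x
  proof -
    have "det (M x) \<noteq> 0" using assms that by (simp add: local_coframe_def M_def)
    then have "\<exists>N. M x ** N = mat 1" using invertible_det_nz invertible_def by blast
    then show ?thesis unfolding N_def by (rule someI_ex)
  qed
  have "smooth_on W (\<lambda>x. M x $ i $ j)" for i j
    using assms by (simp add: M_def local_coframe_def)
  from smooth_on_inverse_matrix[OF W this MN] have N: "smooth_on W (\<lambda>x. N x $ i $ j)" for i j .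
  show thesis
  proof (rule that[of "\<lambda>a x. \<chi> i. N x $ i $ a"])
    show "smooth_on W (\<lambda>x. \<chi> i. N x $ i $ a)" for a
      by (rule smooth_on_vec[OF W]) (simp add: N)
    show "(\<Sum>\<^sub>8i. (\<chi> i. N x $ i $ a) $ i * e b x [i]) = (if a = b then 1 else 0)" if "x \<in> W" for x a b
    proof -
      have "(M x ** N x) $ b $ a = mat 1 $ b $ a" by (simp add: MN that)
      then show ?thesis by (auto simp: matrix_matrix_mult_def M_def mat_def mult.commute)
    qed
  qed
qed

text \<open>A 4-form scales with the fourth power of the coframe, so the factor \<open>exp f\<close>
  is distributed as \<open>exp (f / 4)\<close> over the four covectors.\<close>

lemma adapted_coframe_conformal:
  assumes e: "adapted_coframe \<Psi>' c W e" and f: "smooth_on W (f \<circ> from_chart c)"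
  shows "adapted_coframe (exp_times f \<Psi>') c W (\<lambda>a x I. exp (f (from_chart c x) / 4) * e a x I)"
proof -
  have W: "open W" using e by (simp add: adapted_coframe_def local_coframe_def)
  have s: "smooth_on W (\<lambda>x. exp (f (from_chart c x) / 4))"
  proof -
    have "smooth_on W (\<lambda>x. (f \<circ> from_chart c) x * (1 / 4))"
      by (intro smooth_on_mult smooth_on_const W f)
    from smooth_on_exp[OF W this] show ?thesis by simp
  qed
  have "det (\<chi> a i. r * e a x [i]) \<noteq> 0" if "x \<in> W" "r \<noteq> 0" for x r
  proof -
    have "(\<chi> a i. r * e a x [i]) = (\<chi> a. r *s (\<chi> i. e a x [i]))" by (simp add: vec_eq_iff vector_scalar_mult_def)
    then have "det (\<chi> a i. r * e a x [i]) = (\<Prod>a\<in>(UNIV :: 8 set). r) * det (\<chi> a i. e a x [i])"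
      using det_rows_mul[of "\<lambda>a. r" "\<lambda>a. \<chi> i. e a x [i]"] by simp
    then show ?thesis using e that by (simp add: adapted_coframe_def local_coframe_def)
  qed
  moreover have "exp (y / 4) ^ 4 = exp y" for y :: real by (simp flip: exp_of_nat_mult)
  ultimately show ?thesis
    using e unfolding adapted_coframe_def local_coframe_def
    by (auto simp: spin7_model_scale exp_times_def intro!: smooth_on_mult W s)
qed

subsection \<open>Conformal change of the Lee form\<close>

text \<open>Multiplying by e^f adds the wedge product of df with \<open>\<Psi>'\<close> to the
  exterior derivative, up to the factor e^f. The frames differ by \<open>r\<close>, so a component
  of the 5-form changes by \<open>r^(-5) * r^4\<close>, which is exactly the change of a component
  of a 1-form. The contraction with the model form turns the added term into df with coefficient
  1.\<close>

lemma lee_conformal: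
  assumes S: "open S" "x \<in> S" and \<Psi>': "\<And>I. length I = 4 \<Longrightarrow> (\<lambda>y. \<Psi>' c y I) differentiable (at x)"
    and F: "(f \<circ> from_chart c) differentiable (at x)"
    and alt': "alternating 5 (ext_d (\<Psi>' c) x)" and alt: "alternating 5 (ext_d (exp_times f \<Psi>' c) x)"
    and E': "adapted_at (g' c x) (vol' c x) (\<Psi>' c x) (\<lambda>a. r *\<^sub>R E a)"
    and E: "adapted_at (g c x) (vol c x) (exp_times f \<Psi>' c x) E"
    and r: "r \<noteq> 0" "r ^ 4 = exp (f (from_chart c x))"
  shows "tev (lee_form g vol (exp_times f \<Psi>') c x) [v]
    = tev (lee_form g' vol' \<Psi>' c x) [v] + dd (f \<circ> from_chart c) x v"
proof -
  let ?F = "f \<circ> from_chart c" and ?E' = "\<lambda>a. r *\<^sub>R E a"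
  define \<alpha> where "\<alpha> a = dd ?F x (?E' a)" for a
  \<comment> \<open>The wedge product of df with \<open>\<Psi>'\<close>, in coordinates.\<close>
  define D where "D I = (\<Sum>j<length I. (-1) ^ j * (pdiff (I ! j) ?F x * \<Psi>' c x (take j I @ drop (Suc j) I)))" for I
  have ext: "ext_d (exp_times f \<Psi>' c) x I = r ^ 4 * (ext_d (\<Psi>' c) x I + D I)" if "length I = 5" for I
  proof -
    have "pdiff i (\<lambda>y. exp_times f \<Psi>' c y J) x = r ^ 4 * (pdiff i (\<lambda>y. \<Psi>' c y J) x + pdiff i ?F x * \<Psi>' c x J)"
      if "length J = 4" for i J
    proof -
      have e: "((\<lambda>y. exp (?F y)) has_derivative (\<lambda>v. exp (?F x) * dd ?F x v)) (at x)"
        by (rule has_derivative_compose_real[OF F DERIV_exp])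
      have "((\<lambda>y. exp (?F y) * \<Psi>' c y J) has_derivative
          (\<lambda>v. exp (?F x) * dd (\<lambda>y. \<Psi>' c y J) x v + exp (?F x) * dd ?F x v * \<Psi>' c x J)) (at x)"
        by (rule has_derivative_mult[OF e has_dd[OF \<Psi>'[OF that]]])
      from dd_eqI[OF this] show ?thesis by (simp add: pdiff_def exp_times_def r(2) algebra_simps)
    qed
    then show ?thesis using that
      by (simp add: ext_d_def D_def sum_distrib_left sum.distrib[symmetric] algebra_simps)
  qed
  have DE: "comps ?E' D [i, j, k, l, a] = \<alpha> i * psi j k l a - \<alpha> j * psi i k l a + \<alpha> k * psi i j l a - \<alpha> l * psi i j k a + \<alpha> a * psi i j k l"
    for i j k l a
  proof -
    let ?vs = "map ?E' [i, j, k, l, a]"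
    have "comps ?E' D [i, j, k, l, a]
      = tev (\<lambda>I. \<Sum>j<5. (-1) ^ j * (pdiff (I ! j) ?F x * \<Psi>' c x (take j I @ drop (Suc j) I))) ?vs"
    proof -
      have "length I = 5" if "length I = length ?vs" for I :: "8 list" using that by simp
      then show ?thesis unfolding comps_tev by (intro tev_cong) (simp only: D_def)
    qed
    also have "\<dots> = (\<Sum>j<5. (-1) ^ j * tev (\<lambda>I. pdiff (I ! j) ?F x * \<Psi>' c x (take j I @ drop (Suc j) I)) ?vs)"
      by (simp only: tev_sum tev_cmult)
    also have "\<dots> = (\<Sum>j<5. (-1) ^ j * (dd ?F x (?vs ! j) * tev (\<Psi>' c x) (take j ?vs @ drop (Suc j) ?vs)))"
    proof (intro sum.cong refl arg_cong2[where f = "(*)"])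
      fix j :: nat assume "j \<in> {..<5}"
      then have "j < length ?vs" by simp
      from tev_extract[OF this, of "\<lambda>i J. pdiff i ?F x * \<Psi>' c x J"]
      show "tev (\<lambda>I. pdiff (I ! j) ?F x * \<Psi>' c x (take j I @ drop (Suc j) I)) ?vs
        = dd ?F x (?vs ! j) * tev (\<Psi>' c x) (take j ?vs @ drop (Suc j) ?vs)"
        by (simp only: dd_pdiff[OF F] tev_cmult sum_distrib_right real_scaleR_def mult.assoc)
    qed
    also have "\<dots> = \<alpha> i * psi j k l a - \<alpha> j * psi i k l a + \<alpha> k * psi i j l a - \<alpha> l * psi i j k a + \<alpha> a * psi i j k l"
    proof -
      have "tev (\<Psi>' c x) [?E' p, ?E' q, ?E' s, ?E' t] = psi p q s t" for p q s t
        using E' comps_tev[of ?E' "\<Psi>' c x" "[p, q, s, t]"] by (simp add: adapted_at_def psi_def)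
      then show ?thesis by (simp add: lessThan_Suc numeral_eq_Suc \<alpha>_def)
    qed
    finally show ?thesis .
  qed
  have "comps E (lee_form g vol (exp_times f \<Psi>') c x) [a] = inverse r * (comps ?E' (lee_form g' vol' \<Psi>' c x) [a] + \<alpha> a)" for a
  proof -
    have sc: "comps E t I = inverse r ^ length I * comps ?E' t I" for t I
      using comps_scale[of "inverse r" ?E' t I] r(1) by simp
    have c5: "comps E (ext_d (exp_times f \<Psi>' c) x) I = inverse r * (comps ?E' (ext_d (\<Psi>' c) x) I + comps ?E' D I)" if "length I = 5" for I
    proof -
      have "comps E (ext_d (exp_times f \<Psi>' c) x) I = comps E (\<lambda>I. r ^ 4 * (ext_d (\<Psi>' c) x I + D I)) I"
        by (rule comps_cong) (simp add: ext that)
      also have "\<dots> = inverse r ^ 5 * r ^ 4 * (comps ?E' (ext_d (\<Psi>' c) x) I + comps ?E' D I)"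
        unfolding comps_cmult comps_add sc that by (simp only: distrib_left mult_ac)
      also have "inverse r ^ 5 * r ^ 4 = inverse r" using r(1) by (simp add: field_simps eval_nat_numeral)
      finally show ?thesis .
    qed
    define K where "K i j k l = \<alpha> i * psi j k l a" for i j k l
    \<comment> \<open>The term with \<open>a\<close> in df gives 8 times 42, the four terms with
      \<open>a\<close> in the 4-form give -42 each; the total 168 cancels the denominator of
      \<open>lee_frame\<close>.\<close>
    have p1: "(\<Sum>B | length B = 4. comps ?E' D (B @ [a]) * spin7_model std B) = 168 * \<alpha> a"
    proof -
      have p: "(\<Sum>\<^sub>8j k l. psi j k l a * psi i j k l) = - (42 * delta i a)" for i
      proof -
        have "psi j k l a * psi i j k l = - (psi i j k l * psi a j k l)" for j k l
          using psi_rotate(2)[of j k l a] by simp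
        then show ?thesis using psi_psi3[of i a] by (simp add: sum_negf)
      qed
      have "(\<Sum>\<^sub>8i j k l. K i j k l * psi i j k l) = (\<Sum>\<^sub>8i. \<alpha> i * (- (42 * delta i a)))"
        unfolding K_def mult.assoc sum_distrib_left[symmetric] p ..
      also have "\<dots> = (\<Sum>\<^sub>8i. (- 42 * \<alpha> i) * delta i a)" by (rule sum.cong) auto
      finally have K: "(\<Sum>\<^sub>8i j k l. K i j k l * psi i j k l) = - 42 * \<alpha> a"
        by (simp only: sum_mult_delta)
      have "(\<Sum>\<^sub>8i j k l. \<alpha> a * psi i j k l * psi i j k l) = (\<Sum>i\<in>(UNIV :: 8 set). \<alpha> a * 42)"
        unfolding mult.assoc sum_distrib_left[symmetric] psi_psi3 by simp
      then have S: "(\<Sum>\<^sub>8i j k l. \<alpha> a * psi i j k l * psi i j k l) = 336 * \<alpha> a" by simp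
      have "(\<Sum>B | length B = 4. comps ?E' D (B @ [a]) * spin7_model std B)
        = (\<Sum>\<^sub>8i j k l. (K i j k l - K j i k l + K k i j l - K l i j k) * psi i j k l + \<alpha> a * psi i j k l * psi i j k l)"
        unfolding sum_lists_4 append.simps DE psi_def[symmetric] K_def distrib_right ..
      also have "\<dots> = 4 * (- 42 * \<alpha> a) + 336 * \<alpha> a"
        by (simp only: sum.distrib psi_sum_pairs(2) K S)
      finally show ?thesis by simp
    qed
    have p2: "comps E (lee_form g vol (exp_times f \<Psi>') c x) [a]
      = (\<Sum>B | length B = 4. comps E (ext_d (exp_times f \<Psi>' c) x) (B @ [a]) * spin7_model std B) / 168"
      by (rule lee_frame[where g = g and c = c and x = x and vol = vol and \<Psi> = "exp_times f \<Psi>'", OF E alt])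
    have p3: "comps ?E' (lee_form g' vol' \<Psi>' c x) [a]
      = (\<Sum>B | length B = 4. comps ?E' (ext_d (\<Psi>' c) x) (B @ [a]) * spin7_model std B) / 168"
      by (rule lee_frame[where g = g' and c = c and x = x and vol = vol' and \<Psi> = \<Psi>', OF E' alt'])
    have p4: "(\<Sum>B | length B = 4. comps E (ext_d (exp_times f \<Psi>' c) x) (B @ [a]) * spin7_model std B)
      = inverse r * ((\<Sum>B | length B = 4. comps ?E' (ext_d (\<Psi>' c) x) (B @ [a]) * spin7_model std B)
        + (\<Sum>B | length B = 4. comps ?E' D (B @ [a]) * spin7_model std B))"
      by (simp add: c5 sum_distrib_left sum.distrib distrib_right distrib_left mult.assoc)
    show ?thesis unfolding p2 p3 p4 p1 by (simp add: add_divide_distrib distrib_left)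
  qed
  then have "tev (lee_form g vol (exp_times f \<Psi>') c x) [E a] = inverse r * (r * tev (lee_form g' vol' \<Psi>' c x) [E a] + r * dd ?F x (E a))" for a
    using linear_cmul[OF linear_tev[of "lee_form g' vol' \<Psi>' c x" "[]" "[]"], of r "E a"]
    by (simp add: comps_tev \<alpha>_def dd_scaleR[OF F])
  then have e: "tev (lee_form g vol (exp_times f \<Psi>') c x) [E a] = tev (lee_form g' vol' \<Psi>' c x) [E a] + dd ?F x (E a)" for a
    using r(1) by (simp add: distrib_left mult.assoc[symmetric])
  have "orthonormal_frame (g c x) E" using E by (simp add: adapted_at_def)
  note x = orthonormal_expand[OF this, of v]
  have lin: "linear (\<lambda>v. tev t [v])" for t using linear_tev[of t "[]" "[]"] by simp
  show ?thesis
    apply (subst (1 2 3) x)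
    by (simp only: linear_sum[OF lin] linear_cmul[OF lin] linear_sum[OF linear_dd[OF F]] linear_cmul[OF linear_dd[OF F]] e
      real_scaleR_def distrib_left sum.distrib)
qed

subsection \<open>Change of frames and charts\<close>

lemma gdot_commute: "(\<And>i j. G [i, j] = G [j, i]) \<Longrightarrow> gdot G v w = gdot G w v"
  unfolding gdot_def by (subst sum.swap) (simp add: mult_ac)

text \<open>Expand one argument in the second frame and resum the other one in the first.\<close>

lemma orthonormal_trace:
  fixes B :: "pt \<Rightarrow> pt \<Rightarrow> real"
  assumes sym: "\<And>i j. G [i, j] = G [j, i]" and E: "orthonormal_frame G E" and F: "orthonormal_frame G F"
    and lin: "\<And>w. linear (\<lambda>v. B v w)" "\<And>v. linear (\<lambda>w. B v w)"
  shows "(\<Sum>\<^sub>8a. B (E a) (E a)) = (\<Sum>\<^sub>8b. B (F b) (F b))"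
proof -
  have "B (E a) (E a) = (\<Sum>\<^sub>8b. B (F b) (gdot G (F b) (E a) *\<^sub>R E a))" for a
  proof -
    have "B (E a) (E a) = B (\<Sum>\<^sub>8b. gdot G (E a) (F b) *\<^sub>R F b) (E a)"
      using orthonormal_expand[OF F, of "E a"] by simp
    then show ?thesis
      by (simp add: linear_sum[OF lin(1)] linear_cmul[OF lin(1)] linear_cmul[OF lin(2)] gdot_commute[where G = G and v = "E a", OF sym])
  qed
  then have "(\<Sum>\<^sub>8a. B (E a) (E a)) = (\<Sum>\<^sub>8a b. B (F b) (gdot G (F b) (E a) *\<^sub>R E a))" by simp
  also have "\<dots> = (\<Sum>\<^sub>8b. B (F b) (\<Sum>\<^sub>8a. gdot G (F b) (E a) *\<^sub>R E a))"
    by (subst sum.swap) (simp add: linear_sum[OF lin(2)])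
  finally show ?thesis using orthonormal_expand[OF E] by simp
qed

lemma linear_tev_mult:
  "linear (\<lambda>v. tev s (xs @ v # ys) * r)" "linear (\<lambda>v. r * tev s (xs @ v # ys))"
  by (rule linearI; simp add: linear_add[OF linear_tev] linear_cmul[OF linear_tev] algebra_simps)+

lemma linear_sum_fun:
  fixes f :: "'i \<Rightarrow> pt \<Rightarrow> real"
  shows "(\<And>i. linear (f i)) \<Longrightarrow> linear (\<lambda>v. \<Sum>i\<in>S. f i v)"
  by (rule linear_compose_sum) blast

text \<open>Three successive changes of frame, one per contracted index. This makes contractions of
  tensors comparable between different frames.\<close>

lemma orthonormal_trace3:
  assumes sym: "\<And>i j. G [i, j] = G [j, i]" and E: "orthonormal_frame G E" and F: "orthonormal_frame G F"
  shows "(\<Sum>\<^sub>8i j k. tev s (xs @ [E i, E j, E k]) * tev t (ys @ [E i, E j, E k] @ zs))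
    = (\<Sum>\<^sub>8i j k. tev s (xs @ [F i, F j, F k]) * tev t (ys @ [F i, F j, F k] @ zs))"
proof -
  note tr = orthonormal_trace[OF sym E F]
  note l = linear_tev_mult(1)[where xs = xs and ys = "[v, w]" and s = s for v w, simplified]
    linear_tev_mult(2)[where xs = ys and ys = "[v, w] @ zs" and s = t for v w, simplified]
    linear_tev_mult(1)[where xs = "xs @ [v]" and ys = "[w]" and s = s for v w, simplified]
    linear_tev_mult(2)[where xs = "ys @ [v]" and ys = "[w] @ zs" and s = t for v w, simplified]
    linear_tev_mult(1)[where xs = "xs @ [v, w]" and ys = "[]" and s = s for v w, simplified]
    linear_tev_mult(2)[where xs = "ys @ [v, w]" and ys = "zs" and s = t for v w, simplified]
  have "(\<Sum>\<^sub>8i j k. tev s (xs @ [E i, E j, E k]) * tev t (ys @ [E i, E j, E k] @ zs))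
    = (\<Sum>\<^sub>8i j k. tev s (xs @ [E i, E j, F k]) * tev t (ys @ [E i, E j, F k] @ zs))"
    by (rule sum.cong[OF refl], rule sum.cong[OF refl], rule tr[of "\<lambda>v w. tev s (xs @ [E i, E j, v]) * tev t (ys @ [E i, E j, w] @ zs)" for i j]) (simp_all add: l)
  also have "\<dots> = (\<Sum>\<^sub>8i j k. tev s (xs @ [E i, F j, F k]) * tev t (ys @ [E i, F j, F k] @ zs))"
    by (rule sum.cong[OF refl], rule tr[of "\<lambda>v w. \<Sum>\<^sub>8k. tev s (xs @ [E i, v, F k]) * tev t (ys @ [E i, w, F k] @ zs)" for i])
      (intro linear_sum_fun, simp add: l)+
  also have "\<dots> = (\<Sum>\<^sub>8i j k. tev s (xs @ [F i, F j, F k]) * tev t (ys @ [F i, F j, F k] @ zs))"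
    by (rule tr[of "\<lambda>v w. \<Sum>\<^sub>8j k. tev s (xs @ [v, F j, F k]) * tev t (ys @ [w, F j, F k] @ zs)"])
      (intro linear_sum_fun, simp add: l)+
  finally show ?thesis .
qed

lemma overlap_open:
  assumes c: "is_chart X c" and d: "is_chart X d" shows "open (overlap c d)"
proof -
  have h: "homeomorphic_map (subtopology X (fst c)) (top_of_set (img c)) (snd c)" and "openin X (fst c)"
    using c by (simp_all add: is_chart_def)
  then have sub: "fst c \<subseteq> topspace X" using openin_subset by blast
  have "openin (subtopology X (fst c)) (fst c \<inter> fst d)"
    using d by (auto simp: is_chart_def openin_subtopology)
  moreover have "fst c \<inter> fst d \<subseteq> topspace (subtopology X (fst c))" using sub by auto
  ultimately have "openin (top_of_set (img c)) (overlap c d)"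
    using homeomorphic_map_openness[OF h] by (simp add: overlap_def)
  then show ?thesis using c openin_open_eq[of "img c"] by (simp add: is_chart_def)
qed

lemma chart_inj:
  assumes "is_chart X c" shows "inj_on (snd c) (fst c)"
proof -
  have "fst c \<subseteq> topspace X" using assms by (simp add: is_chart_def openin_subset)
  then show ?thesis
    using homeomorphic_imp_injective_map[of "subtopology X (fst c)" "top_of_set (img c)" "snd c"] assms
    by (simp add: is_chart_def Int_absorb1)
qed

lemma from_chart_snd: "is_chart X c \<Longrightarrow> q \<in> fst c \<Longrightarrow> from_chart c (snd c q) = q"
  unfolding from_chart_def by (rule inv_into_f_f[OF chart_inj])

lemma overlap_subset: "overlap c d \<subseteq> img c"
  by (auto simp: overlap_def img_def)

lemma transition_img: "is_chart X c \<Longrightarrow> x \<in> overlap c d \<Longrightarrow> transition c d x \<in> img d"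
  by (auto simp: overlap_def transition_def img_def from_chart_snd)

text \<open>In the chart \<open>d\<close> the arguments are pushed forward by a derivative that
  varies with the point. Differentiating them produces the second derivatives of the transition map,
  which match the inhomogeneous term in the law for the connection coefficients.\<close>

lemma nabla_transform:
  assumes c: "is_chart X c" and d: "is_chart X d" and trans: "smooth_on (overlap c d) (transition c d)"
    and \<Gamma>c: "\<And>i j. smooth_on (img c) (\<lambda>x. \<Gamma> c x i j)" and \<Gamma>d: "\<And>i j. smooth_on (img d) (\<lambda>x. \<Gamma> d x i j)"
    and law: "\<And>i j. (\<Sum>\<^sub>8k. \<Gamma> c x i j $ k *\<^sub>R jacobian c d x k) =
          pdiff i (pdiff j (transition c d)) x +
          (\<Sum>\<^sub>8a b. (jacobian c d x i $ a * jacobian c d x j $ b) *\<^sub>R \<Gamma> d (transition c d x) a b)"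
    and tc: "\<And>I. length I = length vs \<Longrightarrow> smooth_on (img c) (\<lambda>x. t c x I)"
    and td: "\<And>I. length I = length vs \<Longrightarrow> smooth_on (img d) (\<lambda>x. t d x I)"
    and t: "\<And>y I. y \<in> overlap c d \<Longrightarrow> length I = length vs \<Longrightarrow> t c y I = comps (jacobian c d y) (t d (transition c d y)) I"
    and x: "x \<in> overlap c d"
  defines "J \<equiv> dd (transition c d) x"
  shows "tev (nabla \<Gamma> t c x) (u # vs) = tev (nabla \<Gamma> t d (transition c d x)) (J u # map J vs)"
proof -
  let ?\<tau> = "transition c d"
  have O: "open (overlap c d)" by (rule overlap_open[OF c d])
  interpret C: chart_connection "img c" c \<Gamma> using c \<Gamma>c by unfold_locales (simp_all add: is_chart_def)
  interpret D: chart_connection "img d" d \<Gamma> using d \<Gamma>d by unfold_locales (simp_all add: is_chart_def)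
  have xc: "x \<in> img c" using x overlap_subset by blast
  have xd: "?\<tau> x \<in> img d" by (rule transition_img[OF c x])
  have diff\<tau>: "?\<tau> differentiable (at y)" if "y \<in> overlap c d" for y
    by (rule smooth_on_imp_differentiable[OF trans that])
  have jac: "(\<Sum>\<^sub>8i. v $ i *\<^sub>R jacobian c d y i) = dd ?\<tau> y v" if "y \<in> overlap c d" for y v
    by (simp add: jacobian_def dd_pdiff[OF diff\<tau>[OF that]])
  have tev_t: "tev (t c y) ws = tev (t d (?\<tau> y)) (map (dd ?\<tau> y) ws)" if "y \<in> overlap c d" "length ws = length vs" for y ws
  proof -
    have "tev (t c y) ws = tev (comps (jacobian c d y) (t d (?\<tau> y))) ws"
      by (rule tev_cong) (use t that in simp)
    then show ?thesis by (simp add: tev_comps jac[OF that(1)])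
  qed
  have linJ: "linear J" unfolding J_def by (rule linear_dd[OF diff\<tau>[OF x]])
  have smooth_J: "smooth_on (overlap c d) (\<lambda>y. dd ?\<tau> y v)" for v by (rule smooth_on_dd_const[OF O trans])
  \<comment> \<open>The transformation law for coordinate vectors, extended to arbitrary ones
    because both sides are linear in \<open>w\<close> and in \<open>v\<close>.\<close>
  have law': "J (C.gam x w v) = dd (\<lambda>y. dd ?\<tau> y v) x w + D.gam (?\<tau> x) (J w) (J v)" for w v
  proof -
    have ax: "J (C.gam x (axis i 1) (axis j 1)) = dd (\<lambda>y. dd ?\<tau> y (axis j 1)) x (axis i 1) + D.gam (?\<tau> x) (J (axis i 1)) (J (axis j 1))" for i j
      using law[of i j] jac[OF x, of "\<Gamma> c x i j"]
      unfolding Gam_axis by (simp add: J_def pdiff_def[abs_def] jacobian_def Gam_def[of "\<Gamma> d"])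
    have 1: "linear (\<lambda>v. J (C.gam x w v))" for w
      using linear_compose[OF linear_Gam(2) linJ] by (simp add: o_def)
    have 2: "linear (\<lambda>w. J (C.gam x w v))" for v
      using linear_compose[OF linear_Gam(1) linJ] by (simp add: o_def)
    have "(\<lambda>y. dd ?\<tau> y v) differentiable (at x)" for v by (rule smooth_on_imp_differentiable[OF smooth_J x])
    note dJ = this
    have 3: "linear (\<lambda>w. dd (\<lambda>y. dd ?\<tau> y v) x w + D.gam (?\<tau> x) (J w) (J v))" for v
      using linear_compose[OF linJ linear_Gam(1)] by (intro linear_compose_add linear_dd dJ) (simp add: o_def)
    have 4: "linear (\<lambda>v. dd (\<lambda>y. dd ?\<tau> y v) x w + D.gam (?\<tau> x) (J w) (J v))" for w
    proof (intro linear_compose_add)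
      show "linear (\<lambda>v. D.gam (?\<tau> x) (J w) (J v))" using linear_compose[OF linJ linear_Gam(2)] by (simp add: o_def)
      show "linear (\<lambda>v. dd (\<lambda>y. dd ?\<tau> y v) x w)"
      proof (rule linearI)
        show "dd (\<lambda>y. dd ?\<tau> y (a + b)) x w = dd (\<lambda>y. dd ?\<tau> y a) x w + dd (\<lambda>y. dd ?\<tau> y b) x w" for a b
          unfolding dd_add_fun[OF dJ dJ, symmetric]
          by (rule arg_cong[where f = "\<lambda>F. F w"], rule dd_cong_open[OF O x]) (rule dd_add[OF diff\<tau>])
        show "dd (\<lambda>y. dd ?\<tau> y (r *\<^sub>R a)) x w = r *\<^sub>R dd (\<lambda>y. dd ?\<tau> y a) x w" for r a
        proof -
          have "dd (\<lambda>y. dd ?\<tau> y (r *\<^sub>R a)) x w = dd (\<lambda>y. r *\<^sub>R dd ?\<tau> y a) x w"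
            by (rule arg_cong[where f = "\<lambda>F. F w"], rule dd_cong_open[OF O x]) (rule dd_scaleR[OF diff\<tau>])
          also have "\<dots> = r *\<^sub>R dd (\<lambda>y. dd ?\<tau> y a) x w"
            by (rule dd_eqI) (intro has_derivative_scaleR_right has_dd dJ)
          finally show ?thesis .
        qed
      qed
    qed
    have "J (C.gam x (axis i 1) v) = dd (\<lambda>y. dd ?\<tau> y v) x (axis i 1) + D.gam (?\<tau> x) (J (axis i 1)) (J v)" for i
      unfolding linear_pt_expand[OF 1[of "axis i 1"], of v] linear_pt_expand[OF 4[of "axis i 1"], of v] by (simp only: ax)
    then show ?thesis
      unfolding linear_pt_expand[OF 2[of v], of w] linear_pt_expand[OF 3[of v], of w] by (simp only:)
  qed
  have dc: "(\<lambda>y. t c y I) differentiable (at x)" if "length I = length vs" for I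
    by (rule smooth_on_imp_differentiable[OF tc[OF that] xc])
  have ddd: "(\<lambda>y. t d y I) differentiable (at (?\<tau> x))" if "length I = length vs" for I
    by (rule smooth_on_imp_differentiable[OF td[OF that] xd])
  have chain: "((\<lambda>y. h (?\<tau> y)) has_derivative (\<lambda>w. dd h (?\<tau> x) (J w))) (at x)"
    if "h differentiable (at (?\<tau> x))" for h :: "pt \<Rightarrow> real"
    unfolding J_def using has_derivative_compose[OF has_dd[OF diff\<tau>[OF x]] has_dd[OF that]] .
  let ?As = "map (\<lambda>v y. dd ?\<tau> y v) vs"
  have "dd (\<lambda>y. tev (t c y) vs) x u = dd (\<lambda>y. tev (t d (?\<tau> y)) (map (\<lambda>A. A y) ?As)) x u"
    by (rule arg_cong[where f = "\<lambda>F. F u"], rule dd_cong_open[OF O x]) (simp add: tev_t o_def)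
  also have "\<dots> = dd (\<lambda>y. tev (t d (?\<tau> y)) (map (\<lambda>A. A x) ?As)) x u
      + (\<Sum>k<length ?As. tev (t d (?\<tau> x)) ((map (\<lambda>A. A x) ?As)[k := dd (?As ! k) x u]))"
  proof (rule dd_tev)
    show "(\<lambda>y. t d (?\<tau> y) I) differentiable (at x)" if "length I = length ?As" for I
      using chain[OF ddd[of I]] that by (auto simp: differentiable_def)
    show "B differentiable (at x)" if "B \<in> set ?As" for B
      using that smooth_on_imp_differentiable[OF smooth_J x] by auto
  qed
  also have "\<dots> = dd (\<lambda>y. tev (t d (?\<tau> y)) (map J vs)) x u
      + (\<Sum>k<length vs. tev (t d (?\<tau> x)) ((map J vs)[k := dd (\<lambda>y. dd ?\<tau> y (vs ! k)) x u]))"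
    by (simp add: o_def J_def)
  also have "dd (\<lambda>y. tev (t d (?\<tau> y)) (map J vs)) x u = dd (\<lambda>z. tev (t d z) (map J vs)) (?\<tau> x) (J u)"
    by (rule dd_eqI) (rule chain[OF dd_tev_const(2)], simp add: ddd)
  also have "dd (\<lambda>z. tev (t d z) (map J vs)) (?\<tau> x) (J u) = tev (nabla \<Gamma> t d (?\<tau> x)) (J u # map J vs)
      + (\<Sum>k<length vs. tev (t d (?\<tau> x)) ((map J vs)[k := D.gam (?\<tau> x) (J u) (J (vs ! k))]))"
    using D.tev_nabla[where t = t and vs = "map J vs" and x = "?\<tau> x" and u = "J u"] ddd by simp
  finally have 1: "dd (\<lambda>y. tev (t c y) vs) x u = tev (nabla \<Gamma> t d (?\<tau> x)) (J u # map J vs)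
      + (\<Sum>k<length vs. tev (t d (?\<tau> x)) ((map J vs)[k := dd (\<lambda>y. dd ?\<tau> y (vs ! k)) x u + D.gam (?\<tau> x) (J u) (J (vs ! k))]))"
    by (simp add: tev_update_add sum.distrib)
  have "(\<Sum>k<length vs. tev (t c x) (vs[k := C.gam x u (vs ! k)]))
      = (\<Sum>k<length vs. tev (t d (?\<tau> x)) ((map J vs)[k := J (C.gam x u (vs ! k))]))"
    by (intro sum.cong refl) (simp add: tev_t[OF x] map_update J_def)
  then show ?thesis
    using C.tev_nabla[where t = t and vs = vs and x = x and u = u] dc by (simp add: 1 law')
qed

subsection \<open>The Gauduchon structure near a point\<close>

locale gauduchon_instanton =
  fixes X :: "'a topology" and A :: "'a chart set" and \<Psi>' g' vol' g vol :: "'a field"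
    and f :: "'a \<Rightarrow> real" and \<Gamma> :: "'a chart \<Rightarrow> christoffel"
  assumes manifold: "smooth_manifold8 X A" and spin7: "spin7_structure A \<Psi>'" and induces': "induces A \<Psi>' g' vol'"
    and closed': "closed_1form A (lee_form g' vol' \<Psi>')" and f: "smooth_function A f"
    and induces: "induces A (exp_times f \<Psi>') g vol" and gauduchon: "gauduchon A g vol (exp_times f \<Psi>')"
    and connection: "torsion_connection A g (exp_times f \<Psi>') \<Gamma>"
    and instanton: "spin7_instanton A g (exp_times f \<Psi>') \<Gamma>"
begin

abbreviation "\<Psi> \<equiv> exp_times f \<Psi>'"
abbreviation "\<theta> \<equiv> lee_form g vol \<Psi>"

lemma chart: "c \<in> A \<Longrightarrow> is_chart X c"
  using manifold by (simp add: smooth_manifold8_def)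

lemma open_img: "c \<in> A \<Longrightarrow> open (img c)"
  using chart by (simp add: is_chart_def)

lemma smooth_f: "c \<in> A \<Longrightarrow> smooth_on (img c) (f \<circ> from_chart c)"
  using f by (simp add: smooth_function_def)

lemma smooth_fields:
  assumes "c \<in> A"
  shows "length I = 4 \<Longrightarrow> smooth_on (img c) (\<lambda>x. \<Psi>' c x I)" "length I = 4 \<Longrightarrow> smooth_on (img c) (\<lambda>x. \<Psi> c x I)"
    "length I = 2 \<Longrightarrow> smooth_on (img c) (\<lambda>x. g c x I)" "length I = 8 \<Longrightarrow> smooth_on (img c) (\<lambda>x. vol c x I)"
    "length I = 3 \<Longrightarrow> smooth_on (img c) (\<lambda>x. torsion g \<Gamma> c x I)" "smooth_on (img c) (\<lambda>x. \<Gamma> c x i j)"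
proof -
  show 1: "length I = 4 \<Longrightarrow> smooth_on (img c) (\<lambda>x. \<Psi>' c x I)"
    using spin7 assms by (simp add: spin7_structure_def diff_form_def tensor_field_def)
  show "length I = 4 \<Longrightarrow> smooth_on (img c) (\<lambda>x. \<Psi> c x I)"
    unfolding exp_times_def using smooth_f[OF assms] open_img[OF assms] 1
    by (intro smooth_on_mult smooth_on_exp) (simp_all add: o_def)
  show "length I = 2 \<Longrightarrow> smooth_on (img c) (\<lambda>x. g c x I)"
    using induces assms by (simp add: induces_def riemannian_metric_def tensor_field_def)
  show "length I = 8 \<Longrightarrow> smooth_on (img c) (\<lambda>x. vol c x I)"
    using induces assms by (simp add: induces_def diff_form_def tensor_field_def)
  show "length I = 3 \<Longrightarrow> smooth_on (img c) (\<lambda>x. torsion g \<Gamma> c x I)"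
    using connection assms by (simp add: torsion_connection_def diff_form_def tensor_field_def)
  show "smooth_on (img c) (\<lambda>x. \<Gamma> c x i j)"
    using connection assms by (simp add: torsion_connection_def linear_connection_def)
qed

lemma alternating_fields:
  assumes "c \<in> A" "x \<in> img c"
  shows "alternating 4 (\<Psi>' c x)" "alternating 4 (\<Psi> c x)" "alternating 8 (vol c x)" "alternating 3 (torsion g \<Gamma> c x)"
proof -
  show 1: "alternating 4 (\<Psi>' c x)" using spin7 assms by (simp add: spin7_structure_def diff_form_def)
  show "alternating 4 (\<Psi> c x)" unfolding exp_times_def by (rule alternating_mult_const[OF 1])
  show "alternating 8 (vol c x)" using induces assms by (simp add: induces_def diff_form_def)
  show "alternating 3 (torsion g \<Gamma> c x)" using connection assms by (simp add: torsion_connection_def diff_form_def)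
qed

lemma sym_g: "c \<in> A \<Longrightarrow> x \<in> img c \<Longrightarrow> g c x [i, j] = g c x [j, i]"
  using induces by (simp add: induces_def riemannian_metric_def)

text \<open>An adapted coframe of \<open>\<Psi>'\<close> scaled by \<open>exp (f / 4)\<close> is
  adapted to \<open>\<Psi>\<close>, and its dual frame \<open>E\<close> serves both structures:
  \<open>E\<close> itself is adapted to \<open>\<Psi>\<close> and \<open>exp (f / 4)\<close> times
  \<open>E\<close> to \<open>\<Psi>'\<close>. This is the situation of \<open>lee_conformal\<close>,
  which transfers closedness.\<close>

lemma instanton_chart_exists:
  assumes c: "c \<in> A" and x: "x \<in> img c"
  obtains W E where "x \<in> W" "W \<subseteq> img c" "instanton_chart W c \<Gamma> g \<Psi> vol E"
proof -
  obtain W e' where xW: "x \<in> W" and e': "adapted_coframe \<Psi>' c W e'"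
    using spin7 c x unfolding spin7_structure_def by blast
  have W: "open W" "W \<subseteq> img c" using e' by (simp_all add: adapted_coframe_def local_coframe_def)
  have fW: "smooth_on W (f \<circ> from_chart c)" by (rule smooth_on_subset[OF smooth_f[OF c] W(2)])
  define e where "e = (\<lambda>a x I. exp (f (from_chart c x) / 4) * e' a x I)"
  have e: "adapted_coframe \<Psi> c W e"
    unfolding e_def by (rule adapted_coframe_conformal[OF e' fW])
  obtain E where E: "\<And>a. smooth_on W (E a)"
    and dual: "\<And>x a b. x \<in> W \<Longrightarrow> (\<Sum>\<^sub>8i. E a x $ i * e b x [i]) = (if a = b then 1 else 0)"
  proof -
    have "local_coframe c W e" using e by (simp add: adapted_coframe_def)
    from dual_frame[OF this] that show ?thesis by blast
  qed
  have ad: "adapted_at (g c y) (vol c y) (\<Psi> c y) (\<lambda>a. E a y)" if y: "y \<in> W" for y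
  proof (rule adapted_at_dual[where e = "\<lambda>a. e a y"])
    show "(\<Sum>\<^sub>8i. E a y $ i * e b y [i]) = (if a = b then 1 else 0)" for a b by (rule dual[OF y])
    show "g c y [i, j] = (\<Sum>\<^sub>8a. e a y [i] * e a y [j])" for i j
      using induces c e y unfolding induces_def by blast
    show "vol c y I = e8 (\<lambda>a. e a y) I" if "length I = 8" for I
      using induces c e y that unfolding induces_def by blast
    show "\<Psi> c y I = spin7_model (\<lambda>a. e a y) I" if "length I = 4" for I
      using e y that unfolding adapted_coframe_def by blast
  qed
  have ad': "adapted_at (g' c y) (vol' c y) (\<Psi>' c y) (\<lambda>a. exp (f (from_chart c y) / 4) *\<^sub>R E a y)" if y: "y \<in> W" for y
  proof (rule adapted_at_dual[where e = "\<lambda>a. e' a y"])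
    show "(\<Sum>\<^sub>8i. (exp (f (from_chart c y) / 4) *\<^sub>R E a y) $ i * e' b y [i]) = (if a = b then 1 else 0)" for a b
      using dual[OF y, of a b] by (simp add: e_def mult_ac)
  qed (use e' y induces' c in \<open>auto simp: adapted_coframe_def induces_def\<close>)
  interpret F: adapted_frame W c \<Gamma> g \<Psi> vol E
  proof
    show "open W" by (rule W)
    show "smooth_on W (\<lambda>x. \<Gamma> c x i j)" for i j by (rule smooth_on_subset[OF smooth_fields(6)[OF c] W(2)])
    show "smooth_on W (\<lambda>x. g c x I)" if "length I = 2" for I by (rule smooth_on_subset[OF smooth_fields(3)[OF c that] W(2)])
    show "g c x [i, j] = g c x [j, i]" if "x \<in> W" for x i j using sym_g[OF c, of x] W(2) that by blast
    show "nabla \<Gamma> g c x I = 0" if "x \<in> W" "length I = 3" for x I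
      using connection c W(2) that by (auto simp: torsion_connection_def parallel_def vanishes_def)
    show "smooth_on W (\<lambda>x. torsion g \<Gamma> c x I)" if "length I = 3" for I by (rule smooth_on_subset[OF smooth_fields(5)[OF c that] W(2)])
    show "alternating 3 (torsion g \<Gamma> c x)" if "x \<in> W" for x using alternating_fields(4)[OF c, of x] W(2) that by blast
    show "smooth_on W (\<lambda>x. \<Psi> c x I)" if "length I = 4" for I by (rule smooth_on_subset[OF smooth_fields(2)[OF c that] W(2)])
    show "smooth_on W (\<lambda>x. vol c x I)" if "length I = 8" for I by (rule smooth_on_subset[OF smooth_fields(4)[OF c that] W(2)])
    show "nabla \<Gamma> \<Psi> c x I = 0" if "x \<in> W" "length I = 5" for x I
      using connection c W(2) that by (auto simp: torsion_connection_def parallel_def vanishes_def)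
    show "alternating 4 (\<Psi> c x)" if "x \<in> W" for x using alternating_fields(2)[OF c, of x] W(2) that by blast
    show "alternating 8 (vol c x)" if "x \<in> W" for x using alternating_fields(3)[OF c, of x] W(2) that by blast
    show "smooth_on W (E a)" for a by (rule E)
  qed (use ad in \<open>simp_all add: adapted_at_def\<close>)
  have lee: "tev (\<theta> c y) [v] = tev (lee_form g' vol' \<Psi>' c y) [v] + dd (f \<circ> from_chart c) y v" if y: "y \<in> W" for y v
  proof (rule lee_conformal[OF W(1) y])
    have y': "y \<in> img c" using y W by blast
    show "(\<lambda>y. \<Psi>' c y I) differentiable (at y)" if "length I = 4" for I
      by (rule smooth_on_imp_differentiable[OF smooth_fields(1)[OF c that] y'])
    show "(f \<circ> from_chart c) differentiable (at y)" by (rule smooth_on_imp_differentiable[OF fW y])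
    show "alternating 5 (ext_d (\<Psi>' c) y)"
      using alternating_ext_d[OF open_img[OF c] y', of 4 "\<Psi>' c"] alternating_fields(1)[OF c]
        smooth_on_imp_differentiable[OF smooth_fields(1)[OF c] y'] by simp
    show "alternating 5 (ext_d (\<Psi> c) y)" by (rule F.alternating_ext_d_\<Psi>[OF y])
    show "adapted_at (g' c y) (vol' c y) (\<Psi>' c y) (\<lambda>a. exp (f (from_chart c y) / 4) *\<^sub>R E a y)" by (rule ad'[OF y])
    show "adapted_at (g c y) (vol c y) (\<Psi> c y) (\<lambda>a. E a y)" by (rule ad[OF y])
    show "exp (f (from_chart c y) / 4) ^ 4 = exp (f (from_chart c y))" by (simp flip: exp_of_nat_mult)
  qed simp
  have "instanton_chart W c \<Gamma> g \<Psi> vol E"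
  proof
    fix y assume y: "y \<in> W"
    then have y': "y \<in> img c" using W by blast
    show "codiff (g c) (vol c) (\<theta> c) y [] = 0"
      using gauduchon c y' by (simp add: gauduchon_def coclosed_1form_def vanishes_def)
    \<comment> \<open>By \<open>lee\<close> the two Lee forms differ by df, and the exterior
      derivative of df vanishes by the symmetry of second derivatives.\<close>
    show "ext_d (\<theta> c) y I = 0" if I: "length I = 2" for I
    proof -
      obtain i j where ij: "I = [i, j]" using I by (auto simp: length_Suc_conv numeral_eq_Suc)
      let ?F = "f \<circ> from_chart c"
      have th: "lee_form g' vol' \<Psi>' c z [k] = \<theta> c z [k] - dd ?F z (axis k 1)" if "z \<in> W" for z k
        using lee[OF that, of "axis k 1"] tev_axis[of "\<theta> c z" "[k]"] tev_axis[of "lee_form g' vol' \<Psi>' c z" "[k]"] by simp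
      have p: "pdiff m (\<lambda>z. lee_form g' vol' \<Psi>' c z [k]) y = pdiff m (\<lambda>z. \<theta> c z [k]) y - dd (\<lambda>z. dd ?F z (axis k 1)) y (axis m 1)" for m k
      proof -
        have "pdiff m (\<lambda>z. lee_form g' vol' \<Psi>' c z [k]) y = pdiff m (\<lambda>z. \<theta> c z [k] - dd ?F z (axis k 1)) y"
          by (rule pdiff_cong_open[OF W(1) y th])
        also have "\<dots> = pdiff m (\<lambda>z. \<theta> c z [k]) y - dd (\<lambda>z. dd ?F z (axis k 1)) y (axis m 1)"
          unfolding pdiff_def
          by (rule dd_diff_fun) (simp_all add: F.diff_theta[OF y] smooth_on_imp_differentiable[OF smooth_on_dd_const[OF W(1) fW] y])
        finally show ?thesis .
      qed
      have "ext_d (lee_form g' vol' \<Psi>' c) y [i, j] = 0"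
        using closed' c y' by (simp add: closed_1form_def vanishes_def)
      then show ?thesis
        using smooth_dd_dd_commute[OF W(1) y fW, of "axis i 1" "axis j 1"]
        by (simp add: ij ext_d_def lessThan_Suc p)
    qed
    show "pcontr (\<lambda>a b. gdot (g c y) (F.rm y (E a y) (E b y) (E i y)) (E j y)) k l
        = 2 * gdot (g c y) (F.rm y (E k y) (E l y) (E i y)) (E j y)" for i j k l
    proof -
      have R: "comps (\<lambda>a. E a y) (curvature g \<Gamma> c y) [a, b, i, j] = gdot (g c y) (F.rm y (E a y) (E b y) (E i y)) (E j y)" for a b i j
        by (simp add: comps_tev F.tev_curvature[OF y])
      have P: "comps (\<lambda>a. E a y) (\<Psi> c y) [a, b, k, l] = psi a b k l" for a b k l
        by (simp add: comps_tev F.tev_\<Psi>[OF y])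
      show ?thesis
        using instanton c y' F.frame[OF y] unfolding spin7_instanton_def Let_def pcontr_def R[symmetric] P[symmetric] by blast
    qed
  qed
  then show thesis using that xW W(2) by blast
qed

end

subsection \<open>The length of the Lee form on the manifold\<close>

lemma tensor_field_push:
  assumes A: "smooth_manifold8 X A" and t: "tensor_field A k t" and cd: "c \<in> A" "d \<in> A" and x: "x \<in> overlap c d"
    and vs: "length vs = k"
  shows "tev (t c x) vs = tev (t d (transition c d x)) (map (dd (transition c d) x) vs)"
proof -
  have "transition c d differentiable (at x)"
    using A cd by (intro smooth_on_imp_differentiable[OF _ x]) (simp add: smooth_manifold8_def)
  then have J: "(\<Sum>\<^sub>8i. v $ i *\<^sub>R jacobian c d x i) = dd (transition c d) x v" for v
    by (simp add: jacobian_def dd_pdiff)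
  have "tev (t c x) vs = tev (comps (jacobian c d x) (t d (transition c d x))) vs"
    by (rule tev_cong) (use t cd x vs in \<open>simp add: tensor_field_def\<close>)
  then show ?thesis by (simp add: tev_comps J)
qed

context gauduchon_instanton
begin

lemma from_chart_transition:
  assumes "c \<in> A" "d \<in> A" "x \<in> overlap c d"
  shows "from_chart d (transition c d x) = from_chart c x"
  using assms from_chart_snd[OF chart[OF assms(1)]] from_chart_snd[OF chart[OF assms(2)]]
  by (auto simp: overlap_def transition_def)

lemma tensor_\<Psi>: "tensor_field A 4 \<Psi>"
proof -
  have law: "\<Psi>' c x I = comps (jacobian c d x) (\<Psi>' d (transition c d x)) I"
    if "c \<in> A" "d \<in> A" "x \<in> overlap c d" "length I = 4" for c d x I
    using spin7 that by (simp add: spin7_structure_def diff_form_def tensor_field_def)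
  have "\<Psi> c x I = comps (jacobian c d x) (\<Psi> d (transition c d x)) I"
    if "c \<in> A" "d \<in> A" "x \<in> overlap c d" "length I = 4" for c d x I
    using law[OF that] by (simp add: exp_times_def comps_cmult from_chart_transition[OF that(1-3)])
  then show ?thesis using smooth_fields(2) by (simp add: tensor_field_def)
qed

lemma tensor_g: "tensor_field A 2 g"
  using induces by (simp add: induces_def riemannian_metric_def)

lemma tensor_torsion: "tensor_field A 3 (torsion g \<Gamma>)"
  using connection by (simp add: torsion_connection_def diff_form_def)

text \<open>The Lee form is defined separately in each chart by Hodge stars. This expression by
  tensor fields and an arbitrary orthonormal frame yields its transformation law in
  \<open>lee_push\<close>.\<close>

lemma lee_contraction:
  assumes c: "c \<in> A" "x \<in> img c" and F: "orthonormal_frame (g c x) F"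
  shows "tev (\<theta> c x) [v] = - (1 / 7) * (\<Sum>\<^sub>8i j k.
    tev (torsion g \<Gamma> c x) [F i, F j, F k] * tev (\<Psi> c x) [F i, F j, F k, v])"
proof -
  obtain W E where x: "x \<in> W" and "W \<subseteq> img c" and W: "instanton_chart W c \<Gamma> g \<Psi> vol E"
    by (rule instanton_chart_exists[OF c])
  interpret F: instanton_chart W c \<Gamma> g \<Psi> vol E by (rule W)
  let ?B = "\<lambda>v. - (1 / 7) * (\<Sum>\<^sub>8i j k.
    tev (torsion g \<Gamma> c x) [E i x, E j x, E k x] * tev (\<Psi> c x) [E i x, E j x, E k x, v])"
  have e: "tev (\<theta> c x) [E a x] = ?B (E a x)" for a
    unfolding F.lee_tcontr[OF x] tcontr_eq F.Tf_def F.tev_\<Psi>[OF x] ..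
  have lin: "linear ?B"
  proof -
    have "linear (\<lambda>v. r * tev (\<Psi> c x) [a, b, d, v])" for r a b d
      using linear_tev_mult(2)[of r "\<Psi> c x" "[a, b, d]" "[]"] by simp
    then have "linear (\<lambda>v. \<Sum>\<^sub>8i j k.
      tev (torsion g \<Gamma> c x) [E i x, E j x, E k x] * tev (\<Psi> c x) [E i x, E j x, E k x, v])"
      by (intro linear_sum_fun)
    from linear_compose_scale_right[OF this, of "- (1 / 7)"] show ?thesis by simp
  qed
  have "tev (\<theta> c x) [v] = (\<Sum>\<^sub>8b. gdot (g c x) v (E b x) *\<^sub>R tev (\<theta> c x) [E b x])"
    by (subst F.expand[OF x, of v]) (simp only: linear_sum[OF F.linear_theta] linear_cmul[OF F.linear_theta])
  also have "\<dots> = (\<Sum>\<^sub>8b. gdot (g c x) v (E b x) *\<^sub>R ?B (E b x))" by (simp only: e)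
  also have "\<dots> = ?B (\<Sum>\<^sub>8b. gdot (g c x) v (E b x) *\<^sub>R E b x)"
    by (simp only: linear_sum[OF lin] linear_cmul[OF lin])
  also have "\<dots> = ?B v" using F.expand[OF x, of v] by simp
  finally show ?thesis
    using orthonormal_trace3[where xs = "[]" and ys = "[]" and zs = "[v]" and s = "torsion g \<Gamma> c x" and t = "\<Psi> c x",
      OF sym_g[OF c] F.frame[OF x] F] by simp
qed

lemma push_orthonormal:
  assumes cd: "c \<in> A" "d \<in> A" and x: "x \<in> overlap c d" and E: "orthonormal_frame (g c x) E"
  shows "orthonormal_frame (g d (transition c d x)) (\<lambda>a. dd (transition c d) x (E a))"
  using tensor_field_push[OF manifold tensor_g cd x] E
  by (simp add: orthonormal_frame_def gdot_tev)

lemma lee_push: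
  assumes cd: "c \<in> A" "d \<in> A" and x: "x \<in> overlap c d"
  shows "tev (\<theta> c x) [v] = tev (\<theta> d (transition c d x)) [dd (transition c d) x v]"
proof -
  have xc: "x \<in> img c" using x overlap_subset by blast
  have xd: "transition c d x \<in> img d" by (rule transition_img[OF chart[OF cd(1)] x])
  obtain W E where xW: "x \<in> W" and "W \<subseteq> img c" and W: "instanton_chart W c \<Gamma> g \<Psi> vol E"
    by (rule instanton_chart_exists[OF cd(1) xc])
  interpret F: instanton_chart W c \<Gamma> g \<Psi> vol E by (rule W)
  show ?thesis
    unfolding lee_contraction[OF cd(1) xc F.frame[OF xW]]
      lee_contraction[OF cd(2) xd push_orthonormal[OF cd x F.frame[OF xW]]]
    by (simp add: tensor_field_push[OF manifold tensor_torsion cd x] tensor_field_push[OF manifold tensor_\<Psi> cd x])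
qed

text \<open>The squared length of the Lee form. By \<open>nsq_eq\<close> any orthonormal frame gives
  the same value as the chosen one, so no metric inverse enters.\<close>

definition nsq where
  "nsq c x = (\<Sum>\<^sub>8a. (tev (\<theta> c x) [(SOME E. orthonormal_frame (g c x) E) a])\<^sup>2)"

lemma nsq_eq:
  assumes c: "c \<in> A" "x \<in> img c" and E: "orthonormal_frame (g c x) E"
  shows "nsq c x = (\<Sum>\<^sub>8a. (tev (\<theta> c x) [E a])\<^sup>2)"
  unfolding nsq_def power2_eq_square
proof (rule orthonormal_trace[where B = "\<lambda>v w. tev (\<theta> c x) [v] * tev (\<theta> c x) [w]", OF sym_g[OF c] _ E])
  show "orthonormal_frame (g c x) (SOME E. orthonormal_frame (g c x) E)" by (rule someI[where P = "orthonormal_frame (g c x)", OF E])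
  show "linear (\<lambda>v. tev (\<theta> c x) [v] * tev (\<theta> c x) [w])" "linear (\<lambda>w. tev (\<theta> c x) [v] * tev (\<theta> c x) [w])" for v w
    using linear_tev_mult(1)[of "\<theta> c x" "[]" "[]"] linear_tev_mult(2)[of _ "\<theta> c x" "[]" "[]"] by simp_all
qed

lemma nsq_push:
  assumes cd: "c \<in> A" "d \<in> A" and x: "x \<in> overlap c d"
  shows "nsq c x = nsq d (transition c d x)"
proof -
  have xc: "x \<in> img c" using x overlap_subset by blast
  have xd: "transition c d x \<in> img d" by (rule transition_img[OF chart[OF cd(1)] x])
  obtain W E where xW: "x \<in> W" and "W \<subseteq> img c" and W: "instanton_chart W c \<Gamma> g \<Psi> vol E"
    by (rule instanton_chart_exists[OF cd(1) xc])
  interpret F: instanton_chart W c \<Gamma> g \<Psi> vol E by (rule W)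
  show ?thesis
    unfolding nsq_eq[OF cd(1) xc F.frame[OF xW]] nsq_eq[OF cd(2) xd push_orthonormal[OF cd x F.frame[OF xW]]]
    by (simp add: lee_push[OF cd x])
qed

text \<open>The same function on the manifold itself; \<open>uM_eq\<close> shows that any chart
  around the point computes it.\<close>

definition uM where "uM q = (let c = SOME c. c \<in> A \<and> q \<in> fst c in nsq c (snd c q))"

lemma uM_eq:
  assumes c: "c \<in> A" and q: "q \<in> fst c" shows "uM q = nsq c (snd c q)"
proof -
  define d where "d = (SOME c. c \<in> A \<and> q \<in> fst c)"
  have d: "d \<in> A \<and> q \<in> fst d" unfolding d_def by (rule someI[of _ c]) (use c q in simp)
  have "snd d q \<in> overlap d c" using d q by (auto simp: overlap_def)
  moreover have "transition d c (snd d q) = snd c q"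
    using from_chart_snd[OF chart, of d q] d by (simp add: transition_def)
  ultimately show ?thesis using nsq_push[of d c "snd d q"] d c by (simp add: uM_def Let_def d_def[symmetric])
qed

lemma img_cover: "q \<in> topspace X \<Longrightarrow> \<exists>c\<in>A. q \<in> fst c"
  using manifold by (auto simp: smooth_manifold8_def)

lemma snd_img: "q \<in> fst c \<Longrightarrow> snd c q \<in> img c"
  by (auto simp: img_def)

lemma chart_preimage:
  assumes c: "c \<in> A" and Y: "Y \<subseteq> img c"
  defines "N \<equiv> {q \<in> fst c. snd c q \<in> Y}"
  shows "open Y \<Longrightarrow> openin X N" "connected Y \<Longrightarrow> connectedin X N"
proof -
  have h: "homeomorphic_map (subtopology X (fst c)) (top_of_set (img c)) (snd c)" and o: "openin X (fst c)"
    using chart[OF c] by (simp_all add: is_chart_def)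
  have N: "N \<subseteq> topspace (subtopology X (fst c))" using openin_subset[OF o] by (auto simp: N_def)
  have im: "snd c ` N = Y" using Y by (auto simp: N_def img_def)
  show "openin X N" if "open Y"
  proof -
    have "openin (top_of_set (img c)) (snd c ` N)" unfolding im using that Y open_img[OF c] by (simp add: openin_open_eq)
    then have "openin (subtopology X (fst c)) N" using homeomorphic_map_openness[OF h N] by simp
    then show ?thesis using openin_trans_full o by blast
  qed
  show "connectedin X N" if "connected Y"
  proof -
    have "connectedin (top_of_set (img c)) (snd c ` N)" unfolding im using that Y by (simp add: connectedin_subtopology)
    then have "connectedin (subtopology X (fst c)) N" using homeomorphic_map_connectedness[OF h N] by simp
    then show ?thesis by (simp add: connectedin_subtopology)
  qed
qed

text \<open>The frame exists only near \<open>x\<close>, and the bound \<open>M\<close> is a maximum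
  over a connected component that is known later. Hence the maximum principle is stated for every
  \<open>M\<close> and every open part \<open>V\<close> of the neighbourhood.\<close>

lemma local_structure:
  assumes c: "c \<in> A" and x: "x \<in> img c"
  obtains W where "x \<in> W" "open W" "W \<subseteq> img c" "continuous_on W (nsq c)"
    "\<forall>V M y. open V \<and> V \<subseteq> W \<and> (\<forall>z\<in>V. nsq c z \<le> M) \<and> y \<in> V \<and> nsq c y = M \<longrightarrow>
      (\<exists>r>0. \<forall>z\<in>ball y r. z \<in> V \<and> nsq c z = M)"
proof -
  obtain W E where xW: "x \<in> W" "W \<subseteq> img c" and W: "instanton_chart W c \<Gamma> g \<Psi> vol E"
    by (rule instanton_chart_exists[OF c x])
  interpret F: instanton_chart W c \<Gamma> g \<Psi> vol E by (rule W)
  have u: "F.u y = nsq c y" if "y \<in> W" for y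
    using nsq_eq[OF c _ F.frame[OF that]] that xW(2) by (auto simp: F.u_def F.t_def)
  have smooth_u: "smooth_on W F.u"
    unfolding F.u_def[abs_def] power2_eq_square by (intro smooth_on_sum smooth_on_mult F.open_U F.smooth_t)
  show thesis
  proof (rule that[OF xW(1) F.open_U xW(2)])
    show "continuous_on W (nsq c)"
      using smooth_on_imp_continuous_on[OF smooth_u] u by (simp cong: continuous_on_cong)
    show "\<forall>V M y. open V \<and> V \<subseteq> W \<and> (\<forall>z\<in>V. nsq c z \<le> M) \<and> y \<in> V \<and> nsq c y = M \<longrightarrow>
      (\<exists>r>0. \<forall>z\<in>ball y r. z \<in> V \<and> nsq c z = M)"
    proof (intro allI impI, elim conjE)
      fix V M y assume V: "open V" "V \<subseteq> W" and M: "\<forall>z\<in>V. nsq c z \<le> M" and y: "y \<in> V" "nsq c y = M"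
      note sub = smooth_on_subset[OF _ V(2)]
      \<comment> \<open>The first-order part of \<open>bochner\<close>. What else stands on its
        right-hand side is a sum of squares, so the differential inequality follows.\<close>
      define B where "B z = (\<Sum>\<^sub>8a. F.gam z (E a z) (E a z)) - (7 / 2) *\<^sub>R F.sharp z" for z
      have "smooth_on W B" unfolding B_def[abs_def]
        by (intro smooth_on_diff smooth_on_sum smooth_on_scaleR smooth_on_const smooth_on_Gam F.open_U F.smooth_E F.smooth_\<Gamma> F.smooth_sharp)
      then have B: "continuous_on V B" by (intro smooth_on_imp_continuous_on sub)
      have "\<exists>r>0. \<forall>z\<in>ball y r. z \<in> V \<and> F.u z = M"
      proof (rule hopf_maximum_principle[where B = B and F = E, OF V(1) sub[OF smooth_u] _ B])
        show "continuous_on V (E a)" for a by (rule smooth_on_imp_continuous_on[OF sub[OF F.smooth_E]])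
        show "v = 0" if "z \<in> V" "\<And>a. E a z \<bullet> v = 0" for z v
        proof -
          have "v \<bullet> v = (\<Sum>\<^sub>8b. gdot (g c z) v (E b z) *\<^sub>R E b z) \<bullet> v"
            using F.expand[of z v] that(1) V(2) by auto
          then show ?thesis by (simp add: inner_sum_left that(2))
        qed
        show "dd F.u z (B z) \<le> (\<Sum>\<^sub>8a. dd (\<lambda>y. dd F.u y (E a z)) z (E a z))" if "z \<in> V" for z
        proof -
          have "z \<in> W" using that V(2) by blast
          then show ?thesis unfolding F.bochner[OF \<open>z \<in> W\<close>] B_def by (simp add: sum_nonneg)
        qed
      qed (use M y u V in \<open>auto simp: subset_iff\<close>)
      then show "\<exists>r>0. \<forall>z\<in>ball y r. z \<in> V \<and> nsq c z = M" using u V(2) by (metis subsetD)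
    qed
  qed
qed

lemma continuous_uM: "continuous_map X euclideanreal uM"
proof -
  have "openin X {q \<in> topspace X. uM q \<in> V}" if V: "open V" for V
  proof (subst openin_subopen, intro ballI)
    fix q assume q: "q \<in> {q \<in> topspace X. uM q \<in> V}"
    then obtain c where c: "c \<in> A" "q \<in> fst c" using img_cover by blast
    obtain W where W: "snd c q \<in> W" "open W" "W \<subseteq> img c" "continuous_on W (nsq c)"
      using local_structure[OF c(1) snd_img[OF c(2)]] by metis
    define Y where "Y = W \<inter> nsq c -` V"
    have "open Y" unfolding Y_def using W V by (simp add: continuous_open_preimage)
    moreover have "Y \<subseteq> img c" using W by (auto simp: Y_def)
    ultimately have "openin X {q \<in> fst c. snd c q \<in> Y}" by (intro chart_preimage(1)[OF c(1)])
    moreover have "q \<in> {q \<in> fst c. snd c q \<in> Y}" using q c W uM_eq[OF c] by (simp add: Y_def)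
    moreover have "{q \<in> fst c. snd c q \<in> Y} \<subseteq> {q \<in> topspace X. uM q \<in> V}"
      using uM_eq[OF c(1)] chart[OF c(1)] openin_subset[of X "fst c"] by (auto simp: Y_def is_chart_def)
    ultimately show "\<exists>T. openin X T \<and> q \<in> T \<and> T \<subseteq> {q \<in> topspace X. uM q \<in> V}" by blast
  qed
  then show ?thesis by (simp add: continuous_map_def)
qed

text \<open>A coordinate ball is connected, so it stays inside the component of its centre.\<close>

lemma component_ball:
  assumes c: "c \<in> A" and p: "p \<in> fst c" and r: "r > 0" "ball (snd c p) r \<subseteq> img c"
  defines "N \<equiv> {q \<in> fst c. snd c q \<in> ball (snd c p) r}"
  shows "openin X N" "p \<in> N" "p \<in> connected_component_of_set X q \<Longrightarrow> N \<subseteq> connected_component_of_set X q"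
proof -
  show "openin X N" unfolding N_def by (rule chart_preimage(1)[OF c r(2) open_ball])
  have N: "connectedin X N" unfolding N_def by (rule chart_preimage(2)[OF c r(2) connected_ball])
  show pN: "p \<in> N" using p r by (simp add: N_def)
  assume "p \<in> connected_component_of_set X q"
  then have "connected_component_of_set X p = connected_component_of_set X q"
    by (simp add: connected_component_of_equiv connected_component_of_sym)
  then show "N \<subseteq> connected_component_of_set X q"
    using connected_component_of_maximal[OF N pN] by simp
qed

text \<open>A component is closed and hence compact, so \<open>uM\<close> attains its maximum on it.
  The set where it is attained is open by the maximum principle, its complement is open by
  continuity, and the component is connected.\<close>

lemma uM_constant:
  assumes compact: "compact_space X" and q: "q \<in> topspace X"
  shows "\<exists>M. \<forall>p\<in>connected_component_of_set X q. uM p = M"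
proof -
  let ?C = "connected_component_of_set X q"
  have qC: "q \<in> ?C" using q by (simp add: connected_component_of_refl)
  have sub: "?C \<subseteq> topspace X" by (rule connected_component_of_subset_topspace)
  have "compactin X ?C"
    by (intro closedin_compact_space[OF compact] closedin_connected_component_of)
  then have "compact (uM ` ?C)"
    using image_compactin[OF _ continuous_uM] by simp
  then obtain M where M: "M \<in> uM ` ?C" "\<And>y. y \<in> uM ` ?C \<Longrightarrow> y \<le> M"
    using compact_attains_sup[of "uM ` ?C"] qC by blast
  define S where "S = {p \<in> ?C. uM p = M}"
  have S: "openin X S"
  proof (subst openin_subopen, intro ballI)
    fix p assume p: "p \<in> S"
    then have "p \<in> topspace X" using sub by (auto simp: S_def)
    then obtain c where c: "c \<in> A" "p \<in> fst c" using img_cover by blast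
    obtain W where W: "snd c p \<in> W" "open W" "W \<subseteq> img c" "continuous_on W (nsq c)"
      "\<forall>V M y. open V \<and> V \<subseteq> W \<and> (\<forall>z\<in>V. nsq c z \<le> M) \<and> y \<in> V \<and> nsq c y = M \<longrightarrow>
      (\<exists>r>0. \<forall>z\<in>ball y r. z \<in> V \<and> nsq c z = M)"
      by (rule local_structure[OF c(1) snd_img[OF c(2)]])
    obtain r where r: "r > 0" "ball (snd c p) r \<subseteq> W" using openE[OF W(2,1)] by blast
    note ball = component_ball[OF c r(1) subset_trans[OF r(2) W(3)]]
    have "nsq c z \<le> M" if "z \<in> ball (snd c p) r" for z
    proof -
      have "z \<in> img c" using that r(2) W(3) by blast
      then obtain p' where p': "p' \<in> fst c" "z = snd c p'" by (auto simp: img_def)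
      then have "p' \<in> ?C" using that ball(3)[of q] p by (auto simp: S_def)
      then have "uM p' \<le> M" by (intro M(2) imageI)
      then show ?thesis using uM_eq[OF c(1) p'(1)] p'(2) by simp
    qed
    moreover have "nsq c (snd c p) = M" using p uM_eq[OF c] by (simp add: S_def)
    moreover have "snd c p \<in> ball (snd c p) r" using r(1) by simp
    ultimately have "\<exists>s>0. \<forall>z\<in>ball (snd c p) s. z \<in> ball (snd c p) r \<and> nsq c z = M"
      by (intro W(5)[rule_format] conjI ballI open_ball r(2))
    then obtain s where s: "s > 0" "\<And>z. z \<in> ball (snd c p) s \<Longrightarrow> z \<in> ball (snd c p) r \<and> nsq c z = M"
      by blast
    have sW: "ball (snd c p) s \<subseteq> img c" using s(2) r(2) W(3) by blast
    note ball' = component_ball[OF c s(1) sW]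
    have "{q \<in> fst c. snd c q \<in> ball (snd c p) s} \<subseteq> S"
      using ball'(3)[of q] p s(2) uM_eq[OF c(1)] by (auto simp: S_def)
    then show "\<exists>T. openin X T \<and> p \<in> T \<and> T \<subseteq> S" using ball'(1,2) by blast
  qed
  have T: "openin X {p \<in> topspace X. uM p \<in> - {M}}"
    by (rule openin_continuous_map_preimage[OF continuous_uM]) (simp add: open_Compl)
  have con: "connectedin X ?C" by (rule connectedin_connected_component_of)
  have "{p \<in> topspace X. uM p \<in> - {M}} \<inter> ?C = {}"
  proof (rule ccontr)
    assume "{p \<in> topspace X. uM p \<in> - {M}} \<inter> ?C \<noteq> {}"
    moreover have "S \<inter> ?C \<noteq> {}" using M(1) by (auto simp: S_def)
    moreover have "?C \<subseteq> S \<union> {p \<in> topspace X. uM p \<in> - {M}}" using sub by (auto simp: S_def)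
    moreover have "S \<inter> {p \<in> topspace X. uM p \<in> - {M}} \<inter> ?C = {}" by (auto simp: S_def)
    ultimately show False using connectedinD[OF con S T] by blast
  qed
  then show ?thesis using sub by blast
qed

lemma nsq_locally_constant:
  assumes compact: "compact_space X" and c: "c \<in> A" and x: "x \<in> img c"
  shows "\<exists>r>0. \<exists>M. \<forall>y\<in>ball x r. y \<in> img c \<and> nsq c y = M"
proof -
  obtain p where p: "p \<in> fst c" "x = snd c p" using x by (auto simp: img_def)
  obtain r where r: "r > 0" "ball x r \<subseteq> img c" using open_img[OF c] x open_contains_ball by blast
  have pX: "p \<in> topspace X" using chart[OF c] p(1) openin_subset by (auto simp: is_chart_def)
  obtain M where M: "\<And>q. q \<in> connected_component_of_set X p \<Longrightarrow> uM q = M"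
    using uM_constant[OF compact pX] by blast
  have "p \<in> connected_component_of_set X p" using pX by (simp add: connected_component_of_refl)
  note sub = component_ball(3)[OF c p(1) r(1), folded p(2), OF r(2) this]
  have "nsq c y = M" if y: "y \<in> ball x r" for y
  proof -
    have "y \<in> img c" using y r(2) by blast
    then obtain q where q: "q \<in> fst c" "y = snd c q" by (auto simp: img_def)
    then show ?thesis using M[of q] sub y uM_eq[OF c q(1)] by auto
  qed
  then have "\<forall>y\<in>ball x r. y \<in> img c \<and> nsq c y = M" using r(2) by blast
  then show ?thesis using r(1) by blast
qed

text \<open>As the squared length is locally constant, the Bochner formula leaves no room for the derivative.\<close>

lemma nabla_lee:
  assumes compact: "compact_space X" and c: "c \<in> A" and x: "x \<in> img c" and I: "length I = 2"
  shows "nabla \<Gamma> \<theta> c x I = 0"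
proof -
  obtain W E where xW: "x \<in> W" "W \<subseteq> img c" and W: "instanton_chart W c \<Gamma> g \<Psi> vol E"
    by (rule instanton_chart_exists[OF c x])
  interpret F: instanton_chart W c \<Gamma> g \<Psi> vol E by (rule W)
  obtain r M where r: "r > 0" "\<And>y. y \<in> ball x r \<Longrightarrow> nsq c y = M"
    using nsq_locally_constant[OF compact c x] by blast
  define V where "V = W \<inter> ball x r"
  have V: "open V" "x \<in> V" using F.open_U xW r(1) by (auto simp: V_def)
  have u: "F.u y = M" if "y \<in> V" for y
    using nsq_eq[OF c _ F.frame[of y]] that xW(2) r(2)[of y] by (auto simp: F.u_def F.t_def V_def)
  have d: "dd F.u y v = 0" if "y \<in> V" for y v
    using dd_cong_open[OF V(1) that u] by (simp add: dd_const)
  have "dd (\<lambda>y. dd F.u y v) x w = 0" for v w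
  proof -
    have "dd (\<lambda>y. dd F.u y v) x w = dd (\<lambda>y. 0) x w"
      by (rule arg_cong[where f = "\<lambda>F. F w"], rule dd_cong_open[OF V]) (rule d)
    then show ?thesis by (simp add: dd_const)
  qed
  then have "(\<Sum>\<^sub>8a b. (F.N x (E a x) (E b x))\<^sup>2) = 0"
    using F.bochner[OF xW(1)] d[OF V(2)] by simp
  then have "F.N x (E a x) (E b x) = 0" for a b
    by (simp add: sum_nonneg_eq_0_iff sum_nonneg)
  then have N: "comps (\<lambda>a. E a x) (nabla \<Gamma> \<theta> c x) I = 0" if "length I = 2" for I
    using that by (auto simp: comps_tev length_Suc_conv numeral_eq_Suc)
  have 0: "comps (\<lambda>a. E a x) (\<lambda>I. 0) I = 0" for I by (simp add: comps_def)
  show ?thesis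
    by (rule comps_inject[where t = "\<lambda>I. 0" and s = "nabla \<Gamma> \<theta> c x", OF F.frame[OF xW(1)] _ I]) (simp only: N 0)
qed

end

section \<open>The 4-form built from the covariant derivative of the torsion\<close>

lemma tev_d_nabla:
  "tev (d_nabla \<Gamma> T c x) [u, v, w, z] = tev (nabla \<Gamma> T c x) [u, v, w, z] + tev (nabla \<Gamma> T c x) [v, w, u, z]
    + tev (nabla \<Gamma> T c x) [w, u, v, z] - tev (nabla \<Gamma> T c x) [z, u, v, w]"
proof -
  let ?D = "nabla \<Gamma> T c x"
  have l: "linear (\<lambda>p. tev ?D [p, a, b, d])" "linear (\<lambda>p. tev ?D [a, p, b, d])"
    "linear (\<lambda>p. tev ?D [a, b, p, d])" "linear (\<lambda>p. tev ?D [a, b, d, p])" for a b d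
    using linear_tev[of ?D "[]" "[a, b, d]"] linear_tev[of ?D "[a]" "[b, d]"] linear_tev[of ?D "[a, b]" "[d]"]
      linear_tev[of ?D "[a, b, d]" "[]"] by simp_all
  have ax: "tev ?D [axis i 1, axis j 1, axis k 1, axis m 1] = ?D [i, j, k, m]" for i j k m
    using tev_axis[of ?D "[i, j, k, m]"] by simp
  show ?thesis
  proof (rule tev_quadrilinear[where B = "\<lambda>u v w z. tev ?D [u, v, w, z] + tev ?D [v, w, u, z] + tev ?D [w, u, v, z] - tev ?D [z, u, v, w]"])
    show "d_nabla \<Gamma> T c x [i, j, k, m] = tev ?D [axis i 1, axis j 1, axis k 1, axis m 1] + tev ?D [axis j 1, axis k 1, axis i 1, axis m 1]
      + tev ?D [axis k 1, axis i 1, axis j 1, axis m 1] - tev ?D [axis m 1, axis i 1, axis j 1, axis k 1]" for i j k m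
      by (simp add: d_nabla_def Let_def ax)
  qed (intro linear_compose_sub linear_compose_add l)+
qed

lemma frame_linear_zero:
  fixes f :: "pt \<Rightarrow> real"
  assumes E: "orthonormal_frame G E" and f: "linear f" and 0: "\<And>a. f (E a) = 0"
  shows "f v = 0"
proof -
  have "f v = f (\<Sum>\<^sub>8b. gdot G v (E b) *\<^sub>R E b)" using orthonormal_expand[OF E, of v] by simp
  then show ?thesis by (simp add: linear_sum[OF f] linear_cmul[OF f] 0)
qed

context gauduchon_instanton
begin

abbreviation "T \<equiv> torsion g \<Gamma>"

lemma alternating_nabla_torsion:
  assumes "c \<in> A" "x \<in> img c" shows "alternating 3 (\<lambda>J. nabla \<Gamma> T c x (m # J))"
  by (rule alternating_nabla[OF open_img[OF assms(1)] assms(2)])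
    (simp_all add: alternating_fields(4)[OF assms(1)] smooth_on_imp_differentiable[OF smooth_fields(5)[OF assms(1)] assms(2)])

lemma tensor_nabla_torsion:
  assumes cd: "c \<in> A" "d \<in> A" and x: "x \<in> overlap c d" and vs: "length vs = 3"
  shows "tev (nabla \<Gamma> T c x) (u # vs) = tev (nabla \<Gamma> T d (transition c d x)) (map (dd (transition c d) x) (u # vs))"
  unfolding list.map
proof (rule nabla_transform[where t = T and \<Gamma> = \<Gamma> and u = u and vs = vs, OF chart[OF cd(1)] chart[OF cd(2)] _ smooth_fields(6)[OF cd(1)] smooth_fields(6)[OF cd(2)] _ _ _ _ x])
  show "smooth_on (overlap c d) (transition c d)" using manifold cd by (simp add: smooth_manifold8_def)
  show "(\<Sum>\<^sub>8k. \<Gamma> c x i j $ k *\<^sub>R jacobian c d x k) = pdiff i (pdiff j (transition c d)) x +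
      (\<Sum>\<^sub>8a b. (jacobian c d x i $ a * jacobian c d x j $ b) *\<^sub>R \<Gamma> d (transition c d x) a b)" for i j
    using connection cd x unfolding torsion_connection_def linear_connection_def by blast
  show "smooth_on (img c) (\<lambda>x. T c x I)" "smooth_on (img d) (\<lambda>x. T d x I)" if "length I = length vs" for I
    using smooth_fields(5)[OF cd(1), of I] smooth_fields(5)[OF cd(2), of I] that vs by simp_all
  show "T c y I = comps (jacobian c d y) (T d (transition c d y)) I" if "y \<in> overlap c d" "length I = length vs" for y I
    using tensor_torsion cd that vs by (simp add: tensor_field_def)
qed

text \<open>\<open>tensor_nabla_torsion\<close> gives the transformation law. The minus sign of the
  last of the four terms is that of moving the fourth argument past three others, and with it the
  sum alternates in all four slots; adjacent exchanges suffice to check this.\<close>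

lemma diff_form_d_nabla: "diff_form A 4 (d_nabla \<Gamma> T)"
  unfolding diff_form_def tensor_field_def
proof (intro conjI ballI allI impI)
  fix c and I :: "8 list" assume c: "c \<in> A" and I: "length I = 4"
  interpret C: chart_connection "img c" c \<Gamma>
    by unfold_locales (simp_all add: open_img[OF c] smooth_fields(6)[OF c])
  show "smooth_on (img c) (\<lambda>x. d_nabla \<Gamma> T c x I)"
    unfolding d_nabla_def Let_def
    by (intro smooth_on_add smooth_on_diff C.smooth_on_nabla[where k = 3] open_img[OF c] smooth_fields(5)[OF c]) simp_all
next
  fix c d x and I :: "8 list" assume cd: "c \<in> A" "d \<in> A" and x: "x \<in> overlap c d" and I: "length I = 4"
  obtain i j k l where I: "I = [i, j, k, l]" using I by (auto simp: length_Suc_conv numeral_eq_Suc)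
  have "transition c d differentiable (at x)"
    using manifold cd by (intro smooth_on_imp_differentiable[OF _ x]) (simp add: smooth_manifold8_def)
  then have J: "dd (transition c d) x (axis i 1) = jacobian c d x i" for i
    by (simp add: jacobian_def pdiff_def)
  have "d_nabla \<Gamma> T c x I = tev (d_nabla \<Gamma> T c x) [axis i 1, axis j 1, axis k 1, axis l 1]"
    using tev_axis[of "d_nabla \<Gamma> T c x" I] by (simp add: I)
  also have "\<dots> = tev (d_nabla \<Gamma> T d (transition c d x)) (map (jacobian c d x) I)"
    by (simp add: tev_d_nabla tensor_nabla_torsion[OF cd x] I J)
  finally show "d_nabla \<Gamma> T c x I = comps (jacobian c d x) (d_nabla \<Gamma> T d (transition c d x)) I"
    by (simp add: comps_tev)
next
  fix c x assume c: "c \<in> A" and x: "x \<in> img c"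
  let ?D = "nabla \<Gamma> T c x"
  have s: "?D [m, j, i, k] = - ?D [m, i, j, k]" "?D [m, i, k, j] = - ?D [m, i, j, k]" for m i j k
    using alternating_adj[OF alternating_nabla_torsion[OF c x, of m], of "[]" "[k]" j i]
      alternating_adj[OF alternating_nabla_torsion[OF c x, of m], of "[i]" "[]" k j] by simp_all
  have e: "d_nabla \<Gamma> T c x [i, j, k, l] = ?D [i, j, k, l] + ?D [j, k, i, l] + ?D [k, i, j, l] - ?D [l, i, j, k]" for i j k l
    by (simp add: d_nabla_def Let_def)
  show "alternating 4 (d_nabla \<Gamma> T c x)"
  proof (rule alternating_adjI)
    fix xs ys :: "8 list" and a b assume "length xs + length ys + 2 = 4"
    then have "length xs = 0 \<and> length ys = 2 \<or> length xs = 1 \<and> length ys = 1 \<or> length xs = 2 \<and> length ys = 0"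
      by linarith
    then consider p q where "xs = []" "ys = [p, q]" | p q where "xs = [p]" "ys = [q]" | p q where "xs = [p, q]" "ys = []"
      unfolding length_0_conv numeral_2_eq_2 One_nat_def length_Suc_conv by blast
    then show "d_nabla \<Gamma> T c x (xs @ b # a # ys) = - d_nabla \<Gamma> T c x (xs @ a # b # ys)"
    proof cases
      case 1
      show ?thesis
        unfolding 1 append.simps e
        using s(1)[of a p b q] s(1)[of b p a q] s(1)[of p b a q] s(1)[of q b a p] by linarith
    next
      case 2
      show ?thesis
        unfolding 2 append.simps e
        using s(1)[of p b a q] s(1)[of b a p q] s(1)[of a p b q] s(2)[of q p b a] by linarith
    next
      case 3
      show ?thesis
        unfolding 3 append.simps e
        using s(2)[of p q b a] s(2)[of q b p a] s(1)[of q b a p] s(2)[of q a b p] by linarith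
    qed
  qed
qed

text \<open>With the Lee form parallel, \<open>annihilates\<close> applies in an adapted frame.
  Linearity extends the result to arbitrary \<open>v\<close> and \<open>w\<close>, and
  \<open>orthonormal_trace3\<close> to an arbitrary orthonormal frame.\<close>

lemma d_nabla_contraction:
  assumes compact: "compact_space X" and c: "c \<in> A" and x: "x \<in> img c" and F: "orthonormal_frame (g c x) F"
  shows "(\<Sum>\<^sub>8j k l. tev (d_nabla \<Gamma> T c x) [v, F j, F k, F l] * tev (\<Psi> c x) [w, F j, F k, F l]) = 0"
proof -
  obtain W E where xW: "x \<in> W" "W \<subseteq> img c" and W: "instanton_chart W c \<Gamma> g \<Psi> vol E"
    by (rule instanton_chart_exists[OF c x])
  interpret F: instanton_chart W c \<Gamma> g \<Psi> vol E by (rule W)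
  interpret p: instanton_point "F.Tf x" "\<lambda>m. F.Xf x (E m x)" "F.Rf x" by (rule F.point[OF xW(1)])
  let ?S = "\<lambda>v w. \<Sum>\<^sub>8j k l. tev (d_nabla \<Gamma> T c x) [v, E j x, E k x, E l x] * tev (\<Psi> c x) [w, E j x, E k x, E l x]"
  have "F.N x u (E a x) = 0" for u a
    by (rule tev_zero) (simp add: nabla_lee[OF compact c x])
  then have z: "tcontr (F.Xf x (E i x)) j = 0" for i j
    using F.N_tcontr[OF xW(1), of "E i x" j] by simp
  have 0: "?S (E i x) (E m x) = 0" for i m
    using p.annihilates[OF z, of i m] by (simp only: tev_d_nabla F.Xf_def F.tev_\<Psi>[OF xW(1)])
  have "linear (\<lambda>v. tev (d_nabla \<Gamma> T c x) [v, a, b, d] * r)" for a b d r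
    using linear_tev_mult(1)[of "d_nabla \<Gamma> T c x" "[]" "[a, b, d]" r] by simp
  then have l1: "linear (\<lambda>v. ?S v w)" for w by (intro linear_sum_fun)
  have "linear (\<lambda>v. r * tev (\<Psi> c x) [v, a, b, d])" for a b d r
    using linear_tev_mult(2)[of r "\<Psi> c x" "[]" "[a, b, d]"] by simp
  then have l2: "linear (\<lambda>w. ?S v w)" for v by (intro linear_sum_fun)
  have "?S v (E m x) = 0" for m by (rule frame_linear_zero[where f = "\<lambda>v. ?S v (E m x)", OF F.frame[OF xW(1)] l1 0])
  then have "?S v w = 0" by (rule frame_linear_zero[where f = "\<lambda>w. ?S v w", OF F.frame[OF xW(1)] l2])
  moreover note orthonormal_trace3[where xs = "[v]" and ys = "[w]" and zs = "[]" and s = "d_nabla \<Gamma> T c x" and t = "\<Psi> c x",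
      OF sym_g[OF c x] F.frame[OF xW(1)] F]
  ultimately show ?thesis unfolding append.simps append_Nil2 by linarith
qed

lemma in_Lambda4_27_d_nabla:
  assumes compact: "compact_space X" shows "in_Lambda4_27 A g \<Psi> (d_nabla \<Gamma> T)"
  unfolding in_Lambda4_27_def Let_def
  using diff_form_d_nabla d_nabla_contraction[OF compact] by (simp add: comps_tev)

text \<open>In an adapted frame the vanishing contraction with \<open>psi\<close> is the hypothesis
  of \<open>hstar_annihilator\<close>; \<open>comps_inject\<close> brings the equality back to
  coordinates.\<close>

lemma self_dual_d_nabla:
  assumes compact: "compact_space X" shows "self_dual A g vol (d_nabla \<Gamma> T)"
  unfolding self_dual_def
proof (intro ballI allI impI)
  fix c x and I :: "8 list" assume c: "c \<in> A" and x: "x \<in> img c" and I: "length I = 4"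
  obtain W E where xW: "x \<in> W" "W \<subseteq> img c" and W: "instanton_chart W c \<Gamma> g \<Psi> vol E"
    by (rule instanton_chart_exists[OF c x])
  interpret F: instanton_chart W c \<Gamma> g \<Psi> vol E by (rule W)
  let ?\<sigma> = "d_nabla \<Gamma> T c x" and ?C = "comps (\<lambda>a. E a x)"
  show "star (g c) (vol c) (d_nabla \<Gamma> T c) x I = ?\<sigma> I"
  proof (rule comps_inject[OF F.frame[OF xW(1)] _ I])
    fix J :: "8 list" assume J: "length J = 4"
    have "?C (star (g c) (vol c) (d_nabla \<Gamma> T c) x) J = hstar (?C ?\<sigma>) J"
      unfolding star_def by (rule comps_hodge[OF F.frame[OF xW(1)] F.frame_vol[OF xW(1)]]) (simp_all add: J)
    also have "\<dots> = ?C ?\<sigma> J"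
    proof (rule hstar_annihilator[OF _ _ J])
      show "alternating 4 (?C ?\<sigma>)"
        using diff_form_d_nabla c x by (intro alternating_comps) (simp add: diff_form_def)
      show "(\<Sum>\<^sub>8j k l. ?C ?\<sigma> [i, j, k, l] * psi m j k l) = 0" for i m
        using d_nabla_contraction[OF compact c x F.frame[OF xW(1)], of "E i x" "E m x"]
        by (simp add: comps_tev F.tev_\<Psi>[OF xW(1)])
    qed
    finally show "?C (star (g c) (vol c) (d_nabla \<Gamma> T c) x) J = ?C ?\<sigma> J" .
  qed
qed

end

theorem theorem1p10:
  fixes X :: "'a topology" and A :: "'a chart set"
    and \<Psi>' g' vol' \<Psi> g vol :: "'a field"
    and f :: "'a \<Rightarrow> real"
    and \<Gamma> :: "'a chart \<Rightarrow> christoffel"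
  assumes "smooth_manifold8 X A" and "compact_space X"
    and "spin7_structure A \<Psi>'" and "induces A \<Psi>' g' vol'"
    and "closed_1form A (lee_form g' vol' \<Psi>')"
    and "smooth_function A f" and "\<Psi> = exp_times f \<Psi>'"
    and "induces A \<Psi> g vol" and "gauduchon A g vol \<Psi>"
    and "torsion_connection A g \<Psi> \<Gamma>"
    and "spin7_instanton A g \<Psi> \<Gamma>"
  shows "parallel A \<Gamma> 1 (lee_form g vol \<Psi>)
    \<and> in_Lambda4_27 A g \<Psi> (d_nabla \<Gamma> (torsion g \<Gamma>))
    \<and> self_dual A g vol (d_nabla \<Gamma> (torsion g \<Gamma>))"
proof -
  interpret gauduchon_instanton X A \<Psi>' g' vol' g vol f \<Gamma>
    using assms by unfold_locales simp_all
  show ?thesis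
    using nabla_lee[OF assms(2)] in_Lambda4_27_d_nabla[OF assms(2)] self_dual_d_nabla[OF assms(2)] assms(7)
    by (simp add: parallel_def vanishes_def)
qed

end
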